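(* Let $H$ be a Krull monoid with finite class group $G$ such that every class contains a prime divisor. 1. $\mathsf t(G)=\mathsf D^*(G)$ if and only if $G$ is isomorphic to one of $C_3,\ C_4,\ C_2^2,\ C_2^3$. 2. If one nontrivial class contains at least two distinct prime divisors, then $\mathsf t(H)=\mathsf D^*(G)$ if and only if $G$ is isomorphic to one of $C_2,\ C_3,\ C_4,\ C_2^2$. 3. Suppose that $|G|>1$ and that $G$ has rank $\mathsf r(G)=r$, and consider both $\mathsf D(G)$ and $\mathsf t(H)$ as functions of $r$. Then there are constants $M_1,M_2,M_3,M_4\in\mathbb R_{>0}$, depending only on $\exp(G)$ but not on $r$ (nor otherwise on $G$ or $H$), such that $$M_1 r\le \mathsf D(G)\le M_2 r\qquad\text{and}\qquad M_3r^2\le \mathsf t(H)\le M_4r^2 .$$ In particular, $\mathsf t(H)$ grows (in order of magnitude, as a function of $r$ for fixed exponent) as the upper bound $1+\mathsf D(G)(\mathsf D(G)-1)/2$.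
   Context: $\mathbb N=\{1,2,\dots\}$, $\mathbb N_0=\mathbb N\cup\{0\}$. A monoid is a commutative cancellative semigroup with identity. For a monoid $H$: $H^\times$ is its group of units, $H_{\rm red}=\{aH^\times: a\in H\}$, $\mathcal A(H)$ its set of atoms (irreducible elements), $\mathsf q(H)$ its quotient group. $\mathcal F(P)$ is the free abelian monoid with basis $P$; for $a=\prod_{p\in P}p^{\mathsf v_p(a)}\in\mathcal F(P)$ put $|a|=\sum_p\mathsf v_p(a)$. Factorizations and tame degree: $\mathsf Z(H)=\mathcal F(\mathcal A(H_{\rm red}))$, $\pi:\mathsf Z(H)\to H_{\rm red}$ is the homomorphism with $\pi(u)=u$ on atoms, $\mathsf Z(a)=\pi^{-1}(aH^\times)$ for $a\in H$. For $z,z'\in\mathsf Z(H)$, $\mathsf d(z,z')=\max\{|z\gcd(z,z')^{-1}|,|z'\gcd(z,z')^{-1}|\}$. For $a\in H$ and $x\in\mathsf Z(H)$, $\mathsf t(a,x)\in\mathbb N_0\cup\{\infty\}$ is the smallest $N$ such that: if $\mathsf Z(a)\cap x\mathsf Z(H)\neq\emptyset$ and $z\in\mathsf Z(a)$, then there is $z'\in\mathsf Z(a)\cap x\mathsf Z(H)$ with $\mathsf d(z,z')\le N$. $\mathsf t(H,u)=\sup_{a\in H}\mathsf t(a,u)$ for $u\in\mathcal A(H_{\rm red})$, and $\mathsf t(H)=\sup\{\mathsf t(H,u):u\in\mathcal A(H_{\rm red})\}$ is the tame degree of $H$. Krull monoids: a monoid homomorphism $\varphi:H\to D$ is a divisor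 homomorphism if $\varphi(a)\mid\varphi(b)$ implies $a\mid b$. It is a divisor theory if $D=\mathcal F(P)$ for a set $P$, $\varphi$ is a divisor homomorphism, and each $p\in P$ equals $\gcd(\varphi(X))$ for some finite nonempty $X\subset H$. $H$ is a Krull monoid if it has a divisor theory $\varphi:H\to\mathcal F(P)$; this is essentially unique, and $G=\mathsf q(\mathcal F(P))/\mathsf q(\varphi(H))$ (written additively) is the class group of $H$. Elements of $P$ are the prime divisors; a class $g\in G$ contains the prime divisor $p$ if $[p]=g$. Zero-sum sequences: for an additive abelian group $G$ and $G_0\subset G$, elements of $\mathcal F(G_0)$ are called sequences over $G_0$; $\sigma(g_1\cdots g_\ell)=g_1+\dots+g_\ell$; $\mathcal B(G_0)=\{S\in\mathcal F(G_0):\sigma(S)=0\}$ is a monoid (of zero-sum sequences), $\mathsf t(G_0)=\mathsf t(\mathcal B(G_0))$; $\mathcal A(G_0)=\mathcal A(\mathcal B(G_0))$ is the set of minimal zero-sum sequences over $G_0$; $\mathsf D(G_0)=\sup\{|U|:U\in\mathcal A(G_0)\}$ is the Davenport constant. Finite groups: $C_n$ is the cyclic group of order $n$. If $G\cong C_{n_1}\oplus\dots\oplus C_{n_r}$ with $1<n_1\mid\dots\mid n_r$, then $\mathsf r(G)=r$ is the rank and $\mathsf D^*(G)=1+\sum_{i=1}^r(n_i-1)$; for the trivial group $\mathsf D^*(\{0\})=1$. $\exp(G)$ is the exponent. *)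

theory Defs
  imports "HOL-Algebra.Divisibility" "HOL-Algebra.Product_Groups" "HOL-Algebra.Free_Abelian_Groups"
    "HOL-Library.Multiset" "HOL-Library.Extended_Real"
begin

text \<open>
  Monoids and groups are records of HOL-Algebra and are written multiplicatively, also where the
  mathematics is usually written additively (class groups, zero-sum sequences). A multiset over
  \<open>P\<close> is an element of the free abelian monoid with basis \<open>P\<close>; its length is \<open>size\<close>, and gcd is
  multiset intersection.
\<close>

definition free_monoid :: "'p set \<Rightarrow> 'p multiset monoid" where
  "free_monoid P = \<lparr>carrier = {S. set_mset S \<subseteq> P}, monoid.mult = (+), one = {#}\<rparr>"

definition mset_prod :: "('a, 'm) monoid_scheme \<Rightarrow> 'a multiset \<Rightarrow> 'a" where
  "mset_prod M S = finprod M (\<lambda>x. x [^]\<^bsub>M\<^esub> count S x) (set_mset S)"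


subsection \<open>Factorizations and the tame degree\<close>

definition reduced_monoid :: "('a, 'm) monoid_scheme \<Rightarrow> 'a set monoid" where
  "reduced_monoid H =
     \<lparr>carrier = (\<lambda>a. a <#\<^bsub>H\<^esub> Units H) ` carrier H, monoid.mult = set_mult H, one = Units H\<rparr>"

definition atoms :: "('a, 'm) monoid_scheme \<Rightarrow> 'a set" where
  "atoms H = {u \<in> carrier H. irreducible H u}"

definition factorizations :: "('a, 'm) monoid_scheme \<Rightarrow> 'a \<Rightarrow> 'a set multiset set" where
  "factorizations H a =
     {z \<in> carrier (free_monoid (atoms (reduced_monoid H))).
        mset_prod (reduced_monoid H) z = a <#\<^bsub>H\<^esub> Units H}"

definition fact_dist :: "'b multiset \<Rightarrow> 'b multiset \<Rightarrow> nat" where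
  "fact_dist z z' = max (size (z - z \<inter># z')) (size (z' - z \<inter># z'))"

text \<open>
  In \<open>tame_degree_at\<close>, the condition \<open>x \<subseteq># z\<close> on \<open>z \<in> factorizations H a\<close> expresses that \<open>z\<close> is a
  multiple of \<open>x\<close> in the factorization monoid. The bound \<open>\<infinity>\<close> always has the required property,
  so the least element exists.
\<close>

definition tame_degree_at :: "('a, 'm) monoid_scheme \<Rightarrow> 'a \<Rightarrow> 'a set multiset \<Rightarrow> enat" where
  "tame_degree_at H a x =
     (LEAST N. \<forall>z. {y \<in> factorizations H a. x \<subseteq># y} \<noteq> {} \<and> z \<in> factorizations H a \<longrightarrow>
                 (\<exists>z' \<in> {y \<in> factorizations H a. x \<subseteq># y}. enat (fact_dist z z') \<le> N))"

definition tame_degree_atom :: "('a, 'm) monoid_scheme \<Rightarrow> 'a set \<Rightarrow> enat" where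
  "tame_degree_atom H u = (SUP a \<in> carrier H. tame_degree_at H a {#u#})"

definition tame_degree :: "('a, 'm) monoid_scheme \<Rightarrow> enat" where
  "tame_degree H = (SUP u \<in> atoms (reduced_monoid H). tame_degree_atom H u)"


subsection \<open>Krull monoids and their class groups\<close>

definition divisor_hom ::
    "('a, 'm) monoid_scheme \<Rightarrow> ('b, 'n) monoid_scheme \<Rightarrow> ('a \<Rightarrow> 'b) \<Rightarrow> bool" where
  "divisor_hom H D \<phi> \<longleftrightarrow>
     \<phi> \<in> hom H D \<and> \<phi> \<one>\<^bsub>H\<^esub> = \<one>\<^bsub>D\<^esub> \<and>
     (\<forall>a\<in>carrier H. \<forall>b\<in>carrier H. \<phi> a divides\<^bsub>D\<^esub> \<phi> b \<longrightarrow> a divides\<^bsub>H\<^esub> b)"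

text \<open>
  The infimum of a nonempty set of multisets is taken pointwise in the multiplicities, i.e. it is
  the gcd in the free abelian monoid.
\<close>

definition divisor_theory :: "('a, 'm) monoid_scheme \<Rightarrow> 'p set \<Rightarrow> ('a \<Rightarrow> 'p multiset) \<Rightarrow> bool" where
  "divisor_theory H P \<phi> \<longleftrightarrow>
     divisor_hom H (free_monoid P) \<phi> \<and>
     (\<forall>p\<in>P. \<exists>X. X \<subseteq> carrier H \<and> finite X \<and> X \<noteq> {} \<and> Inf (\<phi> ` X) = {#p#})"

text \<open>
  Being a Krull monoid means having some divisor theory. As one cannot quantify existentially over
  the type of the prime divisors, a Krull monoid is always given together with a divisor theory.
\<close>

definition krull_monoid :: "('a, 'm) monoid_scheme \<Rightarrow> 'p set \<Rightarrow> ('a \<Rightarrow> 'p multiset) \<Rightarrow> bool" where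
  "krull_monoid H P \<phi> \<longleftrightarrow> comm_monoid_cancel H \<and> divisor_theory H P \<phi>"

text \<open>The quotient group of \<open>free_monoid P\<close> is \<open>free_Abelian_group P\<close>, via this embedding.\<close>

definition frag_of_mset :: "'p multiset \<Rightarrow> 'p \<Rightarrow>\<^sub>0 int" where
  "frag_of_mset S = (\<Sum>p\<in>#S. frag_of p)"

definition principal_divisors ::
    "('a, 'm) monoid_scheme \<Rightarrow> ('a \<Rightarrow> 'p multiset) \<Rightarrow> ('p \<Rightarrow>\<^sub>0 int) set" where
  "principal_divisors H \<phi> =
     {frag_of_mset (\<phi> a) - frag_of_mset (\<phi> b) | a b. a \<in> carrier H \<and> b \<in> carrier H}"

definition class_group ::
    "('a, 'm) monoid_scheme \<Rightarrow> 'p set \<Rightarrow> ('a \<Rightarrow> 'p multiset) \<Rightarrow> ('p \<Rightarrow>\<^sub>0 int) set monoid" where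
  "class_group H P \<phi> = free_Abelian_group P Mod principal_divisors H \<phi>"

definition divisor_class ::
    "('a, 'm) monoid_scheme \<Rightarrow> 'p set \<Rightarrow> ('a \<Rightarrow> 'p multiset) \<Rightarrow> 'p \<Rightarrow> ('p \<Rightarrow>\<^sub>0 int) set" where
  "divisor_class H P \<phi> p = principal_divisors H \<phi> #>\<^bsub>free_Abelian_group P\<^esub> frag_of p"

definition krull_finite_primes_everywhere ::
    "('a, 'm) monoid_scheme \<Rightarrow> 'p set \<Rightarrow> ('a \<Rightarrow> 'p multiset) \<Rightarrow> bool" where
  "krull_finite_primes_everywhere H P \<phi> \<longleftrightarrow>
     krull_monoid H P \<phi> \<and> finite (carrier (class_group H P \<phi>)) \<and>
     (\<forall>g \<in> carrier (class_group H P \<phi>). \<exists>p\<in>P. divisor_class H P \<phi> p = g)"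


subsection \<open>Zero-sum sequences and the Davenport constant\<close>

definition zero_sum_monoid :: "('g, 'm) monoid_scheme \<Rightarrow> 'g set \<Rightarrow> 'g multiset monoid" where
  "zero_sum_monoid G G0 =
     (free_monoid G0)\<lparr>carrier := {S \<in> carrier (free_monoid G0). mset_prod G S = \<one>\<^bsub>G\<^esub>}\<rparr>"

definition davenport :: "('g, 'm) monoid_scheme \<Rightarrow> 'g set \<Rightarrow> enat" where
  "davenport G G0 = (SUP U \<in> atoms (zero_sum_monoid G G0). enat (size U))"


subsection \<open>Invariants of finite abelian groups\<close>

text \<open>
  By the structure theorem every finite abelian group has exactly one such list; it is empty for
  the trivial group.
\<close>

definition invariant_factors :: "('g, 'm) monoid_scheme \<Rightarrow> nat list" where
  "invariant_factors G =
     (SOME ns. (\<forall>n\<in>set ns. 1 < n) \<and> sorted_wrt (dvd) ns \<and>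
               G \<cong> product_group {..<length ns} (\<lambda>i. integer_mod_group (ns ! i)))"

definition group_rank :: "('g, 'm) monoid_scheme \<Rightarrow> nat" where
  "group_rank G = length (invariant_factors G)"

definition Dstar :: "('g, 'm) monoid_scheme \<Rightarrow> nat" where
  "Dstar G = 1 + (\<Sum>n\<leftarrow>invariant_factors G. n - 1)"

definition group_exponent :: "('g, 'm) monoid_scheme \<Rightarrow> nat" where
  "group_exponent G = (LEAST n. 0 < n \<and> (\<forall>g\<in>carrier G. g [^]\<^bsub>G\<^esub> n = \<one>\<^bsub>G\<^esub>))"

text \<open>The group \<open>C\<^sub>n\<^sup>r\<close>\<close>

definition cyclic_power :: "nat \<Rightarrow> nat \<Rightarrow> (nat \<Rightarrow> int) monoid" where
  "cyclic_power n r = product_group {..<r} (\<lambda>_. integer_mod_group n)"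


subsection \<open>Growth in terms of the rank\<close>

text \<open>
  The constants \<open>M1, \<dots>, M5\<close> are valid for exponent \<open>e\<close> and for all Krull monoids on the type \<open>'a\<close>
  whose prime divisors have type \<open>'p\<close>. The last two inequalities say that
  \<open>1 + D(G) (D(G) - 1) / 2\<close> is an upper bound for the tame degree and of the same order of
  magnitude. All terms are extended reals, so finiteness of \<open>D(G)\<close> and of the tame degree is part
  of the claim.
\<close>

definition growth_constants ::
    "'a itself \<Rightarrow> 'p itself \<Rightarrow> nat \<Rightarrow> real \<Rightarrow> real \<Rightarrow> real \<Rightarrow> real \<Rightarrow> real \<Rightarrow> bool" where
  "growth_constants TA TP e M1 M2 M3 M4 M5 \<longleftrightarrow>
     0 < M1 \<and> 0 < M2 \<and> 0 < M3 \<and> 0 < M4 \<and> 0 < M5 \<and>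
     (\<forall>(H :: 'a monoid) (P :: 'p set) (\<phi> :: 'a \<Rightarrow> 'p multiset).
        krull_finite_primes_everywhere H P \<phi> \<and>
        1 < order (class_group H P \<phi>) \<and> group_exponent (class_group H P \<phi>) = e \<longrightarrow>
        (let G = class_group H P \<phi>;
             r = real (group_rank G);
             D = ereal_of_enat (davenport G (carrier G));
             t = ereal_of_enat (tame_degree H)
         in ereal (M1 * r) \<le> D \<and> D \<le> ereal (M2 * r) \<and>
            ereal (M3 * r\<^sup>2) \<le> t \<and> t \<le> ereal (M4 * r\<^sup>2) \<and>
            ereal M5 * (1 + D * (D - 1) / 2) \<le> t \<and> t \<le> 1 + D * (D - 1) / 2))"

text \<open>
  The constants must not depend on the monoid, hence not on the types on which it lives either,
  whereas in \<open>\<exists>M1 M2 M3 M4 M5. growth_constants TYPE('a) TYPE('p) e M1 M2 M3 M4 M5\<close> they could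
  vary with \<open>'a\<close> and \<open>'p\<close>. HOL has no quantifier over types, so independence is expressed through
  fixed reference types: such constants exist for countable Krull monoids (given on
  \<open>nat multiset\<close>, with prime divisors in \<open>nat\<close>), and constants that are valid there are valid for
  all types \<open>'a\<close> and \<open>'p\<close>.
\<close>

definition uniform_growth :: "'a itself \<Rightarrow> 'p itself \<Rightarrow> nat \<Rightarrow> bool" where
  "uniform_growth TA TP e \<longleftrightarrow>
     (\<exists>M1 M2 M3 M4 M5. growth_constants TYPE(nat multiset) TYPE(nat) e M1 M2 M3 M4 M5) \<and>
     (\<forall>M1 M2 M3 M4 M5. growth_constants TYPE(nat multiset) TYPE(nat) e M1 M2 M3 M4 M5 \<longrightarrow>
                        growth_constants TA TP e M1 M2 M3 M4 M5)"

end

theory Submission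
  imports Defs "HOL-Number_Theory.Cong" "HOL-Algebra.Multiplicative_Group"
begin

text \<open>
  Let \<open>n\<^sub>1, \<dots>, n\<^sub>r\<close> be the invariant factors of the class group \<open>G\<close>. An isomorphism of \<open>G\<close> with the direct
  sum of the \<open>C\<^bsub>n\<^sub>i\<^esub>\<close> turns the class of every prime divisor \<open>p\<close> into a vector of \<open>r\<close> integers, and the image of \<open>H\<close> in
  the free monoid over \<open>P\<close> consists of the multisets all of whose coordinate sums vanish modulo the
  \<open>n\<^sub>i\<close> (\<open>image_eq_blocks\<close>); for \<open>G\<close> in place of \<open>P\<close> one gets the zero-sum sequences. Since a
  divisor homomorphism only forgets units, the tame degree can be read off from this set of
  multisets (\<open>tame_degree_le_iff\<close>), and every assertion becomes one about \<open>tame_bound\<close> for such sets.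

  Upper bounds. If an atom \<open>u\<close> divides the product of a factorization \<open>z\<close>, then \<open>u\<close> is covered by
  pieces of few factors of \<open>z\<close>; these factors are replaced by \<open>u\<close> and a factorization of the
  rest (\<open>tame_boundI\<close>). As a minimal cover has at most \<open>|u|\<close> members and every atom of the rest has
  length at least \<open>2\<close>, this gives \<open>1 + D (D - 1) / 2\<close> (\<open>tame_bound_davenport_le\<close>). The value \<open>D\<^sup>*(G)\<close> for the
  exceptional groups is finer: in \<open>C\<^sub>2\<close>, \<open>C\<^sub>3\<close>, \<open>C\<^sub>4\<close> all atoms have index one with respect to a
  generator, which bounds the total weight of the rest (\<open>tame_bound_cyclic_le\<close>); in \<open>C\<^sub>2\<^sup>2\<close> and
  \<open>C\<^sub>2\<^sup>3\<close> the few remaining configurations of large length are refactored explicitly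
  (\<open>tame_bound_22_le\<close>, \<open>tame_bound_222_le\<close>).

  Lower bounds. Take an atom \<open>u = p\<^sub>1 \<cdots> p\<^sub>k\<close> and zero-sum free \<open>S\<^sub>j\<close> such that \<open>p\<^sub>j S\<^sub>j\<close> are atoms. If
  none of these divides \<open>W = S\<^sub>1 \<cdots> S\<^sub>k\<close>, every factorization of \<open>u W\<close> that contains \<open>u\<close> is disjoint from
  \<open>z = (p\<^sub>1 S\<^sub>1) \<cdots> (p\<^sub>k S\<^sub>k)\<close>, so the tame degree is at least \<open>1\<close> plus the least number of atoms in a
  factorization of \<open>W\<close> (\<open>tame_bound_exchange_ge\<close>). With \<open>S\<^sub>j\<close> over \<open>\<plusminus>e\<^sub>1, \<dots>, \<plusminus>e\<^sub>r\<close> for a basis of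
  \<open>G\<close>, the atoms of \<open>W\<close> are \<open>e\<^sub>i\<^bsup>n\<^sub>i\<^esup>\<close> and \<open>e\<^sub>i (-e\<^sub>i)\<close>, so that this number is known. Three
  vectors of digits whose addition carries once more than necessary yield \<open>D\<^sup>*(G) + 1\<close> for all groups
  of order greater than \<open>4\<close> except \<open>C\<^sub>2\<^sup>3\<close> and \<open>C\<^sub>3\<^sup>2\<close>; for the latter, five vectors over the basis do the same
  (\<open>tame_bound_carry_ge\<close>, \<open>tame_bound_gt_Dst\<close>); about \<open>r / 2\<close> vectors that all occupy
  the same \<open>r / 2\<close> further coordinates yield a quadratic bound (\<open>tame_bound_quadratic_ge\<close>), and a class
  with two primes yields \<open>5 > D\<^sup>*(C\<^sub>2\<^sup>3)\<close> and \<open>2 = D\<^sup>*(C\<^sub>2)\<close>. The bound \<open>D\<^sup>*(G)\<close> itself comes from an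
  atom of length \<open>D\<^sup>*(G)\<close> and pairs \<open>p (-p)\<close> (\<open>tame_bound_ge_size_irreducible\<close>).

  Growth. For exponent \<open>e\<close>, averaging over the characters of \<open>G\<close> shows \<open>D(G) \<le> e\<^sup>2 r\<close>
  (\<open>irreducible_size_le\<close>); the other estimates are the general upper bound and the
  quadratic lower bound. Constants that are valid for countable monoids are valid for all, because
  discarding primes from classes with infinitely many of them, while keeping countably
  many, changes none of the invariants (\<open>countable_model\<close>).
\<close>

section \<open>Tame bounds for sets of multisets\<close>

text \<open>
  A reduced monoid with a divisor homomorphism into a free monoid is represented by its image \<open>B\<close>, a
  set of multisets that contains \<open>b\<close> whenever it contains \<open>a\<close> and \<open>a + b\<close>.
\<close>
definition irreducibles :: "'p multiset set \<Rightarrow> 'p multiset set" where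
  "irreducibles B = {u \<in> B. u \<noteq> {#} \<and> (\<forall>v\<in>B. v \<subseteq># u \<longrightarrow> v = {#} \<or> v = u)}"

definition decompositions :: "'p multiset set \<Rightarrow> 'p multiset \<Rightarrow> 'p multiset multiset set" where
  "decompositions B a = {z. set_mset z \<subseteq> irreducibles B \<and> \<Sum>\<^sub># z = a}"

text \<open>
  The assertion \<open>t(B) \<le> N\<close> for the tame degree \<open>t(B)\<close>. Bounds are used instead of the degree
  itself, since they need no infinite values and no suprema.
\<close>
definition tame_bound :: "'p multiset set \<Rightarrow> nat \<Rightarrow> bool" where
  "tame_bound B N \<longleftrightarrow>
     (\<forall>u\<in>irreducibles B. \<forall>a. \<forall>z\<in>decompositions B a.
        (\<exists>y\<in>decompositions B a. u \<in># y) \<longrightarrow>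
        (\<exists>y\<in>decompositions B a. u \<in># y \<and> fact_dist z y \<le> N))"

definition saturated :: "'p multiset set \<Rightarrow> bool" where
  "saturated B \<longleftrightarrow> {#} \<in> B \<and> (\<forall>a\<in>B. \<forall>b. a + b \<in> B \<longleftrightarrow> b \<in> B)"

lemma saturated_sum:
  assumes "saturated B" "set_mset z \<subseteq> B" shows "\<Sum>\<^sub># z \<in> B"
  using assms(2) by (induction z) (use assms(1) in \<open>auto simp: saturated_def\<close>)

lemma saturated_diff:
  assumes "saturated B" "a \<in> B" "b \<in> B" "a \<subseteq># b" shows "b - a \<in> B"
  using assms unfolding saturated_def by (metis subset_mset.add_diff_inverse)

lemma irreduciblesD:
  assumes "u \<in> irreducibles B" shows "u \<in> B" "u \<noteq> {#}" "\<And>v. v \<in> B \<Longrightarrow> v \<subseteq># u \<Longrightarrow> v = {#} \<or> v = u"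
  using assms by (auto simp: irreducibles_def)

lemma decomposition_exists:
  assumes B: "saturated B" and "a \<in> B"
  shows "\<exists>z. z \<in> decompositions B a"
  using assms(2)
proof (induction "size a" arbitrary: a rule: less_induct)
  case less
  show ?case
  proof (cases "a = {#} \<or> a \<in> irreducibles B")
    case True
    then show ?thesis
    proof
      assume "a = {#}" then have "{#} \<in> decompositions B a" by (simp add: decompositions_def)
      then show ?thesis ..
    next
      assume "a \<in> irreducibles B" then have "{#a#} \<in> decompositions B a" by (simp add: decompositions_def)
      then show ?thesis ..
    qed
  next
    case False
    then obtain v where v: "v \<in> B" "v \<subseteq># a" "v \<noteq> {#}" "v \<noteq> a"
      using less.prems by (auto simp: irreducibles_def)
    have "a - v \<in> B" using saturated_diff[OF B v(1) less.prems v(2)] .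
    moreover have "size v < size a" using v by (meson mset_subset_size subset_mset.le_neq_trans)
    moreover have "size (a - v) < size a"
      using v by (metis diff_subset_eq_self mset_subset_size nonempty_has_size size_Diff_submset
          add.commute less_add_same_cancel1 subset_mset.diff_add size_union)
    ultimately obtain y z where "y \<in> decompositions B v" "z \<in> decompositions B (a - v)"
      using less.hyps[of v] less.hyps[of "a-v"] v(1) by blast
    then have "y + z \<in> decompositions B a" using v(2) by (auto simp: decompositions_def)
    then show ?thesis ..
  qed
qed

lemma decompositions_add:
  "y \<in> decompositions B a \<Longrightarrow> z \<in> decompositions B b \<Longrightarrow> y + z \<in> decompositions B (a + b)"
  by (auto simp: decompositions_def)

lemma decompositions_single: "u \<in> irreducibles B \<Longrightarrow> {#u#} \<in> decompositions B u"
  by (auto simp: decompositions_def)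

lemma decompositionsD_part:
  assumes "y \<in> decompositions B a" "v \<in># y" shows "v \<in> irreducibles B" "v \<subseteq># a"
proof -
  show "v \<in> irreducibles B" using assms by (auto simp: decompositions_def)
  obtain y' where "y = add_mset v y'" using assms(2) by (metis mset_add)
  then have "a = v + \<Sum>\<^sub># y'" using assms(1) by (simp add: decompositions_def)
  then show "v \<subseteq># a" by simp
qed

lemma decompositions_remove:
  assumes "y \<in> decompositions B a" "v \<in># y"
  shows "y - {#v#} \<in> decompositions B (a - v)"
proof -
  obtain y' where y': "y = add_mset v y'" using assms(2) by (metis mset_add)
  then have "a = v + \<Sum>\<^sub># y'" using assms(1) by (simp add: decompositions_def)
  then show ?thesis using assms(1) y' by (simp add: decompositions_def)
qed

lemma fact_dist_common_part: "fact_dist (y + w) (y' + w) \<le> max (size y) (size y')"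
proof -
  have "y + w - (y + w) \<inter># (y' + w) \<subseteq># y" "y' + w - (y + w) \<inter># (y' + w) \<subseteq># y'"
    by (auto simp: subseteq_mset_def)
  then show ?thesis unfolding fact_dist_def by (meson max.mono size_mset_mono)
qed

lemma fact_dist_disjoint:
  assumes "set_mset y \<inter> set_mset y' = {}" shows "fact_dist y y' = max (size y) (size y')"
proof -
  have "y \<inter># y' = {#}" using assms by (simp flip: set_mset_eq_empty_iff)
  then show ?thesis by (simp add: fact_dist_def)
qed

text \<open>
  The multiset \<open>u\<close> is distributed greedily over the members of \<open>z\<close>; members that receive nothing are
  dropped, so that a pair \<open>(x, v)\<close> records a factor \<open>v\<close> together with the nonempty part \<open>x\<close> of \<open>u\<close> that it provides.
\<close>
lemma cover_by_parts:
  assumes "u \<subseteq># \<Sum>\<^sub># z"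
  shows "\<exists>Q. image_mset snd Q \<subseteq># z \<and> \<Sum>\<^sub># (image_mset fst Q) = u \<and>
             (\<forall>(x, v) \<in># Q. x \<noteq> {#} \<and> x \<subseteq># v)"
  using assms
proof (induction z arbitrary: u)
  case empty
  then show ?case by (intro exI[of _ "{#}"]) auto
next
  case (add v z)
  have "u - v \<subseteq># \<Sum>\<^sub># z" using add.prems by (simp add: subset_eq_diff_conv add.commute)
  from add.IH[OF this] obtain Q where Q: "image_mset snd Q \<subseteq># z"
    "\<Sum>\<^sub># (image_mset fst Q) = u - v" "\<forall>(x, v) \<in># Q. x \<noteq> {#} \<and> x \<subseteq># v" by blast
  have uv: "u \<inter># v + (u - v) = u" by (rule multiset_eqI) auto
  show ?case
  proof (cases "u \<inter># v = {#}")
    case True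
    then have "u - v = u" using uv by simp
    then show ?thesis using Q by (intro exI[of _ Q]) (auto intro: subset_mset.trans[OF Q(1)])
  next
    case False
    then show ?thesis using Q uv by (intro exI[of _ "add_mset (u \<inter># v, v) Q"]) auto
  qed
qed

lemma size_sum_fst_ge:
  assumes "\<forall>(x, v) \<in># Q. x \<noteq> {#} \<and> x \<subseteq># v"
  shows "size Q \<le> size (\<Sum>\<^sub># (image_mset fst Q))"
  using assms
proof (induction Q)
  case (add q Q)
  then show ?case by (cases q) (auto simp: Suc_le_eq nonempty_has_size add_less_le_mono
     intro: order.trans[of _ "1 + _"] add_mono)
qed simp

lemma sum_fst_subset_sum_snd:
  assumes "\<forall>(x, v) \<in># Q. x \<noteq> {#} \<and> x \<subseteq># v"
  shows "\<Sum>\<^sub># (image_mset fst Q) \<subseteq># \<Sum>\<^sub># (image_mset snd Q)"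
  using assms
  by (induction Q) (auto intro: subset_mset.add_mono)

text \<open>
  Only the factors that take part in covering \<open>u\<close> have to be exchanged; the others are common to both
  factorizations and do not count for the distance. Choosing a cover of least size makes it minimal
  in the strong sense that no proper part of the factors covers \<open>u\<close>. A cover by a single factor
  forces this factor to be \<open>u\<close>.
\<close>
lemma tame_boundI:
  assumes B: "saturated B"
    and *: "\<And>u Q. u \<in> irreducibles B \<Longrightarrow> \<Sum>\<^sub># (image_mset fst Q) = u \<Longrightarrow>
      (\<forall>(x, v) \<in># Q. x \<noteq> {#} \<and> x \<subseteq># v \<and> v \<in> irreducibles B) \<Longrightarrow> 2 \<le> size Q \<Longrightarrow>
      (\<forall>Q'. u \<subseteq># \<Sum>\<^sub># (image_mset snd Q') \<longrightarrow> Q' \<subseteq># Q \<longrightarrow> Q' = Q) \<Longrightarrow>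
      size Q \<le> N \<and> (\<exists>y \<in> decompositions B (\<Sum>\<^sub># (image_mset snd Q) - u). Suc (size y) \<le> N)"
  shows "tame_bound B N"
  unfolding tame_bound_def
proof (intro ballI allI impI)
  fix u a z
  assume u: "u \<in> irreducibles B" and z: "z \<in> decompositions B a" and "\<exists>y\<in>decompositions B a. u \<in># y"
  then obtain y where "y \<in> decompositions B a" "u \<in># y" by blast
  then have "u \<subseteq># \<Sum>\<^sub># z" using decompositionsD_part(2) z by (auto simp: decompositions_def)
  \<comment> \<open>Least size is taken over all covers by members of \<open>z\<close>.\<close>
  define C where "C Q \<longleftrightarrow> image_mset snd Q \<subseteq># z \<and> \<Sum>\<^sub># (image_mset fst Q) = u \<and>
             (\<forall>(x, v) \<in># Q. x \<noteq> {#} \<and> x \<subseteq># v)" for Q :: "('a multiset \<times> 'a multiset) multiset"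
  obtain Q0 where "C Q0" using cover_by_parts[OF \<open>u \<subseteq># \<Sum>\<^sub># z\<close>] unfolding C_def by blast
  then obtain Q where "C Q" and min: "\<And>Q'. C Q' \<Longrightarrow> size Q \<le> size Q'"
    by (metis ex_has_least_nat)
  then have Q: "image_mset snd Q \<subseteq># z" "\<Sum>\<^sub># (image_mset fst Q) = u"
    and Qxv: "\<forall>(x, v) \<in># Q. x \<noteq> {#} \<and> x \<subseteq># v" by (auto simp: C_def)
  have Qirr: "\<forall>(x, v) \<in># Q. x \<noteq> {#} \<and> x \<subseteq># v \<and> v \<in> irreducibles B"
  proof (intro ballI, clarify)
    fix x v assume q: "(x, v) \<in># Q"
    have xv: "x \<noteq> {#}" "x \<subseteq># v" using Qxv q by auto
    have "v \<in># image_mset snd Q" using q by force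
    then have "v \<in># z" using Q(1) by (meson mset_subset_eqD)
    then have "v \<in> irreducibles B" using z by (auto simp: decompositions_def)
    then show "x \<noteq> {#} \<and> x \<subseteq># v \<and> v \<in> irreducibles B" using xv by simp
  qed
  have minQ: "Q' = Q" if Q': "u \<subseteq># \<Sum>\<^sub># (image_mset snd Q')" "Q' \<subseteq># Q" for Q'
  proof -
    obtain Q'' where Q'': "image_mset snd Q'' \<subseteq># image_mset snd Q'" "\<Sum>\<^sub># (image_mset fst Q'') = u"
             "\<forall>(x, v) \<in># Q''. x \<noteq> {#} \<and> x \<subseteq># v" using cover_by_parts[OF Q'(1)] by blast
    have "image_mset snd Q'' \<subseteq># z"
      using Q''(1) Q'(2) Q(1) by (meson image_mset_subseteq_mono subset_mset.trans)
    then have "size Q \<le> size Q''" using min Q'' by (auto simp: C_def)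
    also have "\<dots> \<le> size Q'" using size_mset_mono[OF Q''(1)] by simp
    finally show "Q' = Q" using Q'(2) by (metis mset_subset_size not_le subset_mset.le_neq_trans)
  qed
  define w where "w = z - image_mset snd Q"
  have zw: "z = image_mset snd Q + w" using Q(1) by (simp add: w_def)
  have w: "w \<in> decompositions B (\<Sum>\<^sub># w)" using z zw by (auto simp: decompositions_def)
  have a: "a = \<Sum>\<^sub># (image_mset snd Q) + \<Sum>\<^sub># w" using z zw by (auto simp: decompositions_def)
  have sub: "u \<subseteq># \<Sum>\<^sub># (image_mset snd Q)" using sum_fst_subset_sum_snd[OF Qxv] Q(2) by simp
  show "\<exists>y\<in>decompositions B a. u \<in># y \<and> fact_dist z y \<le> N"
  proof (cases "2 \<le> size Q")
    case True
    then obtain y where N: "size Q \<le> N" "Suc (size y) \<le> N"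
      and y: "y \<in> decompositions B (\<Sum>\<^sub># (image_mset snd Q) - u)"
      using *[OF u Q(2) Qirr True] minQ by blast
    have "{#u#} + y + w \<in> decompositions B a"
      unfolding a using decompositions_add[OF decompositions_add[OF decompositions_single[OF u] y] w] sub
      by simp
    moreover have "fact_dist z ({#u#} + y + w) \<le> N"
      unfolding zw using fact_dist_common_part[of "image_mset snd Q" w "{#u#} + y"] N by simp
    ultimately show ?thesis by (intro bexI[of _ "{#u#} + y + w"]) auto
  next
    case False
    have "u \<noteq> {#}" using u by (simp add: irreducibles_def)
    then have "Q \<noteq> {#}" using Q(2) by auto
    then have "size Q = 1" using False by (metis One_nat_def Suc_leI less_2_cases not_le nonempty_has_size not_less0)
    then obtain x v where "Q = {#(x, v)#}" by (metis size_1_singleton_mset surj_pair)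
    then have "u \<subseteq># v" "v \<in> irreducibles B" "v \<in># z" using Q Qirr by auto
    moreover have "v = u" using calculation u by (metis irreduciblesD)
    moreover have "fact_dist z z = 0" by (simp add: fact_dist_def)
    ultimately show ?thesis using z by (intro bexI[of _ z]) auto
  qed
qed

lemma size_diff_cover:
  assumes "\<forall>(x, v) \<in># Q. x \<noteq> {#} \<and> x \<subseteq># v" "u = \<Sum>\<^sub># (image_mset fst Q)"
  shows "\<Sum>\<^sub># (image_mset snd Q) = u + (\<Sum>\<^sub># (image_mset snd Q) - u)"
  using sum_fst_subset_sum_snd[OF assms(1)] assms(2) by simp

text \<open>
  A factorization of \<open>u + W\<close> that contains \<open>u\<close> consists of \<open>u\<close> and parts of \<open>W\<close>, hence shares no member
  with \<open>z\<close>. The distance is then the larger of the two lengths.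
\<close>
lemma tame_bound_ge:
  assumes B: "saturated B" and u: "u \<in> irreducibles B" and z: "set_mset z \<subseteq> irreducibles B"
    and eq: "\<Sum>\<^sub># z = u + W"
    and nin: "\<And>v. v \<in># z \<Longrightarrow> v \<noteq> u \<and> \<not> v \<subseteq># W"
    and N: "\<And>y. y \<in> decompositions B W \<Longrightarrow> N \<le> max (size z) (Suc (size y))"
    and t: "tame_bound B M"
  shows "N \<le> M"
proof -
  have zd: "z \<in> decompositions B (u + W)" using z eq by (simp add: decompositions_def)
  have "u + W \<in> B" using saturated_sum[OF B, of z] z eq by (auto simp: irreducibles_def)
  then have "W \<in> B" using u B by (auto simp: irreducibles_def saturated_def)
  then obtain y0 where "y0 \<in> decompositions B W" using decomposition_exists[OF B] by blast
  then have "{#u#} + y0 \<in> decompositions B (u + W)" using decompositions_add decompositions_single[OF u] by blast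
  then have "\<exists>y\<in>decompositions B (u + W). u \<in># y" by (intro bexI[of _ "{#u#} + y0"]) simp_all
  then obtain y where y: "y \<in> decompositions B (u + W)" "u \<in># y" "fact_dist z y \<le> M"
    using t u zd unfolding tame_bound_def by blast
  have y': "y - {#u#} \<in> decompositions B W" using decompositions_remove[OF y(1,2)] by simp
  have ysplit: "y = add_mset u (y - {#u#})" using y(2) by simp
  have "v \<notin># y" if "v \<in># z" for v
    using nin[OF that] decompositionsD_part(2)[OF y'] ysplit by (metis insert_iff set_mset_add_mset_insert)
  then have "fact_dist z y = max (size z) (size y)" using fact_dist_disjoint[of z y] by blast
  moreover have "size y = Suc (size (y - {#u#}))" using ysplit by (metis size_add_mset)
  ultimately show ?thesis using N[OF y'] y(3) by (metis order.trans)
qed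

section \<open>Zero-sum multisets in coordinates\<close>

definition zero_sum :: "nat list \<Rightarrow> ('p \<Rightarrow> nat \<Rightarrow> int) \<Rightarrow> 'p multiset \<Rightarrow> bool" where
  "zero_sum ns d S \<longleftrightarrow> (\<forall>i<length ns. int (ns ! i) dvd (\<Sum>p\<in>#S. d p i))"

definition blocks :: "nat list \<Rightarrow> 'p set \<Rightarrow> ('p \<Rightarrow> nat \<Rightarrow> int) \<Rightarrow> 'p multiset set" where
  "blocks ns P d = {S. set_mset S \<subseteq> P \<and> zero_sum ns d S}"

text \<open>
  Every class contains a prime: the coordinates \<open>d p\<close> matter only modulo the \<open>n\<^sub>i\<close>.
\<close>
definition covers :: "nat list \<Rightarrow> 'p set \<Rightarrow> ('p \<Rightarrow> nat \<Rightarrow> int) \<Rightarrow> bool" where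
  "covers ns P d \<longleftrightarrow> (\<forall>x. \<exists>p\<in>P. \<forall>i<length ns. [d p i = x i] (mod int (ns ! i)))"

lemma zero_sum_empty [simp]: "zero_sum ns d {#}"
  by (simp add: zero_sum_def)

lemma zero_sum_add: "zero_sum ns d S \<Longrightarrow> zero_sum ns d (S + T) \<longleftrightarrow> zero_sum ns d T"
  by (simp add: zero_sum_def dvd_add_right_iff)

lemma zero_sum_diff:
  "zero_sum ns d S \<Longrightarrow> zero_sum ns d T \<Longrightarrow> T \<subseteq># S \<Longrightarrow> zero_sum ns d (S - T)"
  by (metis subset_mset.add_diff_inverse zero_sum_add)

lemma saturated_blocks: "saturated (blocks ns P d)"
  by (auto simp: saturated_def blocks_def zero_sum_add)

lemma irreducible_blocks_iff:
  "u \<in> irreducibles (blocks ns P d) \<longleftrightarrow> set_mset u \<subseteq> P \<and> zero_sum ns d u \<and> u \<noteq> {#} \<and>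
     (\<forall>v. v \<subseteq># u \<longrightarrow> zero_sum ns d v \<longrightarrow> v = {#} \<or> v = u)"
proof -
  have "set_mset v \<subseteq> P" if "v \<subseteq># u" "set_mset u \<subseteq> P" for v
    using that set_mset_mono by blast
  then show ?thesis unfolding irreducibles_def blocks_def by blast
qed

lemma irreducible_blockD:
  assumes "u \<in> irreducibles (blocks ns P d)"
  shows "set_mset u \<subseteq> P" "zero_sum ns d u" "u \<noteq> {#}"
    "\<And>v. v \<subseteq># u \<Longrightarrow> zero_sum ns d v \<Longrightarrow> v \<noteq> {#} \<Longrightarrow> v = u"
  using assms unfolding irreducible_blocks_iff by auto

lemma subset_image_msetE:
  assumes "v \<subseteq># image_mset f M" obtains T where "T \<subseteq># M" "v = image_mset f T"
proof -
  obtain w where "image_mset f M = v + w" using assms by (auto simp: subset_mset.le_iff_add)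
  from image_mset_eq_plusD[OF this] show ?thesis using that by (metis mset_subset_eq_add_left)
qed

text \<open>
  A zero-sum part that contains \<open>p\<close> has a zero-sum complement inside \<open>S\<close>.
\<close>
lemma irreducible_add_closing:
  assumes P: "set_mset S \<subseteq> P" "p \<in> P" and zs: "zero_sum ns d (add_mset p S)"
    and free: "\<And>T. T \<subseteq># S \<Longrightarrow> zero_sum ns d T \<Longrightarrow> T = {#}"
  shows "add_mset p S \<in> irreducibles (blocks ns P d)"
  unfolding irreducible_blocks_iff
proof (intro conjI allI impI)
  fix v assume v: "v \<subseteq># add_mset p S" "zero_sum ns d v"
  let ?w = "add_mset p S - v"
  have w: "zero_sum ns d ?w" using zero_sum_diff[OF zs v(2,1)] .
  show "v = {#} \<or> v = add_mset p S"
  proof (cases "v \<subseteq># S")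
    case False
    have "?w \<subseteq># S"
    proof -
      have "p \<in># v" using v(1) False by (metis add_mset_diff_bothsides diff_single_trivial subset_eq_diff_conv
            add_mset_remove_trivial diff_subset_eq_self mset_subset_eq_insertD subset_mset.trans insert_DiffM2 add_mset_add_single)
      then obtain v' where "v = add_mset p v'" by (metis mset_add)
      then show ?thesis by simp
    qed
    then have "?w = {#}" using free w by blast
    then have "v = add_mset p S" using v(1) by (metis Diff_eq_empty_iff_mset subset_mset.antisym)
    then show ?thesis ..
  qed (use free v in blast)
qed (use P zs in auto)

lemma irreducible_remove_zero_sum_free:
  assumes u: "add_mset p S \<in> irreducibles (blocks ns P d)" and T: "T \<subseteq># S" "zero_sum ns d T"
  shows "T = {#}"
proof (rule ccontr)
  assume "T \<noteq> {#}"
  moreover have "T \<subseteq># add_mset p S" using T(1) by (auto simp: subseteq_mset_def le_SucI)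
  ultimately have "T = add_mset p S" using irreducible_blockD(4)[OF u] T(2) by blast
  then have "size (add_mset p S) \<le> size S" using T(1) size_mset_mono by blast
  then show False by simp
qed

text \<open>
  The exchange behind all lower bounds: the factorization \<open>z\<close> consists of the \<open>k\<close> atoms \<open>p\<^sub>j S\<^sub>j\<close>, and
  \<open>u = p\<^sub>1 \<cdots> p\<^sub>k\<close> is completed by factorizations of \<open>W = S\<^sub>1 \<cdots> S\<^sub>k\<close>.
\<close>
lemma tame_bound_exchange_ge:
  fixes S :: "nat \<Rightarrow> 'p multiset" and p :: "nat \<Rightarrow> 'p"
  assumes P: "\<And>j. j < k \<Longrightarrow> p j \<in> P \<and> set_mset (S j) \<subseteq> P"
    and zs: "\<And>j. j < k \<Longrightarrow> zero_sum ns d (add_mset (p j) (S j))"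
    and free: "\<And>j T. j < k \<Longrightarrow> T \<subseteq># S j \<Longrightarrow> zero_sum ns d T \<Longrightarrow> T = {#}"
    and U: "image_mset p (mset_set {..<k}) \<in> irreducibles (blocks ns P d)"
    and nin: "\<And>j. j < k \<Longrightarrow> add_mset (p j) (S j) \<noteq> image_mset p (mset_set {..<k}) \<and> \<not> add_mset (p j) (S j) \<subseteq># (\<Sum>j<k. S j)"
    and N: "\<And>y. y \<in> decompositions (blocks ns P d) (\<Sum>j<k. S j) \<Longrightarrow> N \<le> max k (Suc (size y))"
    and t: "tame_bound (blocks ns P d) M"
  shows "N \<le> M"
proof -
  let ?z = "image_mset (\<lambda>j. add_mset (p j) (S j)) (mset_set {..<k})"
  have "\<Sum>\<^sub># ?z = image_mset p (mset_set {..<k}) + (\<Sum>j<k. S j)"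
  proof -
    have "finite A \<Longrightarrow> \<Sum>\<^sub># (image_mset (\<lambda>j. add_mset (p j) (S j)) (mset_set A)) = image_mset p (mset_set A) + sum S A" for A
      by (induction A rule: finite_induct) auto
    then show ?thesis by simp
  qed
  moreover have "set_mset ?z \<subseteq> irreducibles (blocks ns P d)"
    using irreducible_add_closing[where ns = ns and d = d] P zs free by fastforce
  moreover have "v \<noteq> image_mset p (mset_set {..<k}) \<and> \<not> v \<subseteq># (\<Sum>j<k. S j)" if "v \<in># ?z" for v
    using that nin by auto
  ultimately show ?thesis
    using tame_bound_ge[OF saturated_blocks U, of ?z "\<Sum>j<k. S j" N M] N t by auto
qed

lemma covers_inverse:
  assumes "covers ns P d" shows "\<exists>q\<in>P. zero_sum ns d (add_mset q S)"
proof -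
  obtain q where "q \<in> P" "\<forall>i<length ns. [d q i = - (\<Sum>p\<in>#S. d p i)] (mod int (ns ! i))"
    using assms unfolding covers_def by meson
  then show ?thesis
    by (intro bexI[of _ q]) (auto simp: zero_sum_def cong_iff_dvd_diff)
qed

text \<open>
  Let \<open>q\<^sub>p\<close> be a prime in the class \<open>-[p]\<close>. The pairs \<open>p q\<^sub>p\<close> for \<open>p\<close> in \<open>u\<close> form a factorization of length \<open>|u|\<close>
  whose product is divisible by \<open>u\<close>. No pair divides the product of the \<open>q\<^sub>p\<close>: negating classes, it would
  give a zero-sum part of \<open>u\<close> of length \<open>2 < |u|\<close>.
\<close>
lemma tame_bound_ge_size_irreducible:
  assumes c: "covers ns P d" and U: "u \<in> irreducibles (blocks ns P d)" and 3: "3 \<le> size u"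
    and t: "tame_bound (blocks ns P d) M"
  shows "size u \<le> M"
proof -
  have "\<forall>p. \<exists>q. q \<in> P \<and> zero_sum ns d {#p, q#}" 
  proof
    fix p obtain q where "q\<in>P" "zero_sum ns d (add_mset q {#p#})" using covers_inverse[OF c] by blast
    then show "\<exists>q. q \<in> P \<and> zero_sum ns d {#p, q#}" by (auto simp: add_mset_commute)
  qed
  then obtain q where q: "\<And>p. q p \<in> P" "\<And>p. zero_sum ns d {#p, q p#}" by metis
  note u = irreducible_blockD[OF U]
  let ?z = "image_mset (\<lambda>p. {#p, q p#}) u"
  have single: "\<not> zero_sum ns d {#p#}" if "p \<in># u" for p
  proof
    assume "zero_sum ns d {#p#}" then have "{#p#} = u" using u(4)[of "{#p#}"] that by auto
    then show False using 3 by auto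
  qed
  have neg: "zero_sum ns d (T + image_mset q T)" for T
  proof (induction T)
    case (add p T)
    have "add_mset p T + image_mset q (add_mset p T) = {#p, q p#} + (T + image_mset q T)" by simp
    then show ?case using q(2)[of p] add by (metis zero_sum_add)
  qed simp
  have irr: "set_mset ?z \<subseteq> irreducibles (blocks ns P d)"
  proof
    fix v assume "v \<in># ?z" then obtain p where p: "p \<in># u" "v = {#p, q p#}" by auto
    have "T = {#}" if "T \<subseteq># {#q p#}" "zero_sum ns d T" for T
    proof (rule ccontr)
      assume "T \<noteq> {#}" then have "T = {#q p#}" using that(1)
        by (metis nonempty_subseteq_mset_eq_single)
      then have "zero_sum ns d {#p#}" using q(2)[of p] that(2)
        by (metis add.commute add_mset_add_single zero_sum_add)
      then show False using single p by blast
    qed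
    then show "v \<in> irreducibles (blocks ns P d)"
      unfolding p(2) using irreducible_add_closing[of "{#q p#}" P p ns d] q p u(1) by auto
  qed
  have sum: "\<Sum>\<^sub># ?z = u + image_mset q u"
  proof -
    have "\<Sum>\<^sub># (image_mset (\<lambda>p. {#p, q p#}) T) = T + image_mset q T" for T
      by (induction T) auto
    then show ?thesis .
  qed
  show ?thesis
  proof (rule tame_bound_ge[OF saturated_blocks U irr sum _ _ t])
    fix v assume "v \<in># ?z" then obtain p where p: "p \<in># u" "v = {#p, q p#}" by auto
    show "v \<noteq> u \<and> \<not> v \<subseteq># image_mset q u"
    proof
      show "v \<noteq> u" using 3 p by auto
      show "\<not> v \<subseteq># image_mset q u"
      proof
        assume "v \<subseteq># image_mset q u"
        then obtain T where T: "T \<subseteq># u" "v = image_mset q T" by (rule subset_image_msetE)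
        have "zero_sum ns d v" using p q by simp
        then have "zero_sum ns d T" using neg[of T] T(2) by (metis add.commute zero_sum_add)
        moreover have "size T = 2" using T(2) p(2) by (metis size_image_mset size_add_mset size_single Suc_1 size_empty One_nat_def)
        ultimately show False using u(4)[of T] T(1) 3 by fastforce
      qed
    qed
  qed auto
qed

lemma size_decomposition_le:
  assumes y: "y \<in> decompositions B a" and m: "\<And>v. v \<in> B \<Longrightarrow> v \<subseteq># a \<Longrightarrow> v \<noteq> {#} \<Longrightarrow> m \<le> (\<Sum>p\<in>#v. f p :: nat)"
  shows "m * size y \<le> (\<Sum>p\<in>#a. f p :: nat)"
proof -
  have "set_mset z \<subseteq> set_mset y \<Longrightarrow> m * size z \<le> (\<Sum>p\<in>#\<Sum>\<^sub># z. f p)" for z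
  proof (induction z)
    case (add v z)
    then have v: "v \<in># y" by auto
    then have "m \<le> (\<Sum>p\<in>#v. f p)" using decompositionsD_part[OF y v] m irreduciblesD by blast
    then show ?case using add by simp
  qed simp
  from this[of y] show ?thesis using y by (simp add: decompositions_def)
qed

text \<open>
  A prime in the zero class is an atom. If it occurred in a member \<open>v\<close> of a cover, then \<open>v\<close> would be
  that prime, so it would lie in \<open>u\<close> and be all of \<open>u\<close>; the cover would have one member.
\<close>
lemma cover_no_zero_prime:
  assumes u: "u \<in> irreducibles (blocks ns P d)"
    and Q: "\<Sum>\<^sub># (image_mset fst Q) = u" "\<forall>(x, v) \<in># Q. x \<noteq> {#} \<and> x \<subseteq># v \<and> v \<in> irreducibles (blocks ns P d)"
    and 2: "2 \<le> size Q"
  shows "p \<in># \<Sum>\<^sub># (image_mset snd Q) \<Longrightarrow> \<not> zero_sum ns d {#p#}"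
    and "p \<in># u \<Longrightarrow> \<not> zero_sum ns d {#p#}" 
    and "size Q \<le> size u"
    and "\<And>x v. (x,v) \<in># Q \<Longrightarrow> size x + size Q \<le> Suc (size u)"
proof -
  have Q': "\<forall>(x, v) \<in># Q. x \<noteq> {#} \<and> x \<subseteq># v" using Q(2) by auto
  show "size Q \<le> size u" using size_sum_fst_ge[OF Q'] Q(1) by simp
  then have u2: "2 \<le> size u" using 2 by simp
  have *: "\<not> zero_sum ns d {#p#}" if "p \<in># u" for p
  proof
    assume "zero_sum ns d {#p#}"
    then have "u = {#p#}" using irreducible_blockD(4)[OF u, of "{#p#}"] that by auto
    then show False using u2 by simp
  qed
  then show "p \<in># u \<Longrightarrow> \<not> zero_sum ns d {#p#}" .
  assume "p \<in># \<Sum>\<^sub># (image_mset snd Q)"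
  then obtain x v where xv: "(x, v) \<in># Q" "p \<in># v" by fastforce
  show "\<not> zero_sum ns d {#p#}"
  proof
    assume z: "zero_sum ns d {#p#}"
    have "v \<in> irreducibles (blocks ns P d)" using Q(2) xv by auto
    then have "v = {#p#}" using irreducible_blockD(4)[of v ns P d "{#p#}"] xv z by auto
    then have "p \<in># x" using Q' xv(1) by (metis (mono_tags, lifting) case_prodD mset_subset_eq_single nonempty_subseteq_mset_eq_single union_single_eq_member mset_subset_eqD multi_member_last)
    then have "p \<in># u" using Q(1) xv(1) by force
    then show False using * z by blast
  qed
next
  fix x v assume xv: "(x, v) \<in># Q"
  then obtain Q1 where Q1: "Q = add_mset (x, v) Q1" by (metis mset_add)
  have "size Q1 \<le> size (\<Sum>\<^sub># (image_mset fst Q1))" by (rule size_sum_fst_ge) (use Q(2) Q1 in auto)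
  then show "size x + size Q \<le> Suc (size u)" using Q(1) Q1 by auto
qed

lemma size_sum_snd_le:
  fixes Q :: "('a \<times> 'p multiset) multiset"
  assumes "\<forall>(x, v) \<in># Q. size v \<le> D" shows "size (\<Sum>\<^sub># (image_mset snd Q)) \<le> D * size Q"
  using assms by (induction Q) (auto simp: add_mono)

lemma pieces_ge_2:
  assumes "\<And>p. p \<in># W \<Longrightarrow> \<not> zero_sum ns d {#p#}" "v \<in> blocks ns P d" "v \<subseteq># W" "v \<noteq> {#}"
  shows "2 \<le> size v"
proof (rule ccontr)
  assume "\<not> 2 \<le> size v"
  then have "size v = 1" using assms(4) nonempty_has_size[of v] by linarith
  then obtain p where p: "v = {#p#}" by (metis size_1_singleton_mset)
  then show False using assms by (auto simp: blocks_def)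
qed

text \<open>
  Without primes in the zero class, atoms have at least two primes.
\<close>
lemma half_size_decomposition:
  assumes "\<And>p. p \<in># W \<Longrightarrow> \<not> zero_sum ns d {#p#}" "y \<in> decompositions (blocks ns P d) W"
  shows "2 * size y \<le> size W"
proof -
  have "2 \<le> (\<Sum>p\<in>#v. 1 :: nat)" if "v \<in> blocks ns P d" "v \<subseteq># W" "v \<noteq> {#}" for v
    using pieces_ge_2[OF assms(1) that] by simp
  from size_decomposition_le[OF assms(2) this] show ?thesis by simp
qed

lemma block_cover_diff:
  assumes u: "u \<in> irreducibles (blocks ns P d)"
    and Q: "\<Sum>\<^sub># (image_mset fst Q) = u" "\<forall>(x, v) \<in># Q. x \<noteq> {#} \<and> x \<subseteq># v \<and> v \<in> irreducibles (blocks ns P d)"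
  shows "\<Sum>\<^sub># (image_mset snd Q) - u \<in> blocks ns P d"
    and "size (\<Sum>\<^sub># (image_mset snd Q) - u) + size u = size (\<Sum>\<^sub># (image_mset snd Q))"
proof -
  have Q': "\<forall>(x, v) \<in># Q. x \<noteq> {#} \<and> x \<subseteq># v" using Q(2) by auto
  have sub: "u \<subseteq># \<Sum>\<^sub># (image_mset snd Q)" using sum_fst_subset_sum_snd[OF Q'] Q(1) by simp
  have "\<Sum>\<^sub># (image_mset snd Q) \<in> blocks ns P d"
    by (rule saturated_sum[OF saturated_blocks]) (use Q(2) in \<open>auto simp: irreducibles_def\<close>)
  then show "\<Sum>\<^sub># (image_mset snd Q) - u \<in> blocks ns P d"
    using saturated_diff[OF saturated_blocks, of u ns P d] u sub by (auto simp: irreducibles_def)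
  show "size (\<Sum>\<^sub># (image_mset snd Q) - u) + size u = size (\<Sum>\<^sub># (image_mset snd Q))"
    using sub by (metis size_union subset_mset.diff_add)
qed

text \<open>
  In a cover with \<open>k \<le> |u| \<le> D\<close> members the rest has at most \<open>k D - |u| \<le> k (D - 1) \<le> D (D - 1)\<close> primes,
  and every atom takes at least two of them.
\<close>
lemma tame_bound_davenport_le:
  assumes D: "\<And>u. u \<in> irreducibles (blocks ns P d) \<Longrightarrow> size u \<le> D" and D1: "1 \<le> D"
  shows "tame_bound (blocks ns P d) (1 + D * (D - 1) div 2)"
proof (rule tame_boundI[OF saturated_blocks])
  fix u Q
  assume u: "u \<in> irreducibles (blocks ns P d)"
    and Q: "\<Sum>\<^sub># (image_mset fst Q) = u" "\<forall>(x, v) \<in># Q. x \<noteq> {#} \<and> x \<subseteq># v \<and> v \<in> irreducibles (blocks ns P d)"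
    and 2: "2 \<le> size Q"
  note c = cover_no_zero_prime[OF u Q 2]
  let ?V = "\<Sum>\<^sub># (image_mset snd Q)"
  obtain y where y: "y \<in> decompositions (blocks ns P d) (?V - u)"
    using decomposition_exists[OF saturated_blocks block_cover_diff(1)[OF u Q]] by blast
  have "2 * size y \<le> size (?V - u)"
    using half_size_decomposition[OF _ y] c(1) by (meson in_diffD)
  moreover have "size ?V \<le> D * size Q" using size_sum_snd_le[of Q D] Q(2) D by auto
  ultimately have "2 * size y + size u \<le> D * size Q" using block_cover_diff(2)[OF u Q] by linarith
  then have "2 * size y + size Q \<le> D * size Q" using c(3) by linarith
  then have "2 * size y \<le> (D - 1) * size Q" by (simp add: diff_mult_distrib)
  also have "\<dots> \<le> (D - 1) * D" using c(3) D[OF u] by (intro mult_le_mono) auto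
  finally have y2: "2 * size y \<le> D * (D - 1)" by (simp add: mult.commute)
  have "size Q \<le> D" using c(3) D[OF u] by simp
  moreover have "D \<le> 1 + D * (D - 1) div 2"
  proof (cases "D \<le> 1")
    case False
    then have "2 * (D - 1) \<le> D * (D - 1)" by (intro mult_le_mono) auto
    then show ?thesis by linarith
  qed auto
  ultimately show "size Q \<le> 1 + D * (D - 1) div 2 \<and>
    (\<exists>y\<in>decompositions (blocks ns P d) (?V - u). Suc (size y) \<le> 1 + D * (D - 1) div 2)"
    using y y2 by (intro conjI bexI[of _ y]) auto
qed

section \<open>Multisets over a signed basis\<close>

text \<open>
  If no atom below \<open>a\<close> weighs more than \<open>1\<close>, a factorization of \<open>a\<close> has at least as many members as
  \<open>a\<close> weighs. This is how factorizations are bounded from below without knowing all atoms.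
\<close>
lemma size_decomposition_ge:
  fixes wt :: "'p \<Rightarrow> real"
  assumes y: "y \<in> decompositions B a"
    and 1: "\<And>v. v \<in> irreducibles B \<Longrightarrow> v \<subseteq># a \<Longrightarrow> (\<Sum>p\<in>#v. wt p) \<le> 1"
  shows "(\<Sum>p\<in>#a. wt p) \<le> real (size y)"
proof -
  have "set_mset z \<subseteq> set_mset y \<Longrightarrow> (\<Sum>p\<in>#\<Sum>\<^sub># z. wt p) \<le> real (size z)" for z
  proof (induction z)
    case (add v z)
    then have v: "v \<in># y" by auto
    then have "(\<Sum>p\<in>#v. wt p) \<le> 1" using decompositionsD_part[OF y v] 1 by blast
    then show ?case using add by simp
  qed simp
  from this[of y] show ?thesis using y by (simp add: decompositions_def)
qed

definition dstar :: "nat list \<Rightarrow> nat" where "dstar ns = 1 + (\<Sum>n\<leftarrow>ns. n - 1)"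

locale covered_blocks =
  fixes ns :: "nat list" and P :: "'p set" and d :: "'p \<Rightarrow> nat \<Rightarrow> int"
  assumes ns_gt_1: "\<forall>n\<in>set ns. 1 < n" and covers: "covers ns P d"
begin

abbreviation "r \<equiv> length ns"
abbreviation "B \<equiv> blocks ns P d"

lemma n_gt_1: "i < r \<Longrightarrow> 1 < ns ! i"
  using ns_gt_1 by simp

text \<open>
  A prime chosen in the class with coordinates \<open>x\<close>; the choice depends on the class only.
\<close>
definition prime_at :: "(nat \<Rightarrow> int) \<Rightarrow> 'p" where
  "prime_at x = (SOME p. p \<in> P \<and> (\<forall>i<r. [d p i = x i] (mod int (ns ! i))))"

lemma prime_at: "prime_at x \<in> P" "i < r \<Longrightarrow> [d (prime_at x) i = x i] (mod int (ns ! i))"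
proof -
  have "\<exists>p. p \<in> P \<and> (\<forall>i<r. [d p i = x i] (mod int (ns ! i)))"
    using covers unfolding covers_def by blast
  from someI_ex[OF this]
  show "prime_at x \<in> P" "i < r \<Longrightarrow> [d (prime_at x) i = x i] (mod int (ns ! i))"
    unfolding prime_at_def by auto
qed

lemma prime_at_eqI: 
  assumes "\<And>i. i < r \<Longrightarrow> [x i = y i] (mod int (ns ! i))" shows "prime_at x = prime_at y"
proof -
  have "(p \<in> P \<and> (\<forall>i<r. [d p i = x i] (mod int (ns ! i)))) \<longleftrightarrow> (p \<in> P \<and> (\<forall>i<r. [d p i = y i] (mod int (ns ! i))))" for p
    using assms by (meson cong_sym cong_trans)
  then show ?thesis unfolding prime_at_def by simp
qed

lemma zero_sum_cong_iff:
  assumes "\<And>i. i < r \<Longrightarrow> [(\<Sum>p\<in>#S. d p i) = t i] (mod int (ns ! i))"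
  shows "zero_sum ns d S \<longleftrightarrow> (\<forall>i<r. int (ns ! i) dvd t i)"
  unfolding zero_sum_def using assms by (meson cong_dvd_iff)

text \<open>
  For \<open>s = \<plusminus>1\<close> this is a prime in the class \<open>\<plusminus>e\<^sub>i\<close>, where \<open>e\<^sub>1, \<dots>, e\<^sub>r\<close> is the standard basis. If \<open>n\<^sub>i = 2\<close>
  both signs give the same prime.
\<close>
definition e :: "int \<Rightarrow> nat \<Rightarrow> 'p" where "e s i = prime_at (\<lambda>j. if j = i then s else 0)"

text \<open>
  The product of the powers \<open>(s e\<^sub>i)\<^bsup>\<beta>\<^sub>i\<^esup>\<close>.
\<close>
definition monomial :: "int \<Rightarrow> (nat \<Rightarrow> nat) \<Rightarrow> 'p multiset" where
  "monomial s \<beta> = (\<Sum>i<r. replicate_mset (\<beta> i) (e s i))"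

lemma e_in: "e s i \<in> P" by (simp add: e_def prime_at)

lemma d_e: "j < r \<Longrightarrow> [d (e s i) j = (if j = i then s else 0)] (mod int (ns ! j))"
  unfolding e_def using prime_at(2)[of j "\<lambda>j. if j = i then s else 0"] by simp

lemma not_cong_unit:
  assumes "i < r" "s \<in> {1, -1}" shows "\<not> [s = 0] (mod int (ns ! i))"
  using n_gt_1[OF assms(1)] assms(2) by (auto simp: cong_0_iff)

lemma e_neq: "i < r \<Longrightarrow> i \<noteq> j \<Longrightarrow> s \<in> {1, -1} \<Longrightarrow> e s i \<noteq> e t j"
proof
  assume i: "i < r" "i \<noteq> j" "s \<in> {1, -1}" and eq: "e s i = e t j"
  have "[d (e s i) i = s] (mod int (ns ! i))" using d_e[OF i(1), of s i] by simp
  moreover have "[d (e s i) i = 0] (mod int (ns ! i))" unfolding eq using d_e[OF i(1), of t j] i(2) by simp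
  ultimately show False using not_cong_unit[OF i(1,3)] cong_sym cong_trans by blast
qed

lemma e_signs_eqD: "i < r \<Longrightarrow> e 1 i = e (-1) i \<Longrightarrow> ns ! i = 2"
proof -
  assume i: "i < r" and "e 1 i = e (-1) i"
  then have "[d (e 1 i) i = 1] (mod int (ns ! i))" "[d (e 1 i) i = - 1] (mod int (ns ! i))"
    using d_e[of i 1 i] d_e[of i "-1" i] by simp_all
  then have "[1 = - 1] (mod int (ns ! i))" using cong_sym cong_trans by blast
  then have "int (ns ! i) dvd 2" by (auto simp: cong_iff_dvd_diff)
  then have "int (ns ! i) \<le> 2" using zdvd_imp_le[of "int (ns ! i)" 2] by linarith
  then show "ns ! i = 2" using n_gt_1[OF i] by simp
qed

lemma set_monomial: "set_mset (monomial s \<beta>) \<subseteq> e s ` {..<r}"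
  unfolding monomial_def by (auto simp: set_mset_sum split: if_splits)

lemma set_monomial_P: "set_mset (monomial s \<beta>) \<subseteq> P"
  using set_monomial e_in by blast

lemma count_monomial:
  assumes "s \<in> {1, -1}" "i < r" shows "count (monomial s \<beta>) (e s i) = \<beta> i"
proof -
  have "count (monomial s \<beta>) (e s i) = (\<Sum>j<r. if j = i then \<beta> j else 0)"
    unfolding monomial_def count_sum
  proof (rule sum.cong)
    fix j assume "j \<in> {..<r}"
    then show "count (replicate_mset (\<beta> j) (e s j)) (e s i) = (if j = i then \<beta> j else 0)"
      using e_neq[of j i s s] assms by (cases "j = i") auto
  qed simp
  then show ?thesis using assms(2) by simp
qed

lemma sum_monomial: "(\<Sum>p\<in>#monomial s \<beta>. f p) = (\<Sum>i<r. of_nat (\<beta> i) * (f (e s i) :: 'b :: comm_semiring_1))"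
proof -
  have "finite A \<Longrightarrow> (\<Sum>p\<in>#(\<Sum>i\<in>A. replicate_mset (\<beta> i) (e s i)). f p) = (\<Sum>i\<in>A. of_nat (\<beta> i) * f (e s i))" for A
    by (induction A rule: finite_induct) auto
  then show ?thesis by (simp add: monomial_def)
qed

lemma size_monomial: "size (monomial s \<beta>) = (\<Sum>i<r. \<beta> i)"
  using sum_monomial[of "\<lambda>_. 1 :: nat" s \<beta>] by simp

lemma coordinate_monomial: "j < r \<Longrightarrow> [(\<Sum>p\<in>#monomial s \<beta>. d p j) = s * int (\<beta> j)] (mod int (ns ! j))"
proof -
  assume j: "j < r"
  have "[(\<Sum>i<r. int (\<beta> i) * d (e s i) j) = (\<Sum>i<r. int (\<beta> i) * (if j = i then s else 0))] (mod int (ns ! j))"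
    by (intro cong_sum cong_scalar_left d_e[OF j])
  moreover have "(\<Sum>i<r. int (\<beta> i) * (if j = i then s else 0)) = s * int (\<beta> j)"
    using j by (simp add: if_distrib cong: if_cong)
  ultimately show ?thesis by (simp add: sum_monomial)
qed

text \<open>
  The case distinction avoids counting \<open>e\<^sub>i = -e\<^sub>i\<close> twice when \<open>n\<^sub>i = 2\<close>.
\<close>
lemma coordinate_count:
  assumes T: "set_mset T \<subseteq> e 1 ` {..<r} \<union> e (-1) ` {..<r}" and i: "i < r"
  shows "[(\<Sum>p\<in>#T. d p i) = int (count T (e 1 i)) - (if e (-1) i = e 1 i then 0 else int (count T (e (-1) i)))] (mod int (ns ! i))"
  using T
proof (induction T)
  case (add p T)
  define c where "c q = (if q = e 1 i then 1 else if q = e (-1) i then -1 else 0 :: int)" for q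
  have "[d p i = c p] (mod int (ns ! i))"
  proof -
    obtain s j where sj: "s \<in> {1, -1}" "j < r" "p = e s j" using add.prems by auto
    show ?thesis
    proof (cases "j = i")
      case True
      then show ?thesis
      proof (cases "s = 1")
        case False
        then have "s = -1" using sj by auto
        then show ?thesis using d_e[OF i, of s i] d_e[OF i, of 1 i] sj True by (cases "p = e 1 i") (auto simp: c_def)
      qed (use d_e[OF i, of s i] sj in \<open>auto simp: c_def\<close>)
    next
      case False
      have "p \<noteq> e 1 i" "p \<noteq> e (-1) i" using e_neq[OF i, of j _ s] False unfolding sj(3) by (metis insertCI)+
      then show ?thesis using d_e[OF i, of s j] sj False by (simp add: c_def)
    qed
  qed
  moreover have "int (count (add_mset p T) (e 1 i)) - (if e (-1) i = e 1 i then 0 else int (count (add_mset p T) (e (-1) i)))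
     = c p + (int (count T (e 1 i)) - (if e (-1) i = e 1 i then 0 else int (count T (e (-1) i))))"
    by (auto simp: c_def)
  moreover have "[(\<Sum>q\<in>#T. d q i) = int (count T (e 1 i)) - (if e (-1) i = e 1 i then 0 else int (count T (e (-1) i)))] (mod int (ns ! i))"
    using add by auto
  ultimately show ?case by (auto intro: cong_add)
qed simp

text \<open>
  Coordinates do not interact: a nonempty zero-sum part would contain some \<open>e\<^sub>i\<close> a multiple of
  \<open>n\<^sub>i\<close> times.
\<close>
lemma monomial_zero_sum_free:
  assumes s: "s \<in> {1, -1}" and b: "\<And>i. i < r \<Longrightarrow> \<beta> i < ns ! i" and T: "T \<subseteq># monomial s \<beta>" "zero_sum ns d T"
  shows "T = {#}"
proof (rule ccontr)
  assume "T \<noteq> {#}"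
  then obtain p where p: "p \<in># T" by blast
  then obtain i where i: "i < r" "p = e s i" using T(1) set_monomial by (meson imageE lessThan_iff mset_subset_eqD subsetD)
  have sub: "set_mset T \<subseteq> e s ` {..<r}" using T(1) set_monomial set_mset_mono by blast
  then have "[(\<Sum>p\<in>#T. d p i) = s * int (count T (e s i))] (mod int (ns ! i))"
  proof (induction T)
    case (add q T)
    then obtain j where j: "j < r" "q = e s j" by auto
    have "[d q i = (if q = e s i then s else 0)] (mod int (ns ! i))"
      using d_e[OF i(1), of s j] j e_neq[OF i(1), of j s s] s by (cases "j = i") auto
    then show ?case using add by (auto simp: algebra_simps dest: cong_add)
  qed simp
  then have "int (ns ! i) dvd s * int (count T (e s i))"
    using T(2) i(1) unfolding zero_sum_def by (meson cong_dvd_iff)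
  then have "ns ! i dvd count T (e s i)" using s by auto
  moreover have "0 < count T (e s i)" using p i by simp
  moreover have "count T (e s i) \<le> \<beta> i" using T(1) count_monomial[OF s i(1)] by (metis mset_subset_eq_count)
  ultimately show False using b[OF i(1)] by (meson dvd_imp_le leD le_trans)
qed

lemma zero_sum_prime_at_monomial:
  "zero_sum ns d (add_mset (prime_at x) (monomial s \<beta>)) \<longleftrightarrow> (\<forall>i<r. int (ns ! i) dvd x i + s * int (\<beta> i))"
  by (rule zero_sum_cong_iff) (use prime_at(2)[of _ x] coordinate_monomial[of _ s \<beta>] in \<open>auto intro: cong_add\<close>)

lemma irreducible_prime_at_monomial:
  assumes "s \<in> {1, -1}" "\<And>i. i < r \<Longrightarrow> \<beta> i < ns ! i" "\<And>i. i < r \<Longrightarrow> int (ns ! i) dvd x i + s * int (\<beta> i)"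
  shows "add_mset (prime_at x) (monomial s \<beta>) \<in> irreducibles B"
proof (rule irreducible_add_closing[OF set_monomial_P prime_at(1)])
  show "zero_sum ns d (add_mset (prime_at x) (monomial s \<beta>))" using zero_sum_prime_at_monomial assms(3) by blast
  show "T = {#}" if "T \<subseteq># monomial s \<beta>" "zero_sum ns d T" for T
    using monomial_zero_sum_free[OF assms(1) assms(2) that] by blast
qed

text \<open>
  Give \<open>e\<^sub>i\<close> the weight \<open>1/n\<^sub>i\<close> and \<open>-e\<^sub>i\<close> the weight \<open>1 - 1/n\<^sub>i\<close>. The atoms over \<open>\<plusminus>e\<^sub>1, \<dots>, \<plusminus>e\<^sub>r\<close> are \<open>e\<^sub>i (-e\<^sub>i)\<close> and
  \<open>e\<^sub>i\<^bsup>n\<^sub>i\<^esup>\<close> of weight \<open>1\<close>, and \<open>(-e\<^sub>i)\<^bsup>n\<^sub>i\<^esup>\<close>, which is excluded as \<open>-e\<^sub>i\<close> occurs fewer than \<open>n\<^sub>i\<close> times.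
\<close>
lemma size_decomposition_monomial_ge:
  assumes C: "\<And>i. i < r \<Longrightarrow> C i < ns ! i"
    and y: "y \<in> decompositions B (monomial 1 A + monomial (-1) C)"
  shows "(\<Sum>i<r. A i / ns ! i + C i * (1 - 1 / ns ! i)) \<le> size y"
proof -
  define wt :: "'p \<Rightarrow> real" where
    "wt p = (\<Sum>i<r. if p = e 1 i then 1 / ns ! i else if p = e (-1) i then 1 - 1 / ns ! i else 0)" for p
  have wt1: "wt (e 1 i) = 1 / ns ! i" if i: "i < r" for i
  proof -
    have "wt (e 1 i) = (\<Sum>j<r. if j = i then 1 / ns ! j else 0)"
      unfolding wt_def by (rule sum.cong) (use e_neq[of i _ 1] i in auto)
    then show ?thesis using i by simp
  qed
  have wt2: "wt (e (-1) i) = 1 - 1 / ns ! i" if i: "i < r" for i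
  proof -
    have "wt (e (-1) i) = (\<Sum>j<r. if j = i then 1 - 1 / ns ! j else 0)"
      unfolding wt_def
    proof (rule sum.cong, rule refl)
      fix j assume "j \<in> {..<r}"
      show "(if e (-1) i = e 1 j then 1 / ns ! j else if e (-1) i = e (-1) j then 1 - 1 / ns ! j else 0) =
         (if j = i then 1 - 1 / real (ns ! j) else 0)"
      proof (cases "j = i")
        case True
        then show ?thesis using e_signs_eqD[OF i] by fastforce
      next
        case False
        then show ?thesis using e_neq[of i j "-1" 1] e_neq[of i j "-1" "-1"] i by auto
      qed
    qed
    then show ?thesis using i by simp
  qed
  let ?W = "monomial 1 A + monomial (-1) C"
  have setW: "set_mset ?W \<subseteq> e 1 ` {..<r} \<union> e (-1) ` {..<r}" using set_monomial by fastforce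
  have le1: "(\<Sum>p\<in>#v. wt p) \<le> 1" if v: "v \<in> irreducibles B" "v \<subseteq># ?W" for v
  proof -
    note vi = irreducible_blockD[OF v(1)]
    have setv: "set_mset v \<subseteq> e 1 ` {..<r} \<union> e (-1) ` {..<r}" using v(2) setW set_mset_mono by blast
    obtain i where i: "i < r" "e 1 i \<in># v \<or> e (-1) i \<in># v" using setv vi(3) by (metis UnE imageE lessThan_iff multiset_nonemptyE subsetD)
    have dvd: "int (ns ! i) dvd int (count v (e 1 i)) - (if e (-1) i = e 1 i then 0 else int (count v (e (-1) i)))"
      using coordinate_count[OF setv i(1)] vi(2) i(1) unfolding zero_sum_def by (meson cong_dvd_iff)
    consider (pair) "e 1 i \<in># v" "e (-1) i \<in># v" "e (-1) i \<noteq> e 1 i"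
      | (pos) "e 1 i \<in># v" "e (-1) i \<in># v \<longrightarrow> e (-1) i = e 1 i"
      | (neg) "e (-1) i \<in># v" "e 1 i \<notin># v" using i(2) by blast
    then show ?thesis
    proof cases
      case pair
      have "{#e 1 i, e (-1) i#} \<subseteq># v" using pair by (simp add: insert_subset_eq_iff in_diff_count)
      moreover have "zero_sum ns d {#e 1 i, e (-1) i#}"
      proof (subst zero_sum_cong_iff[where t = "\<lambda>_. 0"])
        fix j assume j: "j < r"
        have "[d (e 1 i) j + d (e (-1) i) j = (if j = i then 1 else 0) + (if j = i then -1 else 0)] (mod int (ns ! j))"
          by (intro cong_add d_e j)
        then show "[(\<Sum>p\<in>#{#e 1 i, e (-1) i#}. d p j) = 0] (mod int (ns ! j))" by (simp split: if_splits)
      qed simp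
      ultimately have "v = {#e 1 i, e (-1) i#}" using vi(4)[of "{#e 1 i, e (-1) i#}"] by simp
      then show ?thesis unfolding \<open>v = _\<close> using wt1[OF i(1)] wt2[OF i(1)] by simp
    next
      case pos
      then have "ns ! i dvd count v (e 1 i)" using dvd by (auto simp: not_in_iff split: if_splits)
      then have "ns ! i \<le> count v (e 1 i)" using pos(1) by (simp add: dvd_imp_le)
      then have "replicate_mset (ns ! i) (e 1 i) \<subseteq># v" by (simp add: count_le_replicate_mset_subset_eq)
      moreover have "zero_sum ns d (replicate_mset (ns ! i) (e 1 i))"
      proof (subst zero_sum_cong_iff[where t = "\<lambda>j. int (ns ! i) * (if j = i then 1 else 0)"])
        fix j assume j: "j < r"
        show "[(\<Sum>p\<in>#replicate_mset (ns ! i) (e 1 i). d p j) = int (ns ! i) * (if j = i then 1 else 0)] (mod int (ns ! j))"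
          using cong_scalar_left[OF d_e[OF j, of 1 i], of "int (ns ! i)"] by simp
      qed auto
      moreover have "replicate_mset (ns ! i) (e 1 i) \<noteq> {#}" using n_gt_1[OF i(1)] by (metis count_replicate_mset count_empty not_one_less_zero)
      ultimately have "v = replicate_mset (ns ! i) (e 1 i)" using vi(4)[of "replicate_mset (ns ! i) (e 1 i)"] by simp
      then show ?thesis using wt1[OF i(1)] n_gt_1[OF i(1)] by simp
    next
      case neg
      then have ne: "e (-1) i \<noteq> e 1 i" by auto
      then have "ns ! i dvd count v (e (-1) i)" using dvd neg(2) by (simp add: not_in_iff)
      then have "ns ! i \<le> count v (e (-1) i)" using neg(1) by (simp add: dvd_imp_le)
      also have "\<dots> \<le> count ?W (e (-1) i)" using v(2) by (rule mset_subset_eq_count)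
      also have "\<dots> = C i"
      proof -
        have "e (-1) i \<notin># monomial 1 A" using set_monomial[of 1 A] e_neq[OF i(1), of _ "-1" 1] ne by fastforce
        then show ?thesis using count_monomial[of "-1" i C] i(1) by (simp add: not_in_iff)
      qed
      finally show ?thesis using C[OF i(1)] by simp
    qed
  qed
  have "(\<Sum>p\<in>#?W. wt p) = (\<Sum>i<r. A i / ns ! i + C i * (1 - 1 / ns ! i))"
    by (simp add: sum_monomial wt1 wt2 sum.distrib)
  then show ?thesis using size_decomposition_ge[OF y le1] by simp
qed

abbreviation "Dst \<equiv> dstar ns"

lemma Dst_eq: "Dst = 1 + (\<Sum>i<r. ns ! i - 1)"
  by (simp add: dstar_def sum_list_sum_nth lessThan_atLeast0)

text \<open>
  The standard atom: each \<open>e\<^sub>i\<close> occurs \<open>n\<^sub>i - 1\<close> times, and one prime closes the sum.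
\<close>
lemma ex_irreducible_size_Dst: "\<exists>u\<in>irreducibles B. size u = Dst"
proof -
  have "add_mset (prime_at (\<lambda>_. 1)) (monomial 1 (\<lambda>i. ns ! i - 1)) \<in> irreducibles B"
  proof (rule irreducible_prime_at_monomial)
    fix i assume "i < r" 
    then show "ns ! i - 1 < ns ! i" "int (ns ! i) dvd 1 + 1 * int (ns ! i - 1)" using n_gt_1[of i] by auto
  qed simp
  moreover have "size (add_mset (prime_at (\<lambda>_. 1)) (monomial 1 (\<lambda>i. ns ! i - 1))) = Dst"
    by (simp add: size_monomial Dst_eq)
  ultimately show ?thesis by blast
qed

end

section \<open>Lower bounds from vectors of digits\<close>

context covered_blocks
begin

lemma monomial_add: "monomial s (\<lambda>i. a i + b i) = monomial s a + monomial s b"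
  by (rule multiset_eqI) (auto simp: monomial_def count_sum simp flip: sum.distrib intro!: sum.cong)

lemma monomial_sum: "finite J \<Longrightarrow> monomial s (\<lambda>i. \<Sum>j\<in>J. \<beta> j i) = (\<Sum>j\<in>J. monomial s (\<beta> j))"
  by (induction J rule: finite_induct) (auto simp: monomial_add, simp add: monomial_def)

text \<open>
  Indexed families are needed because different indices \<open>j\<close> may lead to the same prime.
\<close>
lemma irreducible_image_prime_at:
  fixes k :: nat
  assumes k: "0 < k" and total: "\<And>i. i < r \<Longrightarrow> int (ns ! i) dvd (\<Sum>j<k. x j i)"
    and proper: "\<And>J. J \<subseteq> {..<k} \<Longrightarrow> J \<noteq> {} \<Longrightarrow> J \<noteq> {..<k} \<Longrightarrow> \<exists>i<r. \<not> int (ns ! i) dvd (\<Sum>j\<in>J. x j i)"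
  shows "image_mset (\<lambda>j. prime_at (x j)) (mset_set {..<k}) \<in> irreducibles B"
proof -
  have zs: "zero_sum ns d (image_mset (\<lambda>j. prime_at (x j)) (mset_set J)) \<longleftrightarrow> (\<forall>i<r. int (ns ! i) dvd (\<Sum>j\<in>J. x j i))"
    if "finite J" for J
  proof (rule zero_sum_cong_iff)
    fix i assume "i < r"
    then show "[(\<Sum>p\<in>#image_mset (\<lambda>j. prime_at (x j)) (mset_set J). d p i) = (\<Sum>j\<in>J. x j i)] (mod int (ns ! i))"
      using that by (simp add: image_mset.compositionality comp_def sum_unfold_sum_mset[symmetric] prime_at cong_sum)
  qed
  show ?thesis
    unfolding irreducible_blocks_iff
  proof (intro conjI allI impI)
    fix v assume v: "v \<subseteq># image_mset (\<lambda>j. prime_at (x j)) (mset_set {..<k})" "zero_sum ns d v"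
    obtain T where T: "T \<subseteq># mset_set {..<k}" "v = image_mset (\<lambda>j. prime_at (x j)) T" using v(1) by (rule subset_image_msetE)
    define J where "J = set_mset T"
    have J: "J \<subseteq> {..<k}" using T(1) using set_mset_mono[OF T(1)] by (simp add: J_def)
    have "T = mset_set J"
    proof (rule multiset_eqI)
      fix j
      have "count T j \<le> count (mset_set {..<k}) j" using T(1) by (rule mset_subset_eq_count)
      also have "\<dots> \<le> 1" by (simp add: count_mset_set')
      finally have "count T j \<le> 1" .
      moreover have "count T j > 0 \<longleftrightarrow> j \<in> J" by (simp add: J_def)
      moreover have "finite J" by (simp add: J_def)
      ultimately show "count T j = count (mset_set J) j" unfolding count_mset_set' by (cases "j \<in> J") (simp_all del: count_greater_zero_iff)
    qed
    then have vJ: "v = image_mset (\<lambda>j. prime_at (x j)) (mset_set J)" using T(2) by simp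
    have "finite J" by (simp add: J_def)
    then have "\<forall>i<r. int (ns ! i) dvd (\<Sum>j\<in>J. x j i)" using zs v(2) vJ by blast
    then have "J = {} \<or> J = {..<k}" using proper J by blast
    then show "v = {#} \<or> v = image_mset (\<lambda>j. prime_at (x j)) (mset_set {..<k})" using vJ by auto
  qed (use k total zs[of "{..<k}"] prime_at(1) in \<open>auto simp: mset_set_empty_iff\<close>)
qed

text \<open>
  The exchange \<open>tame_bound_exchange_ge\<close> with \<open>S\<^sub>j\<close> the monomial of the digits \<open>\<beta>\<^sub>j\<close>, over the \<open>e\<^sub>i\<close> or over the \<open>-e\<^sub>i\<close>
  according to the sign \<open>\<sigma>\<^sub>j\<close>; the prime \<open>p\<^sub>j\<close> lies in the class opposite to \<open>S\<^sub>j\<close>. The numbers \<open>A\<^sub>i\<close> and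
  \<open>C\<^sub>i\<close> are the multiplicities of \<open>e\<^sub>i\<close> and \<open>-e\<^sub>i\<close> in \<open>W\<close>.
\<close>
lemma tame_bound_signed_ge:
  fixes \<sigma> :: "nat \<Rightarrow> int" and \<beta> :: "nat \<Rightarrow> nat \<Rightarrow> nat" and k :: nat
  defines "p \<equiv> \<lambda>j. prime_at (\<lambda>i. - \<sigma> j * int (\<beta> j i))"
    and "A \<equiv> \<lambda>i. \<Sum>j<k. if \<sigma> j = 1 then \<beta> j i else 0" and "C \<equiv> \<lambda>i. \<Sum>j<k. if \<sigma> j = 1 then 0 else \<beta> j i"
  assumes k: "0 < k" and \<sigma>: "\<And>j. j < k \<Longrightarrow> \<sigma> j \<in> {1, -1}" and \<beta>: "\<And>j i. j < k \<Longrightarrow> i < r \<Longrightarrow> \<beta> j i < ns ! i"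
    and total: "\<And>i. i < r \<Longrightarrow> int (ns ! i) dvd (\<Sum>j<k. \<sigma> j * int (\<beta> j i))"
    and proper: "\<And>J. J \<subseteq> {..<k} \<Longrightarrow> J \<noteq> {} \<Longrightarrow> J \<noteq> {..<k} \<Longrightarrow> \<exists>i<r. \<not> int (ns ! i) dvd (\<Sum>j\<in>J. \<sigma> j * int (\<beta> j i))"
    and C: "\<And>i. i < r \<Longrightarrow> C i < ns ! i"
    and nin: "\<And>j. j < k \<Longrightarrow> add_mset (p j) (monomial (\<sigma> j) (\<beta> j)) \<noteq> image_mset p (mset_set {..<k}) \<and>
       \<not> add_mset (p j) (monomial (\<sigma> j) (\<beta> j)) \<subseteq># monomial 1 A + monomial (-1) C"
    and t: "tame_bound B M"
  shows "(\<Sum>i<r. A i / ns ! i + C i * (1 - 1 / ns ! i)) + 1 \<le> M"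
proof -
  have W: "(\<Sum>j<k. monomial (\<sigma> j) (\<beta> j)) = monomial 1 A + monomial (-1) C"
  proof -
    have 0: "monomial s (\<lambda>i. 0) = {#}" for s by (simp add: monomial_def)
    have "(\<Sum>j<k. monomial (\<sigma> j) (\<beta> j)) = (\<Sum>j<k. monomial 1 (\<lambda>i. if \<sigma> j = 1 then \<beta> j i else 0) + monomial (-1) (\<lambda>i. if \<sigma> j = 1 then 0 else \<beta> j i))"
    proof (rule sum.cong)
      fix j assume "j \<in> {..<k}"
      then have "\<sigma> j = 1 \<or> \<sigma> j = -1" using \<sigma> by auto
      then show "monomial (\<sigma> j) (\<beta> j) = monomial 1 (\<lambda>i. if \<sigma> j = 1 then \<beta> j i else 0) + monomial (-1) (\<lambda>i. if \<sigma> j = 1 then 0 else \<beta> j i)"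
        using 0 by (elim disjE) simp_all
    qed simp
    then show ?thesis unfolding A_def C_def by (simp add: sum.distrib monomial_sum)
  qed
  have neg: "(\<Sum>j\<in>J. - \<sigma> j * int (\<beta> j i)) = - (\<Sum>j\<in>J. \<sigma> j * int (\<beta> j i))" for i J
    by (simp add: sum_negf)
  have U: "image_mset p (mset_set {..<k}) \<in> irreducibles B"
    unfolding p_def by (rule irreducible_image_prime_at[OF k]) (use total proper in \<open>auto simp: neg simp del: mult_minus_left\<close>)
  \<comment> \<open>A factorization has an integral length, so the real estimate is rounded up.\<close>
  define N where "N = nat \<lceil>(\<Sum>i<r. A i / ns ! i + C i * (1 - 1 / ns ! i)) + 1\<rceil>"
  have "N \<le> M"
  proof (rule tame_bound_exchange_ge[where p = p and k = k and S = "\<lambda>j. monomial (\<sigma> j) (\<beta> j)", OF _ _ _ U _ _ t])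
    fix j assume j: "j < k"
    show "p j \<in> P \<and> set_mset (monomial (\<sigma> j) (\<beta> j)) \<subseteq> P" using set_monomial_P prime_at(1) by (simp add: p_def)
    show "zero_sum ns d (add_mset (p j) (monomial (\<sigma> j) (\<beta> j)))" unfolding p_def zero_sum_prime_at_monomial by simp
    show "add_mset (p j) (monomial (\<sigma> j) (\<beta> j)) \<noteq> image_mset p (mset_set {..<k}) \<and>
       \<not> add_mset (p j) (monomial (\<sigma> j) (\<beta> j)) \<subseteq># (\<Sum>j<k. monomial (\<sigma> j) (\<beta> j))" using nin[OF j] W by simp
    show "T = {#}" if "T \<subseteq># monomial (\<sigma> j) (\<beta> j)" "zero_sum ns d T" for T
      using monomial_zero_sum_free[OF \<sigma>[OF j] \<beta>[OF j] that] by blast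
  next
    fix y assume "y \<in> decompositions B (\<Sum>j<k. monomial (\<sigma> j) (\<beta> j))"
    then have "(\<Sum>i<r. A i / ns ! i + C i * (1 - 1 / ns ! i)) \<le> size y"
      using size_decomposition_monomial_ge[OF C] W by simp
    then have "N \<le> Suc (size y)" unfolding N_def by (simp add: nat_le_iff ceiling_le_iff)
    then show "N \<le> max k (Suc (size y))" by simp
  qed
  then have "\<lceil>(\<Sum>i<r. A i / ns ! i + C i * (1 - 1 / ns ! i)) + 1\<rceil> \<le> int M" unfolding N_def by linarith
  then show ?thesis unfolding ceiling_le_iff by simp
qed

lemma prime_at_neq_e:
  assumes "i' < r" "\<not> [x i' = (if i' = i then s else 0)] (mod int (ns ! i'))"
  shows "prime_at x \<noteq> e s i"
  using assms prime_at(2)[OF assms(1), of x] d_e[OF assms(1), of s i] by (metis cong_sym cong_trans)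

lemma prime_at_neq_e_two:
  assumes "i < r" "i' < r" "i \<noteq> i'" "\<not> [x i = 0] (mod int (ns ! i))" "\<not> [x i' = 0] (mod int (ns ! i'))"
  shows "prime_at x \<noteq> e s l"
  using prime_at_neq_e[of i x l s] prime_at_neq_e[of i' x l s] assms by (cases "l = i") auto

lemma not_cong_digit: "0 < b \<Longrightarrow> b < n \<Longrightarrow> \<not> [int b = 0] (mod int n)" "0 < b \<Longrightarrow> b < n \<Longrightarrow> \<not> [- int b = 0] (mod int n)"
  by (auto simp: cong_0_iff dest: zdvd_imp_le)

lemma mem_monomialI: "i < r \<Longrightarrow> 0 < \<beta> i \<Longrightarrow> s \<in> {1, -1} \<Longrightarrow> e s i \<in># monomial s \<beta>"
  using count_monomial[of s i \<beta>] by (metis count_greater_zero_iff)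

text \<open>
  If all signs are positive, it is enough that no \<open>p\<^sub>j\<close> is a basis element: then \<open>p\<^sub>j\<close> does not occur in
  \<open>W\<close>, and no element of \<open>S\<^sub>j\<close> occurs in \<open>u\<close>.
\<close>
lemma tame_bound_positive_ge:
  fixes \<beta> :: "nat \<Rightarrow> nat \<Rightarrow> nat" and k :: nat
  assumes k: "1 < k" and \<beta>: "\<And>j i. j < k \<Longrightarrow> i < r \<Longrightarrow> \<beta> j i < ns ! i"
    and total: "\<And>i. i < r \<Longrightarrow> int (ns ! i) dvd (\<Sum>j<k. int (\<beta> j i))"
    and proper: "\<And>J. J \<subseteq> {..<k} \<Longrightarrow> J \<noteq> {} \<Longrightarrow> J \<noteq> {..<k} \<Longrightarrow> \<exists>i<r. \<not> int (ns ! i) dvd (\<Sum>j\<in>J. int (\<beta> j i))"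
    and ne: "\<And>j i. j < k \<Longrightarrow> i < r \<Longrightarrow> prime_at (\<lambda>i. - int (\<beta> j i)) \<noteq> e 1 i"
    and t: "tame_bound B M"
  shows "(\<Sum>i<r. (\<Sum>j<k. \<beta> j i) / ns ! i) + 1 \<le> M"
proof -
  have "(\<Sum>i<r. real (\<Sum>j<k. if (1::int) = 1 then \<beta> j i else 0) / ns ! i +
      real (\<Sum>j<k. if (1::int) = 1 then 0 else \<beta> j i) * (1 - 1 / ns ! i)) + 1 \<le> M"
  proof (rule tame_bound_signed_ge[where \<sigma> = "\<lambda>_. 1" and k = k and \<beta> = \<beta>, OF _ _ _ _ _ _ _ t])
    fix j assume j: "j < k"
    have "\<exists>i<r. 0 < \<beta> j i"
    proof (rule ccontr)
      assume "\<not> ?thesis"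
      then have "\<forall>i<r. int (ns ! i) dvd (\<Sum>j\<in>{j}. int (\<beta> j i))" by auto
      moreover have "{j} \<noteq> {..<k}" using k by (auto simp: set_eq_iff) 
      ultimately show False using proper[of "{j}"] j by blast
    qed
    then obtain i where i: "i < r" "0 < \<beta> j i" by blast
    have "e 1 i \<in># monomial 1 (\<beta> j)" using mem_monomialI i by simp
    moreover have "e 1 i \<notin># image_mset (\<lambda>j. prime_at (\<lambda>i. - 1 * int (\<beta> j i))) (mset_set {..<k})"
      using ne i(1) by fastforce
    ultimately have "add_mset (prime_at (\<lambda>i. - 1 * int (\<beta> j i))) (monomial 1 (\<beta> j)) \<noteq> image_mset (\<lambda>j. prime_at (\<lambda>i. - 1 * int (\<beta> j i))) (mset_set {..<k})"
      by (metis union_single_eq_member insert_iff set_mset_add_mset_insert)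
    moreover have "prime_at (\<lambda>i. - 1 * int (\<beta> j i)) \<notin># monomial 1 (\<lambda>i. \<Sum>j<k. if (1::int) = 1 then \<beta> j i else 0) + monomial (-1) (\<lambda>i. \<Sum>j<k. if (1::int) = 1 then 0 else \<beta> j i)"
      using ne[OF j] set_monomial[of 1] by (auto simp: monomial_def[of "-1"])
    ultimately show "add_mset (prime_at (\<lambda>i. - 1 * int (\<beta> j i))) (monomial 1 (\<beta> j)) \<noteq> image_mset (\<lambda>j. prime_at (\<lambda>i. - 1 * int (\<beta> j i))) (mset_set {..<k}) \<and>
       \<not> add_mset (prime_at (\<lambda>i. - 1 * int (\<beta> j i))) (monomial 1 (\<beta> j)) \<subseteq># monomial 1 (\<lambda>i. \<Sum>j<k. if (1::int) = 1 then \<beta> j i else 0) + monomial (-1) (\<lambda>i. \<Sum>j<k. if (1::int) = 1 then 0 else \<beta> j i)"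
      using mset_subset_eq_insertD by fast
  qed (use k \<beta> total proper n_gt_1 in \<open>auto simp: less_imp_le intro: order.strict_trans[OF zero_less_one]\<close>)
  then show ?thesis by simp
qed

text \<open>
  For \<open>j = 1, \<dots>, s\<close> let \<open>\<beta>\<^sub>j = e\<^sub>j + f\<close>, where \<open>f\<close> is the sum of the \<open>s\<close> basis vectors with indices from \<open>s + 1\<close> to \<open>2 s\<close>, and let
  \<open>\<beta>\<^sub>0 = f - (e\<^sub>1 + \<cdots> + e\<^sub>s)\<close>. The vectors \<open>e\<^sub>1, \<dots>, e\<^sub>s\<close> and minus their sum have no proper zero-sum part, so
  the \<open>\<beta>\<^sub>j\<close> form an atom as soon as every \<open>n\<^sub>i\<close> divides \<open>s + 1\<close>. Each of the \<open>s\<close> basis elements of \<open>f\<close> occurs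
  \<open>s + 1\<close> times in \<open>W\<close> and contributes \<open>(s + 1)/n\<^sub>i\<close> to the length.
\<close>
lemma tame_bound_quadratic_ge:
  assumes s: "1 \<le> s" "2 * s \<le> r" and dv: "\<And>i. i < r \<Longrightarrow> ns ! i dvd s + 1" and E: "\<And>i. i < r \<Longrightarrow> ns ! i \<le> E"
    and t: "tame_bound B M"
  shows "real (s * s) \<le> E * M"
proof -
  define \<beta> :: "nat \<Rightarrow> nat \<Rightarrow> nat" where
    "\<beta> j i = (if i < s then (if j = 0 then ns ! i - 1 else if i = j - 1 then 1 else 0) else if i < 2 * s then 1 else 0)" for j i
  have sum_lt: "(\<Sum>j\<in>J. int (\<beta> j i)) = (if 0 \<in> J then int (ns ! i) - 1 else 0) + (if Suc i \<in> J then 1 else 0)"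
    if "i < s" "J \<subseteq> {..<s+1}" for J i
  proof -
    have fin: "finite J" using that(2) finite_subset by blast
    have "(\<Sum>j\<in>J. int (\<beta> j i)) = (\<Sum>j\<in>J. (if j = 0 then int (ns ! i) - 1 else 0) + (if j = Suc i then 1 else 0))"
      by (rule sum.cong) (use that s n_gt_1[of i] in \<open>auto simp: \<beta>_def of_nat_diff\<close>)
    then show ?thesis using fin by (simp add: sum.distrib)
  qed
  have "(\<Sum>i<r. (\<Sum>j<s+1. \<beta> j i) / ns ! i) + 1 \<le> M"
  proof (rule tame_bound_positive_ge[OF _ _ _ _ _ t])
    fix j i assume "j < s + 1" "i < r"
    then show "\<beta> j i < ns ! i" using n_gt_1[of i] by (auto simp: \<beta>_def)
  next
    fix i assume i: "i < r"
    show "int (ns ! i) dvd (\<Sum>j<s+1. int (\<beta> j i))"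
    proof (cases "i < s")
      case True then show ?thesis using sum_lt[of i "{..<s+1}"] by simp
    next
      case False
      then have "(\<Sum>j<s+1. int (\<beta> j i)) = (if i < 2 * s then int (s + 1) else 0)" by (simp add: \<beta>_def)
      then show ?thesis using dv[OF i] by (simp flip: of_nat_Suc)
    qed
  next
    fix J assume J: "J \<subseteq> {..<s+1}" "J \<noteq> {}" "J \<noteq> {..<s+1}"
    have "\<exists>i<s. (0 \<in> J) \<noteq> (Suc i \<in> J)"
    proof (rule ccontr)
      assume n: "\<not> ?thesis"
      show False
      proof (cases "0 \<in> J")
        case True
        then have "j \<in> J" if "j < s + 1" for j using n that by (cases j) auto
        then show False using J by blast
      next
        case False
        then have "j \<notin> J" if "j < s + 1" for j using n that by (cases j) auto
        then show False using J by blast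
      qed
    qed
    then obtain i where i: "i < s" "(0 \<in> J) \<noteq> (Suc i \<in> J)" by blast
    then have "(\<Sum>j\<in>J. int (\<beta> j i)) = 1 \<or> (\<Sum>j\<in>J. int (\<beta> j i)) = int (ns ! i) - 1" using sum_lt[OF i(1) J(1)] by auto
    moreover have "1 < ns ! i" "i < r" using n_gt_1[of i] i s by auto
    ultimately show "\<exists>i<r. \<not> int (ns ! i) dvd (\<Sum>j\<in>J. int (\<beta> j i))"
      by (intro exI[of _ i]) (auto dest: zdvd_imp_le)
  next
    fix j i assume j: "j < s + 1" and i: "i < r"
    define l where "l = j - 1"
    have "l < s" using j s by (auto simp: l_def)
    have "0 < \<beta> j l" "\<beta> j l < ns ! l" "0 < \<beta> j s" "\<beta> j s < ns ! s" using \<open>l < s\<close> n_gt_1[of l] n_gt_1[of s] s by (auto simp: \<beta>_def l_def)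
    then show "prime_at (\<lambda>i. - int (\<beta> j i)) \<noteq> e 1 i"
      using prime_at_neq_e_two[of l s "\<lambda>i. - int (\<beta> j i)" 1 i] not_cong_digit(2) \<open>l < s\<close> s by auto
  qed (use s in auto)
  moreover have "real (s * s) / E \<le> (\<Sum>i<r. (\<Sum>j<s+1. \<beta> j i) / ns ! i)"
  proof -
    have E0: "0 < real E" using E[of 0] n_gt_1[of 0] s by (intro of_nat_0_less_iff[THEN iffD2]) linarith
    have "real (s * s) / E = (\<Sum>i\<in>{s..<2*s}. real s / E)" by simp
    also have "\<dots> \<le> (\<Sum>i\<in>{s..<2*s}. (\<Sum>j<s+1. \<beta> j i) / ns ! i)"
    proof (rule sum_mono)
      fix i assume i: "i \<in> {s..<2*s}"
      then have "(\<Sum>j<s+1. \<beta> j i) = s + 1" by (simp add: \<beta>_def)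
      then show "real s / E \<le> (\<Sum>j<s+1. \<beta> j i) / ns ! i" using E[of i] i s n_gt_1[of i]
        by (auto intro!: frac_le)
    qed
    also have "\<dots> \<le> (\<Sum>i<r. (\<Sum>j<s+1. \<beta> j i) / ns ! i)"
      by (rule sum_mono2) (use s in \<open>auto simp del: sum.lessThan_Suc intro!: divide_nonneg_nonneg sum_nonneg\<close>)
    finally show ?thesis .
  qed
  ultimately have "real (s * s) / E \<le> M" by linarith
  moreover have "0 < real E" using E[of 0] n_gt_1[of 0] s by (intro of_nat_0_less_iff[THEN iffD2]) linarith
  ultimately show ?thesis by (simp add: field_simps)
qed

end

context covered_blocks
begin

lemma sum_over_subset_lt3: "J \<subseteq> {..<3::nat} \<Longrightarrow> (\<Sum>j\<in>J. f j) = (if 0 \<in> J then f 0 else 0) + (if 1 \<in> J then f 1 else 0) + (if 2 \<in> J then f 2 else (0::int))"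
proof -
  assume J: "J \<subseteq> {..<3}"
  have "(\<Sum>j\<in>J. f j) = (\<Sum>j\<in>{..<3}. if j \<in> J then f j else 0)"
    using J by (simp add: sum.If_cases Int_absorb1 flip: sum.inter_restrict)
  then show ?thesis by (simp add: eval_nat_numeral)
qed

lemma n_pred_less: "i < r \<Longrightarrow> ns ! i - Suc 0 < ns ! i"
  using n_gt_1[of i] by linarith

text \<open>
  Let \<open>S\<^sub>3 = \<Prod>\<^sub>i (-e\<^sub>i)\<^bsup>n\<^sub>i - 1\<^esup>\<close>, so that the fourth prime of \<open>u\<close> lies in the class with all coordinates \<open>-1\<close>, and
  let \<open>\<beta>\<^sub>0 + \<beta>\<^sub>1 + \<beta>\<^sub>2 = q\<^sub>i n\<^sub>i - 1\<close> in coordinate \<open>i\<close>. In \<open>W\<close> there are \<open>q\<^sub>i n\<^sub>i - 1\<close> copies of \<open>e\<^sub>i\<close> and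
  \<open>n\<^sub>i - 1\<close> copies of \<open>-e\<^sub>i\<close>, which together weigh \<open>q\<^sub>i + n\<^sub>i - 2\<close>. With \<open>q\<^sub>i = 1\<close> throughout, the bound would
  be \<open>D\<^sup>*\<close>; an additional carry in one coordinate, that is \<open>q\<^sub>i = 2\<close>, improves it by one.
\<close>
lemma tame_bound_carry_ge:
  fixes \<beta> :: "nat \<Rightarrow> nat \<Rightarrow> nat"
  assumes \<beta>: "\<And>j i. j < 3 \<Longrightarrow> i < r \<Longrightarrow> \<beta> j i < ns ! i"
    and total: "\<And>i. i < r \<Longrightarrow> ns ! i dvd \<beta> 0 i + \<beta> 1 i + \<beta> 2 i + 1"
    and carry: "i0 < r" "ns ! i0 \<le> \<beta> 0 i0 + \<beta> 1 i0 + \<beta> 2 i0"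
    and free: "\<And>a b c. a \<or> b \<or> c \<Longrightarrow> \<exists>i<r. \<not> ns ! i dvd (if a then \<beta> 0 i else 0) + (if b then \<beta> 1 i else 0) + (if c then \<beta> 2 i else 0)"
    and ne: "\<And>j i s. j < 3 \<Longrightarrow> i < r \<Longrightarrow> s \<in> {1, -1} \<Longrightarrow> prime_at (\<lambda>i. - int (\<beta> j i)) \<noteq> e s i"
    and r1: "r = 1 \<Longrightarrow> 3 \<le> ns ! 0"
    and t: "tame_bound B M"
  shows "Dst + 1 \<le> M"
proof -
  define \<sigma> :: "nat \<Rightarrow> int" where "\<sigma> j = (if j < 3 then 1 else - 1)" for j
  define \<gamma> :: "nat \<Rightarrow> nat \<Rightarrow> nat" where "\<gamma> j i = (if j < 3 then \<beta> j i else ns ! i - 1)" for j i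
  define A where "A i = \<beta> 0 i + \<beta> 1 i + \<beta> 2 i" for i
  define C where "C i = ns ! i - 1" for i
  let ?p = "\<lambda>j. prime_at (\<lambda>i. - \<sigma> j * int (\<gamma> j i))"
  let ?U = "image_mset ?p (mset_set {..<4})"
  have A: "(\<Sum>j<4. if \<sigma> j = 1 then \<gamma> j i else 0) = A i" for i
    by (simp add: eval_nat_numeral \<sigma>_def \<gamma>_def A_def)
  have C: "(\<Sum>j<4. if \<sigma> j = 1 then 0 else \<gamma> j i) = C i" for i
    by (simp add: eval_nat_numeral \<sigma>_def \<gamma>_def C_def)
  have p3: "?p j = prime_at (\<lambda>i. - int (\<beta> j i))" if "j < 3" for j using that by (simp add: \<sigma>_def \<gamma>_def)
  \<comment> \<open>The fourth prime has all coordinates \<open>n\<^sub>i - 1\<close>, that is \<open>-1\<close>.\<close>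
  have pneg: "?p 3 = prime_at (\<lambda>i. -1)"
    by (rule prime_at_eqI) (use n_gt_1 in \<open>auto simp: \<sigma>_def \<gamma>_def of_nat_diff less_imp_le cong_iff_dvd_diff\<close>)
  have psum: "(\<Sum>j\<in>J. \<sigma> j * int (\<gamma> j i)) =
      int ((if 0 \<in> J then \<beta> 0 i else 0) + (if 1 \<in> J then \<beta> 1 i else 0) + (if 2 \<in> J then \<beta> 2 i else 0))"
    if "J \<subseteq> {..<3}" for J i
    using sum_over_subset_lt3[OF that, of "\<lambda>j. \<sigma> j * int (\<gamma> j i)"] by (simp add: \<sigma>_def \<gamma>_def)
  have tot: "int (ns ! i) dvd (\<Sum>j<4. \<sigma> j * int (\<gamma> j i))" if i: "i < r" for i
  proof -
    have "(\<Sum>j<4. \<sigma> j * int (\<gamma> j i)) = int (\<beta> 0 i + \<beta> 1 i + \<beta> 2 i + 1) - int (ns ! i)"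
      using n_gt_1[OF i] by (simp add: eval_nat_numeral \<sigma>_def \<gamma>_def of_nat_diff)
    then show ?thesis using total[OF i] by (metis dvd_diff dvd_refl int_dvd_int_iff)
  qed
  have prop3: "\<exists>i<r. \<not> int (ns ! i) dvd (\<Sum>j\<in>J. \<sigma> j * int (\<gamma> j i))" if J: "J \<subseteq> {..<3}" "J \<noteq> {}" for J
  proof -
    have "0 \<in> J \<or> 1 \<in> J \<or> 2 \<in> J" 
    proof -
      obtain j where "j \<in> J" "j < 3" using J by blast
      moreover have "j = 0 \<or> j = 1 \<or> j = 2" using \<open>j < 3\<close> by linarith
      ultimately show ?thesis by auto
    qed
    from free[OF this] show ?thesis unfolding psum[OF J(1)] int_dvd_int_iff .
  qed
  have eneq: "prime_at (\<lambda>i. -1) \<noteq> e s i" if "1 < r" "s \<in> {1, -1}" for s i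
  proof -
    have "0 < r" "1 < ns ! 0" "1 < ns ! 1" using that n_gt_1[of 0] n_gt_1[of 1] by linarith+
    then show ?thesis using prime_at_neq_e_two[of 0 1 "\<lambda>_. -1" s i] that(1) by (auto simp: cong_0_iff)
  qed
  have j_cases: "j = 0 \<or> j = 1 \<or> j = 2 \<or> j = 3" if "j < 4" for j :: nat using that by linarith
  have "(\<Sum>i<r. (\<Sum>j<4. if \<sigma> j = 1 then \<gamma> j i else 0) / ns ! i +
      (\<Sum>j<4. if \<sigma> j = 1 then 0 else \<gamma> j i) * (1 - 1 / ns ! i)) + 1 \<le> M"
  proof (rule tame_bound_signed_ge[OF _ _ _ tot _ _ _ t])
    fix J assume J: "J \<subseteq> {..<4}" "J \<noteq> {}" "J \<noteq> {..<4::nat}"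
    show "\<exists>i<r. \<not> int (ns ! i) dvd (\<Sum>j\<in>J. \<sigma> j * int (\<gamma> j i))"
    \<comment> \<open>A part that contains the fourth prime is replaced by its complement.\<close>
    proof (cases "3 \<in> J")
      case True
      let ?K = "{..<4} - J"
      have "?K \<subseteq> {..<3}" 
      proof
        fix j assume "j \<in> ?K"
        then have "j < 4" "j \<noteq> 3" using True by auto
        then show "j \<in> {..<3}" by simp
      qed
      moreover have "?K \<noteq> {}" using J(1,3) by auto
      ultimately obtain i where i: "i < r" "\<not> int (ns ! i) dvd (\<Sum>j\<in>?K. \<sigma> j * int (\<gamma> j i))" using prop3 by blast
      have "(\<Sum>j<4. \<sigma> j * int (\<gamma> j i)) = (\<Sum>j\<in>?K. \<sigma> j * int (\<gamma> j i)) + (\<Sum>j\<in>J. \<sigma> j * int (\<gamma> j i))"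
        by (rule sum.subset_diff[OF J(1)]) simp
      then have "\<not> int (ns ! i) dvd (\<Sum>j\<in>J. \<sigma> j * int (\<gamma> j i))" 
        using i(2) tot[OF i(1)] dvd_add_left_iff[of "int (ns ! i)" "\<Sum>j\<in>J. \<sigma> j * int (\<gamma> j i)"] by auto
      then show ?thesis using i(1) by blast
    next
      case False
      have "J \<subseteq> {..<3}"
      proof
        fix j assume "j \<in> J"
        then have "j < 4" "j \<noteq> 3" using False J(1) by auto
        then show "j \<in> {..<3}" by simp
      qed
      then show ?thesis using prop3 J(2) by blast
    qed
  next
    fix j assume j: "j < (4::nat)"
    have W: "monomial 1 (\<lambda>i. \<Sum>j<4. if \<sigma> j = 1 then \<gamma> j i else 0) + monomial (-1) (\<lambda>i. \<Sum>j<4. if \<sigma> j = 1 then 0 else \<gamma> j i)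
       = monomial 1 A + monomial (-1) C" using A C by simp
    have setW: "set_mset (monomial 1 A + monomial (-1) C) \<subseteq> e 1 ` {..<r} \<union> e (-1) ` {..<r}" using set_monomial by fastforce
    have setU: "set_mset ?U = {?p 0, ?p 1, ?p 2, ?p 3}" by (auto simp: eval_nat_numeral lessThan_Suc)
    have r0: "0 < r" using carry(1) by linarith
    have notin: "add_mset (?p j) X \<noteq> ?U" if "q \<in># X" "q \<notin># ?U" for X q using that by (metis insert_iff set_mset_add_mset_insert)
    have notsub: "\<not> add_mset q X \<subseteq># Y" if "q \<notin># Y" for q X and Y :: "'p multiset" using that by (meson mset_subset_eq_insertD)
    have e3: "e s i \<noteq> ?p j" if "j < 3" "i < r" "s \<in> {1, -1}" for s i j using ne[OF that] p3[OF that(1)] by auto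
    show "add_mset (?p j) (monomial (\<sigma> j) (\<gamma> j)) \<noteq> ?U \<and> \<not> add_mset (?p j) (monomial (\<sigma> j) (\<gamma> j)) \<subseteq># 
      monomial 1 (\<lambda>i. \<Sum>j<4. if \<sigma> j = 1 then \<gamma> j i else 0) + monomial (-1) (\<lambda>i. \<Sum>j<4. if \<sigma> j = 1 then 0 else \<gamma> j i)"
      unfolding W
    proof (cases "j < 3")
      case True
      have "\<exists>i<r. 0 < \<beta> j i"
      proof (rule ccontr)
        assume "\<not> ?thesis"
        then show False using free[of "j = 0" "j = 1" "j = 2"] True j_cases[of j] by auto
      qed
      then obtain i where i: "i < r" "0 < \<beta> j i" by blast
      have sj: "\<sigma> j = 1" "\<gamma> j = \<beta> j" using True by (auto simp: \<sigma>_def \<gamma>_def)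
      have "e 1 i \<in># monomial (\<sigma> j) (\<gamma> j)" using mem_monomialI[OF i(1), of "\<beta> j" 1] i(2) sj by simp
      moreover have "e 1 i \<notin># ?U"
      proof -
        have "e 1 i \<noteq> ?p 3"
        proof (cases "r = 1")
          case True
          have "\<not> [- 1 = (1::int)] (mod int (ns ! 0))"
            using r1[OF True] by (auto simp: cong_iff_dvd_diff dest: zdvd_imp_le)
          then show ?thesis unfolding pneg using prime_at_neq_e[of 0 "\<lambda>_. -1" i 1] True i(1) by auto
        next
          case False then show ?thesis unfolding pneg using eneq[of 1 i] r0 by auto
        qed
        then show ?thesis unfolding setU using e3[of 0 i 1] e3[of 1 i 1] e3[of 2 i 1] i(1) by auto
      qed
      moreover have "?p j \<notin># monomial 1 A + monomial (-1) C" 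
      proof
        assume "?p j \<in># monomial 1 A + monomial (-1) C"
        then have "?p j \<in> e 1 ` {..<r} \<union> e (-1) ` {..<r}" using setW by (rule subsetD[rotated])
        then show False using e3[OF True] by fastforce
      qed
      ultimately show "add_mset (?p j) (monomial (\<sigma> j) (\<gamma> j)) \<noteq> ?U \<and> \<not> add_mset (?p j) (monomial (\<sigma> j) (\<gamma> j)) \<subseteq># monomial 1 A + monomial (-1) C"
        by (intro conjI notin notsub)
    next
      case False
      then have j3: "j = 3" using j by simp
      have sj: "\<sigma> j = -1" "\<gamma> j = C" by (auto simp: \<sigma>_def \<gamma>_def C_def j3)
      have e3m: "e (-1) i \<in># monomial (\<sigma> j) (\<gamma> j)" if "i < r" for i
        using mem_monomialI[OF that, of C "-1"] n_gt_1[OF that] sj by (simp add: C_def)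
      show "add_mset (?p j) (monomial (\<sigma> j) (\<gamma> j)) \<noteq> ?U \<and> \<not> add_mset (?p j) (monomial (\<sigma> j) (\<gamma> j)) \<subseteq># monomial 1 A + monomial (-1) C"
      proof (cases "r = 1")
        case True
        have pe: "?p 3 = e (-1) 0" unfolding pneg e_def by (rule prime_at_eqI) (use True in auto)
        have "set_mset (add_mset (?p j) (monomial (\<sigma> j) (\<gamma> j))) \<subseteq> {e (-1) 0}"
          using set_monomial[of "-1"] pe j3 sj True by (auto simp: lessThan_Suc)
        then have "?p 0 \<notin># add_mset (?p j) (monomial (\<sigma> j) (\<gamma> j))"
          using e3[of 0 0 "-1"] r0 by (metis (no_types, lifting) insertCI singletonD subsetD zero_less_numeral)
        moreover have "?p 0 \<in># ?U" using setU by simp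
        ultimately have neU: "add_mset (?p j) (monomial (\<sigma> j) (\<gamma> j)) \<noteq> ?U"
          by (intro notI) (elim notE, erule ssubst)
        have "count (monomial 1 A + monomial (-1) C) (e (-1) 0) = C 0"
        proof -
          have "e 1 0 \<noteq> e (-1) 0" using e_signs_eqD[OF r0] r1[OF True] by auto
          then have "e (-1) 0 \<notin># monomial 1 A" using set_monomial[of 1 A] True by auto
          then show ?thesis using count_monomial[of "-1" 0 C] r0 by (simp add: not_in_iff)
        qed
        moreover have "count (add_mset (?p j) (monomial (\<sigma> j) (\<gamma> j))) (e (-1) 0) = Suc (C 0)"
          using count_monomial[of "-1" 0 C] r0 pe sj j3 by simp
        ultimately have "\<not> add_mset (?p j) (monomial (\<sigma> j) (\<gamma> j)) \<subseteq># monomial 1 A + monomial (-1) C"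
          using mset_subset_eq_count[of "add_mset (?p j) (monomial (\<sigma> j) (\<gamma> j))" "monomial 1 A + monomial (-1) C" "e (-1) 0"] by linarith
        then show ?thesis using neU by simp
      next
        case False
        then have "1 < r" using r0 by linarith
        then have "e (-1) 0 \<notin># ?U" unfolding setU pneg
          using e3[of 0 0 "-1"] e3[of 1 0 "-1"] e3[of 2 0 "-1"] eneq[of "-1" 0] r0 by auto
        moreover have "?p j \<notin># monomial 1 A + monomial (-1) C" 
        proof
          assume "?p j \<in># monomial 1 A + monomial (-1) C"
          then have "?p 3 \<in> e 1 ` {..<r} \<union> e (-1) ` {..<r}" unfolding j3 using setW by (rule subsetD[rotated])
          then show False unfolding pneg using eneq[OF \<open>1 < r\<close>] by fastforce
        qed
        ultimately show ?thesis using e3m[OF r0] by (intro conjI notin notsub)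
      qed
    qed
  qed (use \<beta> n_gt_1 n_pred_less C in \<open>auto simp: \<sigma>_def \<gamma>_def C_def intro: order.strict_trans[OF zero_less_one]\<close>)
  then have le: "(\<Sum>i<r. A i / ns ! i + C i * (1 - 1 / ns ! i)) + 1 \<le> M" unfolding A C .
  have "(\<Sum>i<r. real (ns ! i - 1) + (if i = i0 then 1 else 0)) \<le> (\<Sum>i<r. A i / ns ! i + C i * (1 - 1 / ns ! i))"
  proof (rule sum_mono)
    fix i assume "i \<in> {..<r}"
    then have i: "i < r" by simp
    let ?n = "real (ns ! i)"
    have n: "1 < ?n" using n_gt_1[OF i] by simp
    obtain q where q: "A i + 1 = ns ! i * q" using total[OF i] by (auto simp: A_def)
    have "q \<noteq> 0" using q by (metis Suc_eq_plus1 mult_0_right nat.simps(3))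
    have "i = i0 \<Longrightarrow> q \<noteq> 1" using q carry(2) by (auto simp: A_def)
    then have "1 + (if i = i0 then 1 else 0) \<le> q" using \<open>q \<noteq> 0\<close> by (auto split: if_splits)
    then have q1: "1 + (if i = i0 then 1 else 0) \<le> real q" by (auto split: if_splits)
    have Ai: "real (A i) = ?n * real q - 1" using q by (metis add_diff_cancel_right' of_nat_1 of_nat_add of_nat_mult)
    have Ci: "real (C i) = ?n - 1" using n by (simp add: C_def of_nat_diff)
    have "A i / ns ! i + C i * (1 - 1 / ns ! i) = real q + ?n - 2"
      unfolding Ai Ci using n by (simp add: field_simps)
    moreover have "real (ns ! i - 1) = ?n - 1" using n by (simp add: of_nat_diff)
    ultimately show "real (ns ! i - 1) + (if i = i0 then 1 else 0) \<le> A i / ns ! i + C i * (1 - 1 / ns ! i)"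
      using q1 by linarith
  qed
  also have "(\<Sum>i<r. real (ns ! i - 1) + (if i = i0 then 1 else 0)) = real (\<Sum>i<r. ns ! i - 1) + 1"
    using carry(1) by (simp add: sum.distrib)
  finally have "real (Dst + 1) \<le> M" using le by (simp add: Dst_eq)
  then show ?thesis by simp
qed

end

section \<open>Tame bounds beyond the length of the standard atom\<close>

context covered_blocks
begin

lemma digit_two:
  assumes "i < r" "i' < r" "i \<noteq> i'" "0 < \<beta> i" "\<beta> i < ns ! i" "0 < \<beta> i'" "\<beta> i' < ns ! i'"
  shows "prime_at (\<lambda>i. - int (\<beta> i)) \<noteq> e s l"
  using prime_at_neq_e_two[of i i' "\<lambda>i. - int (\<beta> i)" s l] not_cong_digit(2) assms by auto

lemma not_dvd_between: "0 < b \<Longrightarrow> b < n \<Longrightarrow> \<not> n dvd (b::nat)"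
  by (auto dest: dvd_imp_le)

lemma less_3_cases: "j < (3::nat) \<Longrightarrow> j = 0 \<or> j = 1 \<or> j = 2" by linarith

text \<open>
  Digits \<open>n - 2\<close>, \<open>n - 2\<close>, \<open>3\<close>, with sum \<open>2 n - 1\<close>.
\<close>
lemma tame_bound_cyclic_ge:
  assumes r: "r = 1" and n: "5 \<le> ns ! 0" and t: "tame_bound B M"
  shows "Dst + 1 \<le> M"
proof -
  define n where "n = ns ! 0"
  define \<beta> :: "nat \<Rightarrow> nat \<Rightarrow> nat" where "\<beta> j i = (if j < 2 then n - 2 else 3)" for j i
  have n5: "5 \<le> n" using assms by (simp add: n_def)
  show ?thesis
  proof (rule tame_bound_carry_ge[of \<beta> 0, OF _ _ _ _ _ _ _ t])
    show "ns ! i dvd \<beta> 0 i + \<beta> 1 i + \<beta> 2 i + 1" if "i < r" for i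
    proof -
      have "\<beta> 0 i + \<beta> 1 i + \<beta> 2 i + 1 = 2 * n" using n5 by (simp add: \<beta>_def)
      then show ?thesis using that r by (simp add: n_def)
    qed
    show "\<exists>i<r. \<not> ns ! i dvd (if a then \<beta> 0 i else 0) + (if b then \<beta> 1 i else 0) + (if c then \<beta> 2 i else 0)"
      if abc: "a \<or> b \<or> c" for a b c
    proof -
      define s where "s = (if a then \<beta> 0 0 else 0) + (if b then \<beta> 1 0 else 0) + (if c then \<beta> 2 0 else 0)"
      have "s = n - 2 \<or> s = 3 \<or> s = n + (n - 4) \<or> s = n + 1 \<or> s = n + (n - 1)"
        using abc n5 by (cases a; cases b; cases c) (auto simp: s_def \<beta>_def)
      then obtain k where k: "0 < k" "k < n" "s = k \<or> s = n + k" 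
      proof (elim disjE)
        assume "s = n - 2" then show thesis using that[of "n - 2"] n5 by simp
      next
        assume "s = 3" then show thesis using that[of 3] n5 by simp
      next
        assume "s = n + (n - 4)" then show thesis using that[of "n - 4"] n5 by simp
      next
        assume "s = n + 1" then show thesis using that[of 1] n5 by simp
      next
        assume "s = n + (n - 1)" then show thesis using that[of "n - 1"] n5 by simp
      qed
      then have "\<not> n dvd s" using not_dvd_between[OF k(1,2)] by (metis dvd_add_triv_left_iff)
      then show ?thesis using r unfolding s_def n_def by auto
    qed
    show "prime_at (\<lambda>i. - int (\<beta> j i)) \<noteq> e s i" if "j < 3" "i < r" "s \<in> {1, -1}" for j i s
    proof (rule prime_at_neq_e[of 0])
      have "\<not> int n dvd - int b - s" if "b = n - 2 \<or> b = 3" for b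
      proof -
        have "- int b - s = - int (b + 1) \<or> - int b - s = - int (b - 1)" using \<open>s \<in> _\<close> that n5 by auto
        moreover have "0 < b - 1" "b + 1 < n" using that n5 by linarith+
        then have "\<not> n dvd b + 1" "\<not> n dvd b - 1" by (intro not_dvd_between; linarith)+
        ultimately show ?thesis by (elim disjE) (simp_all only: dvd_minus_iff int_dvd_int_iff not_False_eq_True)
      qed
      moreover have "\<beta> j 0 = n - 2 \<or> \<beta> j 0 = 3" by (simp add: \<beta>_def)
      ultimately show "\<not> [- int (\<beta> j 0) = (if 0 = i then s else 0)] (mod int (ns ! 0))"
        using r that(2) unfolding n_def by (auto simp: cong_iff_dvd_diff)
    qed (use r in auto)
  qed (use r n5 in \<open>auto simp: \<beta>_def n_def\<close>)
qed

text \<open>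
  The last digits \<open>1\<close>, \<open>1\<close>, \<open>n - 3\<close> have no nonempty part divisible by \<open>n\<close>, which takes care of
  zero-sum freeness; the first digits \<open>n\<^sub>1 - 1\<close>, \<open>n\<^sub>1 - 1\<close>, \<open>1\<close> provide the carry. As two coordinates are nonzero,
  the primes are not basis elements.
\<close>
lemma tame_bound_large_exponent_ge:
  assumes r: "2 \<le> r" and n: "4 \<le> ns ! (r - 1)" and t: "tame_bound B M"
  shows "Dst + 1 \<le> M"
proof -
  define l where "l = r - 1"
  define \<beta> :: "nat \<Rightarrow> nat \<Rightarrow> nat" where
    "\<beta> j i = (if i = l then (if j < 2 then 1 else ns ! i - 3) else if i = 0 then (if j < 2 then ns ! i - 1 else 1)
       else if j = 0 then ns ! i - 1 else 0)" for j i
  have l: "l < r" "0 < l" "4 \<le> ns ! l" using r n by (auto simp: l_def)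
  have r0: "0 < r" using r by linarith
  have r0: "0 < r" "1 < ns ! 0" using r0 n_gt_1[OF r0] .
  show ?thesis
  proof (rule tame_bound_carry_ge[of \<beta> 0, OF _ _ _ _ _ _ _ t])
    show "\<beta> j i < ns ! i" if "j < 3" "i < r" for j i using n_gt_1[OF that(2)] l by (auto simp: \<beta>_def)
    show "ns ! i dvd \<beta> 0 i + \<beta> 1 i + \<beta> 2 i + 1" if "i < r" for i
    proof -
      have "\<beta> 0 i + \<beta> 1 i + \<beta> 2 i + 1 = (if i = 0 then 2 * ns ! i else ns ! i)"
        using l n_gt_1[OF that] by (auto simp: \<beta>_def)
      then show ?thesis by simp
    qed
    show "\<exists>i<r. \<not> ns ! i dvd (if a then \<beta> 0 i else 0) + (if b then \<beta> 1 i else 0) + (if c then \<beta> 2 i else 0)"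
      if "a \<or> b \<or> c" for a b c
      by (intro exI[of _ l] conjI l(1) not_dvd_between) (use that l in \<open>auto simp: \<beta>_def\<close>)
    show "prime_at (\<lambda>i. - int (\<beta> j i)) \<noteq> e s i" if "j < 3" "i < r" "s \<in> {1, -1}" for j i s
      by (rule digit_two[of 0 l]) (use l r0 in \<open>auto simp: \<beta>_def\<close>)
  qed (use r l r0 in \<open>auto simp: \<beta>_def\<close>)
qed

text \<open>
  In the first three coordinates the digits of the three vectors are \<open>2, 2, 1\<close>, with sum \<open>2 \<cdot> 3 - 1\<close>, then \<open>1, 1, 0\<close>
  and \<open>1, 0, 1\<close>; in all others \<open>2, 0, 0\<close>. The second and third coordinates ensure zero-sum freeness and keep the
  primes away from the basis.
\<close>
lemma tame_bound_exponent_3_ge: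
  assumes r: "3 \<le> r" and n: "\<And>i. i < r \<Longrightarrow> ns ! i = 3" and t: "tame_bound B M"
  shows "Dst + 1 \<le> M"
proof -
  define \<beta> :: "nat \<Rightarrow> nat \<Rightarrow> nat" where
    "\<beta> j i = (if i = 0 then (if j < 2 then 2 else 1) else if i = 1 then (if j < 2 then 1 else 0)
       else if i = 2 then (if j = 1 then 0 else 1) else if j = 0 then 2 else 0)" for j i
  have lr: "0 < r" "1 < r" "2 < r" using r by linarith+
  note n3 = lr n[OF lr(1)] n[OF lr(2)] n[OF lr(3)]
  show ?thesis
  proof (rule tame_bound_carry_ge[of \<beta> 0, OF _ _ _ _ _ _ _ t])
    show "\<exists>i<r. \<not> ns ! i dvd (if a then \<beta> 0 i else 0) + (if b then \<beta> 1 i else 0) + (if c then \<beta> 2 i else 0)"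
      if "a \<or> b \<or> c" for a b c
    proof -
      have "\<exists>i\<in>{0,1,2}. \<not> 3 dvd (if a then \<beta> 0 i else 0) + (if b then \<beta> 1 i else 0) + (if c then \<beta> 2 i else 0)"
        using that by (cases a; cases b; cases c) (simp_all add: \<beta>_def)
      then obtain i where i: "i \<in> {0,1,2}" "\<not> 3 dvd (if a then \<beta> 0 i else 0) + (if b then \<beta> 1 i else 0) + (if c then \<beta> 2 i else 0)" ..
      have "i < r \<and> ns ! i = 3" using i(1) n3 by fastforce
      then show ?thesis using i(2) by metis
    qed
    show "prime_at (\<lambda>i. - int (\<beta> j i)) \<noteq> e s i" if "j < 3" "i < r" "s \<in> {1, -1}" for j i s
    proof -
      have "0 < \<beta> j 1 \<and> \<beta> j 1 < 3 \<or> 0 < \<beta> j 2 \<and> \<beta> j 2 < 3" using less_3_cases[OF that(1)] by (auto simp: \<beta>_def)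
      moreover have "0 < \<beta> j 0" "\<beta> j 0 < 3" by (auto simp: \<beta>_def)
      ultimately show ?thesis using digit_two[of 0 1 "\<beta> j" s i] digit_two[of 0 2 "\<beta> j" s i] n3 by auto
    qed
  qed (use r n n3 in \<open>auto simp: \<beta>_def simp flip: numeral_3_eq_3\<close>)
qed

text \<open>
  With \<open>1 + 1 + 1 = 2 \<cdot> 2 - 1\<close> there is a carry in the first coordinate; the following three coordinates
  make the vectors independent and keep the primes away from the basis.
\<close>
lemma tame_bound_exponent_2_ge:
  assumes r: "4 \<le> r" and n: "\<And>i. i < r \<Longrightarrow> ns ! i = 2" and t: "tame_bound B M"
  shows "Dst + 1 \<le> M"
proof -
  define \<beta> :: "nat \<Rightarrow> nat \<Rightarrow> nat" where
    "\<beta> j i = (if i = 0 then 1 else if i = 2 then (if j = 1 then 1 else 0)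
       else if i = 3 then (if j = 2 then 1 else 0) else if j = 0 then 1 else 0)" for j i
  have lr: "0 < r" "1 < r" "2 < r" "3 < r" using r by linarith+
  note n2 = lr n[OF lr(1)] n[OF lr(2)] n[OF lr(3)] n[OF lr(4)]
  show ?thesis
  proof (rule tame_bound_carry_ge[of \<beta> 0, OF _ _ _ _ _ _ _ t])
    show "\<exists>i<r. \<not> ns ! i dvd (if a then \<beta> 0 i else 0) + (if b then \<beta> 1 i else 0) + (if c then \<beta> 2 i else 0)"
      if "a \<or> b \<or> c" for a b c
    proof -
      have "\<exists>i\<in>{1,2,3}. \<not> 2 dvd (if a then \<beta> 0 i else 0) + (if b then \<beta> 1 i else 0) + (if c then \<beta> 2 i else 0)"
        using that by (cases a; cases b; cases c) (simp_all add: \<beta>_def)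
      then obtain i where i: "i \<in> {1,2,3}" "\<not> 2 dvd (if a then \<beta> 0 i else 0) + (if b then \<beta> 1 i else 0) + (if c then \<beta> 2 i else 0)" ..
      have "i < r \<and> ns ! i = 2" using i(1) n2 by fastforce
      then show ?thesis using i(2) by metis
    qed
    show "prime_at (\<lambda>i. - int (\<beta> j i)) \<noteq> e s i" if "j < 3" "i < r" "s \<in> {1, -1}" for j i s
    proof -
      have "\<beta> j (j + 1) = 1" "\<beta> j 0 = 1" using less_3_cases[OF that(1)] by (auto simp: \<beta>_def)
      then show ?thesis using digit_two[of 0 "j + 1" "\<beta> j" s i] n[of "j+1"] n2 that(1) r by auto
    qed
  qed (use r n n2 in \<open>auto simp: \<beta>_def\<close>)
qed

text \<open>
  The digits are \<open>(2, 2)\<close> twice, \<open>(2, 1)\<close> twice, and \<open>(1, 0)\<close>. The atom is \<open>g\<^sup>2 h\<^sup>2 (-e\<^sub>1)\<close> with \<open>g = e\<^sub>1 + e\<^sub>2\<close> and \<open>h = e\<^sub>1 - e\<^sub>2\<close>, and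
  \<open>W = e\<^sub>1\<^sup>9 e\<^sub>2\<^sup>6\<close> has length \<open>5 = D\<^sup>*\<close>.
\<close>
lemma tame_bound_33_ge:
  assumes ns: "ns = [3, 3]" and t: "tame_bound B M"
  shows "Dst + 1 \<le> M"
proof -
  define \<beta> :: "nat \<Rightarrow> nat \<Rightarrow> nat" where
    "\<beta> j i = (if i = 0 then (if j < 4 then 2 else 1) else if j < 2 then 2 else if j < 4 then 1 else 0)" for j i
  have less_r: "i < r \<longleftrightarrow> i = 0 \<or> i = 1" for i using ns by (auto simp: less_Suc_eq)
  have n: "ns ! 0 = 3" "ns ! 1 = 3" using ns by auto
  have "(\<Sum>i<r. (\<Sum>j<5. \<beta> j i) / ns ! i) + 1 \<le> M"
  proof (rule tame_bound_positive_ge[OF _ _ _ _ _ t])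
    fix J assume J: "J \<subseteq> {..<5::nat}" "J \<noteq> {}" "J \<noteq> {..<5}"
    define c where "c j = (if j \<in> J then 1 else 0 :: int)" for j
    have sumJ: "(\<Sum>j\<in>J. int (\<beta> j i)) = c 0 * int (\<beta> 0 i) + c 1 * int (\<beta> 1 i) + c 2 * int (\<beta> 2 i) + c 3 * int (\<beta> 3 i) + c 4 * int (\<beta> 4 i)" for i
    proof -
      have "(\<Sum>j\<in>J. int (\<beta> j i)) = (\<Sum>j\<in>{..<5}. c j * int (\<beta> j i))"
        by (rule sum.mono_neutral_cong_left) (use J in \<open>auto simp: c_def\<close>)
      then show ?thesis by (simp add: eval_nat_numeral)
    qed
    have five: "j < 5 \<longleftrightarrow> j = 0 \<or> j = 1 \<or> j = 2 \<or> j = 3 \<or> j = 4" for j :: nat by linarith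
    have "\<not> ((0 \<in> J) \<and> (1 \<in> J) \<and> (2 \<in> J) \<and> (3 \<in> J) \<and> (4 \<in> J))"
    proof -
      obtain j where "j < 5" "j \<notin> J" using J(1,3) by (auto simp: subset_eq set_eq_iff)
      then show ?thesis using five[THEN iffD1, OF \<open>j < 5\<close>] by (elim disjE) simp_all
    qed
    moreover have "(0 \<in> J) \<or> (1 \<in> J) \<or> (2 \<in> J) \<or> (3 \<in> J) \<or> (4 \<in> J)"
    proof -
      obtain j where "j \<in> J" "j < 5" using J(1,2) by auto
      then show ?thesis using five[THEN iffD1, OF \<open>j < 5\<close>] by (elim disjE) simp_all
    qed
    moreover have "\<beta> 0 0 = 2" "\<beta> 1 0 = 2" "\<beta> 2 0 = 2" "\<beta> 3 0 = 2" "\<beta> 4 0 = 1"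
      "\<beta> 0 1 = 2" "\<beta> 1 1 = 2" "\<beta> 2 1 = 1" "\<beta> 3 1 = 1" "\<beta> 4 1 = 0" by (auto simp: \<beta>_def)
    \<comment> \<open>Multiplicities \<open>x\<close>, \<open>y\<close>, \<open>z\<close> of \<open>g\<close>, \<open>h\<close>, \<open>-e\<^sub>1\<close> in a zero-sum part.\<close>
    moreover have "(x = 0 \<and> y = 0 \<and> z = 0) \<or> (x = 2 \<and> y = 2 \<and> z = 1)"
      if "3 dvd 2 * x + 2 * y + z" "3 dvd 2 * x + y" "x \<in> {0, 1, 2}" "y \<in> {0, 1, 2}" "z \<in> {0, 1}" for x y z :: int
      using that by (elim insertE emptyE) simp_all
    from this[of "c 0 + c 1" "c 2 + c 3" "c 4"] have "\<not> (3 dvd 2 * (c 0 + c 1) + 2 * (c 2 + c 3) + c 4 \<and> 3 dvd 2 * (c 0 + c 1) + (c 2 + c 3))"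
      using calculation(1,2) by (auto simp: c_def split: if_splits)
    ultimately have "\<not> (3 dvd (\<Sum>j\<in>J. int (\<beta> j 0)) \<and> 3 dvd (\<Sum>j\<in>J. int (\<beta> j 1)))"
      unfolding sumJ by (simp add: algebra_simps)
    then show "\<exists>i<r. \<not> int (ns ! i) dvd (\<Sum>j\<in>J. int (\<beta> j i))"
      using less_r n by (metis of_nat_numeral)
  next
    fix i assume "i < r"
    then show "int (ns ! i) dvd (\<Sum>j<5. int (\<beta> j i))" unfolding less_r by (elim disjE) (simp_all add: n n(2)[unfolded One_nat_def] \<beta>_def eval_nat_numeral)
  next
    fix j i assume "j < (5::nat)" "i < r"
    show "prime_at (\<lambda>i. - int (\<beta> j i)) \<noteq> e 1 i"
    proof (cases "j < 4")
      case True
      then show ?thesis using digit_two[of 0 1 "\<beta> j" 1 i] n less_r by (auto simp: \<beta>_def)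
    next
      case False
      show ?thesis by (rule prime_at_neq_e[of 0]) (use False less_r n in \<open>auto simp: \<beta>_def cong_iff_dvd_diff\<close>)
    qed
  qed (use n in \<open>auto simp: \<beta>_def less_r\<close>)
  moreover have "(\<Sum>i<r. (\<Sum>j<5. \<beta> j i) / ns ! i) = 5" by (simp add: ns eval_nat_numeral \<beta>_def)
  ultimately have "real 6 \<le> real M" by simp
  then show ?thesis by (simp add: dstar_def ns)
qed

lemma tame_bound_ge_Dst:
  assumes "3 \<le> Dst" and t: "tame_bound B M" shows "Dst \<le> M"
  using ex_irreducible_size_Dst tame_bound_ge_size_irreducible[OF covers] assms by fastforce

text \<open>
  The excluded lists are those of the trivial group and of \<open>C\<^sub>2\<close>, \<open>C\<^sub>3\<close>, \<open>C\<^sub>4\<close>, \<open>C\<^sub>2\<^sup>2\<close>, \<open>C\<^sub>2\<^sup>3\<close>.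
\<close>
lemma tame_bound_gt_Dst:
  assumes srt: "sorted_wrt (dvd) ns" and ne: "ns \<notin> {[], [2], [3], [4], [2, 2], [2, 2, 2]}"
    and t: "tame_bound B M"
  shows "Dst + 1 \<le> M"
proof -
  have r0: "0 < r" using ne by auto
  show ?thesis
  proof (cases "r = 1")
    case True
    then obtain n where n: "ns = [n]" by (metis length_0_conv length_Suc_conv One_nat_def)
    then have "1 < n" "n \<notin> {2, 3, 4}" using ns_gt_1 ne by auto
    then have "5 \<le> ns ! 0" using n by auto
    then show ?thesis using tame_bound_cyclic_ge[OF True _ t] by blast
  next
    case False
    then have r2: "2 \<le> r" using r0 by linarith
    define m where "m = ns ! (r - 1)"
    have dvd: "ns ! i dvd m" if "i < r" for i
      using sorted_wrt_nth_less[OF srt, of i "r - 1"] that by (cases "i = r - 1") (auto simp: m_def)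
    have m1: "1 < m" using n_gt_1[of "r - 1"] r0 by (simp add: m_def)
    have all: "ns ! i = m" if "m = 2 \<or> m = 3" "i < r" for i
    proof -
      have "ns ! i dvd m" "1 < ns ! i" using dvd[OF that(2)] n_gt_1[OF that(2)] .
      moreover have "ns ! i \<le> m" using calculation m1 by (auto intro: dvd_imp_le)
      ultimately have "ns ! i = 2 \<or> ns ! i = m" using that(1) by linarith
      then show ?thesis using \<open>ns ! i dvd m\<close> that(1) by auto
    qed
    consider "4 \<le> m" | "m = 3" | "m = 2" using m1 by linarith
    then show ?thesis
    proof cases
      case 1
      then show ?thesis using tame_bound_large_exponent_ge[OF r2 _ t] by (simp add: m_def)
    next
      case 2
      show ?thesis
      proof (cases "3 \<le> r")
        case True
        then show ?thesis using tame_bound_exponent_3_ge[OF _ _ t] all 2 by blast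
      next
        case False
        then have "r = 2" using r2 by simp
        then have "ns = [3, 3]" using all 2 by (intro nth_equalityI) (auto simp: less_2_cases_iff)
        then show ?thesis using tame_bound_33_ge[OF _ t] by blast
      qed
    next
      case 3
      show ?thesis
      proof (cases "4 \<le> r")
        case True
        then show ?thesis using tame_bound_exponent_2_ge[OF _ _ t] all 3 by blast
      next
        case False
        then have "r = 2 \<or> r = 3" using r2 by linarith
        moreover have "ns = replicate r 2" using all 3 by (intro nth_equalityI) auto
        ultimately have "ns = [2, 2] \<or> ns = [2, 2, 2]"
          by (elim disjE) (simp_all add: numeral_2_eq_2 numeral_3_eq_3)
        then show ?thesis using ne by blast
      qed
    qed
  qed
qed

end

section \<open>Cyclic groups of order at most four\<close>

lemma ex_submultiset_size: "k \<le> size M \<Longrightarrow> \<exists>T. T \<subseteq># M \<and> size T = k"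
proof (induction M arbitrary: k)
  case (add p M)
  show ?case
  proof (cases "k \<le> size M")
    case True
    then obtain T where "T \<subseteq># M" "size T = k" using add.IH by blast
    then show ?thesis by (intro exI[of _ T]) (auto simp: subseteq_mset_def le_SucI)
  next
    case False
    then have "k = size (add_mset p M)" using add.prems by simp
    then show ?thesis by blast
  qed
qed auto

context
  fixes n :: nat and P :: "'p set" and d :: "'p \<Rightarrow> nat \<Rightarrow> int"
  assumes n: "n \<in> {2, 3, 4}"
begin

text \<open>
  Residues in \<open>{0, \<dots>, n - 1}\<close> of the classes, or of their negatives if \<open>s = -1\<close>.
\<close>
definition residue :: "int \<Rightarrow> 'p \<Rightarrow> nat" where "residue s p = nat ((s * d p 0) mod int n)"

lemma residue_less: "residue s p < n"
  using n by (auto simp: residue_def nat_less_iff)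

lemma int_residue: "int (residue s p) = (s * d p 0) mod int n"
  using n by (auto simp: residue_def)

lemma zero_sum_residue:
  assumes "s \<in> {1, -1}" shows "zero_sum [n] d S \<longleftrightarrow> n dvd (\<Sum>p\<in>#S. residue s p)"
proof -
  have "[int (\<Sum>p\<in>#S. residue s p) = s * (\<Sum>p\<in>#S. d p 0)] (mod int n)"
  proof (induction S)
    case (add p S)
    have "[int (residue s p) = s * d p 0] (mod int n)" by (simp add: int_residue cong_def)
    from cong_add[OF this add.IH] show ?case by (simp add: algebra_simps)
  qed simp
  then have "int n dvd int (\<Sum>p\<in>#S. residue s p) \<longleftrightarrow> int n dvd s * (\<Sum>p\<in>#S. d p 0)" by (rule cong_dvd_iff)
  also have "\<dots> \<longleftrightarrow> int n dvd (\<Sum>p\<in>#S. d p 0)" using assms by auto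
  finally show ?thesis unfolding int_dvd_int_iff by (simp add: zero_sum_def)
qed

lemma residue_pos:
  assumes "\<not> zero_sum [n] d {#p#}" "s \<in> {1, -1}" shows "0 < residue s p"
  using assms zero_sum_residue[OF assms(2), of "{#p#}"] by (cases "residue s p") auto

lemma residue_neg:
  assumes "\<not> zero_sum [n] d {#p#}" "s \<in> {1, -1}" shows "residue (- s) p = n - residue s p"
proof -
  have "\<not> n dvd residue s p" using zero_sum_residue[OF assms(2), of "{#p#}"] assms(1) by simp
  then have "(s * d p 0) mod int n \<noteq> 0" using int_residue[of s p] by (metis dvd_0_right int_dvd_int_iff of_nat_0)
  then have "(- (s * d p 0)) mod int n = int n - (s * d p 0) mod int n"
    by (simp add: zmod_zminus1_eq_if)
  then have "int (residue (- s) p) = int n - int (residue s p)" by (simp add: int_residue)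
  then show ?thesis by linarith
qed

lemma zero_sum_subset_eq:
  assumes "v \<in> irreducibles (blocks [n] P d)" "T \<subseteq># v" "T \<noteq> {#}" "n dvd (\<Sum>p\<in>#T. residue s p)" "s \<in> {1, -1}"
  shows "v = T"
  using irreducible_blockD(4)[OF assms(1,2)] zero_sum_residue[OF assms(5)] assms(3,4) by metis

lemma index_sum_all_one:
  assumes v: "v \<in> irreducibles (blocks [n] P d)" and s: "s \<in> {1, -1}" and one: "\<And>p. p \<in># v \<Longrightarrow> residue s p = 1"
  shows "(\<Sum>p\<in>#v. residue s p) = n"
proof -
  have sum: "(\<Sum>p\<in>#T. residue s p) = size T" if "T \<subseteq># v" for T
    using that by (induction T) (auto simp: one dest: mset_subset_eq_insertD subset_mset.less_imp_le)
  have "n dvd size v" using irreducible_blockD(2)[OF v] zero_sum_residue[OF s] sum by simp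
  then have "n \<le> size v" using irreducible_blockD(3)[OF v] by (simp add: dvd_imp_le nonempty_has_size)
  then obtain T where T: "T \<subseteq># v" "size T = n" using ex_submultiset_size by blast
  moreover have "T \<noteq> {#}" using T(2) n by auto
  ultimately have "v = T" using zero_sum_subset_eq[OF v T(1) _ _ s] sum[OF T(1)] n by auto
  then show ?thesis using sum[of v] T by simp
qed

text \<open>
  For \<open>n \<le> 4\<close> an atom that contains a generator, normalized to \<open>1\<close>, is \<open>1 (n - 1)\<close>, \<open>1\<^sup>n\<close>, or \<open>1\<^sup>2 2\<close> with \<open>n = 4\<close>.
\<close>
lemma index_sum_of_generator:
  assumes v: "v \<in> irreducibles (blocks [n] P d)" and nz: "\<And>q. q \<in># v \<Longrightarrow> \<not> zero_sum [n] d {#q#}"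
    and s: "s \<in> {1, -1}" and p: "p \<in># v" "residue s p = 1"
  shows "(\<Sum>q\<in>#v. residue s q) = n"
proof -
  obtain v1 where v1: "v = add_mset p v1" using p(1) by (metis mset_add)
  \<comment> \<open>As \<open>n \<le> 4\<close>, each residue is \<open>1\<close>, \<open>n - 1\<close>, or \<open>2\<close> with \<open>n = 4\<close>.\<close>
  consider (a) q where "q \<in># v1" "residue s q = n - 1" | (b) q where "n = 4" "q \<in># v1" "residue s q = 2" "\<forall>q\<in>#v1. residue s q \<noteq> 3"
    | (c) "\<forall>q\<in>#v1. residue s q = 1"
  proof -
    have "residue s q = 1 \<or> residue s q = n - 1 \<or> n = 4 \<and> residue s q = 2" if "q \<in># v1" for q
      using residue_pos[OF nz s, of q] residue_less[of s q] that v1 n by auto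
    then show thesis using a b c by (metis add_diff_cancel_left' numeral_3_eq_3 numeral_Bit0 One_nat_def Suc_1 add_2_eq_Suc' diff_Suc_1 eval_nat_numeral(2) semiring_norm(26,27,28))
  qed
  then show ?thesis
  proof cases
    case a
    then have "{#p, q#} \<subseteq># v" using v1 by (simp add: insert_subset_eq_iff)
    then have "v = {#p, q#}" using zero_sum_subset_eq[OF v _ _ _ s, of "{#p, q#}"] a p n by auto
    then show ?thesis using a p n by auto
  next
    case b
    obtain v2 where v2: "v1 = add_mset q v2" using b(2) by (metis mset_add)
    have ones: "residue s t = 1" if "t \<in># v2" for t
    proof (rule ccontr)
      assume "residue s t \<noteq> 1"
      then have t2: "residue s t = 2" using residue_pos[OF nz s, of t] residue_less[of s t] that v1 v2 b by auto
      have "{#q, t#} \<subseteq># v" using that v1 v2 by (simp add: insert_subset_eq_iff)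
      then have "v = {#q, t#}" using zero_sum_subset_eq[OF v _ _ _ s, of "{#q, t#}"] b t2 by auto
      then have "p = q \<or> p = t" using p(1) by auto
      then show False using p(2) b t2 by auto
    qed
    have "v2 \<noteq> {#}"
    proof
      assume "v2 = {#}"
      then have "(\<Sum>q\<in>#v. residue s q) = 3" using v1 v2 p b by simp
      then have "4 dvd (3 :: nat)" using irreducible_blockD(2)[OF v] zero_sum_residue[OF s, of v] b(1) by metis
      then show False by simp
    qed
    then obtain t where t: "t \<in># v2" by blast
    then have "{#p, q, t#} \<subseteq># v" using v1 v2 by (simp add: insert_subset_eq_iff)
    then have "v = {#p, q, t#}" using zero_sum_subset_eq[OF v _ _ _ s, of "{#p, q, t#}"] b p ones[OF t] by auto
    then show ?thesis using b p ones[OF t] by simp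
  next
    case c
    then show ?thesis using index_sum_all_one[OF v s] p v1 by auto
  qed
qed

text \<open>
  Atoms have index one: with one of the two signs, the residues add up to \<open>n\<close>. The case without a
  generator is \<open>2\<^sup>2\<close> in \<open>C\<^sub>4\<close>.
\<close>
lemma ex_index_sum:
  assumes v: "v \<in> irreducibles (blocks [n] P d)" and nz: "\<And>q. q \<in># v \<Longrightarrow> \<not> zero_sum [n] d {#q#}"
  shows "\<exists>s\<in>{1, -1}. (\<Sum>q\<in>#v. residue s q) = n"
proof (cases "\<exists>p\<in>#v. residue 1 p \<noteq> 2 \<or> n \<noteq> 4")
  case True
  then obtain p where p: "p \<in># v" "residue 1 p \<noteq> 2 \<or> n \<noteq> 4" by blast
  have "residue 1 p = 1 \<or> residue 1 p = n - 1"
    using residue_pos[OF nz[OF p(1)], of 1] residue_less[of 1 p] p(2) n by auto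
  then have "residue 1 p = 1 \<or> residue (-1) p = 1"
    using residue_neg[OF nz[OF p(1)], of 1] n by auto
  then show ?thesis using index_sum_of_generator[OF v nz _ p(1)] by blast
next
  case False
  then have two: "\<And>p. p \<in># v \<Longrightarrow> residue 1 p = 2" and n4: "n = 4" using irreducible_blockD(3)[OF v] by auto
  obtain p v1 where v1: "v = add_mset p v1" using irreducible_blockD(3)[OF v] by (metis multiset_cases)
  have "v1 \<noteq> {#}" using nz[of p] irreducible_blockD(2)[OF v] v1 by auto
  then obtain q where "q \<in># v1" by blast
  then have "{#p, q#} \<subseteq># v" using v1 by (simp add: insert_subset_eq_iff)
  moreover have residue2: "residue 1 p = 2" "residue 1 q = 2" using two v1 \<open>q \<in># v1\<close> by simp_all
  ultimately have "v = {#p, q#}" using zero_sum_subset_eq[OF v, of "{#p, q#}" 1] n4 by simp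
  then have "(\<Sum>q\<in>#v. residue 1 q) = n" using residue2 n4 by simp
  then show ?thesis by blast
qed

lemma sum_ge_size: "(\<And>q. q \<in># v \<Longrightarrow> 0 < f q) \<Longrightarrow> size v \<le> (\<Sum>q\<in>#v. f q :: nat)"
  by (induction v) (auto simp: Suc_le_eq add_less_le_mono intro: le_less_trans order.strict_trans1)

text \<open>
  If the residues of \<open>v\<close> with respect to \<open>s\<close> add up to \<open>n\<close>, there is nothing to show. Otherwise those with
  respect to \<open>-s\<close> do, and then the first sum is \<open>n (|v| - 1)\<close>, while \<open>|v| - 1 + (n - residue s p) \<le> n\<close>.
\<close>
lemma index_sum_le:
  assumes v: "v \<in> irreducibles (blocks [n] P d)" and nz: "\<And>q. q \<in># v \<Longrightarrow> \<not> zero_sum [n] d {#q#}"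
    and s: "s \<in> {1, -1}" and p: "p \<in># v"
  shows "(\<Sum>q\<in>#v. residue s q) \<le> n * residue s p"
proof -
  have pos: "\<And>q t. q \<in># v \<Longrightarrow> t \<in> {1, -1} \<Longrightarrow> 0 < residue t q" using residue_pos[OF nz] by blast
  obtain t where t: "t \<in> {1, -1}" "(\<Sum>q\<in>#v. residue t q) = n" using ex_index_sum[OF v nz] by blast
  show ?thesis
  proof (cases "t = s")
    case True
    then show ?thesis using t(2) pos[OF p s] by (cases "residue s p") auto
  next
    case False
    then have ts: "s = - t" using t s by auto
    have "(\<Sum>q\<in>#w. residue s q) + (\<Sum>q\<in>#w. residue t q) = n * size w" if "set_mset w \<subseteq> set_mset v" for w
      using that
    proof (induction w)
      case (add q w)
      have "residue s q + residue t q = n" using residue_neg[OF nz t(1), of q] add.prems residue_less[of t q] ts by auto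
      then show ?case using add by (simp add: algebra_simps)
    qed simp
    then have sum: "(\<Sum>q\<in>#v. residue s q) + n = n * size v" using t(2) by (metis order_refl)
    obtain v1 where v1: "v = add_mset p v1" using p by (metis mset_add)
    have "size v1 \<le> (\<Sum>q\<in>#v1. residue t q)" by (rule sum_ge_size) (use pos t v1 in auto)
    then have "size v1 + residue t p \<le> n" using t(2) v1 by simp
    moreover have "residue s p + residue t p = n" using residue_neg[OF nz t(1), of p] p residue_less[of t p] ts by auto
    ultimately have "size v1 \<le> residue s p" by linarith
    then have "n * size v \<le> n * residue s p + n" using v1 by (metis add.commute mult_Suc_right mult_le_mono2 not_less_eq_eq size_add_mset Suc_le_mono)
    then show ?thesis using sum by linarith
  qed
qed

text \<open>
  Choose the sign for which the residues of \<open>u\<close> add up to \<open>n\<close>. A factor \<open>v\<close> of the cover has residue sum at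
  most \<open>n\<close> times that of the part \<open>x\<close> which it contributes, so all of them together have at most \<open>n\<^sup>2\<close>. Subtracting
  \<open>u\<close> leaves \<open>n (n - 1)\<close>, and every atom of the rest takes at least \<open>n\<close>.
\<close>
lemma tame_bound_cyclic_le: "tame_bound (blocks [n] P d) n"
proof (rule tame_boundI[OF saturated_blocks])
  fix u Q
  assume u: "u \<in> irreducibles (blocks [n] P d)"
    and Q: "\<Sum>\<^sub># (image_mset fst Q) = u" "\<forall>(x, v) \<in># Q. x \<noteq> {#} \<and> x \<subseteq># v \<and> v \<in> irreducibles (blocks [n] P d)"
    and 2: "2 \<le> size Q"
  note c = cover_no_zero_prime[OF u Q 2]
  let ?V = "\<Sum>\<^sub># (image_mset snd Q)"
  obtain s where s: "s \<in> {1, -1}" "(\<Sum>q\<in>#u. residue s q) = n" using ex_index_sum[OF u c(2)] by blast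
  have "size u \<le> n" using sum_ge_size[of u "residue s"] s residue_pos c(2) by fastforce
  obtain y where y: "y \<in> decompositions (blocks [n] P d) (?V - u)"
    using decomposition_exists[OF saturated_blocks block_cover_diff(1)[OF u Q]] by blast
  have V: "?V = u + (?V - u)" using size_diff_cover[of Q u] Q by fastforce
  have "(\<Sum>q\<in>#\<Sum>\<^sub># (image_mset snd R). residue s q) \<le> n * (\<Sum>q\<in>#\<Sum>\<^sub># (image_mset fst R). residue s q)" if "R \<subseteq># Q" for R
    using that
  proof (induction R)
    case (add xv R)
    obtain x v where xv: "xv = (x, v)" by (cases xv)
    have "(x, v) \<in># Q" using add.prems xv by (meson mset_subset_eq_insertD)
    then have "x \<noteq> {#}" "x \<subseteq># v" "v \<in> irreducibles (blocks [n] P d)" using Q by auto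
    moreover from \<open>(x, v) \<in># Q\<close> have "\<And>q. q \<in># v \<Longrightarrow> \<not> zero_sum [n] d {#q#}" using c(1) by force
    moreover obtain p x' where x': "x = add_mset p x'" using \<open>x \<noteq> {#}\<close> by (metis multiset_cases)
    ultimately have "(\<Sum>q\<in>#v. residue s q) \<le> n * residue s p" using index_sum_le[OF _ _ s(1), of v p] by (metis mset_subset_eq_insertD)
    also have "\<dots> \<le> n * (\<Sum>q\<in>#x. residue s q)" using x' by simp
    finally have xv_le: "(\<Sum>q\<in>#v. residue s q) \<le> n * (\<Sum>q\<in>#x. residue s q)" .
    have "R \<subseteq># Q" using add.prems by (meson mset_subset_eq_insertD subset_mset.less_imp_le)
    from add_mono[OF xv_le add.IH[OF this]] show ?case unfolding xv
      by (simp only: image_mset_add_mset fst_conv snd_conv sum_mset.add_mset image_mset_union sum_mset.union add_mult_distrib2)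
  qed simp
  from this[of Q] have "(\<Sum>q\<in>#?V. residue s q) \<le> n * n" using Q(1) s(2) by simp
  then have W: "(\<Sum>q\<in>#?V - u. residue s q) + n \<le> n * n" using s(2) by (subst (asm) V) simp
  have "n * size y \<le> (\<Sum>q\<in>#?V - u. residue s q)"
  proof (rule size_decomposition_le[OF y])
    fix v assume v: "v \<in> blocks [n] P d" "v \<subseteq># ?V - u" "v \<noteq> {#}"
    then have "n dvd (\<Sum>p\<in>#v. residue s p)" using zero_sum_residue[OF s(1)] by (auto simp: blocks_def)
    moreover have "0 < (\<Sum>p\<in>#v. residue s p)"
    proof -
      have "0 < residue s q" if "q \<in># v" for q
        by (rule residue_pos[OF c(1) s(1)]) (use that v(2) in \<open>meson in_diffD mset_subset_eqD\<close>)
      then show ?thesis using sum_ge_size[of v "residue s"] v(3) by (metis le_zero_eq not_gr_zero size_eq_0_iff_empty)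
    qed
    ultimately show "n \<le> (\<Sum>p\<in>#v. residue s p)" by (simp add: dvd_imp_le)
  qed
  then have "n * Suc (size y) \<le> n * n" using W by simp
  then have "Suc (size y) \<le> n" using n by auto
  moreover have "size Q \<le> n" using c(3) \<open>size u \<le> n\<close> by simp
  ultimately show "size Q \<le> n \<and> (\<exists>y\<in>decompositions (blocks [n] P d) (?V - u). Suc (size y) \<le> n)"
    using y by blast
qed

end

section \<open>Elementary two-groups of rank at most three\<close>

lemma zero_sum_pair:
  assumes "\<forall>n\<in>set ns. n = 2" "\<And>i. i < length ns \<Longrightarrow> even (d p i) = even (d q i)"
  shows "zero_sum ns d {#p, q#}"
  unfolding zero_sum_def
proof (intro allI impI)
  fix i assume i: "i < length ns"
  then have "ns ! i = 2" using assms(1) by auto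
  then show "int (ns ! i) dvd (\<Sum>p\<in>#{#p, q#}. d p i)" using assms(2)[OF i] by simp
qed

text \<open>
  The sums of different subsets are different, because the symmetric difference of two subsets with
  equal sums has sum zero; so there are at most \<open>2\<^sup>r\<close> subsets.
\<close>
lemma zero_sum_free_size_le:
  assumes ns: "\<forall>n\<in>set ns. n = 2" and free: "\<And>T. T \<subseteq># S \<Longrightarrow> zero_sum ns d T \<Longrightarrow> T = {#}"
  shows "size S \<le> length ns"
proof -
  let ?r = "length ns"
  have nth: "ns ! i = 2" if "i < ?r" for i using ns that by auto
  have "count S p \<le> 1" for p
  proof (rule ccontr)
    assume "\<not> count S p \<le> 1"
    then have "2 \<le> count S p" by simp
    then have "replicate_mset 2 p \<subseteq># S" by (simp add: count_le_replicate_mset_subset_eq)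
    moreover have "zero_sum ns d (replicate_mset 2 p)" using zero_sum_pair[OF ns, of d p p] by (simp add: numeral_2_eq_2)
    ultimately have "replicate_mset 2 p = {#}" by (rule free)
    then show False by (simp add: numeral_2_eq_2)
  qed
  then have S: "S = mset_set (set_mset S)"
  proof (intro multiset_eqI)
    fix p
    show "count S p = count (mset_set (set_mset S)) p"
    proof (cases "p \<in># S")
      case True
      then have "count S p \<noteq> 0" by simp
      then have "count S p = 1" using \<open>count S p \<le> 1\<close> by linarith
      then show ?thesis using True by simp
    qed (simp add: not_in_iff)
  qed
  define f where "f A = (\<lambda>i\<in>{..<?r}. (\<Sum>p\<in>A. d p i) mod 2)" for A
  have "inj_on f (Pow (set_mset S))"
  proof (rule inj_onI)
    fix A B assume A: "A \<in> Pow (set_mset S)" and B: "B \<in> Pow (set_mset S)" and eq: "f A = f B"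
    let ?D = "(A - B) \<union> (B - A)"
    have fin: "finite A" "finite B" using A B finite_subset by auto
    have "?D \<subseteq> set_mset S" using A B by auto
    then have "mset_set ?D \<subseteq># S" by (metis S finite_set_mset subset_imp_msubset_mset_set)
    moreover have "zero_sum ns d (mset_set ?D)"
      unfolding zero_sum_def
    proof (intro allI impI)
      fix i assume i: "i < ?r"
      have "(\<Sum>p\<in>A. d p i) mod 2 = (\<Sum>p\<in>B. d p i) mod 2" using fun_cong[OF eq, of i] i by (simp add: f_def)
      moreover have "(\<Sum>p\<in>A. d p i) = (\<Sum>p\<in>A - B. d p i) + (\<Sum>p\<in>A \<inter> B. d p i)" using fin by (metis sum.Int_Diff add.commute)
      moreover have "(\<Sum>p\<in>B. d p i) = (\<Sum>p\<in>B - A. d p i) + (\<Sum>p\<in>A \<inter> B. d p i)" using fin by (metis sum.Int_Diff add.commute inf_commute)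
      moreover have "(\<Sum>p\<in>?D. d p i) = (\<Sum>p\<in>A - B. d p i) + (\<Sum>p\<in>B - A. d p i)" using fin by (intro sum.union_disjoint) auto
      ultimately have "2 dvd (\<Sum>p\<in>?D. d p i)" by presburger
      then show "int (ns ! i) dvd (\<Sum>p\<in>#mset_set ?D. d p i)" using nth[OF i] by (simp add: sum_unfold_sum_mset)
    qed
    ultimately have "mset_set ?D = {#}" using free by blast
    then show "A = B" using fin by (auto simp: mset_set_empty_iff)
  qed
  moreover have "f ` Pow (set_mset S) \<subseteq> PiE {..<?r} (\<lambda>_. {0, 1})"
    by (auto simp: f_def PiE_def) 
  ultimately have "card (Pow (set_mset S)) \<le> card (PiE {..<?r} (\<lambda>_. {0, 1 :: int}))"
    by (intro card_inj_on_le[of f]) (auto intro!: finite_PiE)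
  then have "2 ^ card (set_mset S) \<le> (2 :: nat) ^ ?r" by (simp add: card_Pow card_PiE numeral_2_eq_2)
  then have "card (set_mset S) \<le> ?r" by (rule power_le_imp_le_exp[rotated]) simp
  then show ?thesis by (metis S size_mset_set)
qed

lemma irreducible_2_size_le:
  assumes ns: "\<forall>n\<in>set ns. n = 2" and u: "u \<in> irreducibles (blocks ns P d)"
  shows "size u \<le> Suc (length ns)"
proof -
  obtain p S where S: "u = add_mset p S" using irreducible_blockD(3)[OF u] by (metis multiset_cases)
  have "T = {#}" if "T \<subseteq># S" "zero_sum ns d T" for T
    by (rule irreducible_remove_zero_sum_free[OF _ that]) (use u S in simp)
  from zero_sum_free_size_le[OF ns this] show ?thesis using S by simp
qed

lemma decomposition_split_size:
  assumes W: "W \<in> blocks ns P d" and nz: "\<And>p. p \<in># W \<Longrightarrow> \<not> zero_sum ns d {#p#}"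
    and T: "T \<subseteq># W" "zero_sum ns d T"
  shows "\<exists>y\<in>decompositions (blocks ns P d) W. size y \<le> size T div 2 + (size W - size T) div 2"
proof -
  have TB: "T \<in> blocks ns P d" using T W set_mset_mono[OF T(1)] by (auto simp: blocks_def)
  then obtain y1 where y1: "y1 \<in> decompositions (blocks ns P d) T" using decomposition_exists[OF saturated_blocks] by blast
  have "W - T \<in> blocks ns P d" using saturated_diff[OF saturated_blocks TB W T(1)] .
  then obtain y2 where y2: "y2 \<in> decompositions (blocks ns P d) (W - T)" using decomposition_exists[OF saturated_blocks] by blast
  have "2 * size y1 \<le> size T" using half_size_decomposition[OF _ y1] nz T(1) by (meson mset_subset_eqD)
  moreover have "2 * size y2 \<le> size W - size T"
    using half_size_decomposition[OF _ y2] nz by (metis in_diffD size_Diff_submset T(1))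
  ultimately have "size y1 \<le> size T div 2" "size y2 \<le> (size W - size T) div 2" by linarith+
  then have "size (y1 + y2) \<le> size T div 2 + (size W - size T) div 2" by simp
  moreover have "y1 + y2 \<in> decompositions (blocks ns P d) W"
    using decompositions_add[OF y1 y2] T(1) by simp
  ultimately show ?thesis by blast
qed

lemma size_mset_3E:
  assumes "size v = 3" "p \<in># v" obtains a b where "v = {#p, a, b#}"
proof -
  obtain v1 where v1: "v = add_mset p v1" using assms(2) by (metis mset_add)
  then have "size v1 = 2" using assms(1) by simp
  then obtain a v2 where v2: "v1 = add_mset a v2" by (metis Suc_1 size_eq_Suc_imp_eq_union add_mset_add_single)
  then have "size v2 = 1" using \<open>size v1 = 2\<close> by simp
  then obtain b where "v2 = {#b#}" by (metis size_1_singleton_mset)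
  then show thesis using that v1 v2 by blast
qed

text \<open>
  An atom of length \<open>3\<close> consists of the three nonzero classes, and the class of \<open>q\<close> is one of the two
  that differ from the class of \<open>p\<close>.
\<close>
lemma irreducible_22_third:
  assumes v: "v \<in> irreducibles (blocks [2, 2] P d)" "size v = 3" "p \<in># v"
    and q: "\<not> zero_sum [2, 2] d {#q#}" "\<not> zero_sum [2, 2] d {#p, q#}"
  shows "\<exists>t. {#t#} \<subseteq># v - {#p#} \<and> zero_sum [2, 2] d {#t, q#}"
proof -
  obtain a b where ab: "v = {#p, a, b#}" using size_mset_3E[OF v(2,3)] .
  have zs: "zero_sum [2, 2] d S \<longleftrightarrow> even (\<Sum>p\<in>#S. d p 0) \<and> even (\<Sum>p\<in>#S. d p 1)" for S
    by (auto simp: zero_sum_def less_Suc_eq)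
  have sub: "\<not> zero_sum [2, 2] d T" if "T \<subseteq># v" "size T = 1 \<or> size T = 2" for T
  proof
    assume "zero_sum [2, 2] d T"
    moreover have "T \<noteq> {#}" using that(2) by auto
    ultimately have "T = v" using irreducible_blockD(4)[OF v(1) that(1)] by blast
    then show False using v(2) that(2) by auto
  qed
  have "\<not> zero_sum [2, 2] d {#p#}" "\<not> zero_sum [2, 2] d {#a#}" "\<not> zero_sum [2, 2] d {#b#}"
    "\<not> zero_sum [2, 2] d {#p, a#}" "\<not> zero_sum [2, 2] d {#p, b#}" "\<not> zero_sum [2, 2] d {#a, b#}" "zero_sum [2, 2] d {#p, a, b#}"
    by (rule sub, use ab in \<open>simp_all add: insert_subset_eq_iff\<close>)+ (use irreducible_blockD(2)[OF v(1)] ab in simp)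
  then have "zero_sum [2, 2] d {#a, q#} \<or> zero_sum [2, 2] d {#b, q#}"
    using q unfolding zs by auto
  then show ?thesis unfolding ab by auto
qed

text \<open>
  The general estimate leaves only the case in which \<open>u\<close> and the three members of the cover have
  length \<open>3\<close> and the rest has length \<open>6\<close>. Each member contains all nonzero classes, so three primes with the
  classes of \<open>u\<close> can be selected from the rest, one from each member; the rest splits into two atoms of length \<open>3\<close>.
\<close>
lemma tame_bound_22_le: "tame_bound (blocks [2, 2] P d) 3"
proof (rule tame_boundI[OF saturated_blocks])
  let ?B = "blocks [2, 2] P d"
  fix u Q
  assume u: "u \<in> irreducibles ?B"
    and Q: "\<Sum>\<^sub># (image_mset fst Q) = u" "\<forall>(x, v) \<in># Q. x \<noteq> {#} \<and> x \<subseteq># v \<and> v \<in> irreducibles ?B"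
    and 2: "2 \<le> size Q"
  note c = cover_no_zero_prime[OF u Q 2]
  let ?V = "\<Sum>\<^sub># (image_mset snd Q)"
  let ?W = "?V - u"
  have D: "size v \<le> 3" if "v \<in> irreducibles ?B" for v using irreducible_2_size_le[OF _ that] by simp
  have WB: "?W \<in> ?B" and WV: "size ?W + size u = size ?V" using block_cover_diff[OF u Q] by auto
  have nzW: "\<not> zero_sum [2, 2] d {#p#}" if "p \<in># ?W" for p using c(1) that by (meson in_diffD)
  have V: "size ?V \<le> 3 * size Q" using size_sum_snd_le[of Q 3] Q(2) D by auto
  have "size Q \<le> 3" using c(3) D[OF u] by simp
  \<comment> \<open>The rest has at most \<open>6\<close> primes; only if there are \<open>6\<close>, three atoms are possible, and a zero-sum part of length \<open>3\<close> is required.\<close>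
  have "\<exists>T. T \<subseteq># ?W \<and> zero_sum [2, 2] d T \<and> size T div 2 + (size ?W - size T) div 2 \<le> 2"
  proof (cases "size ?W \<le> 5")
    case True
    then show ?thesis by (intro exI[of _ "{#}"]) auto
  next
    case False
    then have "6 + size u \<le> 3 * size Q" using WV V by linarith
    then have Q3: "size Q = 3" and u3: "size u = 3" using \<open>size Q \<le> 3\<close> D[OF u] c(3) by linarith+
    then have W6: "size ?W = 6" "size ?V = 9" using False V WV by auto
    have three: "size v = 3 \<and> size x = 1" if xv: "(x, v) \<in># Q" for x v
    proof -
      obtain Q1 where Q1: "Q = add_mset (x, v) Q1" using xv by (metis mset_add)
      have "size (\<Sum>\<^sub># (image_mset snd Q1)) \<le> 3 * size Q1" by (rule size_sum_snd_le) (use Q(2) D Q1 in auto)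
      then have "3 \<le> size v" using W6(2) Q1 Q3 by simp
      moreover have "size v \<le> 3" using Q(2) xv D by auto
      moreover have "x \<noteq> {#}" using Q(2) xv by auto
      then have "1 \<le> size x" by (simp add: Suc_le_eq nonempty_has_size)
      ultimately show ?thesis using c(4)[OF xv] Q3 u3 by simp
    qed
    have "Q \<noteq> {#}" using Q3 by auto
    then obtain xv1 where "xv1 \<in># Q" by blast
    then obtain xv2 xv3 where Qe: "Q = {#xv1, xv2, xv3#}" using size_mset_3E[OF Q3] by metis
    obtain x1 v1 x2 v2 x3 v3 where xvs: "xv1 = (x1, v1)" "xv2 = (x2, v2)" "xv3 = (x3, v3)" by (cases xv1; cases xv2; cases xv3)
    have mem: "(x1, v1) \<in># Q" "(x2, v2) \<in># Q" "(x3, v3) \<in># Q" using Qe xvs by auto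
    obtain p1 p2 p3 where ps: "x1 = {#p1#}" "x2 = {#p2#}" "x3 = {#p3#}"
      using three[OF mem(1)] three[OF mem(2)] three[OF mem(3)] by (metis size_1_singleton_mset)
    have vs: "v1 \<in> irreducibles ?B" "v2 \<in> irreducibles ?B" "v3 \<in> irreducibles ?B" "p1 \<in># v1" "p2 \<in># v2" "p3 \<in># v3"
      using Q(2) mem ps by fastforce+
    have ue: "u = {#p1, p2, p3#}" using Q(1) Qe xvs ps by (auto simp: add_mset_commute)
    have nzp: "\<not> zero_sum [2, 2] d {#p#}" if "p \<in># u" for p using c(2) that .
    have pairs: "\<not> zero_sum [2, 2] d {#p, q#}" if "{#p, q#} \<subseteq># u" for p q
    proof
      assume "zero_sum [2, 2] d {#p, q#}"
      then have "{#p, q#} = u" using irreducible_blockD(4)[OF u that] by simp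
      then have "size {#p, q#} = 3" using u3 by metis
      then show False by simp
    qed
    obtain t1 where t1: "{#t1#} \<subseteq># v1 - {#p1#}" "zero_sum [2, 2] d {#t1, p2#}"
      using irreducible_22_third[OF vs(1) _ vs(4), of p2] three[OF mem(1)] nzp[of p2] pairs[of p1 p2] ue by auto
    obtain t2 where t2: "{#t2#} \<subseteq># v2 - {#p2#}" "zero_sum [2, 2] d {#t2, p3#}"
      using irreducible_22_third[OF vs(2) _ vs(5), of p3] three[OF mem(2)] nzp[of p3] pairs[of p2 p3] ue by auto
    obtain t3 where t3: "{#t3#} \<subseteq># v3 - {#p3#}" "zero_sum [2, 2] d {#t3, p1#}"
      using irreducible_22_third[OF vs(3) _ vs(6), of p1] three[OF mem(3)] nzp[of p1] pairs[of p3 p1] ue by (auto simp: add_mset_commute)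
    have "?V = v1 + v2 + v3" using Qe xvs by simp
    moreover have "v1 = add_mset p1 (v1 - {#p1#})" "v2 = add_mset p2 (v2 - {#p2#})" "v3 = add_mset p3 (v3 - {#p3#})" using vs by auto
    ultimately have "?V = u + ((v1 - {#p1#}) + (v2 - {#p2#}) + (v3 - {#p3#}))" unfolding ue by (metis (no_types, lifting) add_mset_add_single union_assoc union_commute union_mset_add_mset_right)
    then have "?W = (v1 - {#p1#}) + (v2 - {#p2#}) + (v3 - {#p3#})" by simp
    moreover have "{#t1#} + {#t2#} + {#t3#} \<subseteq># (v1 - {#p1#}) + (v2 - {#p2#}) + (v3 - {#p3#})"
      by (intro subset_mset.add_mono t1 t2 t3)
    ultimately have T: "{#t1, t2, t3#} \<subseteq># ?W" by (simp add: add_mset_commute)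
    have "zero_sum [2, 2] d ({#t1, p2#} + ({#t2, p3#} + {#t3, p1#}))" using zero_sum_add t1(2) t2(2) t3(2) by blast
    then have "zero_sum [2, 2] d (u + {#t1, t2, t3#})" unfolding ue by (simp add: add_mset_commute)
    then have "zero_sum [2, 2] d {#t1, t2, t3#}" using zero_sum_add irreducible_blockD(2)[OF u] by blast
    then show ?thesis using T W6 by (intro exI[of _ "{#t1, t2, t3#}"]) auto
  qed
  then obtain T where T: "T \<subseteq># ?W" "zero_sum [2, 2] d T" "size T div 2 + (size ?W - size T) div 2 \<le> 2" by blast
  obtain y where "y \<in> decompositions ?B ?W" "size y \<le> size T div 2 + (size ?W - size T) div 2"
    using decomposition_split_size[OF WB nzW T(1,2)] by blast
  then show "size Q \<le> 3 \<and> (\<exists>y\<in>decompositions ?B ?W. Suc (size y) \<le> 3)"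
    using T(3) \<open>size Q \<le> 3\<close> by (intro conjI bexI[of _ y]) auto
qed

text \<open>
  The cross product \<open>l = a \<times> b\<close> over the field with two elements, as a linear functional: it vanishes on
  \<open>a\<close>, \<open>b\<close>, \<open>a + b\<close>, and takes the value \<open>1\<close> on all other nonzero vectors.
\<close>
lemma line_functional: fixes a1 a2 a3 b1 b2 b3 x1 x2 x3 :: bool
  defines "l1 \<equiv> (a2 \<and> b3) \<noteq> (a3 \<and> b2)" and "l2 \<equiv> (a3 \<and> b1) \<noteq> (a1 \<and> b3)" and "l3 \<equiv> (a1 \<and> b2) \<noteq> (a2 \<and> b1)"
  shows "\<not> (((l1 \<and> a1) \<noteq> (l2 \<and> a2)) \<noteq> (l3 \<and> a3))" "\<not> (((l1 \<and> b1) \<noteq> (l2 \<and> b2)) \<noteq> (l3 \<and> b3))"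
   "\<not> (((l1 \<and> (a1 \<noteq> b1)) \<noteq> (l2 \<and> (a2 \<noteq> b2))) \<noteq> (l3 \<and> (a3 \<noteq> b3)))"
   "a1 \<or> a2 \<or> a3 \<Longrightarrow> b1 \<or> b2 \<or> b3 \<Longrightarrow> a1 \<noteq> b1 \<or> a2 \<noteq> b2 \<or> a3 \<noteq> b3 \<Longrightarrow>
    x1 \<or> x2 \<or> x3 \<Longrightarrow> x1 \<noteq> a1 \<or> x2 \<noteq> a2 \<or> x3 \<noteq> a3 \<Longrightarrow> x1 \<noteq> b1 \<or> x2 \<noteq> b2 \<or> x3 \<noteq> b3 \<Longrightarrow>
    x1 \<noteq> (a1 \<noteq> b1) \<or> x2 \<noteq> (a2 \<noteq> b2) \<or> x3 \<noteq> (a3 \<noteq> b3) \<Longrightarrow> ((l1 \<and> x1) \<noteq> (l2 \<and> x2)) \<noteq> (l3 \<and> x3)"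
  unfolding assms(1-3) by argo+

text \<open>
  The cross product \<open>l = (a + b) \<times> (a + c)\<close>, as a linear functional: for independent \<open>a\<close>, \<open>b\<close>, \<open>c\<close> it
  takes the value \<open>1\<close> on \<open>a\<close>, \<open>b\<close>, \<open>c\<close>, \<open>a + b + c\<close>, and vanishes on all other vectors.
\<close>
lemma plane_functional: fixes a1 a2 a3 b1 b2 b3 c1 c2 c3 x1 x2 x3 :: bool
  defines "l1 \<equiv> ((a2 \<noteq> b2) \<and> (a3 \<noteq> c3)) \<noteq> ((a3 \<noteq> b3) \<and> (a2 \<noteq> c2))" 
   and "l2 \<equiv> ((a3 \<noteq> b3) \<and> (a1 \<noteq> c1)) \<noteq> ((a1 \<noteq> b1) \<and> (a3 \<noteq> c3))" 
   and "l3 \<equiv> ((a1 \<noteq> b1) \<and> (a2 \<noteq> c2)) \<noteq> ((a2 \<noteq> b2) \<and> (a1 \<noteq> c1))" 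
  assumes "a1 \<or> a2 \<or> a3" "b1 \<or> b2 \<or> b3" "c1 \<or> c2 \<or> c3" "a1 \<noteq> b1 \<or> a2 \<noteq> b2 \<or> a3 \<noteq> b3"
    "a1 \<noteq> c1 \<or> a2 \<noteq> c2 \<or> a3 \<noteq> c3" "b1 \<noteq> c1 \<or> b2 \<noteq> c2 \<or> b3 \<noteq> c3"
   "(a1 \<noteq> b1) \<noteq> c1 \<or> (a2 \<noteq> b2) \<noteq> c2 \<or> (a3 \<noteq> b3) \<noteq> c3"
  shows "((l1 \<and> a1) \<noteq> (l2 \<and> a2)) \<noteq> (l3 \<and> a3)" "((l1 \<and> b1) \<noteq> (l2 \<and> b2)) \<noteq> (l3 \<and> b3)" "((l1 \<and> c1) \<noteq> (l2 \<and> c2)) \<noteq> (l3 \<and> c3)"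
   "((l1 \<and> ((a1 \<noteq> b1) \<noteq> c1)) \<noteq> (l2 \<and> ((a2 \<noteq> b2) \<noteq> c2))) \<noteq> (l3 \<and> ((a3 \<noteq> b3) \<noteq> c3))"
   "x1 \<or> x2 \<or> x3 \<Longrightarrow> x1 \<noteq> a1 \<or> x2 \<noteq> a2 \<or> x3 \<noteq> a3 \<Longrightarrow> x1 \<noteq> b1 \<or> x2 \<noteq> b2 \<or> x3 \<noteq> b3 \<Longrightarrow> x1 \<noteq> c1 \<or> x2 \<noteq> c2 \<or> x3 \<noteq> c3 \<Longrightarrow>
    x1 \<noteq> ((a1 \<noteq> b1) \<noteq> c1) \<or> x2 \<noteq> ((a2 \<noteq> b2) \<noteq> c2) \<or> x3 \<noteq> ((a3 \<noteq> b3) \<noteq> c3) \<Longrightarrow> \<not> (((l1 \<and> x1) \<noteq> (l2 \<and> x2)) \<noteq> (l3 \<and> x3))"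
  using assms(4-) unfolding assms(1-3) by argo+

lemma zero_sum_222: "zero_sum [2, 2, 2] d S \<longleftrightarrow> even (\<Sum>p\<in>#S. d p 0) \<and> even (\<Sum>p\<in>#S. d p 1) \<and> even (\<Sum>p\<in>#S. d p 2)"
  by (auto simp: zero_sum_def less_Suc_eq numeral_2_eq_2)

text \<open>
  A linear functional sums to zero over a zero-sum multiset, so it takes the value \<open>1\<close> an even number of times.
\<close>
lemma even_functional:
  fixes d :: "'p \<Rightarrow> nat \<Rightarrow> int"
  assumes "zero_sum [2, 2, 2] d v"
  shows "even (size {#p \<in># v. ((l1 \<and> odd (d p 0)) \<noteq> (l2 \<and> odd (d p 1))) \<noteq> (l3 \<and> odd (d p 2))#})"
proof -
  have "odd (size {#p \<in># w. ((l1 \<and> odd (d p 0)) \<noteq> (l2 \<and> odd (d p 1))) \<noteq> (l3 \<and> odd (d p 2))#}) \<longleftrightarrow>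
    ((l1 \<and> odd (\<Sum>p\<in>#w. d p 0)) \<noteq> (l2 \<and> odd (\<Sum>p\<in>#w. d p 1))) \<noteq> (l3 \<and> odd (\<Sum>p\<in>#w. d p 2))" for w
    by (induction w) auto
  then show ?thesis using assms unfolding zero_sum_222 by blast
qed

text \<open>
  In this part, every class contains at most one prime.
\<close>
context
  fixes P :: "'p set" and d :: "'p \<Rightarrow> nat \<Rightarrow> int"
  assumes inj: "\<And>p q. p \<in> P \<Longrightarrow> q \<in> P \<Longrightarrow> zero_sum [2, 2, 2] d {#p, q#} \<Longrightarrow> p = q"
begin

abbreviation "B2 \<equiv> blocks [2, 2, 2] P d"

lemma irreducible_count_le_1:
  assumes v: "v \<in> irreducibles B2" "3 \<le> size v" shows "count v p \<le> 1"
proof (rule ccontr)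
  assume "\<not> count v p \<le> 1"
  then have "2 \<le> count v p" by simp
  then have "replicate_mset 2 p \<subseteq># v" by (simp add: count_le_replicate_mset_subset_eq)
  moreover have "replicate_mset 2 p = {#p, p#}" by (simp add: numeral_2_eq_2)
  then have "zero_sum [2, 2, 2] d (replicate_mset 2 p)" by (simp add: zero_sum_222)
  moreover have "replicate_mset 2 p \<noteq> {#}" by (simp add: numeral_2_eq_2)
  ultimately have "v = replicate_mset 2 p" using irreducible_blockD(4)[OF v(1)] by metis
  then show False using v(2) by simp
qed

lemma neq_bits:
  assumes "p \<in> P" "q \<in> P" "p \<noteq> q"
  shows "odd (d p 0) \<noteq> odd (d q 0) \<or> odd (d p 1) \<noteq> odd (d q 1) \<or> odd (d p 2) \<noteq> odd (d q 2)"
  using inj[OF assms(1,2)] assms(3) by (auto simp: zero_sum_222)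

lemma nonzero_bits: "\<not> zero_sum [2, 2, 2] d {#p#} \<Longrightarrow> odd (d p 0) \<or> odd (d p 1) \<or> odd (d p 2)"
  by (auto simp: zero_sum_222)

lemma even_off_line:
  assumes u: "u \<in> irreducibles B2" "size u = 3" and nzu: "\<And>p. p \<in># u \<Longrightarrow> \<not> zero_sum [2, 2, 2] d {#p#}"
    and v: "zero_sum [2, 2, 2] d v" "set_mset v \<subseteq> P" "\<And>p. p \<in># v \<Longrightarrow> \<not> zero_sum [2, 2, 2] d {#p#}"
  shows "even (size (filter_mset (\<lambda>p. p \<notin># u) v))"
proof -
  have "u \<noteq> {#}" using u(2) by auto
  then obtain a where "a \<in># u" by blast
  then obtain b c where abc: "u = {#a, b, c#}" using size_mset_3E[OF u(2)] by metis
  have "count u t \<le> 1" for t using irreducible_count_le_1 u by simp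
  from this[of a] have ab: "a \<noteq> b" using abc by auto
  have P: "a \<in> P" "b \<in> P" "c \<in> P" using irreducible_blockD(1)[OF u(1)] abc by auto
  have c: "odd (d c 0) = (odd (d a 0) \<noteq> odd (d b 0))" "odd (d c 1) = (odd (d a 1) \<noteq> odd (d b 1))" "odd (d c 2) = (odd (d a 2) \<noteq> odd (d b 2))"
    using irreducible_blockD(2)[OF u(1)] unfolding abc zero_sum_222 by auto
  let ?l1 = "(odd (d a 1) \<and> odd (d b 2)) \<noteq> (odd (d a 2) \<and> odd (d b 1))"
  let ?l2 = "(odd (d a 2) \<and> odd (d b 0)) \<noteq> (odd (d a 0) \<and> odd (d b 2))"
  let ?l3 = "(odd (d a 0) \<and> odd (d b 1)) \<noteq> (odd (d a 1) \<and> odd (d b 0))"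
  have "((?l1 \<and> odd (d p 0)) \<noteq> (?l2 \<and> odd (d p 1))) \<noteq> (?l3 \<and> odd (d p 2)) \<longleftrightarrow> p \<notin># u" if p: "p \<in># v" for p
  proof (cases "p \<in># u")
    case True
    then consider "p = a" | "p = b" | "p = c" using abc by auto
    then have "\<not> (((?l1 \<and> odd (d p 0)) \<noteq> (?l2 \<and> odd (d p 1))) \<noteq> (?l3 \<and> odd (d p 2)))"
    proof cases
      case 1 show ?thesis unfolding 1 by (rule line_functional(1))
    next
      case 2 show ?thesis unfolding 2 by (rule line_functional(2))
    next
      case 3 show ?thesis unfolding 3 c by (rule line_functional(3))
    qed
    then show ?thesis using True by simp
  next
    case False
    then have "p \<noteq> a" "p \<noteq> b" "p \<noteq> c" "p \<in> P" using abc p v(2) by auto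
    then have "((?l1 \<and> odd (d p 0)) \<noteq> (?l2 \<and> odd (d p 1))) \<noteq> (?l3 \<and> odd (d p 2))"
      using line_functional(4)[OF nonzero_bits nonzero_bits neq_bits[OF P(1,2) ab] nonzero_bits neq_bits neq_bits, of p] P p v(3) nzu abc
        neq_bits[of p c, unfolded c] by auto
    then show ?thesis using False by simp
  qed
  then have "filter_mset (\<lambda>p. p \<notin># u) v = {#p \<in># v. ((?l1 \<and> odd (d p 0)) \<noteq> (?l2 \<and> odd (d p 1))) \<noteq> (?l3 \<and> odd (d p 2))#}"
    by (intro filter_mset_cong) auto
  then show ?thesis using even_functional[OF v(1)] by (simp only:)
qed

lemma even_on_plane:
  assumes u: "u \<in> irreducibles B2" "size u = 4" and nzu: "\<And>p. p \<in># u \<Longrightarrow> \<not> zero_sum [2, 2, 2] d {#p#}"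
    and v: "zero_sum [2, 2, 2] d v" "set_mset v \<subseteq> P" "\<And>p. p \<in># v \<Longrightarrow> \<not> zero_sum [2, 2, 2] d {#p#}"
  shows "even (size (filter_mset (\<lambda>p. p \<in># u) v))"
proof -
  have "u \<noteq> {#}" using u(2) by auto
  then obtain a u1 where u1: "u = add_mset a u1" by (metis multiset_cases)
  then have "size u1 = 3" "u1 \<noteq> {#}" using u(2) by auto
  then obtain b c e where abc: "u = {#a, b, c, e#}" using size_mset_3E[of u1] u1 by (metis multiset_nonemptyE)
  have le1: "count u t \<le> 1" for t using irreducible_count_le_1 u by simp
  have ab: "a \<noteq> b" "a \<noteq> c" using le1[of a, unfolded abc] by (auto split: if_splits)
  have bc: "b \<noteq> c" using le1[of b, unfolded abc] by (auto split: if_splits)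
  have P: "a \<in> P" "b \<in> P" "c \<in> P" "e \<in> P" using irreducible_blockD(1)[OF u(1)] abc by auto
  have e: "odd (d e 0) = ((odd (d a 0) \<noteq> odd (d b 0)) \<noteq> odd (d c 0))" "odd (d e 1) = ((odd (d a 1) \<noteq> odd (d b 1)) \<noteq> odd (d c 1))"
      "odd (d e 2) = ((odd (d a 2) \<noteq> odd (d b 2)) \<noteq> odd (d c 2))"
    using irreducible_blockD(2)[OF u(1)] unfolding abc zero_sum_222 by auto
  have "\<not> zero_sum [2, 2, 2] d {#a, b, c#}"
  proof
    assume z: "zero_sum [2, 2, 2] d {#a, b, c#}"
    have "{#a, b, c#} \<subseteq># u" unfolding abc by (simp add: subseteq_mset_def)
    then have "u = {#a, b, c#}" using irreducible_blockD(4)[OF u(1) _ z] by auto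
    then show False using u(2) by simp
  qed
  then have abcn: "(odd (d a 0) \<noteq> odd (d b 0)) \<noteq> odd (d c 0) \<or> (odd (d a 1) \<noteq> odd (d b 1)) \<noteq> odd (d c 1) \<or> (odd (d a 2) \<noteq> odd (d b 2)) \<noteq> odd (d c 2)"
    unfolding zero_sum_222 by auto
  have nzabc: "odd (d a 0) \<or> odd (d a 1) \<or> odd (d a 2)" "odd (d b 0) \<or> odd (d b 1) \<or> odd (d b 2)" "odd (d c 0) \<or> odd (d c 1) \<or> odd (d c 2)"
    using nonzero_bits nzu abc by auto
  let ?l1 = "((odd (d a 1) \<noteq> odd (d b 1)) \<and> (odd (d a 2) \<noteq> odd (d c 2))) \<noteq> ((odd (d a 2) \<noteq> odd (d b 2)) \<and> (odd (d a 1) \<noteq> odd (d c 1)))"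
  let ?l2 = "((odd (d a 2) \<noteq> odd (d b 2)) \<and> (odd (d a 0) \<noteq> odd (d c 0))) \<noteq> ((odd (d a 0) \<noteq> odd (d b 0)) \<and> (odd (d a 2) \<noteq> odd (d c 2)))"
  let ?l3 = "((odd (d a 0) \<noteq> odd (d b 0)) \<and> (odd (d a 1) \<noteq> odd (d c 1))) \<noteq> ((odd (d a 1) \<noteq> odd (d b 1)) \<and> (odd (d a 0) \<noteq> odd (d c 0)))"
  note f = plane_functional[OF nzabc neq_bits[OF P(1,2) ab(1)] neq_bits[OF P(1,3) ab(2)] neq_bits[OF P(2,3) bc] abcn]
  have "((?l1 \<and> odd (d p 0)) \<noteq> (?l2 \<and> odd (d p 1))) \<noteq> (?l3 \<and> odd (d p 2)) \<longleftrightarrow> p \<in># u" if p: "p \<in># v" for p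
  proof (cases "p \<in># u")
    case True
    then consider "p = a" | "p = b" | "p = c" | "p = e" using abc by auto
    then have "((?l1 \<and> odd (d p 0)) \<noteq> (?l2 \<and> odd (d p 1))) \<noteq> (?l3 \<and> odd (d p 2))"
    proof cases
      case 1 show ?thesis unfolding 1 by (rule f(1))
    next
      case 2 show ?thesis unfolding 2 by (rule f(2))
    next
      case 3 show ?thesis unfolding 3 by (rule f(3))
    next
      case 4 show ?thesis unfolding 4 e by (rule f(4))
    qed
    then show ?thesis using True by simp
  next
    case False
    then have ne: "p \<noteq> a" "p \<noteq> b" "p \<noteq> c" "p \<noteq> e" "p \<in> P" using abc p v(2) by auto
    have "\<not> (((?l1 \<and> odd (d p 0)) \<noteq> (?l2 \<and> odd (d p 1))) \<noteq> (?l3 \<and> odd (d p 2)))"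
      by (rule f(5)[OF nonzero_bits[OF v(3)[OF p]] neq_bits[OF ne(5) P(1) ne(1)] neq_bits[OF ne(5) P(2) ne(2)] neq_bits[OF ne(5) P(3) ne(3)] neq_bits[OF ne(5) P(4) ne(4), unfolded e]])
    then show ?thesis using False by simp
  qed
  then have "filter_mset (\<lambda>p. p \<in># u) v = {#p \<in># v. ((?l1 \<and> odd (d p 0)) \<noteq> (?l2 \<and> odd (d p 1))) \<noteq> (?l3 \<and> odd (d p 2))#}"
    by (intro filter_mset_cong) auto
  then show ?thesis using even_functional[OF v(1)] by (simp only:)
qed

text \<open>
  If the cover has \<open>|u|\<close> members, each contributes a single prime. A member that contained a second prime \<open>q\<close> of \<open>u\<close>
  would make the member that contributes \<open>q\<close> superfluous.
\<close>
lemma minimal_cover_meets_once: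
  assumes u: "u \<in> irreducibles B2" "3 \<le> size u"
    and Q: "\<Sum>\<^sub># (image_mset fst Q) = u" "\<forall>(x, v) \<in># Q. x \<noteq> {#} \<and> x \<subseteq># v \<and> v \<in> irreducibles B2"
    and 2: "2 \<le> size Q" and min: "\<forall>Q'. u \<subseteq># \<Sum>\<^sub># (image_mset snd Q') \<longrightarrow> Q' \<subseteq># Q \<longrightarrow> Q' = Q"
    and eq: "size Q = size u" and xv: "(x, v) \<in># Q"
  shows "\<exists>p. p \<in># v \<and> p \<in># u \<and> (\<forall>q. q \<in># v \<longrightarrow> q \<in># u \<longrightarrow> q = p)"
proof -
  have one: "size x = 1" if "(x, v) \<in># Q" for x v
  proof -
    have "x \<noteq> {#}" using Q(2) that by auto
    then have "0 < size x" by (simp add: nonempty_has_size)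
    then show ?thesis using cover_no_zero_prime(4)[OF u(1) Q 2 that] eq by simp
  qed
  obtain p where p: "x = {#p#}" using one[OF xv] by (metis size_1_singleton_mset)
  have pv: "p \<in># v" using Q(2) xv p by fastforce
  have pu: "p \<in># u" using Q(1) xv p by force
  have "q = p" if q: "q \<in># v" "q \<in># u" for q
  proof (rule ccontr)
    assume "q \<noteq> p"
    obtain y w where yw: "(y, w) \<in># Q" "q \<in># y" using q(2) Q(1) by force
    then have yq: "y = {#q#}" using one[OF yw(1)] by (metis size_1_singleton_mset single_eq_single multi_member_last insert_noteq_member add_mset_eq_single in_multiset_in_set set_mset_single singletonD set_mset_add_mset_insert)
    define Q' where "Q' = Q - {#(y, w)#}"
    have QQ': "Q = add_mset (y, w) Q'" using yw(1) by (simp add: Q'_def)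
    have "t \<in># \<Sum>\<^sub># (image_mset snd Q')" if t: "t \<in># u" for t
    proof (cases "t = q")
      case True
      have "(x, v) \<in># Q'" using xv QQ' p yq \<open>q \<noteq> p\<close> by auto
      then show ?thesis using q(1) True by force
    next
      case False
      then obtain x' v' where x': "(x', v') \<in># Q'" "t \<in># x'" using t Q(1) QQ' yq by force
      then have "t \<in># v'" using Q(2) QQ' by (metis (no_types, lifting) case_prodD mset_subset_eqD union_iff add_mset_add_single)
      then show ?thesis using x'(1) by force
    qed
    moreover have "count u t \<le> 1" for t using irreducible_count_le_1 u by simp
    ultimately have "u \<subseteq># \<Sum>\<^sub># (image_mset snd Q')"
      by (intro mset_subset_eqI) (metis count_greater_eq_one_iff count_inI le_trans zero_le)
    then have "Q' = Q" using min QQ' by auto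
    then show False using QQ' by auto
  qed
  then show ?thesis using pv pu by blast
qed

text \<open>
  A factorization of \<open>W\<close> into \<open>|W| / 2\<close> atoms consists of atoms of length \<open>2\<close>, which are squares since
  no class contains two primes.
\<close>
lemma decomposition_of_squares:
  assumes y: "y \<in> decompositions B2 W" and nz: "\<And>p. p \<in># W \<Longrightarrow> \<not> zero_sum [2, 2, 2] d {#p#}"
    and len: "size W \<le> 2 * size y"
  shows "\<exists>S. y = image_mset (\<lambda>g. {#g, g#}) S \<and> W = S + S"
proof -
  have two: "2 \<le> size v" if "v \<in># y" for v
    using pieces_ge_2[of W "[2,2,2]" d v P] nz decompositionsD_part[OF y that] irreduciblesD[of v B2] by blast
  have eq: "(\<Sum>v\<in>#y. size v) = size W" 
  proof -
    have size_sum: "size (\<Sum>\<^sub># z) = (\<Sum>v\<in>#z. size v)" for z :: "'p multiset multiset" by (induction z) auto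
    have W: "W = \<Sum>\<^sub># y" using y by (simp add: decompositions_def)
    show ?thesis unfolding W by (rule size_sum[symmetric])
  qed
  have sz: "size v = 2" if v: "v \<in># y" for v
  proof -
    obtain y1 where y1: "y = add_mset v y1" using v by (rule mset_add)
    have "2 * size z \<le> (\<Sum>v\<in>#z. size v)" if "set_mset z \<subseteq> set_mset y" for z
      using that
    proof (induction z)
      case (add v z)
      then show ?case using two[of v] by simp
    qed simp
    from this[of y1] have "2 * size y1 \<le> (\<Sum>v\<in>#y1. size v)" using y1 by auto
    then have "size v \<le> 2" using eq len y1 by simp
    then show ?thesis using two[OF v] by simp
  qed
  have "\<exists>g. v = {#g, g#}" if v: "v \<in># y" for v
  proof -
    obtain a w where w: "v = add_mset a w" using sz[OF v] by (metis Suc_1 size_eq_Suc_imp_eq_union)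
    then obtain b where b: "v = {#a, b#}" using sz[OF v] by (metis Suc_1 Suc_inject size_1_singleton_mset One_nat_def size_add_mset)
    have irr: "v \<in> irreducibles B2" using decompositionsD_part[OF y v] by simp
    then have "a \<in> P" "b \<in> P" "zero_sum [2, 2, 2] d {#a, b#}" using irreducible_blockD(1,2)[OF irr] b by auto
    then show ?thesis using inj b by blast
  qed
  then have "\<exists>S. z = image_mset (\<lambda>g. {#g, g#}) S" if "set_mset z \<subseteq> set_mset y" for z
    using that
  proof (induction z)
    case (add v z)
    then obtain S where "z = image_mset (\<lambda>g. {#g, g#}) S" by auto
    moreover obtain g where "v = {#g, g#}" using \<open>\<And>v. v \<in># y \<Longrightarrow> \<exists>g. v = {#g, g#}\<close>[of v] add.prems by auto
    ultimately show ?case by (intro exI[of _ "add_mset g S"]) auto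
  qed auto
  then obtain S where S: "y = image_mset (\<lambda>g. {#g, g#}) S" by blast
  have "\<Sum>\<^sub># (image_mset (\<lambda>g. {#g, g#}) R) = R + R" for R :: "'p multiset" by (induction R) auto
  then show ?thesis using S y by (auto simp: decompositions_def)
qed

text \<open>
  Four vectors in a space of dimension three are dependent, so \<open>S\<close> contains an atom \<open>T\<close>, of length at least \<open>3\<close>. Then
  \<open>T\<close>, \<open>T\<close> and the rest, of length at most \<open>2\<close>, form a short factorization of \<open>S\<^sup>2\<close>.
\<close>
lemma short_decomposition_of_squares:
  assumes W: "S + S \<in> B2" and nz: "\<And>p. p \<in># S \<Longrightarrow> \<not> zero_sum [2, 2, 2] d {#p#}"
    and S: "size S = 4" "\<And>p. count S p \<le> 1"
  shows "\<exists>y\<in>decompositions B2 (S + S). size y \<le> 3"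
proof -
  have SP: "set_mset S \<subseteq> P" using W by (auto simp: blocks_def)
  have "\<not> (\<forall>T. T \<subseteq># S \<longrightarrow> zero_sum [2, 2, 2] d T \<longrightarrow> T = {#})"
    using zero_sum_free_size_le[of "[2, 2, 2]" S d] S(1) by fastforce
  then obtain T0 where T0: "T0 \<subseteq># S" "zero_sum [2, 2, 2] d T0" "T0 \<noteq> {#}" by blast
  have "T0 \<in> B2" using T0(2) set_mset_mono[OF T0(1)] SP by (auto simp: blocks_def)
  then obtain z where z: "z \<in> decompositions B2 T0" using decomposition_exists[OF saturated_blocks] by blast
  then have "z \<noteq> {#}" using T0(3) by (auto simp: decompositions_def)
  then obtain T where "T \<in># z" by blast
  then have T: "T \<in> irreducibles B2" "T \<subseteq># S" using decompositionsD_part[OF z] T0(1) by (auto intro: subset_mset.order_trans)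
  have "3 \<le> size T"
  proof (rule ccontr)
    assume "\<not> 3 \<le> size T"
    moreover have "2 \<le> size T" using pieces_ge_2[OF nz, of S T] T irreduciblesD[OF T(1)] by blast
    ultimately have "size T = 2" by simp
    then obtain a w where w: "T = add_mset a w" by (metis Suc_1 size_eq_Suc_imp_eq_union)
    then obtain b where b: "T = {#a, b#}" using \<open>size T = 2\<close> by (metis Suc_1 Suc_inject size_1_singleton_mset One_nat_def size_add_mset)
    then have "a = b" using inj[of a b] irreducible_blockD(1,2)[OF T(1)] by auto
    then have "2 \<le> count S a" using mset_subset_eq_count[OF T(2), of a] b by simp
    then show False using S(2)[of a] by simp
  qed
  have TT: "T + T \<subseteq># S + S" using T(2) by (intro subset_mset.add_mono)
  have TTB: "T + T \<in> B2" using T(1) saturated_blocks[of "[2,2,2]" P d] by (auto simp: irreducibles_def saturated_def)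
  then have "S + S - (T + T) \<in> B2" using saturated_diff[OF saturated_blocks TTB W TT] by blast
  then obtain y where y: "y \<in> decompositions B2 (S + S - (T + T))" using decomposition_exists[OF saturated_blocks] by blast
  have "2 * size y \<le> size (S + S - (T + T))" using half_size_decomposition[OF _ y] nz by (metis in_diffD union_iff)
  moreover have "size (S + S - (T + T)) = 8 - 2 * size T" using TT S(1) by (simp add: size_Diff_submset)
  ultimately have "size y \<le> 1" using \<open>3 \<le> size T\<close> by simp
  moreover have "{#T, T#} + y \<in> decompositions B2 (T + T + (S + S - (T + T)))"
    by (rule decompositions_add[OF _ y]) (use T(1) in \<open>auto simp: decompositions_def\<close>)
  then have "{#T, T#} + y \<in> decompositions B2 (S + S)" using TT by simp
  ultimately show ?thesis by (intro bexI[of _ "{#T, T#} + y"]) auto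
qed

text \<open>
  If the cover has \<open>|u|\<close> members, then each member meets \<open>u\<close> in a single prime, and the parities given by the two functionals
  bound its length by \<open>6 - |u|\<close>. Counting then leaves only the case of three members of length \<open>4\<close> and
  \<open>|u| = 4\<close>. The rest has length \<open>8\<close>; a factorization of length \<open>4\<close> would consist of squares and can be replaced by one of
  length at most \<open>3\<close>. This needs that no prime occurs more than three times, hence no square twice.
\<close>
lemma tame_bound_222_le: "tame_bound B2 4"
proof (rule tame_boundI[OF saturated_blocks])
  fix u Q
  assume u: "u \<in> irreducibles B2"
    and Q: "\<Sum>\<^sub># (image_mset fst Q) = u" "\<forall>(x, v) \<in># Q. x \<noteq> {#} \<and> x \<subseteq># v \<and> v \<in> irreducibles B2"
    and 2: "2 \<le> size Q" and min: "\<forall>Q'. u \<subseteq># \<Sum>\<^sub># (image_mset snd Q') \<longrightarrow> Q' \<subseteq># Q \<longrightarrow> Q' = Q"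
  note c = cover_no_zero_prime[OF u Q 2]
  let ?V = "\<Sum>\<^sub># (image_mset snd Q)"
  let ?W = "?V - u"
  have D: "size v \<le> 4" if "v \<in> irreducibles B2" for v using irreducible_2_size_le[OF _ that] by simp
  have WB: "?W \<in> B2" and WV: "size ?W + size u = size ?V" using block_cover_diff[OF u Q] by auto
  have nzW: "\<not> zero_sum [2, 2, 2] d {#p#}" if "p \<in># ?W" for p using c(1) that by (meson in_diffD)
  have V4: "size ?V \<le> 4 * size Q" using size_sum_snd_le[of Q 4] Q(2) D by auto
  have Q4: "size Q \<le> 4" using c(3) D[OF u] by simp
  obtain y where y: "y \<in> decompositions B2 ?W" using decomposition_exists[OF saturated_blocks WB] by blast
  have y2: "2 * size y \<le> size ?W" using half_size_decomposition[OF nzW y] .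
  \<comment> \<open>A longer member would meet \<open>u\<close>, or the complement of \<open>u\<close>, an odd number of times.\<close>
  have once: "size v \<le> 6 - size u" if eq: "size Q = size u" and u3: "3 \<le> size u" and xv: "(x, v) \<in># Q" for x v
  proof (rule ccontr)
    assume big: "\<not> size v \<le> 6 - size u"
    have v: "v \<in> irreducibles B2" using Q(2) xv by auto
    have u4: "size u = 3 \<or> size u = 4" using u3 D[OF u] by linarith
    then have v3: "3 \<le> size v" using big D[OF v] by linarith
    have nzv: "\<And>p. p \<in># v \<Longrightarrow> \<not> zero_sum [2, 2, 2] d {#p#}" using c(1) xv by force
    obtain p where p: "p \<in># v" "p \<in># u" "\<forall>q. q \<in># v \<longrightarrow> q \<in># u \<longrightarrow> q = p"
      using minimal_cover_meets_once[OF u u3 Q 2 min eq xv] by blast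
    have "count v p \<noteq> 0" using p(1) by (auto simp only: count_eq_zero_iff)
    then have "count v p = 1" using irreducible_count_le_1[OF v v3, of p] by linarith
    have "filter_mset (\<lambda>p. p \<in># u) v = filter_mset (\<lambda>q. q = p) v"
    proof (rule filter_mset_cong)
      fix q assume "q \<in># v"
      then show "(q \<in># u) = (q = p)" using p(2,3) by metis
    qed simp
    also have "\<dots> = {#p#}" using \<open>count v p = 1\<close> by (simp add: filter_eq_replicate_mset)
    finally have "filter_mset (\<lambda>p. p \<in># u) v = {#p#}" .
    then have on: "size (filter_mset (\<lambda>p. p \<in># u) v) = 1" by simp
    have "size (filter_mset (\<lambda>p. p \<in># u) v) + size (filter_mset (\<lambda>p. p \<notin># u) v) = size v"
      by (metis multiset_partition size_union)
    then have off: "size (filter_mset (\<lambda>p. p \<notin># u) v) = size v - 1" using on by simp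
    from u4 show False
    proof
      assume "size u = 3"
      then have "size v = 4" using big D[OF v] by linarith
      then show False using even_off_line[OF u \<open>size u = 3\<close> c(2) irreducible_blockD(2)[OF v] irreducible_blockD(1)[OF v] nzv] off by simp
    next
      assume "size u = 4"
      then show False using even_on_plane[OF u _ c(2) irreducible_blockD(2)[OF v] irreducible_blockD(1)[OF v] nzv] on by simp
    qed
  qed
  have "\<exists>y\<in>decompositions B2 ?W. size y \<le> 3"
  proof (cases "size ?W \<le> 7")
    case True
    then show ?thesis using y y2 by (intro bexI[of _ y]) auto
  next
    case False
    have u2: "2 \<le> size u" using c(3) 2 by simp
    have "size Q = 3 \<and> size u = 4"
    proof (cases "size Q = size u \<and> 3 \<le> size u")
      case True
      have "size ?V \<le> (6 - size u) * size Q" by (rule size_sum_snd_le) (use once True in auto)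
      moreover have "size u = 3 \<or> size u = 4" using True D[OF u] by linarith
      ultimately show ?thesis using False WV True by auto
    next
      case F: False
      have "8 + size u \<le> 4 * size Q" using False WV V4 by linarith
      then show ?thesis using F c(3) D[OF u] u2 by linarith
    qed
    then have Q3: "size Q = 3" and u4: "size u = 4" by auto
    then have W8: "size ?W = 8" "size ?V = 12" using False WV V4 by auto
    show ?thesis
    proof (cases "size y \<le> 3")
      case True then show ?thesis using y by blast
    next
      case False
      then have "size ?W \<le> 2 * size y" using W8 by simp
      from decomposition_of_squares[OF y nzW this] obtain S where S: "?W = S + S" by blast
      have four: "size v = 4" if xv: "(x, v) \<in># Q" for x v
      proof -
        obtain Q1 where Q1: "Q = add_mset (x, v) Q1" using xv by (metis mset_add)
        have "size (\<Sum>\<^sub># (image_mset snd Q1)) \<le> 4 * size Q1" by (rule size_sum_snd_le) (use Q(2) D Q1 in auto)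
        then have "4 \<le> size v" using W8(2) Q1 Q3 by simp
        moreover have "size v \<le> 4" using Q(2) xv D by auto
        ultimately show ?thesis by simp
      qed
      have "count (\<Sum>\<^sub># (image_mset snd R)) p \<le> size R" if "set_mset R \<subseteq> set_mset Q" for R p
        using that
      proof (induction R)
        case (add xv R)
        obtain x v where xv: "xv = (x, v)" by (cases xv)
        then have "(x, v) \<in># Q" using add.prems by auto
        moreover from this have "v \<in> irreducibles B2" using Q(2) by auto
        ultimately have "count v p \<le> 1" using irreducible_count_le_1 four by fastforce
        then show ?case using add xv by auto
      qed simp
      then have "count ?V p \<le> 3" for p using Q3 by (metis order_refl)
      then have "count ?W p \<le> 3" for p by (metis diff_subset_eq_self mset_subset_eq_count order_trans)
      then have S3: "count S p + count S p \<le> 3" for p unfolding S by simp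
      have "count S p \<le> 1" for p using S3[of p] by linarith
      moreover have "size S = 4" using S W8(1) by simp
      moreover have "\<not> zero_sum [2, 2, 2] d {#p#}" if "p \<in># S" for p using nzW S that by simp
      ultimately show ?thesis using short_decomposition_of_squares[of S] WB unfolding S by blast
    qed
  qed
  then show "size Q \<le> 4 \<and> (\<exists>y\<in>decompositions B2 ?W. Suc (size y) \<le> 4)" using Q4 by auto
qed

end

section \<open>Two primes in one class\<close>

context covered_blocks
begin

text \<open>
  Let \<open>g, h, k\<close> be a basis with two primes in \<open>g\<close>. The atom \<open>u\<close> has the classes \<open>g + h + k\<close>, \<open>g + h\<close>,
  \<open>g + k\<close>, \<open>g\<close>, and uses one prime of the class \<open>g\<close>; all \<open>S\<^sub>j\<close> use the other prime \<open>p'\<close>, so that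
  \<open>W = p'\<^sup>4 H\<^sup>2 K\<^sup>2\<close> with primes \<open>H\<close>, \<open>K\<close> of the classes \<open>h\<close>, \<open>k\<close>. With a single prime in \<open>g\<close>, the
  last \<open>p\<^sub>j S\<^sub>j\<close> would divide \<open>W\<close>.
\<close>
lemma tame_bound_222_two_primes_ge:
  assumes ns: "ns = [2, 2, 2]" and pq: "p \<in> P" "q \<in> P" "p \<noteq> q" and eq: "\<And>i. i < r \<Longrightarrow> [d p i = d q i] (mod int (ns ! i))"
    and nz: "\<not> zero_sum ns d {#p#}" and t: "tame_bound B M"
  shows "5 \<le> M"
proof -
  have r3: "r = 3" using ns by simp
  have n2: "ns ! i = 2" if "i < 3" for i using that ns by (auto simp: less_Suc_eq numeral_3_eq_3 numeral_2_eq_2)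
  have parity: "zero_sum ns d S \<longleftrightarrow> (\<forall>i<3. even (\<Sum>p\<in>#S. d p i))" for S
    unfolding zero_sum_def r3 using n2 by auto
  obtain i where i: "i < 3" "odd (d p i)" using nz by (auto simp: parity)
  obtain j l where jl: "{i, j, l} = {..<3}" "i \<noteq> j" "i \<noteq> l" "j \<noteq> l"
  proof -
    consider "i = 0" | "i = 1" | "i = 2" using i(1) by linarith
    then show thesis
    proof cases
      case 1 then show thesis using that[of 1 2] by (auto simp: eval_nat_numeral lessThan_Suc)
    next
      case 2 then show thesis using that[of 0 2] by (auto simp: eval_nat_numeral lessThan_Suc)
    next
      case 3 then show thesis using that[of 0 1] by (auto simp: eval_nat_numeral lessThan_Suc)
    qed
  qed
  have j3: "j < 3" "l < 3" using jl(1) by auto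
  have all3: "(\<forall>m<3. Q m) \<longleftrightarrow> Q i \<and> Q j \<and> Q l" for Q
  proof -
    have "(\<forall>m<3. Q m) \<longleftrightarrow> (\<forall>m\<in>{i, j, l}. Q m)" unfolding jl(1) by auto
    then show ?thesis by simp
  qed
  let ?g = "d p"
  let ?h = "\<lambda>m. if m = j then 1 else 0 :: int"
  let ?k = "\<lambda>m. if m = l then 1 else 0 :: int"
  \<comment> \<open>One of the two primes differs from the representative of the class that occurs in \<open>u\<close>.\<close>
  obtain p' where p': "p' \<in> P" "p' \<noteq> prime_at ?g" "\<And>m. m < 3 \<Longrightarrow> even (d p' m) = even (d p m)"
  proof (cases "p = prime_at ?g")
    case True
    have "even (d q m) = even (d p m)" if "m < 3" for m using eq[of m] n2[OF that] that r3 by (simp add: cong_iff_dvd_diff)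
    then show thesis using that[of q] pq True by auto
  next
    case False then show thesis using that[of p] pq by auto
  qed
  have even_pr: "even (d (prime_at x) m) = even (x m)" if "m < 3" for x m
    using prime_at(2)[of m x] n2[OF that] that r3 by (simp add: cong_iff_dvd_diff)
  \<comment> \<open>The coordinates of the four primes of \<open>u\<close>; the \<open>S\<^sub>j\<close> below have the same classes, which are their own negatives.\<close>
  define x :: "nat \<Rightarrow> nat \<Rightarrow> int" where
    "x s = (if s = 0 then (\<lambda>m. ?g m + ?h m + ?k m) else if s = 1 then (\<lambda>m. ?g m + ?h m) else if s = 2 then (\<lambda>m. ?g m + ?k m) else ?g)" for s
  define H where "H = prime_at ?h"
  define K where "K = prime_at ?k"
  define S :: "nat \<Rightarrow> 'p multiset" where
    "S s = (if s = 0 then {#p', H, K#} else if s = 1 then {#p', H#} else if s = 2 then {#p', K#} else {#p'#})" for s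
  have HK: "even (d H m) = (m \<noteq> j)" "even (d K m) = (m \<noteq> l)" if "m < 3" for m using even_pr[OF that] by (auto simp: H_def K_def)
  have bits: "odd (d p' i)" "even (d H i)" "odd (d H j)" "even (d H l)" "even (d K i)" "even (d K j)" "odd (d K l)"
    "even (d p' j) = even (d p j)" "even (d p' l) = even (d p l)"
    using i HK jl j3 p'(3) by auto
  have xbits: "odd (d (prime_at (x 0)) i)" "even (d (prime_at (x 0)) j) \<noteq> even (d p j)" "even (d (prime_at (x 0)) l) \<noteq> even (d p l)"
    "odd (d (prime_at (x 1)) i)" "even (d (prime_at (x 1)) j) \<noteq> even (d p j)" "even (d (prime_at (x 1)) l) = even (d p l)"
    "odd (d (prime_at (x 2)) i)" "even (d (prime_at (x 2)) j) = even (d p j)" "even (d (prime_at (x 2)) l) \<noteq> even (d p l)"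
    "odd (d (prime_at (x 3)) i)" "even (d (prime_at (x 3)) j) = even (d p j)" "even (d (prime_at (x 3)) l) = even (d p l)"
    using even_pr i j3 jl by (auto simp: x_def)
  have four: "s < 4 \<longleftrightarrow> s = 0 \<or> s = 1 \<or> s = 2 \<or> s = 3" for s :: nat by linarith
  have S_sub: "S s \<subseteq># {#p', H, K#}" for s by (auto simp: S_def subseteq_mset_def)
  have W: "(\<Sum>s<4. S s) = {#p', p', p', p'#} + {#H, H#} + {#K, K#}" by (simp add: S_def eval_nat_numeral)
  have dist: "p' \<noteq> H" "p' \<noteq> K" "H \<noteq> K" using bits by auto
  have counts: "even (count T p') \<and> even (count T H) \<and> even (count T K)"
    if "set_mset T \<subseteq> {p', H, K}" "zero_sum ns d T" for T
  proof -
    have "(\<Sum>p\<in>#T. d p m) = int (count T p') * d p' m + int (count T H) * d H m + int (count T K) * d K m" for m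
      using that(1)
    proof (induction T)
      case (add y T)
      then show ?case using dist by (auto simp: algebra_simps)
    qed simp
    then show ?thesis using that(2) bits unfolding parity all3 by auto
  qed
  have "real 4 \<le> real (size y)" if y: "y \<in> decompositions B (\<Sum>s<4. S s)" for y
  proof -
    have "(\<Sum>p\<in>#(\<Sum>s<4. S s). 1 / 2 :: real) \<le> size y"
    proof (rule size_decomposition_ge[OF y])
      fix v assume v: "v \<in> irreducibles B" "v \<subseteq># (\<Sum>s<4. S s)"
      have sub: "set_mset v \<subseteq> {p', H, K}" using set_mset_mono[OF v(2)] unfolding W by auto
      obtain z where z: "z \<in># v" using irreducible_blockD(3)[OF v(1)] by blast
      then have "z = p' \<or> z = H \<or> z = K" using sub by auto
      then have "even (count v z)" using counts[OF sub irreducible_blockD(2)[OF v(1)]] by auto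
      moreover have "count v z \<noteq> 0" using z by (auto simp only: count_eq_zero_iff)
      ultimately have "2 \<le> count v z" by presburger
      then have "replicate_mset 2 z \<subseteq># v" by (simp add: count_le_replicate_mset_subset_eq)
      moreover have "replicate_mset 2 z = {#z, z#}" by (simp add: numeral_2_eq_2)
      moreover have "zero_sum ns d {#z, z#}" by (simp add: parity)
      ultimately have "v = {#z, z#}" using irreducible_blockD(4)[OF v(1)] by (metis add_mset_not_empty)
      then show "(\<Sum>p\<in>#v. 1 / 2 :: real) \<le> 1" by simp
    qed
    then show ?thesis unfolding W by simp
  qed
  then have len: "4 \<le> size y" if "y \<in> decompositions B (\<Sum>s<4. S s)" for y using that of_nat_le_iff by blast
  have notW: "prime_at (x s) \<notin> {p', H, K}" if "s < 4" for s
    using that[unfolded four] xbits bits p'(2)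
    by (elim disjE) (auto simp: x_def)
  have setU: "set_mset (image_mset (\<lambda>s. prime_at (x s)) (mset_set {..<4})) = {prime_at (x 0), prime_at (x 1), prime_at (x 2), prime_at (x 3)}"
    by (auto simp: eval_nat_numeral lessThan_Suc)
  have p'U: "p' \<notin># image_mset (\<lambda>s. prime_at (x s)) (mset_set {..<4})" unfolding setU using notW[of 0] notW[of 1] notW[of 2] notW[of 3] by auto
  show "5 \<le> M"
  proof (rule tame_bound_exchange_ge[where p = "\<lambda>s. prime_at (x s)" and S = S and k = 4, OF _ _ _ _ _ _ t])
    fix s assume s: "s < (4::nat)"
    show "prime_at (x s) \<in> P \<and> set_mset (S s) \<subseteq> P" using p'(1) prime_at(1) by (auto simp: S_def H_def K_def)
    show "zero_sum ns d (add_mset (prime_at (x s)) (S s))"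
      using s[unfolded four] xbits bits unfolding parity all3 by (elim disjE) (auto simp: S_def)
    show "T = {#}" if T: "T \<subseteq># S s" "zero_sum ns d T" for T
    proof -
      have T3: "T \<subseteq># {#p', H, K#}" using T(1) S_sub by (rule subset_mset.order_trans)
      have sub: "set_mset T \<subseteq> {p', H, K}" using set_mset_mono[OF T3] by auto
      have "count T z \<le> 1" for z using mset_subset_eq_count[OF T3, of z] dist by (auto split: if_splits)
      then have "count T z = 0" if "even (count T z)" for z using that by (metis One_nat_def le_Suc_eq le_zero_eq odd_one)
      then have "count T p' = 0 \<and> count T H = 0 \<and> count T K = 0" using counts[OF sub T(2)] by blast
      then have "z \<notin># T" for z using sub by (auto simp only: count_eq_zero_iff)
      then show ?thesis by (metis multiset_nonemptyE)
    qed
    have "p' \<in># add_mset (prime_at (x s)) (S s)" by (auto simp: S_def)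
    then have "add_mset (prime_at (x s)) (S s) \<noteq> image_mset (\<lambda>s. prime_at (x s)) (mset_set {..<4})" using p'U by metis
    moreover have "\<not> add_mset (prime_at (x s)) (S s) \<subseteq># (\<Sum>s<4. S s)"
    proof
      assume "add_mset (prime_at (x s)) (S s) \<subseteq># (\<Sum>s<4. S s)"
      then have "prime_at (x s) \<in># (\<Sum>s<4. S s)" by (meson mset_subset_eq_insertD)
      then show False unfolding W using notW[OF s] by auto
    qed
    ultimately show "add_mset (prime_at (x s)) (S s) \<noteq> image_mset (\<lambda>s. prime_at (x s)) (mset_set {..<4}) \<and> \<not> add_mset (prime_at (x s)) (S s) \<subseteq># (\<Sum>s<4. S s)" by blast
  next
    show "image_mset (\<lambda>s. prime_at (x s)) (mset_set {..<4}) \<in> irreducibles B"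
    proof (rule irreducible_image_prime_at)
      fix m assume m: "m < r"
      then have "m < 3" using r3 by simp
      have "(\<Sum>s<4. x s m) = 2 * (2 * ?g m + ?h m + ?k m)" by (simp add: x_def eval_nat_numeral)
      then show "int (ns ! m) dvd (\<Sum>s<4. x s m)" using n2[OF \<open>m < 3\<close>] by simp
    next
      fix J assume J: "J \<subseteq> {..<4::nat}" "J \<noteq> {}" "J \<noteq> {..<4}"
      define c where "c s = (if s \<in> J then 1 else 0 :: int)" for s
      have sumJ: "(\<Sum>s\<in>J. x s m) = c 0 * x 0 m + c 1 * x 1 m + c 2 * x 2 m + c 3 * x 3 m" for m
      proof -
        have "(\<Sum>s\<in>J. x s m) = (\<Sum>s\<in>{..<4}. c s * x s m)"
          by (rule sum.mono_neutral_cong_left) (use J in \<open>auto simp: c_def\<close>)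
        then show ?thesis by (simp add: eval_nat_numeral)
      qed
      have "\<not> (0 \<in> J \<and> 1 \<in> J \<and> 2 \<in> J \<and> 3 \<in> J)"
      proof -
        obtain s where "s < 4" "s \<notin> J" using J(1,3) by (auto simp: subset_eq set_eq_iff)
        then show ?thesis using four[THEN iffD1, OF \<open>s < 4\<close>] by (elim disjE) simp_all
      qed
      moreover have "0 \<in> J \<or> 1 \<in> J \<or> 2 \<in> J \<or> 3 \<in> J"
      proof -
        obtain s where "s \<in> J" "s < 4" using J(1,2) by auto
        then show ?thesis using four[THEN iffD1, OF \<open>s < 4\<close>] by (elim disjE) simp_all
      qed
      ultimately have "\<not> (even (\<Sum>s\<in>J. x s i) \<and> even (\<Sum>s\<in>J. x s j) \<and> even (\<Sum>s\<in>J. x s l))"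
        unfolding sumJ using i(2) jl(2-4)
        by (cases "0 \<in> J"; cases "1 \<in> J"; cases "2 \<in> J"; cases "3 \<in> J") (auto simp: c_def x_def)
      then show "\<exists>m<r. \<not> int (ns ! m) dvd (\<Sum>s\<in>J. x s m)" using n2 r3 i(1) j3 by (metis of_nat_numeral)
    qed simp
  next
    fix y assume "y \<in> decompositions B (\<Sum>s<4. S s)"
    then show "5 \<le> max 4 (Suc (size y))" using len[of y] by simp
  qed
qed

end

section \<open>Characters and the Davenport constant\<close>

text \<open>
  The value of the character with index \<open>b\<close> at the class with coordinates \<open>x\<close>.
\<close>
definition char_val :: "nat list \<Rightarrow> (nat \<Rightarrow> nat) \<Rightarrow> (nat \<Rightarrow> int) \<Rightarrow> complex" where
  "char_val ns b x = (\<Prod>i<length ns. cis (2 * pi * (of_int (int (b i) * x i) / real (ns ! i))))"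

definition char_index :: "nat list \<Rightarrow> (nat \<Rightarrow> nat) set" where
  "char_index ns = (\<Pi>\<^sub>E i\<in>{..<length ns}. {..<ns ! i})"

lemma finite_char_index [simp]: "finite (char_index ns)"
  by (auto simp: char_index_def intro: finite_PiE)

lemma char_val_add: "char_val ns b (\<lambda>i. x i + y i) = char_val ns b x * char_val ns b y"
  unfolding char_val_def prod.distrib[symmetric]
  by (rule prod.cong) (simp_all add: cis_mult algebra_simps add_divide_distrib)

lemma char_val_zero [simp]: "char_val ns b (\<lambda>i. 0) = 1"
  by (simp add: char_val_def)

lemma char_val_power:
  assumes "\<And>i. i < length ns \<Longrightarrow> ns ! i dvd E \<and> 0 < ns ! i"
  shows "char_val ns b x ^ E = 1"
proof -
  have "cis (2 * pi * (of_int (int (b i) * x i) / real (ns ! i))) ^ E = 1" if i: "i < length ns" for i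
  proof -
    obtain m where m: "E = ns ! i * m" using assms[OF i] by auto
    have "cis (2 * pi * (of_int (int (b i) * x i) / real (ns ! i))) ^ E = cis (2 * pi * of_int (int (b i) * x i * int m))"
      using assms[OF i] by (simp add: DeMoivre m field_simps)
    then show ?thesis by simp
  qed
  then show ?thesis unfolding char_val_def prod_power_distrib by (simp add: prod.neutral)
qed

text \<open>
  Orthogonality: the sum factors over the coordinates, and the factor of a coordinate in which \<open>x\<close> does not
  vanish is a geometric sum over all powers of a root of unity other than \<open>1\<close>.
\<close>
lemma sum_char_val_eq_0:
  assumes i: "i < length ns" "\<not> int (ns ! i) dvd x i" and n: "0 < ns ! i"
  shows "(\<Sum>b\<in>char_index ns. char_val ns b x) = 0"
proof -
  let ?c = "\<lambda>i k. cis (2 * pi * (of_int (int k * x i) / real (ns ! i)))"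
  have "(\<Sum>b\<in>char_index ns. char_val ns b x) = (\<Prod>i<length ns. \<Sum>k<ns ! i. ?c i k)"
    unfolding char_val_def char_index_def by (rule prod_sum_PiE[symmetric]) auto
  also have "(\<Sum>k<ns ! i. ?c i k) = 0"
  proof -
    let ?z = "?c i 1"
    have pow: "?c i k = ?z ^ k" for k by (simp add: DeMoivre algebra_simps)
    have "?z ^ (ns ! i) = cis (2 * pi * of_int (x i))" using n by (simp add: DeMoivre field_simps)
    then have one: "?z ^ (ns ! i) = 1" by simp
    have "?z \<noteq> 1"
    proof
      assume "?z = 1"
      then have "cos (2 * pi * (of_int (x i) / real (ns ! i))) = 1" by (simp add: complex_eq_iff)
      then obtain m :: int where "2 * pi * (of_int (x i) / real (ns ! i)) = of_int m * 2 * pi" by (auto simp: cos_one_2pi_int)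
      then have "of_int (x i) = real_of_int (m * int (ns ! i))" using n by (simp add: field_simps)
      then have "x i = m * int (ns ! i)" by (simp only: of_int_eq_iff)
      then show False using i(2) by simp
    qed
    then have "(\<Sum>k<ns ! i. ?z ^ k) = (?z ^ (ns ! i) - 1) / (?z - 1)" by (rule geometric_sum)
    then show ?thesis using one pow by simp
  qed
  then have "(\<Prod>i<length ns. \<Sum>k<ns ! i. ?c i k) = 0" using i(1) by (intro prod_zero) auto
  finally show ?thesis .
qed

text \<open>
  Expanding the product gives sums of characters at \<open>x\<close> plus the sums of the parts of \<open>ps\<close>; by orthogonality all of
  them vanish except the one for the empty part.
\<close>
lemma sum_char_val_prod:
  assumes n: "\<And>i. i < length ns \<Longrightarrow> 0 < ns ! i"
    and free: "\<And>T. T \<subseteq># mset (map fst ps) \<Longrightarrow> T \<noteq> {#} \<Longrightarrow> \<exists>i<length ns. \<not> int (ns ! i) dvd x i + (\<Sum>p\<in>#T. d p i)"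
  shows "(\<Sum>b\<in>char_index ns. char_val ns b x * (\<Prod>(p, a)\<leftarrow>ps. a - char_val ns b (d p)))
    = prod_list (map snd ps) * (\<Sum>b\<in>char_index ns. char_val ns b x)"
  using free
proof (induction ps arbitrary: x)
  case (Cons pa ps)
  obtain p a where pa: "pa = (p, a)" by (cases pa)
  let ?F = "\<lambda>b. \<Prod>(p, a)\<leftarrow>ps. a - char_val ns b (d p)"
  let ?y = "\<lambda>i. x i + d p i"
  have sub: "T \<subseteq># mset (map fst (pa # ps))" "add_mset p T \<subseteq># mset (map fst (pa # ps))" if "T \<subseteq># mset (map fst ps)" for T
    using that by (auto simp: pa subseteq_mset_def le_SucI)
  have 1: "(\<Sum>b\<in>char_index ns. char_val ns b x * ?F b) = prod_list (map snd ps) * (\<Sum>b\<in>char_index ns. char_val ns b x)"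
    by (rule Cons.IH) (use Cons.prems sub(1) in blast)
  have 2: "(\<Sum>b\<in>char_index ns. char_val ns b ?y * ?F b) = prod_list (map snd ps) * (\<Sum>b\<in>char_index ns. char_val ns b ?y)"
  proof (rule Cons.IH)
    fix T assume T: "T \<subseteq># mset (map fst ps)" "T \<noteq> {#}"
    have "\<exists>i<length ns. \<not> int (ns ! i) dvd x i + (\<Sum>p\<in>#add_mset p T. d p i)" by (rule Cons.prems[OF sub(2)[OF T(1)]]) simp
    then show "\<exists>i<length ns. \<not> int (ns ! i) dvd ?y i + (\<Sum>p\<in>#T. d p i)" by (simp add: add.assoc)
  qed
  have "\<exists>i<length ns. \<not> int (ns ! i) dvd x i + (\<Sum>p\<in>#{#p#}. d p i)" by (rule Cons.prems[OF sub(2)[of "{#}"]]) auto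
  then obtain i where "i < length ns" "\<not> int (ns ! i) dvd ?y i" by auto
  then have 3: "(\<Sum>b\<in>char_index ns. char_val ns b ?y) = 0" using n by (intro sum_char_val_eq_0[of i])
  have "(\<Sum>b\<in>char_index ns. char_val ns b x * (\<Prod>(p, a)\<leftarrow>pa # ps. a - char_val ns b (d p)))
    = a * (\<Sum>b\<in>char_index ns. char_val ns b x * ?F b) - (\<Sum>b\<in>char_index ns. char_val ns b ?y * ?F b)"
  proof -
    have "char_val ns b x * (\<Prod>(p, a)\<leftarrow>pa # ps. a - char_val ns b (d p)) = a * (char_val ns b x * ?F b) - char_val ns b ?y * ?F b" for b
      by (simp add: pa char_val_add algebra_simps)
    then show ?thesis by (simp add: sum_subtractf sum_distrib_left)
  qed
  then show ?case using 1 2 3 by (simp add: pa)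
qed simp

lemma pigeonhole_roots:
  assumes E: "0 < E" and Y: "finite Y" "\<And>b. b \<in> Y \<Longrightarrow> f b ^ E = (1 :: complex)"
  shows "\<exists>a. a \<noteq> 0 \<and> E * card {b \<in> Y. f b \<noteq> a} \<le> (E - 1) * card Y"
proof (rule ccontr)
  assume neg: "\<not> ?thesis"
  let ?R = "{z :: complex. z ^ E = 1}"
  have R: "finite ?R" "card ?R = E" using finite_roots_unity[of E] card_roots_unity_eq[OF E] E by auto
  have lt: "E * card {b \<in> Y. f b = a} < card Y" if a: "a \<in> ?R" for a
  proof -
    have "a \<noteq> 0" using a E by (auto simp: power_0_left)
    then have "(E - 1) * card Y < E * card {b \<in> Y. f b \<noteq> a}" using neg by (meson not_le)
    moreover have "card Y = card {b \<in> Y. f b = a} + card {b \<in> Y. f b \<noteq> a}"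
      using Y(1) by (subst card_Un_disjoint[symmetric]) (auto intro: arg_cong[where f = card])
    ultimately show ?thesis using E by (simp add: algebra_simps diff_mult_distrib)
  qed
  have "card Y = (\<Sum>a\<in>?R. card {b \<in> Y. f b = a})"
  proof -
    have "card Y = card (\<Union>a\<in>?R. {b \<in> Y. f b = a})" using Y(2) by (intro arg_cong[where f = card]) auto
    also have "\<dots> = (\<Sum>a\<in>?R. card {b \<in> Y. f b = a})" by (rule card_UN_disjoint) (use R Y in auto)
    finally show ?thesis .
  qed
  then have "E * card Y = (\<Sum>a\<in>?R. E * card {b \<in> Y. f b = a})" by (simp add: sum_distrib_left)
  also have "\<dots> < (\<Sum>a\<in>?R. card Y)" by (rule sum_strict_mono) (use R lt E in \<open>auto intro: exI[of _ 1]\<close>)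
  finally show False using R by simp
qed

text \<open>
  Each entry of \<open>l\<close> takes at most \<open>E\<close> values on the characters left over, so some constant \<open>a\<close> equals the
  value for at least the fraction \<open>1/E\<close> of them.
\<close>
lemma ex_killing_roots:
  assumes E: "0 < E" and X: "finite X" "\<And>b p. b \<in> X \<Longrightarrow> f b p ^ E = (1 :: complex)"
  shows "\<exists>ps. map fst ps = l \<and> (\<forall>(p, a)\<in>set ps. a \<noteq> 0) \<and>
     E ^ length l * card {b \<in> X. \<forall>(p, a)\<in>set ps. f b p \<noteq> a} \<le> (E - 1) ^ length l * card X"
proof (induction l)
  case (Cons p l)
  then obtain ps where ps: "map fst ps = l" "\<forall>(p, a)\<in>set ps. a \<noteq> 0"
     "E ^ length l * card {b \<in> X. \<forall>(p, a)\<in>set ps. f b p \<noteq> a} \<le> (E - 1) ^ length l * card X" by blast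
  let ?Y = "{b \<in> X. \<forall>(p, a)\<in>set ps. f b p \<noteq> a}"
  obtain a where a: "a \<noteq> 0" "E * card {b \<in> ?Y. f b p \<noteq> a} \<le> (E - 1) * card ?Y"
    using pigeonhole_roots[OF E, of ?Y "\<lambda>b. f b p"] X by auto
  have eq: "{b \<in> X. \<forall>(p, a)\<in>set ((p, a) # ps). f b p \<noteq> a} = {b \<in> ?Y. f b p \<noteq> a}" by auto
  have "E ^ length (p # l) * card {b \<in> ?Y. f b p \<noteq> a} = E ^ length l * (E * card {b \<in> ?Y. f b p \<noteq> a})" by simp
  also have "\<dots> \<le> E ^ length l * ((E - 1) * card ?Y)" by (rule mult_le_mono2) (rule a(2))
  also have "\<dots> = (E - 1) * (E ^ length l * card ?Y)" by (simp add: ac_simps)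
  also have "\<dots> \<le> (E - 1) * ((E - 1) ^ length l * card X)" by (rule mult_le_mono2) (rule ps(3))
  finally have "E ^ length (p # l) * card {b \<in> ?Y. f b p \<noteq> a} \<le> (E - 1) ^ length (p # l) * card X" by simp
  then show ?case using ps a(1) eq by (intro exI[of _ "(p, a) # ps"]) auto
qed (auto intro!: exI[of _ "[]"])

lemma exponent_power_estimate:
  assumes "2 \<le> (E :: nat)" shows "E * (E - 1) ^ (E * E) < E ^ (E * E)"
proof -
  define x :: real where "x = 1 / (real E - 1)"
  have E: "1 < real E" using assms by simp
  then have x: "0 < x" "(real E - 1) * (1 + x) = real E" by (simp_all add: x_def field_simps)
  \<comment> \<open>Bernoulli: \<open>(1 + x)\<^bsup>E\<^sup>2\<^esup> \<ge> 1 + E\<^sup>2 / (E - 1) > E\<close>.\<close>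
  have "real E < 1 + real (E * E) * x"
    using E by (simp add: x_def field_simps)
  also have "\<dots> \<le> (1 + x) ^ (E * E)" using Bernoulli_inequality[of x "E * E"] x by simp
  finally have "real E * (real E - 1) ^ (E * E) < (1 + x) ^ (E * E) * (real E - 1) ^ (E * E)"
    using E by (intro mult_strict_right_mono) auto
  also have "\<dots> = real E ^ (E * E)" using x(2) by (simp add: power_mult_distrib[symmetric] mult.commute)
  finally have "real (E * (E - 1) ^ (E * E)) < real (E ^ (E * E))" using assms by (simp add: of_nat_diff)
  then show ?thesis by (simp only: of_nat_less_iff)
qed

text \<open>
  Suppose that \<open>S\<close> has \<open>E\<^sup>2 r\<close> elements. There are at most \<open>E\<^sup>r\<close> characters, and since
  \<open>E (1 - 1/E)\<^bsup>E\<^sup>2\<^esup> < 1\<close>, constants \<open>a\<^sub>p\<close> can be chosen such that every character \<open>\<chi>\<close> has \<open>\<chi> p = a\<^sub>p\<close> for some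
  \<open>p\<close>. So the product of the \<open>a\<^sub>p - \<chi> p\<close> is zero for every \<open>\<chi>\<close>, whereas its average over all
  \<open>\<chi>\<close> is the product of the \<open>a\<^sub>p\<close>, as \<open>S\<close> is zero-sum free.
\<close>
lemma zero_sum_free_size_less:
  assumes ns: "\<And>i. i < length ns \<Longrightarrow> 0 < ns ! i \<and> ns ! i dvd E" and E: "2 \<le> E" and r: "0 < length ns"
    and free: "\<And>T. T \<subseteq># S \<Longrightarrow> zero_sum ns d T \<Longrightarrow> T = {#}"
  shows "size S < E * E * length ns"
proof (rule ccontr)
  let ?r = "length ns" and ?X = "char_index ns"
  assume "\<not> ?thesis"
  then have big: "E * E * ?r \<le> size S" by simp
  obtain l0 where l0: "mset l0 = S" using ex_mset by blast
  define l where "l = take (E * E * ?r) l0"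
  have l: "length l = E * E * ?r" using big l0 by (auto simp: l_def min_def)
  have lS: "mset l \<subseteq># S" using l0 unfolding l_def by (metis append_take_drop_id mset_append mset_subset_eq_add_left)
  have pw: "char_val ns b (d p) ^ E = 1" for b p by (rule char_val_power) (use ns in auto)
  obtain ps where ps: "map fst ps = l" "\<forall>(p, a)\<in>set ps. a \<noteq> 0"
     "E ^ length l * card {b \<in> ?X. \<forall>(p, a)\<in>set ps. char_val ns b (d p) \<noteq> a} \<le> (E - 1) ^ length l * card ?X"
    using ex_killing_roots[of E ?X "\<lambda>b p. char_val ns b (d p)" l] pw E by auto
  have "card ?X \<le> E ^ ?r"
  proof -
    have "card ?X = (\<Prod>i<?r. ns ! i)" by (simp add: char_index_def card_PiE)
    also have "\<dots> \<le> (\<Prod>i<?r. E)" by (rule prod_mono) (use ns E in \<open>auto intro: dvd_imp_le\<close>)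
    finally show ?thesis by simp
  qed
  have "(E - 1) ^ length l * card ?X \<le> (E - 1) ^ (E * E * ?r) * E ^ ?r" using \<open>card ?X \<le> E ^ ?r\<close> l by simp
  also have "\<dots> = (E * (E - 1) ^ (E * E)) ^ ?r" by (simp add: power_mult power_mult_distrib)
  also have "\<dots> < (E ^ (E * E)) ^ ?r" using exponent_power_estimate[OF E] r by (intro power_strict_mono) auto
  also have "\<dots> = E ^ length l" by (simp add: l power_mult)
  finally have "card {b \<in> ?X. \<forall>(p, a)\<in>set ps. char_val ns b (d p) \<noteq> a} = 0"
    using ps(3) by (metis (no_types, lifting) leD le_trans mult.right_neutral mult_le_mono2 less_one not_less)
  then have killed: "\<exists>(p, a)\<in>set ps. char_val ns b (d p) = a" if "b \<in> ?X" for b using that by auto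
  have "(\<Sum>b\<in>?X. char_val ns b (\<lambda>i. 0) * (\<Prod>(p, a)\<leftarrow>ps. a - char_val ns b (d p)))
    = prod_list (map snd ps) * (\<Sum>b\<in>?X. char_val ns b (\<lambda>i. 0))"
  proof (rule sum_char_val_prod)
    fix T assume T: "T \<subseteq># mset (map fst ps)" "T \<noteq> {#}"
    then have "\<not> zero_sum ns d T" using free lS ps(1) by (metis subset_mset.order_trans)
    then show "\<exists>i<?r. \<not> int (ns ! i) dvd 0 + (\<Sum>p\<in>#T. d p i)" by (simp add: zero_sum_def)
  qed (use ns in auto)
  moreover have "(\<Prod>(p, a)\<leftarrow>ps. a - char_val ns b (d p)) = 0" if "b \<in> ?X" for b
    using killed[OF that] by (force simp: prod_list_zero_iff)
  ultimately have "prod_list (map snd ps) * of_nat (card ?X) = (0 :: complex)" by simp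
  moreover have "prod_list (map snd ps) \<noteq> 0" using ps(2) by (force simp: prod_list_zero_iff)
  moreover have "card ?X \<noteq> 0" using ns by (auto simp: char_index_def card_PiE)
  ultimately show False by simp
qed

lemma irreducible_size_le:
  assumes ns: "\<And>i. i < length ns \<Longrightarrow> 0 < ns ! i \<and> ns ! i dvd E" and E: "2 \<le> E" and r: "0 < length ns"
    and u: "u \<in> irreducibles (blocks ns P d)"
  shows "size u \<le> E * E * length ns"
proof -
  obtain p S where S: "u = add_mset p S" using irreducible_blockD(3)[OF u] by (metis multiset_cases)
  have free: "T = {#}" if "T \<subseteq># S" "zero_sum ns d T" for T
    by (rule irreducible_remove_zero_sum_free[OF _ that]) (use u S in simp)
  have "size S < E * E * length ns" by (rule zero_sum_free_size_less[OF ns E r free])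
  then show ?thesis using S by simp
qed

section \<open>Invariant factors of finite abelian groups\<close>

lemma (in comm_group) ord_mult_coprime_ge:
  assumes x: "x \<in> carrier G" and y: "y \<in> carrier G" and c: "coprime (ord x) (ord y)"
  shows "ord x * ord y dvd ord (x \<otimes> y)"
proof -
  let ?N = "ord (x \<otimes> y)"
  have one: "x [^] (?N * k) \<otimes> y [^] (?N * k) = \<one>" for k
  proof -
    have "(x \<otimes> y) [^] (?N * k) = \<one>" using x y by (simp add: pow_eq_id)
    then show ?thesis using x y by (simp add: nat_pow_distrib)
  qed
  have "ord x dvd ?N * ord y"
  proof -
    have "y [^] (?N * ord y) = \<one>" using y by (simp add: pow_eq_id)
    then have "x [^] (?N * ord y) = \<one>" using one[of "ord y"] x by simp
    then show ?thesis using x by (simp add: pow_eq_id)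
  qed
  moreover have "ord y dvd ?N * ord x"
  proof -
    have "x [^] (?N * ord x) = \<one>" using x by (simp add: pow_eq_id)
    then have "y [^] (?N * ord x) = \<one>" using one[of "ord x"] y by simp
    then show ?thesis using y by (simp add: pow_eq_id)
  qed
  ultimately show ?thesis using c
    by (metis coprime_commute coprime_dvd_mult_left_iff divides_mult)
qed

text \<open>
  An element of maximal order works: if a prime \<open>p\<close> had a higher power in \<open>ord x\<close> than in \<open>ord g\<close>, then the part of \<open>g\<close> prime to
  \<open>p\<close>, multiplied by the \<open>p\<close>-part of \<open>x\<close>, would have larger order.
\<close>
lemma (in comm_group) ex_exponent_element:
  assumes fin: "finite (carrier G)"
  shows "\<exists>g\<in>carrier G. \<forall>x\<in>carrier G. ord x dvd ord g"
proof -
  have ord_pos: "0 < ord x" if "x \<in> carrier G" for x using ord_ge_1[OF fin that] by simp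
  have "finite (ord ` carrier G)" "ord ` carrier G \<noteq> {}" using fin by auto
  then obtain g where g: "g \<in> carrier G" "\<And>x. x \<in> carrier G \<Longrightarrow> ord x \<le> ord g"
    by (metis (no_types, lifting) Max_ge Max_in imageE image_eqI)
  have "ord x dvd ord g" if x: "x \<in> carrier G" for x
  proof (rule ccontr)
    assume n: "\<not> ord x dvd ord g"
    obtain p where p: "normalization_semidom_class.prime p" "multiplicity p (ord g) < multiplicity p (ord x)"
      using n multiplicity_le_imp_dvd[of "ord x" "ord g"] ord_pos[OF x] by (metis not_gr_zero not_le)
    let ?k = "multiplicity p (ord g)"
    have pk: "p ^ ?k dvd ord g" by (rule multiplicity_dvd)
    have pk1: "p ^ Suc ?k dvd ord x" using p(2) by (meson Suc_leI multiplicity_dvd')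
    have p0: "p ^ n \<noteq> 0" for n using p(1) by (simp add: prime_gt_0_nat)
    \<comment> \<open>The orders of these two elements are the part of \<open>ord g\<close> prime to \<open>p\<close> and \<open>p\<^bsup>k + 1\<^esup>\<close>.\<close>
    let ?g = "g [^] (p ^ ?k)" and ?x = "x [^] (ord x div p ^ Suc ?k)"
    have og: "ord ?g = ord g div p ^ ?k" by (rule ord_pow[OF g(1) pk p0])
    have "ord x div p ^ Suc ?k dvd ord x" using pk1 by (metis dvd_div_mult_self dvd_triv_left)
    moreover have "ord x div p ^ Suc ?k \<noteq> 0" using pk1 ord_pos[OF x] p0 by (metis dvd_div_eq_0_iff less_not_refl)
    ultimately have "ord ?x = ord x div (ord x div p ^ Suc ?k)" using ord_pow[OF x] by blast
    then have ox: "ord ?x = p ^ Suc ?k" using pk1 ord_pos[OF x] by (metis div_div_eq_right div_self dvd_refl less_not_refl nat_mult_1)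
    have "ord g \<noteq> 0" "\<not> is_unit p" using ord_pos[OF g(1)] prime_gt_1_nat[OF p(1)] by auto
    then have "\<not> p dvd ord g div p ^ ?k" by (rule multiplicity_decompose)
    then have "coprime (ord ?g) (ord ?x)" unfolding og ox
      using p(1) by (metis coprime_commute coprime_power_left_iff prime_imp_coprime)
    then have "ord ?g * ord ?x dvd ord (?g \<otimes> ?x)" using ord_mult_coprime_ge g(1) x by simp
    then have "ord ?g * ord ?x \<le> ord (?g \<otimes> ?x)" using ord_pos g(1) x by (simp add: dvd_imp_le)
    also have "\<dots> \<le> ord g" using g x by simp
    finally have "ord g * p \<le> ord g" unfolding og ox using pk by (simp add: algebra_simps)
    then show False using ord_pos[OF g(1)] prime_gt_1_nat[OF p(1)] by simp
  qed
  then show ?thesis using g(1) by blast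
qed

text \<open>
  A homomorphism from the subgroup \<open>A\<close> to the integers modulo \<open>e\<close>, represented by integers.
\<close>
definition char_on :: "('a, 'm) monoid_scheme \<Rightarrow> int \<Rightarrow> 'a set \<Rightarrow> ('a \<Rightarrow> int) \<Rightarrow> bool" where
  "char_on G e A \<chi> \<longleftrightarrow> (\<forall>a\<in>A. \<forall>b\<in>A. [\<chi> (a \<otimes>\<^bsub>G\<^esub> b) = \<chi> a + \<chi> b] (mod e))"

lemma (in group) char_on_one: 
  assumes "subgroup A G" "char_on G e A \<chi>" shows "[\<chi> \<one> = 0] (mod e)"
proof -
  have "[\<chi> \<one> = \<chi> \<one> + \<chi> \<one>] (mod e)" using assms subgroup.one_closed[OF assms(1)] unfolding char_on_def by force
  then show ?thesis by (simp add: cong_iff_dvd_diff)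
qed

lemma (in group) char_on_nat_pow:
  assumes "subgroup A G" "char_on G e A \<chi>" "a \<in> A" shows "[\<chi> (a [^] (k::nat)) = int k * \<chi> a] (mod e)"
proof (induction k)
  case 0 then show ?case using char_on_one[OF assms(1,2)] by simp
next
  case (Suc k)
  have "a [^] k \<in> A" using subgroup_int_pow_closed[OF assms(1,3), of "int k"] by (simp add: int_pow_int)
  then have "[\<chi> (a [^] k \<otimes> a) = \<chi> (a [^] k) + \<chi> a] (mod e)" using assms by (simp add: char_on_def)
  also have "[\<chi> (a [^] k) + \<chi> a = int k * \<chi> a + \<chi> a] (mod e)" using Suc by (intro cong_add) auto
  finally show ?case by (simp add: algebra_simps)
qed

lemma (in group) char_on_int_pow:
  assumes A: "subgroup A G" "char_on G e A \<chi>" "a \<in> A" shows "[\<chi> (a [^] (k::int)) = k * \<chi> a] (mod e)"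
proof (cases "0 \<le> k")
  case True
  then obtain n where "k = int n" using nonneg_int_cases by blast
  then show ?thesis using char_on_nat_pow[OF assms] by (simp add: int_pow_int)
next
  case False
  then obtain n where n: "k = - int n" by (metis linear neg_equal_iff_equal nonneg_int_cases neg_0_le_iff_le add.inverse_inverse)
  have aG: "a \<in> carrier G" using A by (meson subgroup.mem_carrier)
  have mem: "a [^] n \<in> A" "a [^] k \<in> A"
    using subgroup_int_pow_closed[OF A(1,3), of "int n"] subgroup_int_pow_closed[OF A(1,3), of k] by (simp_all add: int_pow_int)
  have "a [^] k \<otimes> a [^] n = \<one>" using aG by (simp add: n int_pow_neg_int)
  then have "[\<chi> \<one> = \<chi> (a [^] k) + \<chi> (a [^] n)] (mod e)" using A mem unfolding char_on_def by metis
  moreover have "[\<chi> \<one> = 0] (mod e)" by (rule char_on_one[OF A(1,2)])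
  moreover have "[\<chi> (a [^] n) = int n * \<chi> a] (mod e)" by (rule char_on_nat_pow[OF A])
  ultimately have "e dvd \<chi> \<one> - (\<chi> (a [^] k) + \<chi> (a [^] n))" "e dvd \<chi> \<one>" "e dvd \<chi> (a [^] n) - int n * \<chi> a"
    by (simp_all add: cong_iff_dvd_diff)
  then obtain s t v where "\<chi> \<one> - (\<chi> (a [^] k) + \<chi> (a [^] n)) = e * s" "\<chi> \<one> = e * t" "\<chi> (a [^] n) - int n * \<chi> a = e * v"
    by (elim dvdE)
  then have "\<chi> (a [^] k) - k * \<chi> a = e * (t - s - v)" by (simp add: n right_diff_distrib)
  then show ?thesis by (simp add: cong_iff_dvd_diff)
qed

text \<open>
  Let \<open>m\<close> be the order of \<open>x\<close> modulo \<open>A\<close>. As \<open>e\<close> kills \<open>x\<close>, the value at \<open>x\<^sup>m\<close> is divisible by \<open>m\<close>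
  modulo \<open>e\<close>, so it can be divided by \<open>m\<close> to obtain a value at \<open>x\<close>.
\<close>
lemma (in comm_group) char_extend_step:
  assumes A: "subgroup A G" "char_on G e A \<chi>" and e: "0 < e" "\<And>x. x \<in> carrier G \<Longrightarrow> x [^] nat e = \<one>"
    and x: "x \<in> carrier G" "x \<notin> A"
  shows "\<exists>A' \<chi>'. subgroup A' G \<and> A \<subset> A' \<and> char_on G e A' \<chi>' \<and> (\<forall>a\<in>A. [\<chi>' a = \<chi> a] (mod e))"
proof -
  define m where "m = (LEAST m::nat. 0 < m \<and> x [^] m \<in> A)"
  have AG: "A \<subseteq> carrier G" using A(1) by (rule subgroup.subset)
  have "x [^] nat e \<in> A" using e(2)[OF x(1)] A(1) by (simp add: subgroup.one_closed)
  then have ex: "0 < nat e \<and> x [^] nat e \<in> A" using e(1) by simp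
  have "\<exists>m::nat. 0 < m \<and> x [^] m \<in> A" using ex by blast
  from LeastI_ex[OF this] have "0 < m \<and> x [^] m \<in> A" unfolding m_def .
  then have m: "0 < m" "x [^] m \<in> A" by simp_all
  have m_dvd: "int m dvd k" if k: "x [^] k \<in> A" for k :: int
  proof -
    let ?q = "k div int m" and ?s = "k mod int m"
    have "x [^] k = (x [^] m) [^] ?q \<otimes> x [^] ?s"
    proof -
      have "x [^] k = x [^] (int m * ?q + ?s)" by simp
      also have "\<dots> = x [^] (int m * ?q) \<otimes> x [^] ?s" using x(1) by (intro int_pow_mult)
      also have "x [^] (int m * ?q) = (x [^] m) [^] ?q" using x(1) by (metis int_pow_int int_pow_pow)
      finally show ?thesis .
    qed
    moreover have q: "(x [^] m) [^] ?q \<in> A" using m(2) A(1) by (simp add: subgroup_int_pow_closed)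
    ultimately have "x [^] ?s = inv ((x [^] m) [^] ?q) \<otimes> x [^] k" using x(1) by (simp add: m_assoc[symmetric])
    then have sA: "x [^] ?s \<in> A" using q k A(1) by (simp add: subgroup.m_closed subgroup.m_inv_closed)
    have s: "0 \<le> ?s" "?s < int m" using m(1) by auto
    then have "x [^] nat ?s \<in> A" using sA by (metis int_pow_int int_nat_eq)
    moreover have s_less: "nat ?s < m" using s by linarith
    have "\<not> (0 < nat ?s \<and> x [^] nat ?s \<in> A)" by (rule not_less_Least) (use s_less in \<open>simp add: m_def\<close>)
    ultimately have "\<not> 0 < nat ?s" by simp
    then have "?s = 0" using s by linarith
    then show ?thesis by auto
  qed
  \<comment> \<open>So \<open>e = m f\<close>, and \<open>f\<close> kills \<open>x\<^sup>m\<close>; hence \<open>f m\<close> divides \<open>f\<close> times the value at \<open>x\<^sup>m\<close>.\<close>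
  have "int m dvd e" using m_dvd[of "int (nat e)"] ex by (simp add: int_pow_int e(1) less_imp_le)
  then obtain f where f: "e = int m * f" by auto
  have f0: "0 < f" using f e(1) m(1) by (metis of_nat_0_less_iff zero_less_mult_pos)
  have "e dvd f * \<chi> (x [^] m)"
  proof -
    have "(x [^] m) [^] f = \<one>"
      using e(2)[OF x(1)] f f0 x(1) e(1) by (metis int_nat_eq int_pow_int int_pow_pow less_imp_le)
    then have "[\<chi> \<one> = f * \<chi> (x [^] m)] (mod e)" using char_on_int_pow[OF A m(2), of f] by simp
    then show ?thesis using char_on_one[OF A] by (metis cong_0_iff cong_sym cong_trans)
  qed
  then have "int m dvd \<chi> (x [^] m)" using f f0 by (simp add: mult.commute)
  then obtain y where y: "\<chi> (x [^] m) = int m * y" by auto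
  define A' where "A' = {a \<otimes> x [^] (k::int) | a k. a \<in> A}"
  have key: "[\<chi> a + k * y = \<chi> a' + k' * y] (mod e)" if aa: "a \<in> A" "a' \<in> A" "a \<otimes> x [^] k = a' \<otimes> x [^] k'" for a a' and k k' :: int
  proof -
    have G: "a \<in> carrier G" "a' \<in> carrier G" using aa AG by auto
    have "x [^] (k - k') = x [^] k \<otimes> inv (x [^] k')" using x(1) by (simp add: int_pow_diff)
    also have "\<dots> = inv a \<otimes> (a \<otimes> x [^] k) \<otimes> inv (x [^] k')" using G x(1) by (simp add: m_assoc[symmetric])
    also have "\<dots> = inv a \<otimes> a'" unfolding aa(3) using G x(1) by (simp add: m_assoc)
    finally have xk: "x [^] (k - k') = inv a \<otimes> a'" .
    then have "x [^] (k - k') \<in> A" using aa A(1) by (simp add: subgroup.m_closed subgroup.m_inv_closed)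
    then obtain t where t: "k - k' = int m * t" using m_dvd by (meson dvdE)
    have xt: "x [^] (k - k') = (x [^] m) [^] t" unfolding t using x(1) by (metis int_pow_int int_pow_pow)
    have "a' = a \<otimes> x [^] (k - k')" unfolding xk using G by (simp add: m_assoc[symmetric])
    then have "[\<chi> a' = \<chi> a + \<chi> (x [^] (k - k'))] (mod e)" using A(2) aa \<open>x [^] (k - k') \<in> A\<close> unfolding char_on_def by metis
    also have "[\<chi> a + \<chi> (x [^] (k - k')) = \<chi> a + t * \<chi> (x [^] m)] (mod e)"
      unfolding xt by (intro cong_add cong_refl char_on_int_pow[OF A m(2)])
    also have "\<chi> a + t * \<chi> (x [^] m) = \<chi> a + (k - k') * y" by (simp add: y t)
    finally have "[\<chi> a' + k' * y = \<chi> a + (k - k') * y + k' * y] (mod e)" by (intro cong_add cong_refl)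
    then show ?thesis by (simp add: algebra_simps cong_sym)
  qed
  define \<chi>' where "\<chi>' z = (SOME v. \<exists>a k. a \<in> A \<and> z = a \<otimes> x [^] (k::int) \<and> v = \<chi> a + k * y)" for z
  have \<chi>': "[\<chi>' (a \<otimes> x [^] k) = \<chi> a + k * y] (mod e)" if "a \<in> A" for a and k :: int
  proof -
    have "\<exists>v a' k'. a' \<in> A \<and> a \<otimes> x [^] k = a' \<otimes> x [^] (k'::int) \<and> v = \<chi> a' + k' * y" using that by blast
    from someI_ex[OF this] obtain a' k' where "a' \<in> A" "a \<otimes> x [^] k = a' \<otimes> x [^] (k'::int)" "\<chi>' (a \<otimes> x [^] k) = \<chi> a' + k' * y"
      unfolding \<chi>'_def by blast
    then show ?thesis using key[of a' a k' k] that by simp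
  qed
  have mult: "(a \<otimes> x [^] k) \<otimes> (b \<otimes> x [^] l) = (a \<otimes> b) \<otimes> x [^] (k + l)" if "a \<in> A" "b \<in> A" for a b and k l :: int
    using that AG x(1) by (simp add: int_pow_mult m_ac subset_iff)
  have "subgroup A' G"
  proof (rule subgroupI)
    show "A' \<subseteq> carrier G" using AG x(1) by (auto simp: A'_def)
    show "A' \<noteq> {}" using subgroup.one_closed[OF A(1)] by (auto simp: A'_def)
    fix u assume "u \<in> A'"
    then obtain a k where a: "a \<in> A" "u = a \<otimes> x [^] (k::int)" by (auto simp: A'_def)
    have "inv u = inv a \<otimes> x [^] (- k)" using a AG x(1) by (simp add: inv_mult int_pow_neg subset_iff)
    moreover have "inv a \<in> A" using a A(1) by (simp add: subgroup.m_inv_closed)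
    ultimately show "inv u \<in> A'" unfolding A'_def by blast
    fix v assume "v \<in> A'"
    then obtain b l where b: "b \<in> A" "v = b \<otimes> x [^] (l::int)" by (auto simp: A'_def)
    have "a \<otimes> b \<in> A" using a b A(1) by (simp add: subgroup.m_closed)
    then show "u \<otimes> v \<in> A'" unfolding A'_def a(2) b(2) using mult[OF a(1) b(1)] by blast
  qed
  moreover have "char_on G e A' \<chi>'"
    unfolding char_on_def
  proof (intro ballI)
    fix u v assume "u \<in> A'" "v \<in> A'"
    then obtain a k b l where ab: "a \<in> A" "u = a \<otimes> x [^] (k::int)" "b \<in> A" "v = b \<otimes> x [^] (l::int)" by (auto simp: A'_def)
    have abA: "a \<otimes> b \<in> A" using ab A(1) by (simp add: subgroup.m_closed)
    have "[\<chi>' (u \<otimes> v) = \<chi> (a \<otimes> b) + (k + l) * y] (mod e)" unfolding ab(2,4) mult[OF ab(1,3)] by (rule \<chi>'[OF abA])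
    also have "[\<chi> (a \<otimes> b) + (k + l) * y = \<chi> a + \<chi> b + (k + l) * y] (mod e)" using A(2) ab by (intro cong_add cong_refl) (auto simp: char_on_def)
    also have "\<chi> a + \<chi> b + (k + l) * y = (\<chi> a + k * y) + (\<chi> b + l * y)" by (simp add: algebra_simps)
    also have "[(\<chi> a + k * y) + (\<chi> b + l * y) = \<chi>' u + \<chi>' v] (mod e)" unfolding ab by (intro cong_add cong_sym[OF \<chi>'] ab)
    finally show "[\<chi>' (u \<otimes> v) = \<chi>' u + \<chi>' v] (mod e)" .
  qed
  moreover have "[\<chi>' a = \<chi> a] (mod e)" if "a \<in> A" for a using \<chi>'[OF that, of 0] that AG by (simp add: subset_iff)
  moreover have "A \<subset> A'"
  proof -
    have "a = a \<otimes> x [^] (0::int)" if "a \<in> A" for a using that AG by (simp add: subset_iff)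
    then have "A \<subseteq> A'" unfolding A'_def by blast
    moreover have "x = \<one> \<otimes> x [^] (1::int)" using x(1) by simp
    then have "x \<in> A'" unfolding A'_def using subgroup.one_closed[OF A(1)] by blast
    ultimately show ?thesis using x(2) by blast
  qed
  ultimately show ?thesis by blast
qed

lemma (in comm_group) char_extend:
  assumes fin: "finite (carrier G)" and A: "subgroup A G" "char_on G e A \<chi>" and e: "0 < e" "\<And>x. x \<in> carrier G \<Longrightarrow> x [^] nat e = \<one>"
  shows "\<exists>\<chi>'. char_on G e (carrier G) \<chi>' \<and> (\<forall>a\<in>A. [\<chi>' a = \<chi> a] (mod e))"
  using A
proof (induction "card (carrier G) - card A" arbitrary: A \<chi> rule: less_induct)
  case less
  show ?case
  proof (cases "carrier G \<subseteq> A")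
    case True
    then have "A = carrier G" using subgroup.subset[OF less.prems(1)] by blast
    then show ?thesis using less.prems by auto
  next
    case False
    then obtain x where "x \<in> carrier G" "x \<notin> A" by blast
    from char_extend_step[OF less.prems e this] obtain A' \<chi>' where A': "subgroup A' G" "A \<subset> A'" "char_on G e A' \<chi>'"
      "\<forall>a\<in>A. [\<chi>' a = \<chi> a] (mod e)" by blast
    have "finite A'" "A' \<subseteq> carrier G" using subgroup.subset[OF A'(1)] fin finite_subset by blast+
    then have "card A < card A'" "card A' \<le> card (carrier G)" using A'(2) psubset_card_mono card_mono fin by metis+
    then have "card (carrier G) - card A' < card (carrier G) - card A" by linarith
    from less.hyps[OF this A'(1,3)] obtain \<chi>'' where \<chi>'': "char_on G e (carrier G) \<chi>''" "\<forall>a\<in>A'. [\<chi>'' a = \<chi>' a] (mod e)" by blast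
    have "[\<chi>'' a = \<chi> a] (mod e)" if "a \<in> A" for a
      using \<chi>''(2) A'(2,4) that by (meson cong_trans psubsetD)
    then show ?thesis using \<chi>''(1) by blast
  qed
qed

definition invariant_product :: "nat list \<Rightarrow> (nat \<Rightarrow> int) monoid" where
  "invariant_product ns = product_group {..<length ns} (\<lambda>i. integer_mod_group (ns ! i))"

lemma group_invariant_product [simp]: "group (invariant_product ns)"
  by (simp add: invariant_product_def)

text \<open>
  The map \<open>g\<^sup>k \<mapsto> k\<close> is a character of the subgroup generated by \<open>g\<close>, and it extends to the whole group because the
  order of \<open>g\<close> is the exponent.
\<close>
lemma (in comm_group) ex_retraction:
  assumes fin: "finite (carrier G)" and g: "g \<in> carrier G" "\<And>x. x \<in> carrier G \<Longrightarrow> ord x dvd ord g"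
  shows "\<exists>\<chi>. char_on G (int (ord g)) (carrier G) \<chi> \<and> [\<chi> g = 1] (mod int (ord g))"
proof -
  let ?A = "range (\<lambda>k::int. g [^] k)"
  have A: "subgroup ?A G"
  proof (rule subgroupI)
    fix a assume "a \<in> ?A"
    then obtain k :: int where k: "a = g [^] k" by blast
    have "inv a = g [^] (- k)" using g(1) k by (simp add: int_pow_neg)
    then show "inv a \<in> ?A" by blast
    fix b assume "b \<in> ?A"
    then obtain l :: int where l: "b = g [^] l" by blast
    have "a \<otimes> b = g [^] (k + l)" using g(1) k l by (simp add: int_pow_mult)
    then show "a \<otimes> b \<in> ?A" by blast
  qed (use g(1) in auto)
  define \<chi> where "\<chi> a = (SOME k :: int. a = g [^] k)" for a
  have \<chi>: "[\<chi> (g [^] k) = k] (mod int (ord g))" for k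
  proof -
    have "\<exists>l :: int. g [^] k = g [^] l" by blast
    from someI_ex[OF this] have "g [^] k = g [^] \<chi> (g [^] k)" unfolding \<chi>_def .
    then show ?thesis using g(1) by (simp add: int_pow_eq cong_iff_dvd_diff) 
  qed
  have "char_on G (int (ord g)) ?A \<chi>"
    unfolding char_on_def
  proof (intro ballI)
    fix a b assume "a \<in> ?A" "b \<in> ?A"
    then obtain k l :: int where kl: "a = g [^] k" "b = g [^] l" by blast
    have "a \<otimes> b = g [^] (k + l)" using g(1) kl by (simp add: int_pow_mult)
    then have "[\<chi> (a \<otimes> b) = k + l] (mod int (ord g))" using \<chi> by simp
    also have "[k + l = \<chi> a + \<chi> b] (mod int (ord g))" unfolding kl by (intro cong_add cong_sym[OF \<chi>])
    finally show "[\<chi> (a \<otimes> b) = \<chi> a + \<chi> b] (mod int (ord g))" .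
  qed
  moreover have "0 < int (ord g)" using ord_ge_1[OF fin g(1)] by simp
  moreover have "x [^] nat (int (ord g)) = \<one>" if "x \<in> carrier G" for x using g(2)[OF that] that by (simp add: pow_eq_id)
  ultimately obtain \<chi>' where "char_on G (int (ord g)) (carrier G) \<chi>'" "\<forall>a\<in>?A. [\<chi>' a = \<chi> a] (mod int (ord g))"
    using char_extend[OF fin A] by blast
  moreover have "g \<in> ?A" using g(1) by (metis int_pow_1 rangeI)
  moreover have "[\<chi> g = 1] (mod int (ord g))" using \<chi>[of 1] g(1) by simp
  ultimately show ?thesis using cong_trans by blast
qed

lemma (in comm_group) subgroup_is_comm_group:
  assumes "subgroup H G" shows "comm_group (G\<lparr>carrier := H\<rparr>)"
  by (rule group.group_comm_groupI[OF subgroup_imp_group[OF assms]])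
     (use subgroup.subset[OF assms] m_comm in auto)

text \<open>
  The condition on exponents says that every factor divides the exponent of \<open>G\<close>. It carries the
  divisibility chain through the induction.
\<close>
definition has_invariant_factors :: "('a, 'm) monoid_scheme \<Rightarrow> nat list \<Rightarrow> bool" where
  "has_invariant_factors G ns \<longleftrightarrow> (\<forall>n\<in>set ns. 1 < n) \<and> sorted_wrt (dvd) ns \<and>
     (\<forall>n\<in>set ns. \<forall>e. (\<forall>x\<in>carrier G. x [^]\<^bsub>G\<^esub> (e::nat) = \<one>\<^bsub>G\<^esub>) \<longrightarrow> n dvd e) \<and> G \<cong> invariant_product ns"

text \<open>
  The group is the direct product of the kernel \<open>K\<close> of the retraction \<open>\<chi>\<close> and of the subgroup generated by \<open>g\<close>; the
  component of \<open>x\<close> in \<open>K\<close> is \<open>x g\<^bsup>-\<chi> x\<^esup>\<close>. The order of \<open>g\<close> is the exponent, so it becomes the last factor.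
\<close>
lemma (in comm_group) invariant_factors_step:
  assumes fin: "finite (carrier G)"
    and IH: "\<And>K. subgroup K G \<Longrightarrow> card K < card (carrier G) \<Longrightarrow> \<exists>ns. has_invariant_factors (G\<lparr>carrier := K\<rparr>) ns"
  shows "\<exists>ns. has_invariant_factors G ns"
proof -
  obtain g where g: "g \<in> carrier G" "\<And>x. x \<in> carrier G \<Longrightarrow> ord x dvd ord g" using ex_exponent_element[OF fin] by blast
  let ?e = "ord g"
  have e0: "0 < ?e" using ord_ge_1[OF fin g(1)] by simp
  show ?thesis
  proof (cases "?e = 1")
    case True
    have one: "x = \<one>" if "x \<in> carrier G" for x
    proof -
      have "ord x dvd 1" using g(2)[OF that] True by simp
      then have "ord x = 1" by simp
      then show ?thesis using ord_eq_1[OF that] by blast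
    qed
    have "(\<lambda>_. \<lambda>_. undefined) \<in> iso G (invariant_product [])"
      by (auto simp: iso_def hom_def bij_betw_def inj_on_def invariant_product_def product_group_def intro!: image_eqI[of _ _ \<one>]) (metis one)
    then have "G \<cong> invariant_product []" by (rule is_isoI)
    then show ?thesis by (intro exI[of _ "[]"]) (auto simp: has_invariant_factors_def)
  next
    case False
    then have e1: "1 < ?e" using e0 by simp
    obtain \<chi> where \<chi>: "char_on G (int ?e) (carrier G) \<chi>" "[\<chi> g = 1] (mod int ?e)" using ex_retraction[OF fin g] by blast
    have \<chi>m: "[\<chi> (x \<otimes> y) = \<chi> x + \<chi> y] (mod int ?e)" if "x \<in> carrier G" "y \<in> carrier G" for x y
      using \<chi>(1) that by (simp add: char_on_def)
    have \<chi>1: "[\<chi> \<one> = 0] (mod int ?e)" by (rule char_on_one[OF subgroup_self \<chi>(1)])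
    have \<chi>g: "[\<chi> (g [^] k) = k] (mod int ?e)" for k :: int
      using cong_trans[OF char_on_int_pow[OF subgroup_self \<chi>(1) g(1)] cong_scalar_left[OF \<chi>(2), of k]] by simp
    have gpow: "g [^] k = g [^] l" if "[k = l] (mod int ?e)" for k l :: int
      using cong_sym[OF that] g(1) by (simp add: int_pow_eq cong_iff_dvd_diff)
    define K where "K = {x \<in> carrier G. int ?e dvd \<chi> x}"
    have K: "subgroup K G"
    proof (rule subgroupI)
      show "K \<noteq> {}" using \<chi>1 by (auto simp: K_def cong_0_iff)
      fix a assume a: "a \<in> K"
      have "[\<chi> (inv a) + \<chi> a = \<chi> \<one>] (mod int ?e)" using \<chi>m[of "inv a" a] a by (simp add: K_def cong_sym)
      then show "inv a \<in> K" using a \<chi>1 by (simp add: K_def) (metis cong_0_iff cong_dvd_iff dvd_add_left_iff)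
      fix b assume b: "b \<in> K"
      show "a \<otimes> b \<in> K" using a b \<chi>m[of a b] by (simp add: K_def) (metis cong_dvd_iff dvd_add)
    qed (auto simp: K_def)
    let ?K = "G\<lparr>carrier := K\<rparr>"
    interpret K: comm_group ?K using K by (rule subgroup_is_comm_group)
    have KG: "K \<subseteq> carrier G" by (auto simp: K_def)
    have "g \<notin> K"
    proof
      assume "g \<in> K"
      then have "int ?e dvd 1" using \<chi>(2) by (simp add: K_def cong_dvd_iff)
      then show False using e1 by simp
    qed
    then have "card K < card (carrier G)" using KG g(1) fin by (intro psubset_card_mono) auto
    then obtain ms where ms: "\<forall>n\<in>set ms. 1 < n" "sorted_wrt (dvd) ms"
      "\<And>n e. n \<in> set ms \<Longrightarrow> (\<forall>x\<in>K. x [^]\<^bsub>?K\<^esub> (e::nat) = \<one>) \<Longrightarrow> n dvd e" "?K \<cong> invariant_product ms"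
      using IH[OF K] by (auto simp: has_invariant_factors_def)
    obtain f where f: "f \<in> iso ?K (invariant_product ms)" using ms(4) by (auto simp: is_iso_def)
    have fK: "f x \<in> carrier (invariant_product ms)" if "x \<in> K" for x using f that by (auto simp: iso_def hom_def)
    have fm: "f (x \<otimes> y) = f x \<otimes>\<^bsub>invariant_product ms\<^esub> f y" if "x \<in> K" "y \<in> K" for x y using f that by (auto simp: iso_def hom_def)
    have fbij: "bij_betw f K (carrier (invariant_product ms))" using f by (simp add: iso_def)
    have dvd_e: "n dvd e" if "n \<in> set ms" "\<forall>x\<in>carrier G. x [^] (e::nat) = \<one>" for n e
      using ms(3)[OF that(1), of e] that(2) KG by (auto simp: nat_pow_consistent[symmetric])
    have ge: "\<forall>x\<in>carrier G. x [^] ?e = \<one>" using g(2) by (simp add: pow_eq_id)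
    define ns where "ns = ms @ [?e]"
    let ?k = "length ms"
    have lns: "length ns = Suc ?k" and nsk: "ns ! ?k = ?e" and nsi: "\<And>i. i < ?k \<Longrightarrow> ns ! i = ms ! i"
      by (auto simp: ns_def nth_append)
    define \<kappa> where "\<kappa> x = x \<otimes> g [^] (- \<chi> x)" for x
    have \<kappa>K: "\<kappa> x \<in> K" if "x \<in> carrier G" for x
    proof -
      have "[\<chi> (\<kappa> x) = \<chi> x + \<chi> (g [^] (- \<chi> x))] (mod int ?e)" unfolding \<kappa>_def using \<chi>m that g(1) by simp
      also have "[\<chi> x + \<chi> (g [^] (- \<chi> x)) = \<chi> x + - \<chi> x] (mod int ?e)" by (intro cong_add cong_refl \<chi>g)
      finally show ?thesis using that g(1) by (simp add: K_def cong_0_iff \<kappa>_def)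
    qed
    have \<kappa>m: "\<kappa> (x \<otimes> y) = \<kappa> x \<otimes> \<kappa> y" if "x \<in> carrier G" "y \<in> carrier G" for x y
    proof -
      have "[- \<chi> (x \<otimes> y) = - \<chi> x + - \<chi> y] (mod int ?e)" using cong_minus_minus_iff[THEN iffD2, OF \<chi>m[OF that]] by (simp only: minus_add_distrib)
      then have "g [^] (- \<chi> (x \<otimes> y)) = g [^] (- \<chi> x + - \<chi> y)" by (rule gpow)
      then have "g [^] (- \<chi> (x \<otimes> y)) = g [^] (- \<chi> x) \<otimes> g [^] (- \<chi> y)" using int_pow_mult[OF g(1)] by (simp only:)
      then show ?thesis unfolding \<kappa>_def using that g(1) by (simp add: m_ac)
    qed
    define h where "h x = (\<lambda>i\<in>{..<Suc ?k}. if i < ?k then f (\<kappa> x) i else \<chi> x mod int ?e)" for x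
    have hc: "h x \<in> carrier (invariant_product ns)" if "x \<in> carrier G" for x
    proof -
      have "f (\<kappa> x) i \<in> carrier (integer_mod_group (ms ! i))" if "i < ?k" for i
        using fK[OF \<kappa>K[OF \<open>x \<in> carrier G\<close>]] that unfolding invariant_product_def by (simp add: PiE_iff)
      moreover have "\<chi> x mod int ?e \<in> carrier (integer_mod_group ?e)" using e0 by (simp add: carrier_integer_mod_group)
      ultimately show ?thesis unfolding invariant_product_def
        by (auto simp: h_def lns nsk nsi PiE_iff less_Suc_eq)
    qed
    have hm: "h (x \<otimes> y) = h x \<otimes>\<^bsub>invariant_product ns\<^esub> h y" if xy: "x \<in> carrier G" "y \<in> carrier G" for x y
    proof
      fix i
      consider "i < ?k" | "i = ?k" | "i > ?k" by linarith
      then show "h (x \<otimes> y) i = (h x \<otimes>\<^bsub>invariant_product ns\<^esub> h y) i"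
      proof cases
        case 1
        then show ?thesis using fm[OF \<kappa>K[OF xy(1)] \<kappa>K[OF xy(2)]] \<kappa>m[OF xy]
          by (simp add: h_def invariant_product_def lns nsi)
      next
        case 2
        then show ?thesis using \<chi>m[OF xy] by (simp add: h_def invariant_product_def lns nsk cong_def mod_add_eq)
      next
        case 3
        then show ?thesis by (simp add: h_def invariant_product_def lns)
      qed
    qed
    interpret h: group_hom G "invariant_product ns" h
      by (intro group_hom.intro group_hom_axioms.intro is_group group_invariant_product) (use hc hm in \<open>auto simp: hom_def\<close>)
    have "h \<in> iso G (invariant_product ns)"
      unfolding h.iso_iff
    proof (intro conjI subsetI ballI impI)
      fix z assume z: "z \<in> carrier (invariant_product ns)"
      let ?z = "\<lambda>i\<in>{..<?k}. z i"
      have zi: "z i \<in> carrier (integer_mod_group (ns ! i))" if "i < Suc ?k" for i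
        using z that by (auto simp: invariant_product_def lns PiE_iff simp del: carrier_integer_mod_group)
      have "?z \<in> carrier (invariant_product ms)"
        unfolding invariant_product_def carrier_product_group
      proof (rule PiE_I)
        fix i assume "i \<in> {..<?k}"
        then have i: "i < ?k" by simp
        then show "?z i \<in> carrier (integer_mod_group (ms ! i))" using zi[of i] nsi[OF i] by simp
      qed simp
      then obtain a where a: "a \<in> K" "f a = ?z" using fbij by (metis (no_types, lifting) bij_betw_imp_surj_on imageE)
      have zk: "0 \<le> z ?k" "z ?k < int ?e" using z e0 by (auto simp: invariant_product_def lns nsk PiE_iff carrier_integer_mod_group dest!: bspec[of _ _ ?k])
      let ?x = "a \<otimes> g [^] z ?k"
      have x: "?x \<in> carrier G" using a KG g(1) by auto
      have "[\<chi> ?x = \<chi> a + \<chi> (g [^] z ?k)] (mod int ?e)" using \<chi>m a KG g(1) by auto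
      also have "[\<chi> a + \<chi> (g [^] z ?k) = 0 + z ?k] (mod int ?e)" using a(1) by (intro cong_add \<chi>g) (auto simp: K_def cong_0_iff)
      finally have \<chi>x: "[\<chi> ?x = z ?k] (mod int ?e)" by simp
      then have mod: "\<chi> ?x mod int ?e = z ?k" using zk by (simp add: cong_def)
      have "g [^] (- \<chi> ?x) = g [^] (- z ?k)" by (rule gpow) (use \<chi>x cong_minus_minus_iff in blast)
      then have "\<kappa> ?x = a" unfolding \<kappa>_def using a(1) KG g(1) by (auto simp: m_assoc int_pow_neg)
      then have "h ?x i = z i" for i
        using a(2) mod z by (cases "i < ?k") (auto simp: h_def invariant_product_def lns PiE_iff extensional_def less_Suc_eq)
      then have hz: "h ?x = z" by blast
      show "z \<in> h ` carrier G" by (rule image_eqI[of z h ?x, OF hz[symmetric] x])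
    next
      fix x assume x: "x \<in> carrier G" "h x = \<one>\<^bsub>invariant_product ns\<^esub>"
      have "\<chi> x mod int ?e = 0" using fun_cong[OF x(2), of ?k] by (simp add: h_def invariant_product_def lns nsk)
      then have "[- \<chi> x = 0] (mod int ?e)" by (simp add: cong_0_iff mod_eq_0_iff_dvd)
      then have "g [^] (- \<chi> x) = \<one>" using gpow[of "- \<chi> x" 0] g(1) by simp
      then have \<kappa>: "\<kappa> x = x" using x(1) by (simp add: \<kappa>_def)
      have fx: "f x \<in> carrier (invariant_product ms)" "x \<in> K" using fK[OF \<kappa>K[OF x(1)]] \<kappa>K[OF x(1)] \<kappa> by simp_all
      have "f x = \<one>\<^bsub>invariant_product ms\<^esub>"
      proof
        fix i show "f x i = \<one>\<^bsub>invariant_product ms\<^esub> i"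
        proof (cases "i < ?k")
          case True
          then show ?thesis using fun_cong[OF x(2), of i] by (simp add: h_def invariant_product_def lns \<kappa> less_Suc_eq)
        next
          case False
          then show ?thesis using fx(1) by (simp add: invariant_product_def PiE_iff extensional_def)
        qed
      qed
      moreover have "f \<one> = \<one>\<^bsub>invariant_product ms\<^esub>"
        using f K.one_closed hom_one[of f ?K "invariant_product ms"] K.is_group by (auto simp: iso_def)
      ultimately show "x = \<one>" using fbij fx(2) subgroup.one_closed[OF K] by (metis bij_betw_inv_into_left)
    qed
    then have "G \<cong> invariant_product ns" by (rule is_isoI)
    moreover have "\<forall>n\<in>set ns. 1 < n" using ms(1) e1 by (auto simp: ns_def)
    moreover have "sorted_wrt (dvd) ns" using ms(2) dvd_e ge by (auto simp: ns_def sorted_wrt_append)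
    moreover have "n dvd e" if "n \<in> set ns" "\<forall>x\<in>carrier G. x [^] (e::nat) = \<one>" for n e
      using that dvd_e g(1) by (auto simp: ns_def pow_eq_id)
    ultimately show ?thesis unfolding has_invariant_factors_def by blast
  qed
qed

theorem finite_abelian_invariant_factors:
  assumes "comm_group G" "finite (carrier G)"
  shows "\<exists>ns. has_invariant_factors G ns"
  using assms
proof (induction "card (carrier G)" arbitrary: G rule: less_induct)
  case less
  interpret comm_group G by (rule less.prems(1))
  show ?case
  proof (rule invariant_factors_step[OF less.prems(2)])
    fix K assume K: "subgroup K G" "card K < card (carrier G)"
    have "finite K" using subgroup.subset[OF K(1)] less.prems(2) finite_subset by blast
    then show "\<exists>ns. has_invariant_factors (G\<lparr>carrier := K\<rparr>) ns"
      using less.hyps[of "G\<lparr>carrier := K\<rparr>"] K subgroup_is_comm_group[OF K(1)] by simp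
  qed
qed

section \<open>The tame degree of a divisor homomorphism\<close>

lemma (in comm_monoid) mset_prod_closed: "set_mset z \<subseteq> carrier G \<Longrightarrow> mset_prod G z \<in> carrier G"
  unfolding mset_prod_def by (rule finprod_closed) auto

lemma (in comm_monoid) mset_prod_empty [simp]: "mset_prod G {#} = \<one>"
  by (simp add: mset_prod_def)

lemma (in comm_monoid) mset_prod_add_mset:
  assumes "x \<in> carrier G" "set_mset z \<subseteq> carrier G"
  shows "mset_prod G (add_mset x z) = x \<otimes> mset_prod G z"
proof -
  let ?A = "set_mset z - {x}"
  let ?f = "\<lambda>z y. y [^] count z y"
  have f: "?f w \<in> ?A \<rightarrow> carrier G" for w using assms by auto
  have eq: "finprod G (?f (add_mset x z)) ?A = finprod G (?f z) ?A"
    by (rule finprod_cong') (use assms in auto)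
  have split: "finprod G (?f w) (insert x ?A) = x [^] count w x \<otimes> finprod G (?f w) ?A" for w
    by (rule finprod_insert) (use assms f in auto)
  have "finprod G (?f z) (set_mset z) = x [^] count z x \<otimes> finprod G (?f z) ?A"
  proof (cases "x \<in># z")
    case True
    then show ?thesis using split[of z] by (simp add: insert_absorb)
  next
    case False
    then have "?A = set_mset z" "count z x = 0" by (auto simp: not_in_iff)
    moreover have "finprod G (?f z) (set_mset z) \<in> carrier G" by (rule finprod_closed) (use assms in auto)
    ultimately show ?thesis using assms by simp
  qed
  moreover have "finprod G (?f (add_mset x z)) (set_mset (add_mset x z)) = x [^] Suc (count z x) \<otimes> finprod G (?f z) ?A"
    using split[of "add_mset x z"] eq by simp
  moreover have "finprod G (?f z) ?A \<in> carrier G" by (rule finprod_closed) (rule f)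
  ultimately show ?thesis unfolding mset_prod_def using assms(1)
    by (simp add: m_ac nat_pow_Suc2)
qed

lemma fact_dist_image_mset:
  assumes inj: "inj_on \<psi> (set_mset z \<union> set_mset y)"
  shows "fact_dist (image_mset \<psi> z) (image_mset \<psi> y) = fact_dist z y"
proof -
  have *: "size (image_mset \<psi> v - image_mset \<psi> w) = size (v - w)" if "set_mset v \<union> set_mset w \<subseteq> set_mset z \<union> set_mset y" for v w
  proof -
    have vw: "v = (v - w) + v \<inter># w" "w = (w - v) + v \<inter># w" by (auto intro: multiset_eqI)
    have "image_mset \<psi> v - image_mset \<psi> w = image_mset \<psi> (v - w) - image_mset \<psi> (w - v)"
      by (subst (1) vw(1), subst (2) vw(2)) (simp only: image_mset_union add_diff_cancel_right)
    also have "\<dots> = image_mset \<psi> (v - w)"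
    proof (rule multiset_eqI)
      fix x
      show "count (image_mset \<psi> (v - w) - image_mset \<psi> (w - v)) x = count (image_mset \<psi> (v - w)) x"
      proof (cases "x \<in># image_mset \<psi> (w - v)")
        case True
        then obtain y where y: "y \<in># w - v" "x = \<psi> y" by auto
        have "x \<notin># image_mset \<psi> (v - w)"
        proof
          assume "x \<in># image_mset \<psi> (v - w)"
          then obtain y' where y': "y' \<in># v - w" "x = \<psi> y'" by auto
          then have "y' = y" using inj y that by (auto dest!: inj_onD in_diffD)
          then show False using y y' by (simp add: in_diff_count)
        qed
        then show ?thesis by (simp only: count_diff not_in_iff)
      next
        case False
        then have "count (image_mset \<psi> (w - v)) x = 0" by (simp only: not_in_iff)
        then show ?thesis by simp
      qed
    qed
    finally show ?thesis by simp
  qed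
  have "size (v - v \<inter># w) = size (v - w)" "size (w - v \<inter># w) = size (w - v)" for v w :: "'c multiset"
    by (rule arg_cong[where f = size], rule multiset_eqI, simp)+
  then show ?thesis unfolding fact_dist_def using * by auto
qed

text \<open>
  By cancellation a divisor homomorphism is injective up to units, so it embeds the reduced monoid.
\<close>
locale divisor_embedding =
  fixes H :: "('a, 'm) monoid_scheme" and P :: "'p set" and \<phi> :: "'a \<Rightarrow> 'p multiset"
  assumes cancel: "comm_monoid_cancel H" and hom: "divisor_hom H (free_monoid P) \<phi>"
begin

interpretation H: comm_monoid_cancel H by (rule cancel)

abbreviation "B \<equiv> \<phi> ` carrier H"

lemma \<phi>_mult: "a \<in> carrier H \<Longrightarrow> b \<in> carrier H \<Longrightarrow> \<phi> (a \<otimes>\<^bsub>H\<^esub> b) = \<phi> a + \<phi> b"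
  using hom by (simp add: divisor_hom_def hom_def free_monoid_def)

lemma \<phi>_one: "\<phi> \<one>\<^bsub>H\<^esub> = {#}"
  using hom by (simp add: divisor_hom_def free_monoid_def)

lemma \<phi>_P: "a \<in> carrier H \<Longrightarrow> set_mset (\<phi> a) \<subseteq> P"
  using hom by (auto simp: divisor_hom_def hom_def free_monoid_def)

lemma \<phi>_quotient:
  assumes "a \<in> carrier H" "b \<in> carrier H" "\<phi> a \<subseteq># \<phi> b"
  obtains c where "c \<in> carrier H" "b = a \<otimes>\<^bsub>H\<^esub> c" "\<phi> b = \<phi> a + \<phi> c"
proof -
  have "\<phi> b - \<phi> a \<in> carrier (free_monoid P)" using \<phi>_P[OF assms(2)] by (auto simp: free_monoid_def dest: in_diffD)
  moreover have "\<phi> b = \<phi> a \<otimes>\<^bsub>free_monoid P\<^esub> (\<phi> b - \<phi> a)" using assms(3) by (simp add: free_monoid_def)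
  ultimately have "\<phi> a divides\<^bsub>free_monoid P\<^esub> \<phi> b" unfolding factor_def by blast
  then have "a divides\<^bsub>H\<^esub> b" using hom assms by (auto simp: divisor_hom_def)
  then show thesis using that \<phi>_mult assms(1) by (auto simp: factor_def)
qed

lemma saturated_image: "saturated B"
  unfolding saturated_def
proof (intro conjI ballI allI)
  show "{#} \<in> B" using \<phi>_one by (metis H.one_closed image_eqI)
  fix a b assume "a \<in> B" then obtain x where x: "x \<in> carrier H" "a = \<phi> x" by blast
  show "a + b \<in> B \<longleftrightarrow> b \<in> B"
  proof
    assume "a + b \<in> B" then obtain y where y: "y \<in> carrier H" "a + b = \<phi> y" by auto
    then have "\<phi> x \<subseteq># \<phi> y" using x by (metis mset_subset_eq_add_left)
    then obtain c where "c \<in> carrier H" "\<phi> y = \<phi> x + \<phi> c" using \<phi>_quotient x y by blast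
    then show "b \<in> B" using x y by auto
  next
    assume "b \<in> B" then obtain y where "y \<in> carrier H" "b = \<phi> y" by blast
    then have "x \<otimes>\<^bsub>H\<^esub> y \<in> carrier H" "a + b = \<phi> (x \<otimes>\<^bsub>H\<^esub> y)" using x \<phi>_mult by auto
    then show "a + b \<in> B" by blast
  qed
qed

lemma \<phi>_unit: "u \<in> Units H \<Longrightarrow> \<phi> u = {#}"
proof -
  assume u: "u \<in> Units H"
  then have "\<phi> (u \<otimes>\<^bsub>H\<^esub> inv\<^bsub>H\<^esub> u) = \<phi> u + \<phi> (inv\<^bsub>H\<^esub> u)" by (intro \<phi>_mult) auto
  then show "\<phi> u = {#}" using u \<phi>_one by simp
qed

lemma coset_eq_iff:
  assumes a: "a \<in> carrier H" and b: "b \<in> carrier H"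
  shows "a <#\<^bsub>H\<^esub> Units H = b <#\<^bsub>H\<^esub> Units H \<longleftrightarrow> \<phi> a = \<phi> b"
proof
  assume "a <#\<^bsub>H\<^esub> Units H = b <#\<^bsub>H\<^esub> Units H"
  moreover have "a = a \<otimes>\<^bsub>H\<^esub> \<one>\<^bsub>H\<^esub>" using a by simp
  then have "a \<in> a <#\<^bsub>H\<^esub> Units H" unfolding l_coset_def using H.Units_one_closed by blast
  ultimately have "a \<in> b <#\<^bsub>H\<^esub> Units H" by simp
  then obtain u where u: "u \<in> Units H" "a = b \<otimes>\<^bsub>H\<^esub> u" unfolding l_coset_def by blast
  then have "\<phi> a = \<phi> b + \<phi> u" using \<phi>_mult[OF b H.Units_closed[OF u(1)]] by simp
  then show "\<phi> a = \<phi> b" using \<phi>_unit[OF u(1)] by simp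
next
  assume eq: "\<phi> a = \<phi> b"
  obtain c where c: "c \<in> carrier H" "b = a \<otimes>\<^bsub>H\<^esub> c" using \<phi>_quotient[OF a b] eq by auto
  obtain e where e: "e \<in> carrier H" "a = b \<otimes>\<^bsub>H\<^esub> e" using \<phi>_quotient[OF b a] eq by auto
  have "a \<otimes>\<^bsub>H\<^esub> (c \<otimes>\<^bsub>H\<^esub> e) = (a \<otimes>\<^bsub>H\<^esub> c) \<otimes>\<^bsub>H\<^esub> e" using H.m_assoc[OF a c(1) e(1)] by (rule sym)
  also have "\<dots> = a" by (simp only: c(2)[symmetric] e(2)[symmetric])
  finally have "a \<otimes>\<^bsub>H\<^esub> (c \<otimes>\<^bsub>H\<^esub> e) = a \<otimes>\<^bsub>H\<^esub> \<one>\<^bsub>H\<^esub>" using a by simp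
  then have ce: "c \<otimes>\<^bsub>H\<^esub> e = \<one>\<^bsub>H\<^esub>" using a c e H.l_cancel by (metis H.m_closed H.one_closed)
  then have ec: "e \<otimes>\<^bsub>H\<^esub> c = \<one>\<^bsub>H\<^esub>" using c e H.m_comm by metis
  have cU: "c \<in> Units H" and eU: "e \<in> Units H" using ce ec c(1) e(1) unfolding Units_def by auto
  show "a <#\<^bsub>H\<^esub> Units H = b <#\<^bsub>H\<^esub> Units H"
  proof (intro equalityI subsetI)
    fix x assume "x \<in> a <#\<^bsub>H\<^esub> Units H"
    then obtain u where u: "u \<in> Units H" "x = a \<otimes>\<^bsub>H\<^esub> u" unfolding l_coset_def by blast
    then have "x = b \<otimes>\<^bsub>H\<^esub> (e \<otimes>\<^bsub>H\<^esub> u)" using e b by (metis H.Units_closed H.m_assoc)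
    moreover have "e \<otimes>\<^bsub>H\<^esub> u \<in> Units H" using eU u(1) by simp
    ultimately show "x \<in> b <#\<^bsub>H\<^esub> Units H" unfolding l_coset_def by blast
  next
    fix x assume "x \<in> b <#\<^bsub>H\<^esub> Units H"
    then obtain u where u: "u \<in> Units H" "x = b \<otimes>\<^bsub>H\<^esub> u" unfolding l_coset_def by blast
    then have "x = a \<otimes>\<^bsub>H\<^esub> (c \<otimes>\<^bsub>H\<^esub> u)" using c a by (metis H.Units_closed H.m_assoc)
    moreover have "c \<otimes>\<^bsub>H\<^esub> u \<in> Units H" using cU u(1) by simp
    ultimately show "x \<in> a <#\<^bsub>H\<^esub> Units H" unfolding l_coset_def by blast
  qed
qed

abbreviation "R \<equiv> reduced_monoid H"

text \<open>
  The map on the reduced monoid induced by \<open>\<phi>\<close>.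
\<close>
definition \<psi> :: "'a set \<Rightarrow> 'p multiset" where
  "\<psi> c = \<phi> (SOME a. a \<in> carrier H \<and> a <#\<^bsub>H\<^esub> Units H = c)"

lemma \<psi>_coset: assumes "a \<in> carrier H" shows "\<psi> (a <#\<^bsub>H\<^esub> Units H) = \<phi> a"
proof -
  have "\<exists>b. b \<in> carrier H \<and> b <#\<^bsub>H\<^esub> Units H = a <#\<^bsub>H\<^esub> Units H" using assms by blast
  from someI_ex[OF this] show ?thesis unfolding \<psi>_def using coset_eq_iff assms by blast
qed

lemma carrier_R: "carrier R = (\<lambda>a. a <#\<^bsub>H\<^esub> Units H) ` carrier H" by (simp add: reduced_monoid_def)

lemma inj_\<psi>: "inj_on \<psi> (carrier R)"
  by (auto simp: inj_on_def carrier_R \<psi>_coset coset_eq_iff)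

lemma image_\<psi>: "\<psi> ` carrier R = B"
  by (simp add: carrier_R image_image \<psi>_coset)

lemma coset_mult:
  assumes "a \<in> carrier H" "b \<in> carrier H"
  shows "(a <#\<^bsub>H\<^esub> Units H) \<otimes>\<^bsub>R\<^esub> (b <#\<^bsub>H\<^esub> Units H) = (a \<otimes>\<^bsub>H\<^esub> b) <#\<^bsub>H\<^esub> Units H"
proof -
  have shuffle: "(a \<otimes>\<^bsub>H\<^esub> u) \<otimes>\<^bsub>H\<^esub> (b \<otimes>\<^bsub>H\<^esub> v) = (a \<otimes>\<^bsub>H\<^esub> b) \<otimes>\<^bsub>H\<^esub> (u \<otimes>\<^bsub>H\<^esub> v)" if "u \<in> Units H" "v \<in> Units H" for u v
    using assms H.Units_closed[OF that(1)] H.Units_closed[OF that(2)] by (simp add: H.m_assoc H.m_lcomm)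
  show ?thesis
    unfolding reduced_monoid_def monoid.simps set_mult_def l_coset_def
  proof (intro equalityI subsetI)
    fix x assume "x \<in> (\<Union>h\<in>\<Union>u\<in>Units H. {a \<otimes>\<^bsub>H\<^esub> u}. \<Union>k\<in>\<Union>u\<in>Units H. {b \<otimes>\<^bsub>H\<^esub> u}. {h \<otimes>\<^bsub>H\<^esub> k})"
    then obtain u v where "u \<in> Units H" "v \<in> Units H" "x = (a \<otimes>\<^bsub>H\<^esub> u) \<otimes>\<^bsub>H\<^esub> (b \<otimes>\<^bsub>H\<^esub> v)" by blast
    then show "x \<in> (\<Union>u\<in>Units H. {a \<otimes>\<^bsub>H\<^esub> b \<otimes>\<^bsub>H\<^esub> u})" using shuffle H.Units_m_closed by blast
  next
    fix x assume "x \<in> (\<Union>u\<in>Units H. {a \<otimes>\<^bsub>H\<^esub> b \<otimes>\<^bsub>H\<^esub> u})"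
    then obtain u where u: "u \<in> Units H" "x = a \<otimes>\<^bsub>H\<^esub> b \<otimes>\<^bsub>H\<^esub> u" by blast
    then have "x = (a \<otimes>\<^bsub>H\<^esub> u) \<otimes>\<^bsub>H\<^esub> (b \<otimes>\<^bsub>H\<^esub> \<one>\<^bsub>H\<^esub>)" using shuffle[OF u(1) H.Units_one_closed] H.Units_closed[OF u(1)] by simp
    then show "x \<in> (\<Union>h\<in>\<Union>u\<in>Units H. {a \<otimes>\<^bsub>H\<^esub> u}. \<Union>k\<in>\<Union>u\<in>Units H. {b \<otimes>\<^bsub>H\<^esub> u}. {h \<otimes>\<^bsub>H\<^esub> k})"
      using u(1) H.Units_one_closed by blast
  qed
qed

lemma R_closed: "c \<in> carrier R \<Longrightarrow> e \<in> carrier R \<Longrightarrow> c \<otimes>\<^bsub>R\<^esub> e \<in> carrier R"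
  by (auto simp: carrier_R coset_mult)

lemma \<psi>_mult: "c \<in> carrier R \<Longrightarrow> e \<in> carrier R \<Longrightarrow> \<psi> (c \<otimes>\<^bsub>R\<^esub> e) = \<psi> c + \<psi> e"
  by (auto simp: carrier_R coset_mult \<psi>_coset \<phi>_mult)

lemma one_R: "\<one>\<^bsub>R\<^esub> = \<one>\<^bsub>H\<^esub> <#\<^bsub>H\<^esub> Units H"
proof -
  have "\<one>\<^bsub>H\<^esub> \<otimes>\<^bsub>H\<^esub> u = u" if "u \<in> Units H" for u using H.Units_closed[OF that] by simp
  then show ?thesis by (simp add: reduced_monoid_def l_coset_def)
qed

lemma \<psi>_one: "\<psi> \<one>\<^bsub>R\<^esub> = {#}"
  by (simp add: one_R \<psi>_coset \<phi>_one)

lemma one_R_closed: "\<one>\<^bsub>R\<^esub> \<in> carrier R" by (auto simp: one_R carrier_R)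

lemma \<psi>_eq: "c \<in> carrier R \<Longrightarrow> e \<in> carrier R \<Longrightarrow> \<psi> c = \<psi> e \<Longrightarrow> c = e"
  using inj_\<psi> by (rule inj_onD)

lemma comm_monoid_R: "comm_monoid R"
proof (rule comm_monoidI)
  fix x y z assume c: "x \<in> carrier R" "y \<in> carrier R" "z \<in> carrier R"
  show "x \<otimes>\<^bsub>R\<^esub> y \<otimes>\<^bsub>R\<^esub> z = x \<otimes>\<^bsub>R\<^esub> (y \<otimes>\<^bsub>R\<^esub> z)"
    by (rule \<psi>_eq) (simp_all add: c R_closed \<psi>_mult ac_simps)
next
  fix x y assume c: "x \<in> carrier R" "y \<in> carrier R"
  show "x \<otimes>\<^bsub>R\<^esub> y \<in> carrier R" using R_closed c .
  show "x \<otimes>\<^bsub>R\<^esub> y = y \<otimes>\<^bsub>R\<^esub> x"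
    by (rule \<psi>_eq) (simp_all add: c R_closed \<psi>_mult ac_simps)
next
  fix x assume c: "x \<in> carrier R"
  show "\<one>\<^bsub>R\<^esub> \<otimes>\<^bsub>R\<^esub> x = x"
    by (rule \<psi>_eq) (simp_all add: c R_closed \<psi>_mult \<psi>_one one_R_closed)
qed (rule one_R_closed)

interpretation R: comm_monoid R by (rule comm_monoid_R)

lemma divides_R:
  assumes "c \<in> carrier R" "e \<in> carrier R" shows "c divides\<^bsub>R\<^esub> e \<longleftrightarrow> \<psi> c \<subseteq># \<psi> e"
proof
  assume "c divides\<^bsub>R\<^esub> e" then show "\<psi> c \<subseteq># \<psi> e" using assms by (auto simp: factor_def \<psi>_mult)
next
  assume sub: "\<psi> c \<subseteq># \<psi> e"
  have "\<psi> c \<in> B" "\<psi> e \<in> B" using assms image_\<psi> by blast+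
  then have "\<psi> e - \<psi> c \<in> B" using saturated_diff[OF saturated_image] sub by blast
  then obtain x where x: "x \<in> carrier R" "\<psi> x = \<psi> e - \<psi> c" using image_\<psi> by (metis (no_types, lifting) imageE)
  have "\<psi> (c \<otimes>\<^bsub>R\<^esub> x) = \<psi> e" using assms x sub by (simp add: \<psi>_mult)
  then have "e = c \<otimes>\<^bsub>R\<^esub> x" using \<psi>_eq R_closed assms x by metis
  then show "c divides\<^bsub>R\<^esub> e" unfolding factor_def using x by blast
qed

lemma Units_R: "c \<in> carrier R \<Longrightarrow> c \<in> Units R \<longleftrightarrow> \<psi> c = {#}"
proof
  assume c: "c \<in> carrier R"
  show "\<psi> c = {#}" if "c \<in> Units R"
  proof -
    have "\<exists>e\<in>carrier R. e \<otimes>\<^bsub>R\<^esub> c = \<one>\<^bsub>R\<^esub> \<and> c \<otimes>\<^bsub>R\<^esub> e = \<one>\<^bsub>R\<^esub>" using that by (simp only: Units_def mem_Collect_eq)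
    then obtain e where "e \<in> carrier R" "c \<otimes>\<^bsub>R\<^esub> e = \<one>\<^bsub>R\<^esub>" by (elim bexE conjE)
    then have "\<psi> c + \<psi> e = {#}" using \<psi>_mult[OF c, of e] \<psi>_one by simp
    then show ?thesis by simp
  qed
  show "c \<in> Units R" if "\<psi> c = {#}"
    using \<psi>_eq[OF c one_R_closed] that \<psi>_one by simp
qed

lemma atoms_iff: 
  assumes c: "c \<in> carrier R" shows "c \<in> atoms R \<longleftrightarrow> \<psi> c \<in> irreducibles B"
proof -
  have "Divisibility.irreducible R c \<longleftrightarrow> \<psi> c \<noteq> {#} \<and> (\<forall>e\<in>carrier R. \<psi> e \<subseteq># \<psi> c \<and> \<not> \<psi> c \<subseteq># \<psi> e \<longrightarrow> \<psi> e = {#})"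
    unfolding Divisibility.irreducible_def properfactor_def using c by (auto simp: divides_R Units_R)
  also have "\<dots> \<longleftrightarrow> \<psi> c \<noteq> {#} \<and> (\<forall>b\<in>B. b \<subseteq># \<psi> c \<longrightarrow> b = {#} \<or> b = \<psi> c)"
    unfolding image_\<psi>[symmetric] by (auto dest: subset_mset.antisym)
  also have "\<dots> \<longleftrightarrow> \<psi> c \<in> irreducibles B" using c image_\<psi> by (auto simp: irreducibles_def)
  finally show ?thesis using c by (simp add: atoms_def)
qed

lemma irreducible_image: "irreducibles B = \<psi> ` atoms R"
proof -
  have "irreducibles B \<subseteq> \<psi> ` carrier R" unfolding image_\<psi> by (auto simp: irreducibles_def)
  then show ?thesis using atoms_iff by (auto simp: atoms_def)
qed

lemma \<psi>_mset_prod: "set_mset z \<subseteq> carrier R \<Longrightarrow> \<psi> (mset_prod R z) = \<Sum>\<^sub># (image_mset \<psi> z)"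
  by (induction z) (auto simp: R.mset_prod_add_mset R.mset_prod_closed \<psi>_mult \<psi>_one)

lemma atoms_carrier: "atoms R \<subseteq> carrier R" by (auto simp: atoms_def)

lemma factorizations_iff:
  assumes a: "a \<in> carrier H" and z: "set_mset z \<subseteq> atoms R"
  shows "z \<in> factorizations H a \<longleftrightarrow> image_mset \<psi> z \<in> decompositions B (\<phi> a)"
proof -
  have zc: "set_mset z \<subseteq> carrier R" using z atoms_carrier by blast
  have "mset_prod R z = a <#\<^bsub>H\<^esub> Units H \<longleftrightarrow> \<Sum>\<^sub># (image_mset \<psi> z) = \<phi> a"
    using \<psi>_eq[OF R.mset_prod_closed[OF zc], of "a <#\<^bsub>H\<^esub> Units H"] \<psi>_mset_prod[OF zc] \<psi>_coset[OF a] a carrier_R by auto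
  then show ?thesis using z irreducible_image by (auto simp: factorizations_def decompositions_def free_monoid_def)
qed

lemma decomposition_lift:
  assumes "y \<in> decompositions B (\<phi> a)" "a \<in> carrier H"
  obtains z where "z \<in> factorizations H a" "y = image_mset \<psi> z"
proof -
  have "set_mset w \<subseteq> \<psi> ` atoms R \<Longrightarrow> \<exists>z. set_mset z \<subseteq> atoms R \<and> w = image_mset \<psi> z" for w
  proof (induction w)
    case (add v w)
    then obtain z c where "set_mset z \<subseteq> atoms R" "w = image_mset \<psi> z" "c \<in> atoms R" "v = \<psi> c" by auto
    then show ?case by (intro exI[of _ "add_mset c z"]) auto
  qed auto
  then obtain z where "set_mset z \<subseteq> atoms R" "y = image_mset \<psi> z" using assms(1) irreducible_image by (auto simp: decompositions_def)
  then show thesis using that factorizations_iff assms by metis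
qed

lemma factorizations_atoms: "z \<in> factorizations H a \<Longrightarrow> set_mset z \<subseteq> atoms R"
  by (auto simp: factorizations_def free_monoid_def)

lemma fact_dist_image:
  assumes "set_mset z \<subseteq> atoms R" "set_mset y \<subseteq> atoms R"
  shows "fact_dist (image_mset \<psi> z) (image_mset \<psi> y) = fact_dist z y"
  by (rule fact_dist_image_mset) (meson inj_\<psi> atoms_carrier assms Un_least inj_on_subset subset_trans)

lemma tame_degree_at_le_iff:
  "tame_degree_at H a x \<le> enat N \<longleftrightarrow> (\<forall>z. {y \<in> factorizations H a. x \<subseteq># y} \<noteq> {} \<and> z \<in> factorizations H a \<longrightarrow>
                 (\<exists>z' \<in> {y \<in> factorizations H a. x \<subseteq># y}. fact_dist z z' \<le> N))"
proof -
  define Q where "Q M \<longleftrightarrow> (\<forall>z. {y \<in> factorizations H a. x \<subseteq># y} \<noteq> {} \<and> z \<in> factorizations H a \<longrightarrow>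
                 (\<exists>z' \<in> {y \<in> factorizations H a. x \<subseteq># y}. enat (fact_dist z z') \<le> M))" for M
  have td: "tame_degree_at H a x = (LEAST M. Q M)" by (simp add: tame_degree_at_def Q_def)
  have "Q \<infinity>" by (auto simp: Q_def)
  then have "Q (LEAST M. Q M)" by (rule LeastI)
  moreover have "Q M'" if "Q M" "M \<le> M'" for M M' using that unfolding Q_def by (meson order_trans)
  ultimately have "(LEAST M. Q M) \<le> enat N \<longleftrightarrow> Q (enat N)" by (meson Least_le)
  also have "\<dots> \<longleftrightarrow> (\<forall>z. {y \<in> factorizations H a. x \<subseteq># y} \<noteq> {} \<and> z \<in> factorizations H a \<longrightarrow>
                 (\<exists>z' \<in> {y \<in> factorizations H a. x \<subseteq># y}. fact_dist z z' \<le> N))" by (simp add: Q_def)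
  finally show ?thesis unfolding td .
qed

text \<open>
  The induced map is an isomorphism of the reduced monoid onto the image of \<open>\<phi>\<close>, under which atoms,
  factorizations and distances correspond.
\<close>
theorem tame_degree_le_iff: "tame_degree H \<le> enat N \<longleftrightarrow> tame_bound B N"
proof -
  have "tame_degree H \<le> enat N \<longleftrightarrow> (\<forall>u\<in>atoms R. \<forall>a\<in>carrier H. tame_degree_at H a {#u#} \<le> enat N)"
    by (simp add: tame_degree_def tame_degree_atom_def SUP_le_iff)
  also have "\<dots> \<longleftrightarrow> tame_bound B N"
  proof
    assume L: "\<forall>u\<in>atoms R. \<forall>a\<in>carrier H. tame_degree_at H a {#u#} \<le> enat N"
    show "tame_bound B N"
      unfolding tame_bound_def
    proof (intro ballI allI impI)
      fix u b z assume u: "u \<in> irreducibles B" and z: "z \<in> decompositions B b" and ex: "\<exists>y\<in>decompositions B b. u \<in># y"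
      have "b \<in> B" using z saturated_sum[OF saturated_image, of z] by (auto simp: decompositions_def irreducibles_def)
      then obtain a where a: "a \<in> carrier H" "b = \<phi> a" by blast
      obtain c where c: "c \<in> atoms R" "u = \<psi> c" using u irreducible_image by blast
      obtain z0 where z0: "z0 \<in> factorizations H a" "z = image_mset \<psi> z0" using decomposition_lift z a by blast
      have mem: "c \<in># y \<longleftrightarrow> u \<in># image_mset \<psi> y" if "set_mset y \<subseteq> atoms R" for y
        using that c inj_\<psi> atoms_carrier by (auto dest: inj_onD)
      obtain y where y: "y \<in> decompositions B b" "u \<in># y" using ex by blast
      obtain y0 where y0: "y0 \<in> factorizations H a" "y = image_mset \<psi> y0" using decomposition_lift y(1) a by blast
      have "c \<in># y0" using mem[OF factorizations_atoms[OF y0(1)]] y y0 by simp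
      then have "{y \<in> factorizations H a. {#c#} \<subseteq># y} \<noteq> {}" using y0(1) by auto
      then obtain w where w: "w \<in> factorizations H a" "{#c#} \<subseteq># w" "fact_dist z0 w \<le> N"
        using L[rule_format, OF c(1) a(1)] z0(1) unfolding tame_degree_at_le_iff by blast
      have wa: "set_mset w \<subseteq> atoms R" "set_mset z0 \<subseteq> atoms R" using w z0 factorizations_atoms by auto
      show "\<exists>y\<in>decompositions B b. u \<in># y \<and> fact_dist z y \<le> N"
        using w(1,2) fact_dist_image[OF wa(2,1)] factorizations_iff[OF a(1) wa(1)] a(2) z0(2) w(3) mem[OF wa(1)]
        by (intro bexI[of _ "image_mset \<psi> w"]) auto
    qed
  next
    assume T: "tame_bound B N"
    show "\<forall>u\<in>atoms R. \<forall>a\<in>carrier H. tame_degree_at H a {#u#} \<le> enat N"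
      unfolding tame_degree_at_le_iff
    proof (intro ballI allI impI)
      fix c a z assume c: "c \<in> atoms R" and a: "a \<in> carrier H"
        and z: "{y \<in> factorizations H a. {#c#} \<subseteq># y} \<noteq> {} \<and> z \<in> factorizations H a"
      then obtain y where y: "y \<in> factorizations H a" "c \<in># y" by auto
      have u: "\<psi> c \<in> irreducibles B" using irreducible_image c by blast
      have za: "set_mset z \<subseteq> atoms R" "set_mset y \<subseteq> atoms R" using z y factorizations_atoms by auto
      have "image_mset \<psi> z \<in> decompositions B (\<phi> a)" "image_mset \<psi> y \<in> decompositions B (\<phi> a)"
        using factorizations_iff[OF a za(1)] factorizations_iff[OF a za(2)] z y by auto
      moreover have "\<psi> c \<in># image_mset \<psi> y" using y by auto
      ultimately obtain w where w: "w \<in> decompositions B (\<phi> a)" "\<psi> c \<in># w" "fact_dist (image_mset \<psi> z) w \<le> N"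
        using T u unfolding tame_bound_def by blast
      obtain w0 where w0: "w0 \<in> factorizations H a" "w = image_mset \<psi> w0" using decomposition_lift w(1) a by blast
      have "set_mset w0 \<subseteq> atoms R" using w0 factorizations_atoms by auto
      moreover have "c \<in># w0" using w(2) w0(2) calculation c inj_\<psi> atoms_carrier by (auto dest: inj_onD)
      ultimately show "\<exists>z'\<in>{y \<in> factorizations H a. {#c#} \<subseteq># y}. fact_dist z z' \<le> N"
        using w0 w(3) fact_dist_image[OF za(1)] by (intro bexI[of _ w0]) auto
    qed
  qed
  finally show ?thesis .
qed

end

section \<open>Zero-sum monoids and coordinates\<close>

definition multiset_monoid :: "'p multiset set \<Rightarrow> 'p multiset monoid" where
  "multiset_monoid B = \<lparr>carrier = B, monoid.mult = (+), one = {#}\<rparr>"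

lemma divides_multiset_monoid:
  assumes "saturated B" "a \<in> B" "b \<in> B" shows "a divides\<^bsub>multiset_monoid B\<^esub> b \<longleftrightarrow> a \<subseteq># b"
proof
  assume "a \<subseteq># b"
  then have "b = a + (b - a)" "b - a \<in> B" using saturated_diff[OF assms] by auto
  then show "a divides\<^bsub>multiset_monoid B\<^esub> b" by (auto simp: factor_def multiset_monoid_def)
qed (auto simp: factor_def multiset_monoid_def)

lemma comm_monoid_cancel_multiset_monoid:
  assumes "saturated B" shows "comm_monoid_cancel (multiset_monoid B)"
proof (intro comm_monoid_cancelI)
  show "comm_monoid (multiset_monoid B)"
    by (rule comm_monoidI) (use assms in \<open>auto simp: multiset_monoid_def saturated_def ac_simps\<close>)
qed (simp add: multiset_monoid_def)

lemma divisor_hom_multiset_monoid: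
  assumes "saturated B" "\<And>S. S \<in> B \<Longrightarrow> set_mset S \<subseteq> P"
  shows "divisor_hom (multiset_monoid B) (free_monoid P) id"
  unfolding divisor_hom_def
proof (intro conjI ballI impI)
  show "id \<in> hom (multiset_monoid B) (free_monoid P)" using assms(2) by (auto simp: hom_def multiset_monoid_def free_monoid_def)
  show "id \<one>\<^bsub>multiset_monoid B\<^esub> = \<one>\<^bsub>free_monoid P\<^esub>" by (simp add: multiset_monoid_def free_monoid_def)
  fix a b assume "a \<in> carrier (multiset_monoid B)" "b \<in> carrier (multiset_monoid B)" "id a divides\<^bsub>free_monoid P\<^esub> id b"
  then have "a \<in> B" "b \<in> B" "a \<subseteq># b" by (auto simp: multiset_monoid_def factor_def free_monoid_def)
  then show "a divides\<^bsub>multiset_monoid B\<^esub> b" using divides_multiset_monoid[OF assms(1)] by blast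
qed

lemma atoms_multiset_monoid:
  assumes B: "saturated B" shows "atoms (multiset_monoid B) = irreducibles B"
proof -
  have Units: "Units (multiset_monoid B) = {{#}}" using B by (auto simp: Units_def multiset_monoid_def saturated_def)
  have "Divisibility.irreducible (multiset_monoid B) u \<longleftrightarrow> u \<noteq> {#} \<and> (\<forall>v\<in>B. v \<subseteq># u \<longrightarrow> v = {#} \<or> v = u)" if u: "u \<in> B" for u
  proof -
    have "Divisibility.irreducible (multiset_monoid B) u \<longleftrightarrow> u \<noteq> {#} \<and> (\<forall>v\<in>B. v \<subseteq># u \<and> \<not> u \<subseteq># v \<longrightarrow> v = {#})"
      unfolding Divisibility.irreducible_def properfactor_def Units
      using divides_multiset_monoid[OF B] u by (auto simp: multiset_monoid_def)
    then show ?thesis by (auto dest: subset_mset.antisym)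
  qed
  then show ?thesis by (auto simp: atoms_def irreducibles_def) (auto simp: multiset_monoid_def)
qed

lemma tame_degree_multiset_monoid:
  assumes "saturated B" "\<And>S. S \<in> B \<Longrightarrow> set_mset S \<subseteq> P"
  shows "tame_degree (multiset_monoid B) \<le> enat N \<longleftrightarrow> tame_bound B N"
proof -
  interpret divisor_embedding "multiset_monoid B" P id
    by (intro divisor_embedding.intro comm_monoid_cancel_multiset_monoid divisor_hom_multiset_monoid assms)
  show ?thesis using tame_degree_le_iff[of N] by (simp add: multiset_monoid_def)
qed

text \<open>
  A group with a fixed decomposition into cyclic groups. Congruences for the coordinates replace equations in
  the groups \<open>C\<^bsub>n\<^sub>i\<^esub>\<close>.
\<close>
locale coordinates =
  fixes G :: "('g, 'm) monoid_scheme" and ns :: "nat list" and h :: "'g \<Rightarrow> nat \<Rightarrow> int"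
  assumes comm_group: "comm_group G" and ns_gt_1: "\<forall>n\<in>set ns. 1 < n" and iso: "h \<in> iso G (invariant_product ns)"
begin

interpretation G: comm_group G by (rule comm_group)

abbreviation "r \<equiv> length ns"

lemma nth_gt_1: "i < r \<Longrightarrow> 1 < ns ! i" using ns_gt_1 by simp

lemma h_range: "g \<in> carrier G \<Longrightarrow> i < r \<Longrightarrow> 0 \<le> h g i \<and> h g i < int (ns ! i)"
proof -
  assume g: "g \<in> carrier G" "i < r"
  have "h g \<in> carrier (invariant_product ns)" using iso g(1) by (auto simp: iso_def hom_def)
  then have "h g i \<in> carrier (integer_mod_group (ns ! i))" using g(2) by (auto simp: invariant_product_def PiE_iff)
  then show ?thesis using nth_gt_1[OF g(2)] by (simp add: carrier_integer_mod_group)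
qed

lemma h_mult: "x \<in> carrier G \<Longrightarrow> y \<in> carrier G \<Longrightarrow> i < r \<Longrightarrow> [h (x \<otimes>\<^bsub>G\<^esub> y) i = h x i + h y i] (mod int (ns ! i))"
  using iso by (auto simp: iso_def hom_def invariant_product_def cong_def)

lemma h_inj: 
  assumes "x \<in> carrier G" "y \<in> carrier G" "\<And>i. i < r \<Longrightarrow> [h x i = h y i] (mod int (ns ! i))"
  shows "x = y"
proof -
  have "h x i = h y i" for i
  proof (cases "i < r")
    case True
    then show ?thesis using assms(3)[OF True] h_range[OF assms(1) True] h_range[OF assms(2) True] by (simp add: cong_def)
  next
    case False
    have "h x \<in> carrier (invariant_product ns)" "h y \<in> carrier (invariant_product ns)" using iso assms by (auto simp: iso_def hom_def)
    then show ?thesis using False by (auto simp: invariant_product_def PiE_iff extensional_def)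
  qed
  then have "h x = h y" by blast
  moreover have "inj_on h (carrier G)" using iso by (auto simp: iso_def bij_betw_def)
  ultimately show ?thesis using assms by (auto dest: inj_onD)
qed

lemma h_surj: "\<exists>g\<in>carrier G. \<forall>i<r. [h g i = x i] (mod int (ns ! i))"
proof -
  have "(\<lambda>i\<in>{..<r}. x i mod int (ns ! i)) \<in> carrier (invariant_product ns)"
    using nth_gt_1 by (auto simp: invariant_product_def carrier_integer_mod_group)
  moreover have "h ` carrier G = carrier (invariant_product ns)" using iso by (auto simp: iso_def bij_betw_def)
  ultimately obtain g where g: "g \<in> carrier G" "h g = (\<lambda>i\<in>{..<r}. x i mod int (ns ! i))" by (metis (no_types, lifting) imageE)
  then show ?thesis by (intro bexI[of _ g]) (auto simp: cong_def)
qed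

lemma h_one: "i < r \<Longrightarrow> [h \<one>\<^bsub>G\<^esub> i = 0] (mod int (ns ! i))"
proof -
  assume i: "i < r"
  have "[h (\<one>\<^bsub>G\<^esub> \<otimes>\<^bsub>G\<^esub> \<one>\<^bsub>G\<^esub>) i = h \<one>\<^bsub>G\<^esub> i + h \<one>\<^bsub>G\<^esub> i] (mod int (ns ! i))" by (rule h_mult) (use i in auto)
  then show ?thesis by (simp add: cong_iff_dvd_diff)
qed

lemma one_iff: "g \<in> carrier G \<Longrightarrow> g = \<one>\<^bsub>G\<^esub> \<longleftrightarrow> (\<forall>i<r. int (ns ! i) dvd h g i)"
proof
  assume g: "g \<in> carrier G"
  show "\<forall>i<r. int (ns ! i) dvd h g i" if "g = \<one>\<^bsub>G\<^esub>" using that h_one by (auto simp: cong_0_iff)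
  show "g = \<one>\<^bsub>G\<^esub>" if "\<forall>i<r. int (ns ! i) dvd h g i"
    by (rule h_inj[OF g G.one_closed]) (use that h_one in \<open>meson cong_0_iff cong_sym cong_trans\<close>)
qed

lemma h_pow: "g \<in> carrier G \<Longrightarrow> i < r \<Longrightarrow> [h (g [^]\<^bsub>G\<^esub> (k::nat)) i = int k * h g i] (mod int (ns ! i))"
proof (induction k)
  case 0 then show ?case using h_one by simp
next
  case (Suc k)
  have "[h (g [^]\<^bsub>G\<^esub> k \<otimes>\<^bsub>G\<^esub> g) i = h (g [^]\<^bsub>G\<^esub> k) i + h g i] (mod int (ns ! i))" using Suc.prems by (intro h_mult) auto
  also have "[h (g [^]\<^bsub>G\<^esub> k) i + h g i = int k * h g i + h g i] (mod int (ns ! i))" using Suc by (intro cong_add) auto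
  finally show ?case by (simp add: algebra_simps)
qed

lemma exponent_iff: "(\<forall>g\<in>carrier G. g [^]\<^bsub>G\<^esub> (k::nat) = \<one>\<^bsub>G\<^esub>) \<longleftrightarrow> (\<forall>i<r. ns ! i dvd k)"
proof
  assume all: "\<forall>g\<in>carrier G. g [^]\<^bsub>G\<^esub> k = \<one>\<^bsub>G\<^esub>"
  show "\<forall>i<r. ns ! i dvd k"
  proof (intro allI impI)
    fix i assume i: "i < r"
    obtain g where g: "g \<in> carrier G" "\<forall>i<r. [h g i = 1] (mod int (ns ! i))" using h_surj[of "\<lambda>_. 1"] by blast
    have "int (ns ! i) dvd h (g [^]\<^bsub>G\<^esub> k) i" using all g(1) one_iff[of "g [^]\<^bsub>G\<^esub> k"] i by auto
    moreover have "[h (g [^]\<^bsub>G\<^esub> k) i = int k * 1] (mod int (ns ! i))"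
      using h_pow[OF g(1) i, of k] g(2) i by (meson cong_scalar_left cong_trans)
    ultimately show "ns ! i dvd k" by (metis cong_dvd_iff int_dvd_int_iff mult.right_neutral)
  qed
next
  assume dv: "\<forall>i<r. ns ! i dvd k"
  show "\<forall>g\<in>carrier G. g [^]\<^bsub>G\<^esub> k = \<one>\<^bsub>G\<^esub>"
  proof
    fix g assume g: "g \<in> carrier G"
    have "int (ns ! i) dvd h (g [^]\<^bsub>G\<^esub> k) i" if "i < r" for i
      using h_pow[OF g that, of k] dv that by (metis cong_dvd_iff dvd_mult2 int_dvd_int_iff)
    then show "g [^]\<^bsub>G\<^esub> k = \<one>\<^bsub>G\<^esub>" using one_iff g by simp
  qed
qed

lemma order_eq: "order G = (\<Prod>i<r. ns ! i)"
proof -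
  have "order G = card (carrier (invariant_product ns))" using iso by (auto simp: order_def iso_def dest: bij_betw_same_card)
  also have "\<dots> = (\<Prod>i<r. card (carrier (integer_mod_group (ns ! i))))" by (simp add: invariant_product_def card_PiE)
  also have "\<dots> = (\<Prod>i<r. ns ! i)" by (rule prod.cong) (use nth_gt_1 in \<open>auto simp: carrier_integer_mod_group\<close>)
  finally show ?thesis .
qed

lemma h_mset_prod:
  assumes "set_mset S \<subseteq> carrier G" "i < r"
  shows "[h (mset_prod G S) i = (\<Sum>g\<in>#S. h g i)] (mod int (ns ! i))"
  using assms(1)
proof (induction S)
  case empty then show ?case using h_one[OF assms(2)] by simp
next
  case (add g S)
  have "[h (g \<otimes>\<^bsub>G\<^esub> mset_prod G S) i = h g i + h (mset_prod G S) i] (mod int (ns ! i))"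
    using add.prems assms(2) G.mset_prod_closed[of S] by (intro h_mult) auto
  also have "[h g i + h (mset_prod G S) i = h g i + (\<Sum>g\<in>#S. h g i)] (mod int (ns ! i))" using add by (intro cong_add) auto
  finally show ?case using add.prems G.mset_prod_add_mset[of g S] by simp
qed

lemma zero_sum_monoid_eq: "zero_sum_monoid G (carrier G) = multiset_monoid (blocks ns (carrier G) h)"
proof -
  have "mset_prod G S = \<one>\<^bsub>G\<^esub> \<longleftrightarrow> zero_sum ns h S" if S: "set_mset S \<subseteq> carrier G" for S
    unfolding one_iff[OF G.mset_prod_closed[OF S]] zero_sum_def using h_mset_prod[OF S] by (meson cong_dvd_iff)
  then have "carrier (zero_sum_monoid G (carrier G)) = blocks ns (carrier G) h"
    by (auto simp: zero_sum_monoid_def free_monoid_def blocks_def)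
  then show ?thesis by (simp add: zero_sum_monoid_def free_monoid_def multiset_monoid_def)
qed

lemma covers_G: "covers ns (carrier G) h"
  unfolding covers_def using h_surj by blast

lemma tame_degree_zero_sum_monoid:
  "tame_degree (zero_sum_monoid G (carrier G)) \<le> enat N \<longleftrightarrow> tame_bound (blocks ns (carrier G) h) N"
  unfolding zero_sum_monoid_eq by (rule tame_degree_multiset_monoid[OF saturated_blocks, of _ _ _ "carrier G"]) (auto simp: blocks_def)

lemma davenport_eq: "davenport G (carrier G) = (SUP U\<in>irreducibles (blocks ns (carrier G) h). enat (size U))"
  unfolding davenport_def zero_sum_monoid_eq atoms_multiset_monoid[OF saturated_blocks] ..

end

lemma zero_sum_image:
  assumes "\<And>p i. p \<in># S \<Longrightarrow> i < length ns \<Longrightarrow> [d' (f p) i = d p i] (mod int (ns ! i))"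
  shows "zero_sum ns d' (image_mset f S) \<longleftrightarrow> zero_sum ns d S"
proof -
  have "[(\<Sum>p\<in>#image_mset f S. d' p i) = (\<Sum>p\<in>#S. d p i)] (mod int (ns ! i))" if "i < length ns" for i
    using assms by (induction S) (auto intro!: cong_add that)
  then show ?thesis unfolding zero_sum_def by (meson cong_dvd_iff)
qed

text \<open>
  Parts of the image come from parts of \<open>u\<close>, and the map \<open>f\<close> preserves classes.
\<close>
lemma irreducible_image_class:
  assumes f: "\<And>p i. p \<in># u \<Longrightarrow> i < length ns \<Longrightarrow> [d' (f p) i = d p i] (mod int (ns ! i))" "\<And>p. p \<in># u \<Longrightarrow> f p \<in> P'"
    and u: "u \<in> irreducibles (blocks ns P d)"
  shows "image_mset f u \<in> irreducibles (blocks ns P' d')"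
  unfolding irreducible_blocks_iff
proof (intro conjI allI impI)
  note ui = irreducible_blockD[OF u]
  show "set_mset (image_mset f u) \<subseteq> P'" using f(2) by auto
  show "zero_sum ns d' (image_mset f u)" using zero_sum_image[of u ns d' f d] f ui(2) by blast
  show "image_mset f u \<noteq> {#}" using ui(3) by simp
  fix v assume v: "v \<subseteq># image_mset f u" "zero_sum ns d' v"
  obtain T where T: "T \<subseteq># u" "v = image_mset f T" using v(1) by (rule subset_image_msetE)
  have "zero_sum ns d T" using zero_sum_image[of T ns d' f d] f(1) T v(2) by (meson mset_subset_eqD)
  then have "T = {#} \<or> T = u" using ui(4)[OF T(1)] by blast
  then show "v = {#} \<or> v = image_mset f u" using T(2) by auto
qed

lemma ex_irreducible_same_size:
  assumes c: "covers ns P' d'" and u: "u \<in> irreducibles (blocks ns P d)"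
  shows "\<exists>u'\<in>irreducibles (blocks ns P' d'). size u' = size u"
proof -
  have "\<forall>p. \<exists>q. q \<in> P' \<and> (\<forall>i<length ns. [d' q i = d p i] (mod int (ns ! i)))" using c unfolding covers_def by blast
  then obtain f where "\<And>p. f p \<in> P'" "\<And>p i. i < length ns \<Longrightarrow> [d' (f p) i = d p i] (mod int (ns ! i))" by metis
  then have "image_mset f u \<in> irreducibles (blocks ns P' d')" using irreducible_image_class[OF _ _ u] by blast
  then show ?thesis by force
qed

lemma SUP_irreducible_size_eq:
  assumes "covers ns P d" "covers ns P' d'"
  shows "(SUP U\<in>irreducibles (blocks ns P d). enat (size U)) = (SUP U\<in>irreducibles (blocks ns P' d'). enat (size U))"
  by (intro antisym SUP_least) (metis ex_irreducible_same_size[OF assms(2)] SUP_upper, metis ex_irreducible_same_size[OF assms(1)] SUP_upper)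

section \<open>Class groups\<close>

lemma frag_of_mset_empty [simp]: "frag_of_mset {#} = 0" by (simp add: frag_of_mset_def)
lemma frag_of_mset_add_mset [simp]: "frag_of_mset (add_mset p S) = frag_of p + frag_of_mset S" by (simp add: frag_of_mset_def)
lemma frag_of_mset_union [simp]: "frag_of_mset (S + T) = frag_of_mset S + frag_of_mset T" by (simp add: frag_of_mset_def)

lemma lookup_frag_of_mset: "Poly_Mapping.lookup (frag_of_mset S) p = int (count S p)"
  by (induction S) (auto simp: lookup_add lookup_single when_def)

lemma frag_of_mset_inj: "frag_of_mset S = frag_of_mset T \<Longrightarrow> S = T"
  by (rule multiset_eqI) (metis lookup_frag_of_mset of_nat_eq_iff)

lemma keys_frag_of_mset: "Poly_Mapping.keys (frag_of_mset S) = set_mset S"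
  by (auto simp: in_keys_iff lookup_frag_of_mset)

lemma frag_of_mset_closed: "set_mset S \<subseteq> P \<Longrightarrow> frag_of_mset S \<in> carrier (free_Abelian_group P)"
  by (simp add: keys_frag_of_mset)

context divisor_embedding
begin

abbreviation "F \<equiv> free_Abelian_group P"
abbreviation "N \<equiv> principal_divisors H \<phi>"
abbreviation "G \<equiv> class_group H P \<phi>"

interpretation H: comm_monoid_cancel H by (rule cancel)
interpretation F: comm_group F by (rule abelian_free_Abelian_group)

lemma N_subgroup: "subgroup N F"
proof (rule F.subgroupI)
  show "N \<subseteq> carrier F"
    using \<phi>_P keys_diff by (fastforce simp: principal_divisors_def keys_frag_of_mset)
  show "N \<noteq> {}" by (auto simp: principal_divisors_def)
  fix x assume x: "x \<in> N"
  then have "Poly_Mapping.keys x \<subseteq> P" using \<open>N \<subseteq> carrier F\<close> unfolding carrier_free_Abelian_group_iff[symmetric] by blast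
  then have "inv\<^bsub>F\<^esub> x = - x" by simp
  then show "inv\<^bsub>F\<^esub> x \<in> N" using x by (force simp: principal_divisors_def)
  fix y assume y: "y \<in> N"
  obtain a b c e where *: "a \<in> carrier H" "b \<in> carrier H" "x = frag_of_mset (\<phi> a) - frag_of_mset (\<phi> b)"
    "c \<in> carrier H" "e \<in> carrier H" "y = frag_of_mset (\<phi> c) - frag_of_mset (\<phi> e)" using x y by (auto simp: principal_divisors_def)
  have "x + y = frag_of_mset (\<phi> (a \<otimes>\<^bsub>H\<^esub> c)) - frag_of_mset (\<phi> (b \<otimes>\<^bsub>H\<^esub> e))" using * by (simp add: \<phi>_mult)
  then show "x \<otimes>\<^bsub>F\<^esub> y \<in> N" using * by (auto simp: principal_divisors_def)
qed

lemma N_normal: "normal N F"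
  using N_subgroup F.normal_iff_subgroup by blast

lemma comm_group_G: "comm_group G"
  unfolding class_group_def using F.abelian_FactGroup[OF N_subgroup] .

interpretation G: comm_group G by (rule comm_group_G)

definition coset :: "('p \<Rightarrow>\<^sub>0 int) \<Rightarrow> ('p \<Rightarrow>\<^sub>0 int) set" where "coset f = N #>\<^bsub>F\<^esub> f"

lemma coset_hom: "coset \<in> hom F G"
  unfolding coset_def class_group_def using normal.r_coset_hom_Mod[OF N_normal] .

lemma coset_closed: "f \<in> carrier F \<Longrightarrow> coset f \<in> carrier G"
  using coset_hom by (auto simp: hom_def)

lemma coset_add: "f \<in> carrier F \<Longrightarrow> g \<in> carrier F \<Longrightarrow> coset (f + g) = coset f \<otimes>\<^bsub>G\<^esub> coset g"
  using coset_hom by (auto simp: hom_def)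

lemma coset_surj: "g \<in> carrier G \<Longrightarrow> \<exists>f\<in>carrier F. g = coset f"
  by (auto simp: class_group_def FactGroup_def RCOSETS_def coset_def)

lemma coset_eq_one_iff: "f \<in> carrier F \<Longrightarrow> coset f = \<one>\<^bsub>G\<^esub> \<longleftrightarrow> f \<in> N"
proof
  assume f: "f \<in> carrier F"
  have one: "\<one>\<^bsub>G\<^esub> = N" by (simp add: class_group_def FactGroup_def)
  show "f \<in> N" if "coset f = \<one>\<^bsub>G\<^esub>" using F.coset_join1[of N f] that f N_subgroup one by (simp add: coset_def)
  show "coset f = \<one>\<^bsub>G\<^esub>" if "f \<in> N" using subgroup.rcos_const[OF N_subgroup F.is_group that] one by (simp add: coset_def)
qed

lemma divisor_class_eq: "divisor_class H P \<phi> p = coset (frag_of p)"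
  by (simp add: divisor_class_def coset_def)

text \<open>
  A divisor homomorphism is saturated: if a multiset is a quotient of two elements of the image, it is itself in the
  image. So its image consists of the multisets in the principal class.
\<close>
lemma mem_image_iff: "S \<in> \<phi> ` carrier H \<longleftrightarrow> set_mset S \<subseteq> P \<and> coset (frag_of_mset S) = \<one>\<^bsub>G\<^esub>"
proof
  assume "S \<in> \<phi> ` carrier H"
  then obtain a where a: "a \<in> carrier H" "S = \<phi> a" by blast
  then have "frag_of_mset S = frag_of_mset (\<phi> a) - frag_of_mset (\<phi> \<one>\<^bsub>H\<^esub>)" by (simp add: \<phi>_one)
  then have "frag_of_mset S \<in> N" unfolding principal_divisors_def using a(1) H.one_closed by blast
  then show "set_mset S \<subseteq> P \<and> coset (frag_of_mset S) = \<one>\<^bsub>G\<^esub>" using coset_eq_one_iff[OF frag_of_mset_closed] a \<phi>_P by auto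
next
  assume S: "set_mset S \<subseteq> P \<and> coset (frag_of_mset S) = \<one>\<^bsub>G\<^esub>"
  then have "frag_of_mset S \<in> N" using coset_eq_one_iff[OF frag_of_mset_closed] by blast
  then obtain a b where ab: "a \<in> carrier H" "b \<in> carrier H" "frag_of_mset S = frag_of_mset (\<phi> a) - frag_of_mset (\<phi> b)"
    by (auto simp: principal_divisors_def)
  then have "frag_of_mset (S + \<phi> b) = frag_of_mset (\<phi> a)" by simp
  then have eq: "S + \<phi> b = \<phi> a" by (rule frag_of_mset_inj)
  then have "\<phi> b \<subseteq># \<phi> a" by (metis mset_subset_eq_add_right)
  then obtain c where "c \<in> carrier H" "\<phi> a = \<phi> b + \<phi> c" using \<phi>_quotient[OF ab(2,1)] by blast
  then have "S = \<phi> c" using eq by (metis add.commute add_left_cancel)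
  then show "S \<in> \<phi> ` carrier H" using \<open>c \<in> carrier H\<close> by blast
qed

lemma coset_coordinates:
  assumes "coordinates G ns h" and S: "set_mset S \<subseteq> P" and i: "i < length ns"
  shows "[h (coset (frag_of_mset S)) i = (\<Sum>p\<in>#S. h (divisor_class H P \<phi> p) i)] (mod int (ns ! i))"
  using S
proof (induction S)
  interpret coordinates G ns h by (rule assms(1))
  {
    case empty
    have "coset 0 = \<one>\<^bsub>G\<^esub>" using coset_eq_one_iff[of 0] subgroup.one_closed[OF N_subgroup] by simp
    then show ?case using h_one[OF i] by simp
  next
    case (add p S)
    have p: "p \<in> P" "set_mset S \<subseteq> P" using add.prems by auto
    then have c: "frag_of p \<in> carrier F" "frag_of_mset S \<in> carrier F" using frag_of_mset_closed by auto
    have "[h (coset (frag_of p) \<otimes>\<^bsub>G\<^esub> coset (frag_of_mset S)) i = h (coset (frag_of p)) i + h (coset (frag_of_mset S)) i] (mod int (ns ! i))"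
      by (rule h_mult) (use c coset_closed i in auto)
    also have "[h (coset (frag_of p)) i + h (coset (frag_of_mset S)) i = h (coset (frag_of p)) i + (\<Sum>p\<in>#S. h (divisor_class H P \<phi> p) i)] (mod int (ns ! i))"
      using add.IH p by (intro cong_add) auto
    finally show ?case using coset_add[OF c] by (simp add: divisor_class_eq)
  }
qed

lemma image_eq_blocks:
  assumes "coordinates G ns h"
  shows "\<phi> ` carrier H = blocks ns P (\<lambda>p. h (divisor_class H P \<phi> p))"
proof -
  interpret coordinates G ns h by (rule assms)
  have "coset (frag_of_mset S) = \<one>\<^bsub>G\<^esub> \<longleftrightarrow> zero_sum ns (\<lambda>p. h (divisor_class H P \<phi> p)) S" if "set_mset S \<subseteq> P" for S
    unfolding one_iff[OF coset_closed[OF frag_of_mset_closed[OF that]]] zero_sum_def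
    using coset_coordinates[OF assms that] by (meson cong_dvd_iff)
  then show ?thesis unfolding blocks_def set_eq_iff mem_image_iff mem_Collect_eq by blast
qed

lemma covers_primes:
  assumes "coordinates G ns h" and "\<forall>g\<in>carrier G. \<exists>p\<in>P. divisor_class H P \<phi> p = g"
  shows "covers ns P (\<lambda>p. h (divisor_class H P \<phi> p))"
proof -
  interpret coordinates G ns h by (rule assms)
  show ?thesis unfolding covers_def using h_surj assms(2) by metis
qed

end

lemma krull_divisor_embedding: "krull_monoid H P \<phi> \<Longrightarrow> divisor_embedding H P \<phi>"
  by (simp add: krull_monoid_def divisor_theory_def divisor_embedding_def)

text \<open>
  In a group of order two with a single prime \<open>p\<close> in the nontrivial class, \<open>p\<close> would occur an even number of times in
  every element of the image, and could not be the greatest common divisor of such elements.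
\<close>
lemma two_primes_of_divisor_theory:
  assumes dt: "divisor_theory H P \<phi>" and im: "\<phi> ` carrier H = blocks [2] P d" and c: "covers [2] P d"
  shows "\<exists>p\<in>P. \<exists>q\<in>P. p \<noteq> q \<and> odd (d p 0) \<and> odd (d q 0)"
proof -
  obtain p where p: "p \<in> P" "[d p 0 = 1] (mod 2)" using c unfolding covers_def by fastforce
  then have odd: "odd (d p 0)" by (simp add: cong_iff_dvd_diff)
  obtain X where X: "X \<subseteq> carrier H" "finite X" "X \<noteq> {}" "Inf (\<phi> ` X) = {#p#}"
    using dt p(1) unfolding divisor_theory_def by blast
  have "count (Inf (\<phi> ` X)) p = Inf ((\<lambda>S. count S p) ` \<phi> ` X)" using X(3) by (intro count_Inf_multiset_nonempty) auto
  moreover have "Inf ((\<lambda>S. count S p) ` \<phi> ` X) \<in> (\<lambda>S. count S p) ` \<phi> ` X" using X(3) by (intro Inf_nat_def1) auto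
  ultimately obtain a where a: "a \<in> X" "count (\<phi> a) p = 1" using X(4) by auto
  then have "p \<in># \<phi> a" by (metis count_inI zero_neq_one)
  then obtain T where T: "\<phi> a = add_mset p T" by (metis mset_add)
  have pT: "p \<notin># T" using a(2) T by (simp add: not_in_iff)
  have B: "\<phi> a \<in> blocks [2] P d" using im a(1) X(1) by blast
  then have "odd (\<Sum>q\<in>#T. d q 0)" using odd T by (simp add: blocks_def zero_sum_def)
  then have "\<exists>q\<in>#T. odd (d q 0)" by (induction T) auto
  then obtain q where q: "q \<in># T" "odd (d q 0)" by blast
  have "q \<in> P" using B T q(1) by (auto simp: blocks_def)
  then show ?thesis using p(1) odd q pT by metis
qed

text \<open>
  The two factorizations of \<open>p\<^sup>2 q\<^sup>2\<close> are \<open>p\<^sup>2 \<cdot> q\<^sup>2\<close> and \<open>(p q) \<cdot> (p q)\<close>.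
\<close>
lemma tame_bound_2_two_primes_ge:
  assumes pq: "p \<in> P" "q \<in> P" "p \<noteq> q" "odd (d p 0)" "odd (d q 0)" and t: "tame_bound (blocks [2] P d) M"
  shows "2 \<le> M"
proof -
  let ?p = "\<lambda>j::nat. if j = 0 then p else q"
  let ?S = "\<lambda>j::nat. if j = 0 then {#p#} else {#q#}"
  have two: "{..<2::nat} = {0, 1}" by auto
  have zs: "zero_sum [2] d S \<longleftrightarrow> even (\<Sum>p\<in>#S. d p 0)" for S by (simp add: zero_sum_def)
  have single: "T = {#}" if "T \<subseteq># {#x#}" "zero_sum [2] d T" "odd (d x 0)" for T x
  proof (rule ccontr)
    assume "T \<noteq> {#}"
    then have "T = {#x#}" using that(1) nonempty_subseteq_mset_eq_single by metis
    then show False using that(2,3) by (simp add: zs)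
  qed
  have U: "image_mset ?p (mset_set {..<2}) = {#p, q#}" by (simp add: two)
  have "{#p, q#} \<in> irreducibles (blocks [2] P d)"
    using irreducible_add_closing[of "{#q#}" P p "[2]" d] single pq by (auto simp: zs)
  then show ?thesis
    using pq by (intro tame_bound_exchange_ge[where p = ?p and S = ?S and k = 2 and N = 2, OF _ _ _ _ _ _ t])
      (auto simp: U zs two single split: if_splits dest: single)
qed

section \<open>Invariant factors of the exceptional groups\<close>

lemma invariant_factors_spec:
  assumes "comm_group G" "finite (carrier G)"
  shows "(\<forall>n\<in>set (invariant_factors G). 1 < n) \<and> sorted_wrt (dvd) (invariant_factors G) \<and> G \<cong> invariant_product (invariant_factors G)"
proof -
  have "\<exists>ns. (\<forall>n\<in>set ns. 1 < n) \<and> sorted_wrt (dvd) ns \<and> G \<cong> product_group {..<length ns} (\<lambda>i. integer_mod_group (ns ! i))"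
    using finite_abelian_invariant_factors[OF assms] unfolding has_invariant_factors_def invariant_product_def by blast
  from someI_ex[OF this] show ?thesis unfolding invariant_factors_def invariant_product_def .
qed

lemma ex_coordinates:
  assumes "comm_group G" "finite (carrier G)"
  obtains h where "coordinates G (invariant_factors G) h"
  using invariant_factors_spec[OF assms] assms(1) unfolding is_iso_def coordinates_def by blast

lemma invariant_factors_cong:
  assumes "group G" "group G'" "G \<cong> G'" shows "invariant_factors G = invariant_factors G'"
proof -
  have "G \<cong> K \<longleftrightarrow> G' \<cong> K" for K :: "(nat \<Rightarrow> int) monoid"
    using assms iso_trans group.iso_sym by metis
  then show ?thesis by (simp add: invariant_factors_def)
qed

lemma iso_invariant_product_single:
  assumes "1 < n" shows "invariant_product [n] \<cong> integer_mod_group n"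
proof (rule is_isoI)
  show "(\<lambda>x. x 0) \<in> iso (invariant_product [n]) (integer_mod_group n)"
    unfolding iso_def
  proof (intro CollectI conjI)
    show "(\<lambda>x. x 0) \<in> hom (invariant_product [n]) (integer_mod_group n)"
      by (auto simp: hom_def invariant_product_def PiE_iff)
    show "bij_betw (\<lambda>x. x 0) (carrier (invariant_product [n])) (carrier (integer_mod_group n))"
      unfolding bij_betw_def
    proof (intro conjI inj_onI equalityI subsetI)
      fix x y assume "x \<in> carrier (invariant_product [n])" "y \<in> carrier (invariant_product [n])" "x 0 = y 0"
      then show "x = y"
        unfolding invariant_product_def carrier_product_group by (intro PiE_ext) auto
    next
      fix k assume "k \<in> (\<lambda>x. x 0) ` carrier (invariant_product [n])"
      then obtain x where x: "x \<in> carrier (invariant_product [n])" "k = x 0" by (elim imageE)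
      have "x 0 \<in> carrier (integer_mod_group ([n] ! 0))"
        using x(1) unfolding invariant_product_def carrier_product_group by (rule PiE_mem) simp
      then show "k \<in> carrier (integer_mod_group n)" using x(2) by simp
    next
      fix k assume "k \<in> carrier (integer_mod_group n)"
      then have "(\<lambda>i\<in>{..<1}. k) \<in> carrier (invariant_product [n])" by (auto simp: invariant_product_def)
      then show "k \<in> (\<lambda>x. x 0) ` carrier (invariant_product [n])" by (rule rev_image_eqI) simp
    qed
  qed
qed

lemma cyclic_power_eq: "cyclic_power n r = invariant_product (replicate r n)"
proof -
  have "(\<Pi>\<^sub>E i\<in>{..<r}. carrier (integer_mod_group n)) = (\<Pi>\<^sub>E i\<in>{..<r}. carrier (integer_mod_group (replicate r n ! i)))"
    by (rule PiE_cong) simp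
  moreover have "(\<lambda>x y. \<lambda>i\<in>{..<r}. x i \<otimes>\<^bsub>integer_mod_group n\<^esub> y i) = (\<lambda>x y. \<lambda>i\<in>{..<r}. x i \<otimes>\<^bsub>integer_mod_group (replicate r n ! i)\<^esub> y i)"
    by (intro ext restrict_ext) simp
  ultimately show ?thesis by (simp add: cyclic_power_def invariant_product_def product_group_def)
qed

lemma prod_list_small:
  assumes "\<forall>n\<in>set ns. 1 < (n::nat)"
  shows "prod_list ns = 2 \<Longrightarrow> ns = [2]" "prod_list ns = 3 \<Longrightarrow> ns = [3]" "prod_list ns = 4 \<Longrightarrow> ns = [4] \<or> ns = [2, 2]"
proof -
  have pos: "1 \<le> prod_list ms" if "\<forall>n\<in>set ms. 1 < (n::nat)" for ms
    using that by (induction ms) (auto simp: Suc_le_eq)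
  have big: "1 < prod_list ms" if ms1: "\<forall>n\<in>set ms. 1 < (n::nat)" and ne: "ms \<noteq> []" for ms
  proof -
    obtain n ms' where ms: "ms = n # ms'" using ne by (cases ms) auto
    then have n: "1 < n" "1 \<le> prod_list ms'" using ms1 pos by auto
    then have "n * 1 \<le> n * prod_list ms'" by (intro mult_le_mono2)
    moreover have "prod_list ms = n * prod_list ms'" using ms by simp
    ultimately show ?thesis using n(1) by linarith
  qed
  have four: "4 \<le> n * m * k \<and> (n * m * k = 4 \<longrightarrow> n = 2 \<and> m = 2 \<and> k = 1)" if "2 \<le> n" "2 \<le> m" "1 \<le> k" for n m k :: nat
  proof -
    have 1: "2 * 2 \<le> n * m" using that by (intro mult_le_mono)
    have 2: "n * m \<le> n * m * k" using that(3) by simp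
    have "n = 2 \<and> m = 2 \<and> k = 1" if e: "n * m * k = 4"
    proof -
      have nm: "n * m = 4" using 1 2 e by linarith
      have "n * 2 \<le> n * m" "2 * m \<le> n * m" using \<open>2 \<le> n\<close> \<open>2 \<le> m\<close> by (intro mult_le_mono; simp)+
      then have "n = 2" "m = 2" using nm \<open>2 \<le> n\<close> \<open>2 \<le> m\<close> by linarith+
      then show ?thesis using e by simp
    qed
    then show ?thesis using 1 2 by linarith
  qed
  have long: "4 \<le> prod_list ns \<and> (prod_list ns = 4 \<longrightarrow> ns = [2, 2])" if l: "ns = n # m # ms" for n m ms
  proof -
    have ms: "2 \<le> n" "2 \<le> m" "1 \<le> prod_list ms" "\<forall>n\<in>set ms. 1 < n" using assms l pos[of ms] by auto
    have p: "prod_list ns = n * m * prod_list ms" using l by (simp add: mult.assoc)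
    have "ns = [2, 2]" if "prod_list ns = 4"
    proof -
      have "n = 2 \<and> m = 2 \<and> prod_list ms = 1" using four[OF ms(1-3)] that p by simp
      moreover have "ms = []" using big[OF ms(4)] calculation by fastforce
      ultimately show ?thesis using l by simp
    qed
    then show ?thesis using four[OF ms(1-3)] p by simp
  qed
  have cases: "ns = [] \<or> (\<exists>n. ns = [n]) \<or> (\<exists>n m ms. ns = n # m # ms)" by (metis list.exhaust)
  show "prod_list ns = 2 \<Longrightarrow> ns = [2]" using cases long by fastforce
  show "prod_list ns = 3 \<Longrightarrow> ns = [3]" using cases long by fastforce
  show "prod_list ns = 4 \<Longrightarrow> ns = [4] \<or> ns = [2, 2]" using cases long by fastforce
qed

lemma coordinates_compare:
  assumes "coordinates G ns h" "coordinates G ms f"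
  shows "(\<Prod>i<length ns. ns ! i) = (\<Prod>i<length ms. ms ! i)"
    and "(\<forall>i<length ns. ns ! i dvd k) \<longleftrightarrow> (\<forall>i<length ms. ms ! i dvd (k::nat))"
  using coordinates.order_eq[OF assms(1)] coordinates.order_eq[OF assms(2)]
    coordinates.exponent_iff[OF assms(1), of k] coordinates.exponent_iff[OF assms(2), of k] by auto

lemma prod_list_nth: "prod_list ns = (\<Prod>i<length ns. ns ! i :: nat)"
  by (induction ns) (simp_all add: prod.lessThan_Suc_shift del: prod.lessThan_Suc)

text \<open>
  The groups in question are determined by their order and exponent.
\<close>
lemma invariant_factors_unique_small:
  assumes c: "coordinates G ns h" and G: "group G"
  shows "n \<in> {2, 3} \<Longrightarrow> G \<cong> integer_mod_group n \<longleftrightarrow> ns = [n]"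
    and "G \<cong> integer_mod_group 4 \<longleftrightarrow> ns = [4]"
    and "G \<cong> cyclic_power 2 r \<longleftrightarrow> ns = replicate r 2"
proof -
  have gt: "\<forall>n\<in>set ns. 1 < n" and cg: "comm_group G" and iso: "G \<cong> invariant_product ns"
    using c by (auto simp: coordinates_def is_iso_def)
  have other: "\<exists>f. coordinates G ms f" if "G \<cong> invariant_product ms" "\<forall>n\<in>set ms. 1 < n" for ms
    using that cg unfolding coordinates_def is_iso_def by auto
  have single: "G \<cong> integer_mod_group n \<longleftrightarrow> G \<cong> invariant_product [n]" if "1 < n" for n
    using iso_trans[of G] iso_invariant_product_single[OF that] group.iso_sym[of "invariant_product [n]"] by (metis group_invariant_product)
  have prod: "prod_list ns = prod_list ms" if "G \<cong> invariant_product ms" "\<forall>n\<in>set ms. 1 < n" for ms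
    using coordinates_compare(1)[OF c] other[OF that] by (auto simp: prod_list_nth)
  have dvd: "(\<forall>i<length ns. ns ! i dvd k) \<longleftrightarrow> (\<forall>i<length ms. ms ! i dvd (k::nat))" if "G \<cong> invariant_product ms" "\<forall>n\<in>set ms. 1 < n" for ms k
    using coordinates_compare(2)[OF c] other[OF that] by blast
  show "G \<cong> integer_mod_group n \<longleftrightarrow> ns = [n]" if n: "n \<in> {2, 3}"
  proof
    assume "G \<cong> integer_mod_group n"
    then have "prod_list ns = n" using prod[of "[n]"] single[of n] n by auto
    then show "ns = [n]" using prod_list_small(1,2)[OF gt] n by auto
  qed (use iso single[of n] n in auto)
  show "G \<cong> integer_mod_group 4 \<longleftrightarrow> ns = [4]"
  proof
    assume "G \<cong> integer_mod_group 4"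
    then have i: "G \<cong> invariant_product [4]" using single[of 4] by simp
    then have "ns = [4] \<or> ns = [2, 2]" using prod[of "[4]"] prod_list_small(3)[OF gt] by simp
    moreover have "ns \<noteq> [2, 2]" using dvd[OF i, of 2] by (auto simp: less_Suc_eq)
    ultimately show "ns = [4]" by blast
  qed (use iso single[of 4] in auto)
  show "G \<cong> cyclic_power 2 r \<longleftrightarrow> ns = replicate r 2"
  proof
    assume i: "G \<cong> cyclic_power 2 r"
    have "ns ! i dvd 2" if "i < length ns" for i using dvd[of "replicate r 2" 2] i that by (auto simp: cyclic_power_eq)
    then have "ns ! i = 2" if "i < length ns" for i using that gt by (metis dvd_imp_le le_antisym nth_mem Suc_leI one_add_one plus_1_eq_Suc zero_less_numeral)
    then have ns: "ns = replicate (length ns) 2" by (intro nth_equalityI) auto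
    have "prod_list ns = prod_list (replicate r 2)" using prod[of "replicate r 2"] i by (auto simp: cyclic_power_eq)
    then have "(2::nat) ^ length ns = 2 ^ r" by (subst (asm) ns) (simp add: prod_list_replicate)
    then show "ns = replicate r 2" using ns by simp
  qed (use iso in \<open>simp add: cyclic_power_eq\<close>)
qed

lemma Dstar_eq: "Dstar G = dstar (invariant_factors G)" by (simp add: Dstar_def dstar_def)

lemma eq_enat_iff:
  assumes "\<And>N. t \<le> enat N \<longleftrightarrow> T N" shows "t = enat k \<longleftrightarrow> T k \<and> (\<forall>M. T M \<longrightarrow> k \<le> M)"
proof
  assume "t = enat k" then show "T k \<and> (\<forall>M. T M \<longrightarrow> k \<le> M)" using assms by fastforce
next
  assume *: "T k \<and> (\<forall>M. T M \<longrightarrow> k \<le> M)"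
  then have "t \<le> enat k" using assms by blast
  then obtain m where m: "t = enat m" by (cases t) auto
  then have "T m" using assms by force
  then have "k \<le> m" using * by blast
  then show "t = enat k" using \<open>t \<le> enat k\<close> m by simp
qed

lemma tame_bound_nil: "tame_bound (blocks [] P d) 0"
proof (rule tame_boundI[OF saturated_blocks])
  fix u :: "'a multiset" and Q
  assume u: "u \<in> irreducibles (blocks [] P d)"
    and Q: "\<Sum>\<^sub># (image_mset fst Q) = u" "\<forall>(x, v) \<in># Q. x \<noteq> {#} \<and> x \<subseteq># v \<and> v \<in> irreducibles (blocks [] P d)"
    and 2: "2 \<le> size Q"
  obtain p where "p \<in># u" using irreducible_blockD(3)[OF u] by blast
  then have "\<not> zero_sum [] d {#p#}" using cover_no_zero_prime(2)[OF u Q 2] by blast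
  then show "size Q \<le> 0 \<and> (\<exists>y\<in>decompositions (blocks [] P d) (\<Sum>\<^sub># (image_mset snd Q) - u). Suc (size y) \<le> 0)"
    by (simp add: zero_sum_def)
qed

text \<open>
  With one prime \<open>p\<close> in the nontrivial class, \<open>p\<^sup>2\<close> and the primes in the zero class are the only atoms,
  and factorizations are unique.
\<close>
lemma tame_bound_2_inj:
  assumes inj: "\<And>p q. p \<in> P \<Longrightarrow> q \<in> P \<Longrightarrow> zero_sum [2] d {#p, q#} \<Longrightarrow> p = q"
  shows "tame_bound (blocks [2] P d) 0"
proof (rule tame_boundI[OF saturated_blocks])
  let ?B = "blocks [2] P d"
  fix u Q
  assume u: "u \<in> irreducibles ?B"
    and Q: "\<Sum>\<^sub># (image_mset fst Q) = u" "\<forall>(x, v) \<in># Q. x \<noteq> {#} \<and> x \<subseteq># v \<and> v \<in> irreducibles ?B"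
    and 2: "2 \<le> size Q" and min: "\<forall>Q'. u \<subseteq># \<Sum>\<^sub># (image_mset snd Q') \<longrightarrow> Q' \<subseteq># Q \<longrightarrow> Q' = Q"
  note c = cover_no_zero_prime[OF u Q 2]
  have pair: "w = {#p, p#}" if w: "w \<in> irreducibles ?B" "p \<in># w" and nz: "\<And>p. p \<in># w \<Longrightarrow> \<not> zero_sum [2] d {#p#}" for w p
  proof -
    obtain w' where w': "w = add_mset p w'" using w(2) by (metis mset_add)
    have "w' \<noteq> {#}" using nz[OF w(2)] irreducible_blockD(2)[OF w(1)] w' by auto
    then obtain q where q: "q \<in># w'" by blast
    have "odd (d p 0)" "odd (d q 0)" using nz[of p] nz[of q] w' q by (auto simp: zero_sum_def)
    then have z: "zero_sum [2] d {#p, q#}" by (simp add: zero_sum_def)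
    moreover have "p \<in> P" "q \<in> P" using irreducible_blockD(1)[OF w(1)] w' q by auto
    ultimately have "p = q" using inj by blast
    have "{#p, q#} \<subseteq># w" using w' q by (simp add: insert_subset_eq_iff)
    then have "w = {#p, q#}" using irreducible_blockD(4)[OF w(1) _ z] by simp
    then show ?thesis using \<open>p = q\<close> by simp
  qed
  obtain p where p: "p \<in># u" using irreducible_blockD(3)[OF u] by blast
  obtain x v where xv: "(x, v) \<in># Q" "p \<in># x" using p Q(1) by force
  have v: "v \<in> irreducibles ?B" "p \<in># v" using Q(2) xv by (auto dest: mset_subset_eqD)
  have "\<And>p. p \<in># v \<Longrightarrow> \<not> zero_sum [2] d {#p#}" using c(1) xv(1) by force
  then have "v = u" using pair[OF v] pair[OF u p c(2)] by simp
  moreover have "{#(x, v)#} \<subseteq># Q" using xv(1) by simp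
  ultimately have "{#(x, v)#} = Q" using min by simp
  then show "size Q \<le> 0 \<and> (\<exists>y\<in>decompositions ?B (\<Sum>\<^sub># (image_mset snd Q) - u). Suc (size y) \<le> 0)" using 2 by auto
qed

text \<open>
  In the monoid of zero-sum sequences over \<open>G\<close> every class contains one prime. For the trivial group and for \<open>C\<^sub>2\<close>
  the tame degree is \<open>0\<close>, which is smaller than \<open>D\<^sup>*\<close>.
\<close>
theorem tame_degree_zero_sum_eq_dstar_iff:
  assumes c: "coordinates G ns h" and srt: "sorted_wrt (dvd) ns"
  shows "tame_degree (zero_sum_monoid G (carrier G)) = enat (dstar ns) \<longleftrightarrow> ns \<in> {[3], [4], [2, 2], [2, 2, 2]}"
proof -
  interpret coordinates G ns h by (rule c)
  let ?B = "blocks ns (carrier G) h"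
  have cb: "covered_blocks ns (carrier G) h" by (rule covered_blocks.intro[OF ns_gt_1 covers_G])
  have t: "tame_degree (zero_sum_monoid G (carrier G)) = enat (dstar ns) \<longleftrightarrow> tame_bound ?B (dstar ns) \<and> (\<forall>M. tame_bound ?B M \<longrightarrow> dstar ns \<le> M)"
    by (rule eq_enat_iff) (rule tame_degree_zero_sum_monoid)
  have inj: "p = q" if "p \<in> carrier G" "q \<in> carrier G" "zero_sum ns h {#p, q#}" "\<forall>n\<in>set ns. n = 2" for p q
  proof (rule h_inj[OF that(1,2)])
    fix i assume i: "i < length ns"
    then have "ns ! i = 2" using that(4) by auto
    moreover have "int (ns ! i) dvd h p i + h q i" using that(3) i by (simp add: zero_sum_def)
    ultimately show "[h p i = h q i] (mod int (ns ! i))" by (simp add: cong_iff_dvd_diff)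
  qed
  show ?thesis
  proof (cases "ns \<in> {[3], [4], [2, 2], [2, 2, 2]}")
    case True
    have "3 \<le> dstar ns" using True by (auto simp: dstar_def)
    then have "\<forall>M. tame_bound ?B M \<longrightarrow> dstar ns \<le> M" using covered_blocks.tame_bound_ge_Dst[OF cb] by blast
    moreover have "tame_bound ?B (dstar ns)"
    proof -
      consider n where "n \<in> {3, 4}" "ns = [n]" | "ns = [2, 2]" | "ns = [2, 2, 2]" using True by auto
      then show ?thesis
      proof cases
        case 1
        then have "1 \<le> n" "n \<in> {2, 3, 4}" by auto
        then have "dstar ns = n" using 1(2) by (simp add: dstar_def)
        then show ?thesis using tame_bound_cyclic_le[OF \<open>n \<in> {2, 3, 4}\<close>, of "carrier G" h] 1(2) by simp
      next
        case 2
        moreover have "dstar [2, 2] = 3" by (simp add: dstar_def)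
        ultimately show ?thesis using tame_bound_22_le[of "carrier G" h] by simp
      next
        case 3 
        have "tame_bound (blocks [2, 2, 2] (carrier G) h) 4"
        proof (rule tame_bound_222_le)
          fix p q assume pq: "p \<in> carrier G" "q \<in> carrier G" "zero_sum [2, 2, 2] h {#p, q#}"
          show "p = q" by (rule inj[OF pq(1,2)]) (use pq(3) 3 in simp_all)
        qed
        moreover have "dstar [2, 2, 2] = 4" by (simp add: dstar_def)
        ultimately show ?thesis using 3 by simp
      qed
    qed
    ultimately show ?thesis using t True by blast
  next
    case False
    have "\<not> (tame_bound ?B (dstar ns) \<and> (\<forall>M. tame_bound ?B M \<longrightarrow> dstar ns \<le> M))"
    proof (cases "ns \<in> {[], [2]}")
      case True
      have "tame_bound ?B 0"
      proof (cases "ns = []")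
        case True then show ?thesis using tame_bound_nil[of "carrier G" h] by simp
      next
        case False
        then have "ns = [2]" using \<open>ns \<in> {[], [2]}\<close> by simp
        moreover have "tame_bound (blocks [2] (carrier G) h) 0"
        proof (rule tame_bound_2_inj)
          fix p q assume pq: "p \<in> carrier G" "q \<in> carrier G" "zero_sum [2] h {#p, q#}"
          show "p = q" by (rule inj[OF pq(1,2)]) (use pq(3) \<open>ns = [2]\<close> in simp_all)
        qed
        ultimately show ?thesis by simp
      qed
      moreover have "0 < dstar ns" by (simp add: dstar_def)
      ultimately show ?thesis by fastforce
    next
      case F: False
      then have "Suc (dstar ns) \<le> dstar ns" if "tame_bound ?B (dstar ns)" using covered_blocks.tame_bound_gt_Dst[OF cb srt _ that] False by simp
      then show ?thesis by fastforce
    qed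
    then show ?thesis using t False by blast
  qed
qed

locale krull_coordinates =
  fixes H :: "('a, 'm) monoid_scheme" and P :: "'p set" and \<phi> and ns :: "nat list" and h
  assumes krull: "krull_finite_primes_everywhere H P \<phi>" and coordinates: "coordinates (class_group H P \<phi>) ns h"
begin

abbreviation "d p \<equiv> h (divisor_class H P \<phi> p)"

lemma embedding: "divisor_embedding H P \<phi>"
  using krull by (simp add: krull_finite_primes_everywhere_def krull_monoid_def divisor_theory_def divisor_embedding_def)

lemma covers: "covers ns P d"
  using divisor_embedding.covers_primes[OF embedding coordinates] krull by (simp add: krull_finite_primes_everywhere_def)

lemma gt_1: "\<forall>n\<in>set ns. 1 < n"
  using coordinates by (simp add: coordinates_def)

lemma covered: "covered_blocks ns P d"
  using covers gt_1 by (rule covered_blocks.intro[rotated])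

lemma image_blocks: "\<phi> ` carrier H = blocks ns P d"
  by (rule divisor_embedding.image_eq_blocks[OF embedding coordinates])

lemma tame_degree_le: "tame_degree H \<le> enat N \<longleftrightarrow> tame_bound (blocks ns P d) N"
  using divisor_embedding.tame_degree_le_iff[OF embedding, of N] image_blocks by simp

lemma two_primes: "ns = [2] \<Longrightarrow> \<exists>p\<in>P. \<exists>q\<in>P. p \<noteq> q \<and> odd (d p 0) \<and> odd (d q 0)"
  using two_primes_of_divisor_theory[of H P \<phi> d] image_blocks covers krull
  by (simp add: krull_finite_primes_everywhere_def krull_monoid_def)

lemma davenport_eq_SUP: "davenport (class_group H P \<phi>) (carrier (class_group H P \<phi>)) = (SUP U\<in>irreducibles (blocks ns P d). enat (size U))"
  using coordinates.davenport_eq[OF coordinates] SUP_irreducible_size_eq[OF coordinates.covers_G[OF coordinates] covers] by simp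

text \<open>
  The second prime in a class changes the answer for two groups: \<open>C\<^sub>2\<close> enters the list since its factorizations are no longer
  unique, and \<open>C\<^sub>2\<^sup>3\<close> leaves it.
\<close>
theorem tame_degree_eq_dstar_iff:
  assumes srt: "sorted_wrt (dvd) ns"
    and two: "\<exists>g\<in>carrier (class_group H P \<phi>). g \<noteq> \<one>\<^bsub>class_group H P \<phi>\<^esub> \<and>
       (\<exists>p\<in>P. \<exists>q\<in>P. p \<noteq> q \<and> divisor_class H P \<phi> p = g \<and> divisor_class H P \<phi> q = g)"
  shows "tame_degree H = enat (dstar ns) \<longleftrightarrow> ns \<in> {[2], [3], [4], [2, 2]}"
proof -
  let ?B = "blocks ns P d"
  have t: "tame_degree H = enat (dstar ns) \<longleftrightarrow> tame_bound ?B (dstar ns) \<and> (\<forall>M. tame_bound ?B M \<longrightarrow> dstar ns \<le> M)"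
    by (rule eq_enat_iff) (rule tame_degree_le)
  obtain g p q where g: "g \<in> carrier (class_group H P \<phi>)" "g \<noteq> \<one>\<^bsub>class_group H P \<phi>\<^esub>"
    and pq: "p \<in> P" "q \<in> P" "p \<noteq> q" "divisor_class H P \<phi> p = g" "divisor_class H P \<phi> q = g" using two by blast
  obtain i where i: "i < length ns" "\<not> int (ns ! i) dvd h g i" using coordinates.one_iff[OF coordinates g(1)] g(2) by blast
  have nz: "\<not> zero_sum ns d {#p#}" using i pq by (auto simp: zero_sum_def)
  show ?thesis
  proof (cases "ns \<in> {[2], [3], [4], [2, 2]}")
    case True
    have "tame_bound ?B (dstar ns)"
    proof -
      consider n where "n \<in> {2, 3, 4}" "ns = [n]" | "ns = [2, 2]" using True by auto
      then show ?thesis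
      proof cases
        case 1
        then have "1 \<le> n" by auto
        then have "dstar ns = n" using 1(2) by (simp add: dstar_def)
        then show ?thesis using tame_bound_cyclic_le[OF 1(1), of P d] 1(2) by simp
      next
        case 2
        moreover have "dstar [2, 2] = 3" by (simp add: dstar_def)
        ultimately show ?thesis using tame_bound_22_le[of P d] by simp
      qed
    qed
    moreover have "dstar ns \<le> M" if M: "tame_bound ?B M" for M
    proof (cases "ns = [2]")
      case True
      have "odd (h g 0)" using i True by simp
      then have "2 \<le> M" using tame_bound_2_two_primes_ge[of p P q d M] pq M True by simp
      then show ?thesis using True by (simp add: dstar_def)
    next
      case False
      then have "3 \<le> dstar ns" using True by (auto simp: dstar_def)
      then show ?thesis using covered_blocks.tame_bound_ge_Dst[OF covered _ M] by blast
    qed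
    ultimately show ?thesis using t True by blast
  next
    case False
    have "dstar ns + 1 \<le> M" if M: "tame_bound ?B M" for M
    proof (cases "ns = [2, 2, 2]")
      case True
      have "5 \<le> M" by (rule covered_blocks.tame_bound_222_two_primes_ge[OF covered True pq(1-3) _ nz M]) (simp add: pq)
      then show ?thesis using True by (simp add: dstar_def)
    next
      case F: False
      have "ns \<noteq> []" using i by auto
      then show ?thesis using covered_blocks.tame_bound_gt_Dst[OF covered srt _ M] False F by simp
    qed
    then have "\<not> tame_bound ?B (dstar ns)" by fastforce
    then show ?thesis using t False by blast
  qed
qed

text \<open>
  The quadratic lower bound requires \<open>s + 1\<close> to be divisible by all \<open>n\<^sub>i\<close> and \<open>2 s \<le> r\<close>; if \<open>s + 1\<close> is the
  largest such multiple of \<open>E\<close>, then \<open>r \<le> 4 s\<close>, provided that \<open>r \<ge> 4 E\<close>. For smaller ranks any positive lower bound is enough.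
\<close>
lemma growth_bounds:
  assumes ne: "ns \<noteq> []" and E: "2 \<le> E" "\<And>i. i < length ns \<Longrightarrow> ns ! i dvd E"
  obtains D t where "davenport (class_group H P \<phi>) (carrier (class_group H P \<phi>)) = enat D" "tame_degree H = enat t"
    "length ns \<le> D" "1 \<le> D" "D \<le> E * E * length ns" "t \<le> 1 + D * (D - 1) div 2" "real (length ns * length ns) \<le> 16 * (E * E) * t"
proof -
  let ?B = "blocks ns P d" and ?r = "length ns"
  have r0: "0 < ?r" using ne by simp
  have nsE: "0 < ns ! i \<and> ns ! i dvd E" if "i < ?r" for i using gt_1 that E(2) by (auto intro: less_trans[OF zero_less_one])
  have nsE': "ns ! i \<le> E" if "i < ?r" for i using nsE[OF that] E(1) by (auto intro: dvd_imp_le)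
  have size_le: "size u \<le> E * E * ?r" if "u \<in> irreducibles ?B" for u by (rule irreducible_size_le[OF nsE E(1) r0 that])
  obtain u0 where u0: "u0 \<in> irreducibles ?B" "size u0 = dstar ns" using covered_blocks.ex_irreducible_size_Dst[OF covered] by blast
  define D where "D = Max (size ` irreducibles ?B)"
  have fin: "finite (size ` irreducibles ?B)"
  proof (rule finite_subset)
    show "size ` irreducibles ?B \<subseteq> {..E * E * ?r}" by (rule image_subsetI, rule atMost_iff[THEN iffD2], rule size_le)
  qed simp
  have D_in: "D \<in> size ` irreducibles ?B" unfolding D_def by (rule Max_in[OF fin]) (use u0 in auto)
  have D_ge: "size u \<le> D" if "u \<in> irreducibles ?B" for u unfolding D_def by (rule Max_ge[OF fin]) (use that in auto)
  have dav: "davenport (class_group H P \<phi>) (carrier (class_group H P \<phi>)) = enat D"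
    unfolding davenport_eq_SUP using D_in D_ge by (intro antisym SUP_least) (auto intro: SUP_upper)
  have "?r + 1 \<le> dstar ns"
  proof -
    have "length ms \<le> (\<Sum>n\<leftarrow>ms. n - 1)" if "\<forall>n\<in>set ms. 1 < n" for ms :: "nat list" using that by (induction ms) auto
    then show ?thesis using gt_1 by (simp add: dstar_def)
  qed
  then have rD: "?r + 1 \<le> D" using D_ge[OF u0(1)] u0(2) by simp
  have tb: "tame_bound ?B (1 + D * (D - 1) div 2)" by (rule tame_bound_davenport_le[OF D_ge]) (use rD in auto)
  then have "tame_degree H \<le> enat (1 + D * (D - 1) div 2)" using tame_degree_le by blast
  then obtain t where t: "tame_degree H = enat t" "t \<le> 1 + D * (D - 1) div 2" by (cases "tame_degree H") auto
  then have T: "tame_bound ?B t" using tame_degree_le[of t] by simp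
  have t1: "1 \<le> t"
  proof (cases "ns = [2]")
    case True
    obtain p q where pq: "p \<in> P" "q \<in> P" "p \<noteq> q" "odd (d p 0)" "odd (d q 0)" using two_primes[OF True] by blast
    have "tame_bound (blocks [2] P d) t" using T True by simp
    then have "2 \<le> t" by (rule tame_bound_2_two_primes_ge[of p P q d t, OF pq])
    then show ?thesis by simp
  next
    case False
    have "3 \<le> dstar ns"
    proof (cases "?r = 1")
      case True
      then obtain n where "ns = [n]" by (metis One_nat_def length_0_conv length_Suc_conv)
      then show ?thesis using False gt_1 by (simp add: dstar_def)
    next
      case F: False
      then show ?thesis using \<open>?r + 1 \<le> dstar ns\<close> r0 by linarith
    qed
    then show ?thesis using covered_blocks.tame_bound_ge_Dst[OF covered _ T] by linarith
  qed
  have quad: "real (?r * ?r) \<le> 16 * (E * E) * t"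
  proof (cases "?r < 4 * E")
    case True
    then have "?r * ?r \<le> (4 * E) * (4 * E)" by (intro mult_le_mono) auto
    also have "\<dots> \<le> 16 * (E * E) * t" using t1 by simp
    finally show ?thesis by (metis of_nat_le_iff)
  next
    case False
    \<comment> \<open>The largest \<open>k\<close> such that \<open>s = E k - 1\<close> satisfies \<open>2 s \<le> r\<close>.\<close>
    define k where "k = (?r + 2) div (2 * E)"
    define s where "s = E * k - 1"
    have "(4 * E + 2) div (2 * E) \<le> k" unfolding k_def using False by (intro div_le_mono) simp
    moreover have "2 \<le> (4 * E + 2) div (2 * E)" using E(1) by (simp add: div_add1_eq less_eq_div_iff_mult_less_eq)
    ultimately have k1: "2 \<le> k" by simp
    have Ek: "2 * E \<le> E * k" using k1 by simp
    have s1: "1 \<le> s" "s + 1 = E * k" using Ek E(1) unfolding s_def by linarith+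
    have "2 * E * k \<le> ?r + 2" unfolding k_def by simp
    then have s2: "2 * s \<le> ?r" using s1(2) by (simp add: mult.assoc)
    have "?r + 2 < 2 * E * (k + 1)" unfolding k_def using E(1) by (simp add: dividend_less_times_div mult.commute)
    then have "?r \<le> 2 * (s + 1) + 2 * E" using s1(2) by (simp add: algebra_simps)
    moreover have "2 * E \<le> s + 1" using s1(2) Ek by simp
    ultimately have r4: "?r \<le> 4 * s" using E(1) by presburger
    have "ns ! i dvd s + 1" if "i < ?r" for i unfolding s1(2) using E(2)[OF that] by simp
    then have "real (s * s) \<le> E * t" using covered_blocks.tame_bound_quadratic_ge[OF covered s1(1) s2 _ nsE' T] by blast
    then have st: "s * s \<le> E * t" by (metis of_nat_le_iff of_nat_mult)
    have "?r * ?r \<le> (4 * s) * (4 * s)" using r4 by (intro mult_le_mono)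
    also have "\<dots> \<le> 16 * (E * t)" using st by simp
    also have "\<dots> \<le> 16 * (E * E) * t" using E(1) by simp
    finally show ?thesis by (metis of_nat_le_iff)
  qed
  show thesis using that[OF dav t(1) _ _ _ t(2) quad] rD D_in size_le by auto
qed

end

section \<open>Countable models\<close>

lemma count_image_mset_inj_on:
  assumes "inj_on f A" "set_mset S \<subseteq> A" "p \<in> A" shows "count (image_mset f S) (f p) = count S p"
  using assms(2) by (induction S) (use assms(1,3) in \<open>auto simp: inj_on_eq_iff\<close>)

text \<open>
  Greatest common divisors are formed in each multiplicity separately, so they are preserved by renaming primes
  injectively.
\<close>
lemma Inf_image_mset:
  assumes inj: "inj_on f A" and M: "M \<noteq> {}" "\<And>S. S \<in> M \<Longrightarrow> set_mset S \<subseteq> A"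
  shows "Inf (image_mset f ` M) = image_mset f (Inf M)"
proof (rule multiset_eqI)
  fix y
  have "Inf M \<subseteq># S" if "S \<in> M" for S using that by (intro subset_mset.cInf_lower) auto
  then have A: "set_mset (Inf M) \<subseteq> A" using M by (metis ex_in_conv set_mset_mono subset_trans)
  have cnt: "count (Inf (image_mset f ` M)) y = (INF S\<in>M. count (image_mset f S) y)"
    using M(1) by (simp add: count_Inf_multiset_nonempty image_image)
  show "count (Inf (image_mset f ` M)) y = count (image_mset f (Inf M)) y"
  proof (cases "y \<in> f ` A")
    case True
    then obtain p where p: "p \<in> A" "y = f p" by blast
    have "(INF S\<in>M. count (image_mset f S) y) = (INF S\<in>M. count S p)"
      unfolding p(2) by (rule INF_cong[OF refl]) (rule count_image_mset_inj_on[OF inj M(2) p(1)])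
    also have "\<dots> = count (Inf M) p" using M(1) by (simp add: count_Inf_multiset_nonempty)
    also have "\<dots> = count (image_mset f (Inf M)) y" unfolding p(2) by (rule count_image_mset_inj_on[OF inj A p(1), symmetric])
    finally show ?thesis using cnt by simp
  next
    case False
    have zero: "count (image_mset f S) y = 0" if "set_mset S \<subseteq> A" for S
      using that False by (metis (no_types, lifting) count_inI image_mono set_image_mset subsetD)
    have "(INF S\<in>M. count (image_mset f S) y) = (INF S\<in>M. 0)" by (rule INF_cong[OF refl]) (rule zero[OF M(2)])
    also have "\<dots> = 0" using M(1) by simp
    finally show ?thesis using cnt zero[OF A] by simp
  qed
qed

text \<open>
  Keep all primes of a class with finitely many, and countably infinitely many of any other class. A finite
  set of primes can be moved into the remaining set without leaving the classes and without moving
  the primes that are already there.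
\<close>
lemma countable_local_retract:
  assumes "countable (c ` P)"
  obtains P' where "P' \<subseteq> P" "countable P'"
    "\<And>P0. finite P0 \<Longrightarrow> P0 \<subseteq> P \<Longrightarrow> \<exists>f. inj_on f P0 \<and> f ` P0 \<subseteq> P' \<and> (\<forall>p\<in>P0. c (f p) = c p) \<and> (\<forall>p\<in>P0 \<inter> P'. f p = p)"
proof -
  have "\<exists>A. A \<subseteq> {p \<in> P. c p = g} \<and> countable A \<and> (finite A \<longrightarrow> A = {p \<in> P. c p = g})" for g
  proof (cases "finite {p \<in> P. c p = g}")
    case True then show ?thesis by (intro exI[of _ "{p \<in> P. c p = g}"]) (simp add: countable_finite)
  next
    case False then show ?thesis using infinite_countable_subset' by blast
  qed
  then obtain A where A: "\<And>g. A g \<subseteq> {p \<in> P. c p = g}" "\<And>g. countable (A g)" "\<And>g. finite (A g) \<Longrightarrow> A g = {p \<in> P. c p = g}" by metis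
  define P' where "P' = (\<Union>g\<in>c ` P. A g)"
  have sub: "P' \<subseteq> P" using A(1) by (auto simp: P'_def)
  have ext: "\<exists>f. inj_on f (P1 \<union> R) \<and> f ` (P1 \<union> R) \<subseteq> P' \<and> (\<forall>p\<in>P1 \<union> R. c (f p) = c p) \<and> (\<forall>p\<in>P1. f p = p)"
    if P1: "finite P1" "P1 \<subseteq> P'" and R: "finite R" "R \<subseteq> P - P'" for P1 R
    using R
  proof (induction R rule: finite_induct)
    case empty
    show ?case using P1(2) by (intro exI[of _ id]) auto
  next
    case (insert p R)
    then obtain f where f: "inj_on f (P1 \<union> R)" "f ` (P1 \<union> R) \<subseteq> P'" "\<forall>p\<in>P1 \<union> R. c (f p) = c p" "\<forall>p\<in>P1. f p = p" by auto
    have p: "p \<in> P" "p \<notin> P'" "p \<notin> P1 \<union> R" using insert.prems insert.hyps P1(2) by auto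
    have "p \<notin> A (c p)" using p(1,2) by (auto simp: P'_def)
    \<comment> \<open>As \<open>p\<close> was discarded, its class has infinitely many primes, and one of those kept is still free.\<close>
    then have "infinite (A (c p))" using A(3)[of "c p"] p(1) by auto
    moreover have "finite (f ` (P1 \<union> R))" using P1(1) insert.hyps(1) by simp
    ultimately obtain q where q: "q \<in> A (c p)" "q \<notin> f ` (P1 \<union> R)" by (metis finite_subset subsetI)
    have q': "c q = c p" "q \<in> P'" using q(1) A(1)[of "c p"] p(1) by (auto simp: P'_def)
    have pP1: "p' \<noteq> p" if "p' \<in> P1 \<union> R" for p' using that p(3) by blast
    let ?f = "f(p := q)"
    have i: "inj_on ?f (P1 \<union> R)" by (rule inj_on_fun_updI[OF f(1) q(2)])
    have im: "?f ` (P1 \<union> R) = f ` (P1 \<union> R)" using pP1 by (intro image_cong) auto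
    have "inj_on ?f (insert p (P1 \<union> R))" using i q(2) im p(3) by simp
    moreover have "?f ` (insert p (P1 \<union> R)) \<subseteq> P'" using im f(2) q'(2) unfolding image_insert by (simp only: fun_upd_same insert_subset simp_thms)
    moreover have "\<forall>p'\<in>insert p (P1 \<union> R). c (?f p') = c p'" using f(3) q'(1) by simp
    moreover have "\<forall>p'\<in>P1. ?f p' = p'" using f(4) pP1 by simp
    ultimately show ?case unfolding Un_insert_right by blast
  qed
  show thesis
  proof (rule that[OF sub])
    show "countable P'" unfolding P'_def using assms A(2) by (intro countable_UN) auto
    fix P0 assume P0: "finite P0" "P0 \<subseteq> P"
    have "P0 = (P0 \<inter> P') \<union> (P0 - P')" by blast
    then show "\<exists>f. inj_on f P0 \<and> f ` P0 \<subseteq> P' \<and> (\<forall>p\<in>P0. c (f p) = c p) \<and> (\<forall>p\<in>P0 \<inter> P'. f p = p)"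
      using ext[of "P0 \<inter> P'" "P0 - P'"] P0 by (metis Diff_mono finite_Diff finite_Int inf_le2 order_refl)
  qed
qed

text \<open>
  A tame bound concerns the factorizations of one element at a time, and these involve finitely many primes only. So it is enough
  to embed finite sets of primes.
\<close>
lemma tame_bound_local_embedding:
  assumes t: "tame_bound (blocks ns P' d') N"
    and emb: "\<And>P0. finite P0 \<Longrightarrow> P0 \<subseteq> P \<Longrightarrow>
      \<exists>f. inj_on f P0 \<and> f ` P0 \<subseteq> P' \<and> (\<forall>p\<in>P0. \<forall>i<length ns. [d' (f p) i = d p i] (mod int (ns ! i)))"
  shows "tame_bound (blocks ns P d) N"
  unfolding tame_bound_def
proof (intro ballI allI impI)
  let ?B = "blocks ns P d" and ?B' = "blocks ns P' d'"
  fix u a z assume u: "u \<in> irreducibles ?B" and z: "z \<in> decompositions ?B a" and "\<exists>y\<in>decompositions ?B a. u \<in># y"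
  then obtain y0 where y0: "y0 \<in> decompositions ?B a" "u \<in># y0" by blast
  have part: "w \<subseteq># b" if "w \<in># y" "\<Sum>\<^sub># y = b" for w b :: "'c multiset" and y
    using that by (metis mset_subset_eq_add_left sum_mset.remove)
  have zP: "set_mset w \<subseteq> P" if "w \<in># z" for w
    using that z irreducible_blockD(1)[of w ns P d] unfolding decompositions_def by blast
  have "a = \<Sum>\<^sub># z" using z by (simp add: decompositions_def)
  then have "set_mset a \<subseteq> P" using zP by auto
  then obtain f where f: "inj_on f (set_mset a)" "f ` set_mset a \<subseteq> P'"
    "\<And>p i. p \<in># a \<Longrightarrow> i < length ns \<Longrightarrow> [d' (f p) i = d p i] (mod int (ns ! i))" using emb[OF finite_set_mset] by metis
  define g where "g = inv_into (set_mset a) f"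
  let ?f = "image_mset f" and ?g = "image_mset g"
  have gf: "?g (?f w) = w" if "set_mset w \<subseteq> set_mset a" for w
  proof -
    have "?g (?f w) = image_mset id w" unfolding image_mset.compositionality
      by (rule image_mset_cong) (use that f(1) in \<open>auto simp: g_def inv_into_f_f\<close>)
    then show ?thesis by simp
  qed
  have fg: "?f (?g w) = w" if "set_mset w \<subseteq> f ` set_mset a" for w
  proof -
    have "?f (?g w) = image_mset id w" unfolding image_mset.compositionality
      by (rule image_mset_cong) (use that in \<open>auto simp: g_def f_inv_into_f\<close>)
    then show ?thesis by simp
  qed
  have push: "image_mset ?f y \<in> decompositions ?B' (?f a)" if y: "y \<in> decompositions ?B a" for y
  proof -
    have y': "set_mset y \<subseteq> irreducibles ?B" "\<Sum>\<^sub># y = a" using y by (auto simp: decompositions_def)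
    have "?f w \<in> irreducibles ?B'" if w: "w \<in># y" for w
    proof (rule irreducible_image_class)
      show "w \<in> irreducibles ?B" using y'(1) w by blast
      have "set_mset w \<subseteq> set_mset a" using part[OF w y'(2)] by (rule set_mset_mono)
      then have wa: "p \<in># a" if "p \<in># w" for p using that by blast
      show "[d' (f p) i = d p i] (mod int (ns ! i))" if "p \<in># w" "i < length ns" for p i
        using f(3)[OF wa[OF that(1)] that(2)] .
      show "f p \<in> P'" if "p \<in># w" for p using wa[OF that] f(2) by blast
    qed
    moreover have "\<Sum>\<^sub># (image_mset ?f y) = ?f a" unfolding y'(2)[symmetric] by (induction y) auto
    ultimately show ?thesis unfolding decompositions_def by auto
  qed
  have au: "set_mset u \<subseteq> set_mset a" by (rule set_mset_mono, rule part[OF y0(2)]) (use y0(1) in \<open>simp add: decompositions_def\<close>)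
  have u': "?f u \<in> irreducibles ?B'" "?f u \<in># image_mset ?f y0" using push[OF y0(1)] y0(2) by (auto simp: decompositions_def)
  then obtain y' where y': "y' \<in> decompositions ?B' (?f a)" "?f u \<in># y'" "fact_dist (image_mset ?f z) y' \<le> N"
    using t push[OF z] push[OF y0(1)] unfolding tame_bound_def by blast
  have y's: "set_mset w \<subseteq> f ` set_mset a" if w: "w \<in># y'" for w
  proof -
    have "w \<subseteq># ?f a" by (rule part[OF w]) (use y'(1) in \<open>simp add: decompositions_def\<close>)
    then show ?thesis using set_mset_mono by fastforce
  qed
  define y where "y = image_mset ?g y'"
  have y'_eq: "y' = image_mset ?f y"
  proof -
    have "image_mset ?f y = image_mset id y'" unfolding y_def image_mset.compositionality
      by (rule image_mset_cong) (simp add: fg[OF y's])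
    then show ?thesis by simp
  qed
  have pull: "?g w \<in> irreducibles ?B" if w: "w \<in># y'" for w
  proof (rule irreducible_image_class)
    show "w \<in> irreducibles ?B'" using y'(1) w by (auto simp: decompositions_def)
    fix q assume q: "q \<in># w"
    then obtain p where p: "p \<in># a" "q = f p" using y's[OF w] by blast
    have gq: "g q = p" using p f(1) by (simp add: g_def inv_into_f_f)
    show "g q \<in> P" using gq p(1) \<open>set_mset a \<subseteq> P\<close> by blast
    show "[d (g q) i = d' q i] (mod int (ns ! i))" if "i < length ns" for i
      unfolding gq unfolding p(2) using f(3)[OF p(1) that] by (rule cong_sym)
  qed
  have "\<Sum>\<^sub># y = ?g (\<Sum>\<^sub># y')" unfolding y_def by (induction y') auto
  also have "\<Sum>\<^sub># y' = ?f a" using y'(1) by (simp add: decompositions_def)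
  finally have ya: "\<Sum>\<^sub># y = a" using gf by simp
  have y: "y \<in> decompositions ?B a" using pull ya by (auto simp: decompositions_def y_def)
  have "?g (?f u) \<in># y" unfolding y_def using y'(2) by simp
  then have "u \<in># y" using gf[OF au] by simp
  moreover have "fact_dist z y = fact_dist (image_mset ?f z) y'"
    unfolding y'_eq
  proof (rule fact_dist_image_mset[symmetric])
    have "set_mset w \<subseteq> set_mset a" if "w \<in> set_mset z \<union> set_mset y" for w
      using that part[of w z a] part[of w y a] z ya set_mset_mono by (fastforce simp: decompositions_def)
    then show "inj_on ?f (set_mset z \<union> set_mset y)" using gf by (intro inj_on_inverseI[of _ ?g]) blast
  qed
  ultimately show "\<exists>y\<in>decompositions ?B a. u \<in># y \<and> fact_dist z y \<le> N" using y y'(3) by auto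
qed

lemma frag_eq_diff:
  assumes "Poly_Mapping.keys f \<subseteq> Q"
  shows "\<exists>S T. set_mset S \<subseteq> Q \<and> set_mset T \<subseteq> Q \<and> f = frag_of_mset S - frag_of_mset T"
proof (rule free_Abelian_group_induct[OF assms])
  show "\<exists>S T. set_mset S \<subseteq> Q \<and> set_mset T \<subseteq> Q \<and> 0 = frag_of_mset S - frag_of_mset T"
    by (intro exI[of _ "{#}"]) simp
next
  fix f g
  assume "\<exists>S T. set_mset S \<subseteq> Q \<and> set_mset T \<subseteq> Q \<and> f = frag_of_mset S - frag_of_mset T"
    and "\<exists>S T. set_mset S \<subseteq> Q \<and> set_mset T \<subseteq> Q \<and> g = frag_of_mset S - frag_of_mset T"
  then obtain S T S' T' where *: "set_mset S \<subseteq> Q" "set_mset T \<subseteq> Q" "f = frag_of_mset S - frag_of_mset T"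
    "set_mset S' \<subseteq> Q" "set_mset T' \<subseteq> Q" "g = frag_of_mset S' - frag_of_mset T'" by blast
  have "f - g = frag_of_mset (S + T') - frag_of_mset (T + S')" using * by simp
  moreover have "set_mset (S + T') \<subseteq> Q" "set_mset (T + S') \<subseteq> Q" using * by auto
  ultimately show "\<exists>S T. set_mset S \<subseteq> Q \<and> set_mset T \<subseteq> Q \<and> f - g = frag_of_mset S - frag_of_mset T" by blast
next
  fix q assume "q \<in> Q"
  then show "\<exists>S T. set_mset S \<subseteq> Q \<and> set_mset T \<subseteq> Q \<and> frag_of q = frag_of_mset S - frag_of_mset T"
    by (intro exI[of _ "{#q#}"] exI[of _ "{#}"]) simp
qed

lemma comm_group_invariant_product: "comm_group (invariant_product ns)"
  by (rule group.group_comm_groupI[OF group_invariant_product])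
    (auto simp: invariant_product_def add.commute intro: restrict_ext)

text \<open>
  The class of a divisor is given by its coordinate sums, so the class group is the product of the \<open>C\<^bsub>n\<^sub>i\<^esub>\<close>: a
  divisor \<open>S - T\<close> with vanishing coordinate sums becomes a difference of elements of the monoid after
  adding to \<open>S\<close> and \<open>T\<close> a prime in the class \<open>-[T]\<close>.
\<close>
lemma krull_blocks:
  fixes Q :: "'q set"
  assumes gt: "\<forall>n\<in>set ns. 1 < n" and c: "covers ns Q d"
    and gcd: "\<And>q. q \<in> Q \<Longrightarrow> \<exists>X. X \<subseteq> blocks ns Q d \<and> finite X \<and> X \<noteq> {} \<and> Inf X = {#q#}"
  obtains h where "krull_finite_primes_everywhere (multiset_monoid (blocks ns Q d)) Q id"
    "coordinates (class_group (multiset_monoid (blocks ns Q d)) Q id) ns h"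
proof -
  let ?B = "blocks ns Q d" and ?K = "invariant_product ns"
  let ?H = "multiset_monoid ?B"
  have BQ: "set_mset S \<subseteq> Q" if "S \<in> ?B" for S using that by (simp add: blocks_def)
  have E: "divisor_embedding ?H Q id"
    by (intro divisor_embedding.intro comm_monoid_cancel_multiset_monoid divisor_hom_multiset_monoid saturated_blocks BQ)
  let ?N = "principal_divisors ?H id" and ?F = "free_Abelian_group Q" and ?G = "class_group ?H Q id"
  interpret K: comm_group ?K by (rule comm_group_invariant_product)
  have nz: "0 < int (ns ! i)" if "i < length ns" for i
  proof -
    have "1 < ns ! i" using gt that by simp
    then show ?thesis by simp
  qed
  let ?e = "\<lambda>x. \<lambda>i\<in>{..<length ns}. x i mod int (ns ! i)"
  have eK: "?e x \<in> carrier ?K" for x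
    using gt nz by (auto simp: invariant_product_def carrier_integer_mod_group)
  have "(\<lambda>q. ?e (d q)) ` Q \<subseteq> carrier ?K" by (rule image_subsetI) (rule eK)
  then obtain \<theta> where \<theta>: "\<theta> \<in> hom ?F ?K" "\<And>q. q \<in> Q \<Longrightarrow> \<theta> (frag_of q) = ?e (d q)"
    by (rule K.free_Abelian_group_universal) (erule that, assumption)
  interpret \<theta>: group_hom ?F ?K \<theta> using \<theta>(1) by (simp add: group_hom_def group_hom_axioms_def)
  have mset: "\<theta> (frag_of_mset S) = ?e (\<lambda>i. \<Sum>q\<in>#S. d q i)" if "set_mset S \<subseteq> Q" for S
    using that
  proof (induction S)
    case empty
    have "\<theta> 0 = \<one>\<^bsub>?K\<^esub>" using \<theta>.hom_one by simp
    then show ?case by (simp add: invariant_product_def fun_eq_iff)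
  next
    case (add q S)
    have "\<theta> (frag_of q \<otimes>\<^bsub>?F\<^esub> frag_of_mset S) = \<theta> (frag_of q) \<otimes>\<^bsub>?K\<^esub> \<theta> (frag_of_mset S)"
      by (rule \<theta>.hom_mult) (use add.prems frag_of_mset_closed[of S Q] in auto)
    also have "\<dots> = ?e (\<lambda>i. \<Sum>q\<in>#add_mset q S. d q i)"
      using add by (auto simp: \<theta>(2) invariant_product_def fun_eq_iff mod_add_eq)
    finally show ?case by simp
  qed
  have eq_iff: "?e x = ?e y \<longleftrightarrow> (\<forall>i<length ns. [x i = y i] (mod int (ns ! i)))" for x y
    by (auto simp: cong_def fun_eq_iff restrict_def)
  have kernel: "kernel ?F ?K \<theta> = ?N"
  proof (intro equalityI subsetI)
    fix f assume "f \<in> kernel ?F ?K \<theta>"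
    then have f: "f \<in> carrier ?F" "\<theta> f = \<one>\<^bsub>?K\<^esub>" by (auto simp: kernel_def)
    obtain S T where ST: "set_mset S \<subseteq> Q" "set_mset T \<subseteq> Q" "f = frag_of_mset S - frag_of_mset T"
      using frag_eq_diff[of f Q] f(1) by auto
    have "\<theta> (f \<otimes>\<^bsub>?F\<^esub> frag_of_mset T) = \<theta> f \<otimes>\<^bsub>?K\<^esub> \<theta> (frag_of_mset T)"
      by (rule \<theta>.hom_mult) (use f frag_of_mset_closed[OF ST(2)] in auto)
    then have "\<theta> (frag_of_mset S) = \<theta> (frag_of_mset T)" using ST f(2) eK[of "\<lambda>i. \<Sum>q\<in>#T. d q i"] by (simp add: mset)
    then have cong: "[(\<Sum>q\<in>#S. d q i) = (\<Sum>q\<in>#T. d q i)] (mod int (ns ! i))" if "i < length ns" for i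
      using that unfolding mset[OF ST(1)] mset[OF ST(2)] eq_iff by blast
    \<comment> \<open>A prime \<open>q\<close> in the class \<open>-[T] = -[S]\<close> turns \<open>S\<close> and \<open>T\<close> into elements of the monoid.\<close>
    obtain q where q: "q \<in> Q" "zero_sum ns d (add_mset q T)" using covers_inverse[OF c] by blast
    have "zero_sum ns d (add_mset q S)" unfolding zero_sum_def
    proof (intro allI impI)
      fix i assume i: "i < length ns"
      have "int (ns ! i) dvd d q i + (\<Sum>q\<in>#T. d q i)" using q(2) i by (simp add: zero_sum_def)
      moreover have "[d q i + (\<Sum>q\<in>#S. d q i) = d q i + (\<Sum>q\<in>#T. d q i)] (mod int (ns ! i))" using cong[OF i] by (rule cong_add[OF cong_refl])
      ultimately show "int (ns ! i) dvd (\<Sum>q\<in>#add_mset q S. d q i)" by (simp add: cong_dvd_iff)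
    qed
    then have "add_mset q S \<in> ?B" "add_mset q T \<in> ?B" using q ST by (auto simp: blocks_def)
    moreover have "f = frag_of_mset (id (add_mset q S)) - frag_of_mset (id (add_mset q T))" using ST(3) by simp
    ultimately show "f \<in> ?N" unfolding principal_divisors_def multiset_monoid_def by fastforce
  next
    fix f assume f: "f \<in> ?N"
    then obtain S T where ST: "S \<in> ?B" "T \<in> ?B" "f = frag_of_mset S - frag_of_mset T"
      by (auto simp: principal_divisors_def multiset_monoid_def)
    have fF: "f \<in> carrier ?F" using f subgroup.subset[OF divisor_embedding.N_subgroup[OF E]] by blast
    have zero: "\<theta> (frag_of_mset S) = \<one>\<^bsub>?K\<^esub>" if "S \<in> ?B" for S
      using that by (auto simp: mset[OF BQ] invariant_product_def fun_eq_iff blocks_def zero_sum_def)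
    have "\<theta> (f \<otimes>\<^bsub>?F\<^esub> frag_of_mset T) = \<theta> f \<otimes>\<^bsub>?K\<^esub> \<theta> (frag_of_mset T)"
      by (rule \<theta>.hom_mult) (use fF frag_of_mset_closed[OF BQ[OF ST(2)]] in auto)
    then have "\<theta> f = \<one>\<^bsub>?K\<^esub>" using ST zero \<theta>.hom_closed[OF fF] by simp
    then show "f \<in> kernel ?F ?K \<theta>" using fF by (simp add: kernel_def)
  qed
  have hit: "\<exists>q\<in>Q. \<theta> (frag_of q) = x" if x: "x \<in> carrier ?K" for x
  proof -
    obtain q where q: "q \<in> Q" "\<forall>i<length ns. [d q i = x i] (mod int (ns ! i))" using c unfolding covers_def by blast
    have "x = ?e x"
    proof
      fix i show "x i = ?e x i"
      proof (cases "i < length ns")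
        case True
        then have "x i \<in> carrier (integer_mod_group (ns ! i))" using x by (auto simp: invariant_product_def PiE_iff)
        then show ?thesis using True nz[OF True] by (auto simp: carrier_integer_mod_group split: if_splits)
      qed (use x in \<open>auto simp: invariant_product_def PiE_iff extensional_def\<close>)
    qed
    moreover have "?e (d q) = ?e x" unfolding eq_iff by (rule q(2))
    ultimately show ?thesis using q(1) \<theta>(2)[OF q(1)] by (intro bexI[of _ q]) simp_all
  qed
  have "\<theta> ` carrier ?F = carrier ?K"
  proof (intro equalityI subsetI)
    fix x assume "x \<in> carrier ?K"
    then obtain q where "q \<in> Q" "\<theta> (frag_of q) = x" using hit by blast
    then show "x \<in> \<theta> ` carrier ?F" by (intro image_eqI[of _ _ "frag_of q"]) auto
  qed (use \<theta>.hom_closed in blast)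
  then have "?G \<cong> ?K" using \<theta>.FactGroup_iso unfolding kernel class_group_def by blast
  then obtain h where h: "h \<in> iso ?G ?K" unfolding is_iso_def by blast
  have coord: "coordinates ?G ns h"
    unfolding coordinates_def using divisor_embedding.comm_group_G[OF E] gt h by blast
  have fin: "finite (carrier ?G)"
  proof -
    have "bij_betw h (carrier ?G) (carrier ?K)" using h by (simp add: iso_def)
    moreover have "finite (carrier ?K)"
      unfolding invariant_product_def carrier_product_group
      by (rule finite_PiE) (use gt nz in \<open>auto simp: carrier_integer_mod_group\<close>)
    ultimately show ?thesis by (simp add: bij_betw_finite)
  qed
  interpret G: comm_group ?G by (rule divisor_embedding.comm_group_G[OF E])
  have all: "\<exists>q\<in>Q. divisor_class ?H Q id q = g" if g: "g \<in> carrier ?G" for g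
  proof -
    obtain f where f: "f \<in> carrier ?F" "g = divisor_embedding.coset ?H Q id f" using divisor_embedding.coset_surj[OF E g] by blast
    obtain q where q: "q \<in> Q" "\<theta> (frag_of q) = \<theta> f" using hit[OF \<theta>.hom_closed[OF f(1)]] by blast
    have qF: "frag_of q \<in> carrier ?F" using q(1) by simp
    have dF: "f - frag_of q \<in> carrier ?F" using f(1) q(1) keys_diff[of f "frag_of q"] by auto
    have "\<theta> ((f - frag_of q) \<otimes>\<^bsub>?F\<^esub> frag_of q) = \<theta> (f - frag_of q) \<otimes>\<^bsub>?K\<^esub> \<theta> (frag_of q)" by (rule \<theta>.hom_mult[OF dF qF])
    then have "\<theta> (f - frag_of q) = \<one>\<^bsub>?K\<^esub>" using q(2) \<theta>.hom_closed[OF dF] \<theta>.hom_closed[OF f(1)] by simp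
    then have "f - frag_of q \<in> ?N" using dF unfolding kernel[symmetric] kernel_def by simp
    then have "divisor_embedding.coset ?H Q id (f - frag_of q) = \<one>\<^bsub>?G\<^esub>" using divisor_embedding.coset_eq_one_iff[OF E dF] by blast
    then have "g = \<one>\<^bsub>?G\<^esub> \<otimes>\<^bsub>?G\<^esub> divisor_class ?H Q id q"
      using divisor_embedding.coset_add[OF E dF qF] f(2) divisor_embedding.divisor_class_eq[OF E, of q] by simp
    moreover have "divisor_class ?H Q id q \<in> carrier ?G"
      using divisor_embedding.coset_closed[OF E qF] divisor_embedding.divisor_class_eq[OF E, of q] by simp
    ultimately show ?thesis using q(1) G.l_one by (intro bexI[of _ q]) simp_all
  qed
  have "divisor_theory ?H Q id"
    unfolding divisor_theory_def using divisor_embedding.hom[OF E] gcd by (simp add: multiset_monoid_def)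
  then have "krull_finite_primes_everywhere ?H Q id"
    unfolding krull_finite_primes_everywhere_def krull_monoid_def using divisor_embedding.cancel[OF E] fin all by blast
  then show thesis using that coord by blast
qed

lemma enat_eqI: "(\<And>N. x \<le> enat N \<longleftrightarrow> y \<le> enat N) \<Longrightarrow> x = y"
  by (cases x; cases y) (metis antisym enat_ord_simps(1) order_refl enat_ord_simps(5) enat_ord_code(4))+

context krull_coordinates
begin

lemma divisor_theory: "divisor_theory H P \<phi>"
  using krull by (simp add: krull_finite_primes_everywhere_def krull_monoid_def)

text \<open>
  The primes that are kept are renamed to natural numbers. The finite sets that witness a divisor theory are transported by
  embeddings that fix the prime in question.
\<close>
lemma countable_model:
  "\<exists>(H' :: nat multiset monoid) (Q :: nat set) \<phi>' h'. krull_coordinates H' Q \<phi>' ns h' \<and> tame_degree H' = tame_degree H"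
proof -
  let ?c = "divisor_class H P \<phi>"
  have "?c p \<in> carrier (class_group H P \<phi>)" if "p \<in> P" for p
    using divisor_embedding.divisor_class_eq[OF embedding] divisor_embedding.coset_closed[OF embedding, of "frag_of p"] that by simp
  then have "?c ` P \<subseteq> carrier (class_group H P \<phi>)" by blast
  moreover have "finite (carrier (class_group H P \<phi>))" using krull by (simp add: krull_finite_primes_everywhere_def)
  ultimately have "countable (?c ` P)" by (meson countable_finite finite_subset)
  then obtain P' where P': "P' \<subseteq> P" "countable P'"
    and retract: "\<And>P0. finite P0 \<Longrightarrow> P0 \<subseteq> P \<Longrightarrow> \<exists>f. inj_on f P0 \<and> f ` P0 \<subseteq> P' \<and> (\<forall>p\<in>P0. ?c (f p) = ?c p) \<and> (\<forall>p\<in>P0 \<inter> P'. f p = p)"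
    by (rule countable_local_retract) (erule that, assumption, assumption)
  define \<iota> where "\<iota> = to_nat_on P'"
  have \<iota>: "inj_on \<iota> P'" unfolding \<iota>_def by (rule inj_on_to_nat_on[OF P'(2)])
  define Q where "Q = \<iota> ` P'"
  define e where "e = inv_into P' \<iota>"
  have e\<iota>: "e (\<iota> p) = p" if "p \<in> P'" for p unfolding e_def by (rule inv_into_f_f[OF \<iota> that])
  have e: "e q \<in> P'" if "q \<in> Q" for q using that e\<iota> by (auto simp: Q_def)
  let ?d = "\<lambda>q. d (e q)"
  let ?B = "blocks ns P d" and ?B' = "blocks ns Q ?d"
  let ?H = "multiset_monoid ?B'"
  have emb: "\<exists>f. inj_on f P0 \<and> f ` P0 \<subseteq> Q \<and> (\<forall>p\<in>P0. ?c (e (f p)) = ?c p) \<and> (\<forall>p\<in>P0 \<inter> P'. f p = \<iota> p)"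
    if P0: "finite P0" "P0 \<subseteq> P" for P0
  proof -
    obtain f where f: "inj_on f P0" "f ` P0 \<subseteq> P'" "\<forall>p\<in>P0. ?c (f p) = ?c p" "\<forall>p\<in>P0 \<inter> P'. f p = p" using retract[OF P0] by blast
    have "inj_on (\<iota> \<circ> f) P0" by (rule comp_inj_on[OF f(1) inj_on_subset[OF \<iota> f(2)]])
    moreover have "(\<iota> \<circ> f) ` P0 \<subseteq> Q" using f(2) by (auto simp: Q_def)
    moreover have "\<forall>p\<in>P0. ?c (e ((\<iota> \<circ> f) p)) = ?c p" using f(2,3) e\<iota> by (simp add: image_subset_iff)
    moreover have "\<forall>p\<in>P0 \<inter> P'. (\<iota> \<circ> f) p = \<iota> p" using f(4) by simp
    ultimately show ?thesis by blast
  qed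
  have "covers ns Q ?d"
    unfolding covers_def
  proof
    fix x
    obtain p where p: "p \<in> P" "\<forall>i<length ns. [d p i = x i] (mod int (ns ! i))" using covers unfolding covers_def by blast
    then obtain f where "f ` {p} \<subseteq> Q" "?c (e (f p)) = ?c p" using emb[of "{p}"] by auto
    then show "\<exists>q\<in>Q. \<forall>i<length ns. [?d q i = x i] (mod int (ns ! i))" using p(2) by (intro bexI[of _ "f p"]) simp_all
  qed
  moreover have "\<exists>X. X \<subseteq> ?B' \<and> finite X \<and> X \<noteq> {} \<and> Inf X = {#q#}" if q: "q \<in> Q" for q
  proof -
    obtain p where p: "p \<in> P'" "q = \<iota> p" using q by (auto simp: Q_def)
    obtain X where X: "X \<subseteq> carrier H" "finite X" "X \<noteq> {}" "Inf (\<phi> ` X) = {#p#}"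
      using divisor_theory p(1) P'(1) unfolding divisor_theory_def by blast
    have XB: "\<phi> ` X \<subseteq> ?B" unfolding image_blocks[symmetric] using X(1) by (rule image_mono)
    let ?P0 = "insert p (\<Union>S\<in>\<phi> ` X. set_mset S)"
    have "finite ?P0" using X(2) by simp
    moreover have "?P0 \<subseteq> P" using XB p(1) P'(1) by (auto simp: blocks_def)
    ultimately obtain f where f: "inj_on f ?P0" "f ` ?P0 \<subseteq> Q" "\<forall>p\<in>?P0. ?c (e (f p)) = ?c p" "\<forall>p\<in>?P0 \<inter> P'. f p = \<iota> p"
      using emb by meson
    have "image_mset f S \<in> ?B'" if S: "S \<in> \<phi> ` X" for S
    proof -
      have S0: "set_mset S \<subseteq> ?P0" using S by blast
      have "zero_sum ns d S" using S XB by (auto simp: blocks_def)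
      moreover have "zero_sum ns ?d (image_mset f S) \<longleftrightarrow> zero_sum ns d S"
      proof (rule zero_sum_image)
        fix p i assume "p \<in># S"
        with S0 have "p \<in> ?P0" by (rule subsetD)
        then have "?c (e (f p)) = ?c p" by (rule bspec[OF f(3)])
        then show "[?d (f p) i = d p i] (mod int (ns ! i))" by simp
      qed
      moreover have "set_mset (image_mset f S) \<subseteq> Q" using f(2) S0 by auto
      ultimately show ?thesis by (simp add: blocks_def)
    qed
    then have "image_mset f ` \<phi> ` X \<subseteq> ?B'" by (rule image_subsetI)
    moreover have "Inf (image_mset f ` \<phi> ` X) = {#q#}"
    proof -
      have "Inf (image_mset f ` \<phi> ` X) = image_mset f (Inf (\<phi> ` X))"
        by (rule Inf_image_mset[OF f(1)]) (use X(3) in auto)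
      also have "\<dots> = {#q#}" using X(4) f(4) p by simp
      finally show ?thesis .
    qed
    ultimately show ?thesis using X(2,3) by (intro exI[of _ "image_mset f ` \<phi> ` X"]) simp
  qed
  ultimately obtain h' where h': "krull_finite_primes_everywhere ?H Q id" "coordinates (class_group ?H Q id) ns h'"
    by (rule krull_blocks[OF gt_1])
  have "tame_degree ?H \<le> enat N \<longleftrightarrow> tame_bound ?B' N" for N
    by (rule tame_degree_multiset_monoid[OF saturated_blocks, of _ _ _ Q]) (simp add: blocks_def)
  moreover have "tame_bound ?B' N \<longleftrightarrow> tame_bound ?B N" for N
  proof
    assume t: "tame_bound ?B N"
    show "tame_bound ?B' N"
    proof (rule tame_bound_local_embedding[OF t])
      fix P0 assume "finite P0" "P0 \<subseteq> Q"
      moreover have "inj_on e Q" by (rule inj_onI) (auto simp: Q_def e\<iota>)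
      ultimately show "\<exists>f. inj_on f P0 \<and> f ` P0 \<subseteq> P \<and> (\<forall>p\<in>P0. \<forall>i<length ns. [d (f p) i = ?d p i] (mod int (ns ! i)))"
        using e P'(1) by (intro exI[of _ e]) (auto intro: inj_on_subset)
    qed
  next
    assume t: "tame_bound ?B' N"
    show "tame_bound ?B N"
    proof (rule tame_bound_local_embedding[OF t])
      fix P0 assume "finite P0" "P0 \<subseteq> P"
      then obtain f where "inj_on f P0" "f ` P0 \<subseteq> Q" "\<forall>p\<in>P0. ?c (e (f p)) = ?c p" using emb by meson
      then show "\<exists>f. inj_on f P0 \<and> f ` P0 \<subseteq> Q \<and> (\<forall>p\<in>P0. \<forall>i<length ns. [?d (f p) i = d p i] (mod int (ns ! i)))"
        by (intro exI[of _ f]) simp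
    qed
  qed
  ultimately have "tame_degree ?H \<le> enat N \<longleftrightarrow> tame_degree H \<le> enat N" for N using tame_degree_le by simp
  then have "tame_degree ?H = tame_degree H" by (rule enat_eqI)
  then show ?thesis using h' unfolding krull_coordinates_def by blast
qed

end

lemma davenport_cong:
  assumes "krull_coordinates H P \<phi> ns h" "krull_coordinates H' P' \<phi>' ns h'"
  shows "davenport (class_group H P \<phi>) (carrier (class_group H P \<phi>)) = davenport (class_group H' P' \<phi>') (carrier (class_group H' P' \<phi>'))"
  unfolding krull_coordinates.davenport_eq_SUP[OF assms(1)] krull_coordinates.davenport_eq_SUP[OF assms(2)]
  by (rule SUP_irreducible_size_eq) (rule krull_coordinates.covers[OF assms(1)] krull_coordinates.covers[OF assms(2)])+

lemma class_group_invariants_cong: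
  assumes "coordinates G ns h" "coordinates G' ns h'"
  shows "group_rank G = group_rank G'" "order G = order G'" "group_exponent G = group_exponent G'"
proof -
  have g: "group G" "group G'" and i: "G \<cong> invariant_product ns" "G' \<cong> invariant_product ns"
    using assms by (auto simp: coordinates_def comm_group_def is_iso_def)
  then have "G \<cong> G'" using iso_trans group.iso_sym by metis
  then show "group_rank G = group_rank G'" unfolding group_rank_def using invariant_factors_cong g by metis
  show "order G = order G'" unfolding coordinates.order_eq[OF assms(1)] coordinates.order_eq[OF assms(2)] ..
  show "group_exponent G = group_exponent G'"
    unfolding group_exponent_def coordinates.exponent_iff[OF assms(1)] coordinates.exponent_iff[OF assms(2)] ..
qed

lemma ex_krull_coordinates:
  assumes "krull_finite_primes_everywhere H P \<phi>"
  obtains h where "krull_coordinates H P \<phi> (invariant_factors (class_group H P \<phi>)) h"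
    "sorted_wrt (dvd) (invariant_factors (class_group H P \<phi>))"
proof -
  have "divisor_embedding H P \<phi>" by (rule krull_divisor_embedding) (use assms in \<open>simp add: krull_finite_primes_everywhere_def\<close>)
  then have "comm_group (class_group H P \<phi>)" by (rule divisor_embedding.comm_group_G)
  moreover have "finite (carrier (class_group H P \<phi>))" using assms by (simp add: krull_finite_primes_everywhere_def)
  ultimately show thesis using ex_coordinates invariant_factors_spec that assms unfolding krull_coordinates_def by metis
qed

theorem growth_constants_transfer:
  assumes c: "growth_constants TYPE(nat multiset) TYPE(nat) e M1 M2 M3 M4 M5"
  shows "growth_constants TYPE('a) TYPE('p) e M1 M2 M3 M4 M5"
  unfolding growth_constants_def
proof (intro conjI allI impI)
  show "0 < M1" "0 < M2" "0 < M3" "0 < M4" "0 < M5" using c by (simp_all add: growth_constants_def)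
  fix H :: "'a monoid" and P :: "'p set" and \<phi>
  let ?G = "class_group H P \<phi>"
  assume H: "krull_finite_primes_everywhere H P \<phi> \<and> 1 < order ?G \<and> group_exponent ?G = e"
  obtain h where kc: "krull_coordinates H P \<phi> (invariant_factors ?G) h" using ex_krull_coordinates[of H P \<phi>] H by blast
  then obtain Q :: "nat set" and H' \<phi>' h' where kc': "krull_coordinates (H' :: nat multiset monoid) Q \<phi>' (invariant_factors ?G) h'"
    and t: "tame_degree H' = tame_degree H" using krull_coordinates.countable_model by blast
  let ?G' = "class_group H' Q \<phi>'"
  note inv = class_group_invariants_cong[OF krull_coordinates.coordinates[OF kc] krull_coordinates.coordinates[OF kc']]
  have "krull_finite_primes_everywhere H' Q \<phi>' \<and> 1 < order ?G' \<and> group_exponent ?G' = e"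
    using H inv krull_coordinates.krull[OF kc'] by simp
  then show "let G = ?G; r = real (group_rank G); D = ereal_of_enat (davenport G (carrier G)); t = ereal_of_enat (tame_degree H)
         in ereal (M1 * r) \<le> D \<and> D \<le> ereal (M2 * r) \<and>
            ereal (M3 * r\<^sup>2) \<le> t \<and> t \<le> ereal (M4 * r\<^sup>2) \<and>
            ereal M5 * (1 + D * (D - 1) / 2) \<le> t \<and> t \<le> 1 + D * (D - 1) / 2"
    using c unfolding growth_constants_def inv(1) davenport_cong[OF kc kc'] t[symmetric] Let_def by blast
qed

section \<open>Growth and the main result\<close>

lemma group_exponent_dvd:
  assumes "coordinates G ns h" shows "0 < group_exponent G" "i < length ns \<Longrightarrow> ns ! i dvd group_exponent G"
proof -
  have "0 < order G \<and> (\<forall>g\<in>carrier G. g [^]\<^bsub>G\<^esub> order G = \<one>\<^bsub>G\<^esub>)"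
  proof
    have gt: "0 < ns ! i" if "i < length ns" for i
      using coordinates.nth_gt_1[OF assms that] by simp
    show "0 < order G" unfolding coordinates.order_eq[OF assms] using gt by (intro prod_pos) simp
    show "\<forall>g\<in>carrier G. g [^]\<^bsub>G\<^esub> order G = \<one>\<^bsub>G\<^esub>"
      unfolding coordinates.exponent_iff[OF assms] unfolding coordinates.order_eq[OF assms] by (auto intro: dvd_prodI)
  qed
  from LeastI[of "\<lambda>n. 0 < n \<and> (\<forall>g\<in>carrier G. g [^]\<^bsub>G\<^esub> n = \<one>\<^bsub>G\<^esub>)", OF this]
  have *: "0 < group_exponent G \<and> (\<forall>g\<in>carrier G. g [^]\<^bsub>G\<^esub> group_exponent G = \<one>\<^bsub>G\<^esub>)" unfolding group_exponent_def .
  then show "0 < group_exponent G" ..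
  show "ns ! i dvd group_exponent G" if "i < length ns" using * that unfolding coordinates.exponent_iff[OF assms] by blast
qed

text \<open>
  From \<open>D \<le> E\<^sup>2 r\<close> and \<open>r\<^sup>2 \<le> 16 E\<^sup>2 t\<close> one obtains
  \<open>1 + D (D - 1) / 2 \<le> D\<^sup>2 \<le> E\<^sup>4 r\<^sup>2 \<le> 16 E\<^sup>6 t\<close>. If there is any group to consider, then \<open>e \<ge> 2\<close> and \<open>E = e\<close>.
\<close>
theorem ex_growth_constants: "\<exists>M1 M2 M3 M4 M5. growth_constants TYPE('a) TYPE('p) e M1 M2 M3 M4 M5"
proof -
  define E where "E = max 2 e"
  define c where "c = real E"
  have c2: "2 \<le> c" by (simp add: c_def E_def)
  then have c0: "0 < c" by linarith
  have "growth_constants TYPE('a) TYPE('p) e 1 (c^2) (1 / (16 * c^2)) (c^4) (1 / (16 * c^6))"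
    unfolding growth_constants_def
  proof (intro conjI allI impI)
    show "0 < c^2" "0 < 1 / (16 * c^2)" "0 < c^4" "0 < 1 / (16 * c^6)" using c0 by simp_all
    fix H :: "'a monoid" and P :: "'p set" and \<phi>
    let ?G = "class_group H P \<phi>"
    assume H: "krull_finite_primes_everywhere H P \<phi> \<and> 1 < order ?G \<and> group_exponent ?G = e"
    define ns where "ns = invariant_factors ?G"
    obtain h where kc: "krull_coordinates H P \<phi> ns h" unfolding ns_def using ex_krull_coordinates[of H P \<phi>] H by blast
    note co = krull_coordinates.coordinates[OF kc]
    have ne: "ns \<noteq> []" using coordinates.order_eq[OF co] H by auto
    have dvd: "ns ! i dvd E" if i: "i < length ns" for i
    proof -
      have "ns ! i dvd e" "0 < e" using group_exponent_dvd[OF co] i H by auto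
      moreover have "1 < ns ! i" using krull_coordinates.gt_1[OF kc] i by simp
      moreover have "ns ! i \<le> e" by (rule dvd_imp_le) fact+
      ultimately have "2 \<le> e" by linarith
      then show ?thesis using \<open>ns ! i dvd e\<close> by (simp add: E_def max_def)
    qed
    have "2 \<le> E" by (simp add: E_def)
    then obtain D t where Dt: "davenport ?G (carrier ?G) = enat D" "tame_degree H = enat t"
      "length ns \<le> D" "1 \<le> D" "D \<le> E * E * length ns" "t \<le> 1 + D * (D - 1) div 2" "real (length ns * length ns) \<le> 16 * (E * E) * t"
      by (rule krull_coordinates.growth_bounds[OF kc ne _ dvd]) (assumption, rule that)
    define r where "r = real (length ns)"
    define x where "x = real D"
    define y where "y = real t"
    have r: "1 \<le> r" using ne by (simp add: r_def Suc_le_eq)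
    have x: "r \<le> x" "1 \<le> x" "x \<le> c^2 * r" using Dt(3,4,5) unfolding r_def x_def c_def
      by (simp_all add: power2_eq_square flip: of_nat_mult)
    have "D * (D - 1) div 2 * 2 \<le> D * (D - 1)" by (rule div_times_less_eq_dividend)
    then have "real (D * (D - 1) div 2 * 2) \<le> real (D * (D - 1))" by (rule of_nat_mono)
    then have "real (D * (D - 1) div 2) * 2 \<le> real D * (real D - 1)"
      using Dt(4) by (simp only: of_nat_mult of_nat_numeral of_nat_diff of_nat_1)
    then have y1: "y \<le> 1 + x * (x - 1) / 2" using Dt(6) unfolding x_def y_def by (simp add: field_simps)
    have y2: "r^2 \<le> 16 * c^2 * y" using Dt(7) unfolding r_def y_def c_def by (simp add: power2_eq_square)
    have "x * 1 \<le> x * x" "1 * 1 \<le> x * x" using x(2) by (intro mult_mono; simp)+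
    then have "2 + (x * x - x) \<le> 2 * (x * x)" using x(2) by linarith
    then have D2: "1 + x * (x - 1) / 2 \<le> x^2" by (simp add: power2_eq_square field_simps)
    have "x^2 \<le> (c^2 * r)^2" using x by (intro power_mono) auto
    then have x4: "x^2 \<le> c^4 * r^2" by (simp add: power_mult_distrib)
    have y4: "c^4 * r^2 \<le> c^4 * (16 * c^2 * y)" using y2 by (intro mult_left_mono) auto
    have "c^4 * (16 * c^2 * y) = 16 * c^6 * y" by (simp add: power_add[symmetric] algebra_simps)
    then have low: "1 + x * (x - 1) / 2 \<le> 16 * c^6 * y" using D2 x4 y4 by linarith
    have G: "group_rank ?G = length ns" by (simp add: group_rank_def ns_def)
    have ed: "ereal_of_enat (davenport ?G (carrier ?G)) = ereal x" "ereal_of_enat (tame_degree H) = ereal y"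
      using Dt(1,2) by (simp_all add: x_def y_def)
    have q: "1 + ereal x * (ereal x - 1) / 2 = ereal (1 + x * (x - 1) / 2)"
    proof -
      have 2: "(2 :: ereal) = ereal 2" by simp
      show ?thesis unfolding 2 one_ereal_def by (simp only: ereal_minus times_ereal.simps ereal_divide plus_ereal.simps zero_neq_numeral[symmetric] if_False)
    qed
    have "1 / (16 * c^2) * r^2 \<le> y" using y2 c0 by (simp add: field_simps)
    moreover have "y \<le> c^4 * r^2" using y1 D2 x4 by linarith
    moreover have "1 / (16 * c^6) * (1 + x * (x - 1) / 2) \<le> y" using low c0 by (simp add: divide_le_eq mult.commute)
    ultimately show "let G = ?G; r = real (group_rank G); D = ereal_of_enat (davenport G (carrier G)); t = ereal_of_enat (tame_degree H)
         in ereal (1 * r) \<le> D \<and> D \<le> ereal (c^2 * r) \<and>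
            ereal (1 / (16 * c^2) * r\<^sup>2) \<le> t \<and> t \<le> ereal (c^4 * r\<^sup>2) \<and>
            ereal (1 / (16 * c^6)) * (1 + D * (D - 1) / 2) \<le> t \<and> t \<le> 1 + D * (D - 1) / 2"
      unfolding Let_def G ed q r_def[symmetric] times_ereal.simps(1) ereal_less_eq(3) using x y1 by simp
  qed simp
  then show ?thesis by blast
qed

theorem uniform_growth: "uniform_growth TYPE('a) TYPE('p) e"
  unfolding uniform_growth_def using ex_growth_constants growth_constants_transfer by blast

theorem theorem4p12:
  shows
    "(\<forall>(H :: 'a monoid) (P :: 'p set) \<phi>. krull_finite_primes_everywhere H P \<phi> \<longrightarrow>
        (let G = class_group H P \<phi> in
           (tame_degree (zero_sum_monoid G (carrier G)) = enat (Dstar G) \<longleftrightarrow>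
              G \<cong> integer_mod_group 3 \<or> G \<cong> integer_mod_group 4 \<or>
              G \<cong> cyclic_power 2 2 \<or> G \<cong> cyclic_power 2 3) \<and>
           ((\<exists>g\<in>carrier G. g \<noteq> \<one>\<^bsub>G\<^esub> \<and>
               (\<exists>p\<in>P. \<exists>q\<in>P. p \<noteq> q \<and> divisor_class H P \<phi> p = g \<and> divisor_class H P \<phi> q = g)) \<longrightarrow>
            (tame_degree H = enat (Dstar G) \<longleftrightarrow>
               G \<cong> integer_mod_group 2 \<or> G \<cong> integer_mod_group 3 \<or>
               G \<cong> integer_mod_group 4 \<or> G \<cong> cyclic_power 2 2)))) \<and>
     (\<forall>e. uniform_growth TYPE('a) TYPE('p) e)"
proof (intro conjI allI impI uniform_growth)
  fix H :: "'a monoid" and P :: "'p set" and \<phi>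
  assume H: "krull_finite_primes_everywhere H P \<phi>"
  define G where "G = class_group H P \<phi>"
  define ns where "ns = invariant_factors G"
  obtain h where kc: "krull_coordinates H P \<phi> ns h" and srt: "sorted_wrt (dvd) ns"
    unfolding ns_def G_def using ex_krull_coordinates[OF H] by blast
  have co: "coordinates G ns h" unfolding G_def by (rule krull_coordinates.coordinates[OF kc])
  have grp: "group G" using co by (simp add: coordinates_def comm_group_def)
  have small: "G \<cong> integer_mod_group 2 \<longleftrightarrow> ns = [2]" "G \<cong> integer_mod_group 3 \<longleftrightarrow> ns = [3]" "G \<cong> integer_mod_group 4 \<longleftrightarrow> ns = [4]"
    "G \<cong> cyclic_power 2 2 \<longleftrightarrow> ns = [2, 2]" "G \<cong> cyclic_power 2 3 \<longleftrightarrow> ns = [2, 2, 2]"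
    using invariant_factors_unique_small[OF co grp] by (simp_all add: numeral_2_eq_2 numeral_3_eq_3)
  have D: "Dstar G = dstar ns" unfolding ns_def by (rule Dstar_eq)
  show "let G = class_group H P \<phi> in
           (tame_degree (zero_sum_monoid G (carrier G)) = enat (Dstar G) \<longleftrightarrow>
              G \<cong> integer_mod_group 3 \<or> G \<cong> integer_mod_group 4 \<or>
              G \<cong> cyclic_power 2 2 \<or> G \<cong> cyclic_power 2 3) \<and>
           ((\<exists>g\<in>carrier G. g \<noteq> \<one>\<^bsub>G\<^esub> \<and>
               (\<exists>p\<in>P. \<exists>q\<in>P. p \<noteq> q \<and> divisor_class H P \<phi> p = g \<and> divisor_class H P \<phi> q = g)) \<longrightarrow>
            (tame_degree H = enat (Dstar G) \<longleftrightarrow>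
               G \<cong> integer_mod_group 2 \<or> G \<cong> integer_mod_group 3 \<or>
               G \<cong> integer_mod_group 4 \<or> G \<cong> cyclic_power 2 2))"
    unfolding Let_def G_def[symmetric]
  proof (intro conjI impI)
    show "tame_degree (zero_sum_monoid G (carrier G)) = enat (Dstar G) \<longleftrightarrow>
              G \<cong> integer_mod_group 3 \<or> G \<cong> integer_mod_group 4 \<or> G \<cong> cyclic_power 2 2 \<or> G \<cong> cyclic_power 2 3"
      unfolding small D tame_degree_zero_sum_eq_dstar_iff[OF co srt] by blast
    assume "\<exists>g\<in>carrier G. g \<noteq> \<one>\<^bsub>G\<^esub> \<and>
               (\<exists>p\<in>P. \<exists>q\<in>P. p \<noteq> q \<and> divisor_class H P \<phi> p = g \<and> divisor_class H P \<phi> q = g)"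
    then show "tame_degree H = enat (Dstar G) \<longleftrightarrow>
               G \<cong> integer_mod_group 2 \<or> G \<cong> integer_mod_group 3 \<or> G \<cong> integer_mod_group 4 \<or> G \<cong> cyclic_power 2 2"
      unfolding small D using krull_coordinates.tame_degree_eq_dstar_iff[OF kc srt] unfolding G_def by blast
  qed
qed

end
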